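(* Fix $\varepsilon>0$. Let $p\to\infty$ and let $k=k(p)$ be positive integers satisfying $k<(2-\varepsilon)\,p\log p$. Let $d_1,\dots,d_k$ be drawn independently and uniformly at random from the unit sphere in $\mathbb{R}^p$, and let $u$ be drawn uniformly at random from the unit sphere in $\mathbb{R}^p$, independently of the $d_i$. Set $G=uu^\top$ and consider the semidefinite program $$\text{maximize } \langle G,B\rangle \quad\text{subject to}\quad B\in\mathrm{Span}\{d_1d_1^\top,\dots,d_kd_k^\top\},\ \ \mathrm{Tr}(B)=1,\ \ B\succeq 0,$$ over symmetric matrices $B\in\mathbb{R}^{p\times p}$. Then with probability tending to $1$ as $p\to\infty$, the matrix $d_id_i^\top$ for which $d_i^\top G d_i$ is largest is the unique maximizer of this program.
   Context: $\langle G,B\rangle=\mathrm{Tr}(G^\top B)$ is the Frobenius inner product; $B\succeq 0$ means $B$ is positive semidefinite. *)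

theory Defs
  imports "HOL-Probability.Probability"
begin

text \<open>Vectors in R^p are functions nat => real, relevant on indices < p
  (elements of PiM {..<p} are extensional: undefined outside {..<p}).
  p x p matrices are functions nat => nat => real, relevant on indices < p.\<close>

definition lebesgue_p :: "nat \<Rightarrow> (nat \<Rightarrow> real) measure" where
  "lebesgue_p p = PiM {..<p} (\<lambda>_. lborel)"

definition sqnorm_p :: "nat \<Rightarrow> (nat \<Rightarrow> real) \<Rightarrow> real" where
  "sqnorm_p p x = (\<Sum>i<p. (x i)^2)"

text \<open>Uniform (normalized surface / cone) measure on the unit sphere of R^p:
  push-forward of the uniform distribution on the open unit ball under x |-> x/|x|.\<close>
definition unif_sphere :: "nat \<Rightarrow> (nat \<Rightarrow> real) measure" where
  "unif_sphere p = distr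
     (uniform_measure (lebesgue_p p) {x \<in> space (lebesgue_p p). sqnorm_p p x < 1})
     (lebesgue_p p)
     (\<lambda>x. restrict (\<lambda>i. x i / sqrt (sqnorm_p p x)) {..<p})"

definition rank1 :: "nat \<Rightarrow> (nat \<Rightarrow> real) \<Rightarrow> nat \<Rightarrow> nat \<Rightarrow> real" where
  "rank1 p x = (\<lambda>i j. if i < p \<and> j < p then x i * x j else 0)"

definition frob :: "nat \<Rightarrow> (nat \<Rightarrow> nat \<Rightarrow> real) \<Rightarrow> (nat \<Rightarrow> nat \<Rightarrow> real) \<Rightarrow> real" where
  "frob p G B = (\<Sum>i<p. \<Sum>j<p. G i j * B i j)"

definition quad :: "nat \<Rightarrow> (nat \<Rightarrow> nat \<Rightarrow> real) \<Rightarrow> (nat \<Rightarrow> real) \<Rightarrow> real" where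
  "quad p B x = (\<Sum>i<p. \<Sum>j<p. x i * B i j * x j)"

definition trace_p :: "nat \<Rightarrow> (nat \<Rightarrow> nat \<Rightarrow> real) \<Rightarrow> real" where
  "trace_p p B = (\<Sum>i<p. B i i)"

definition psd_p :: "nat \<Rightarrow> (nat \<Rightarrow> nat \<Rightarrow> real) \<Rightarrow> bool" where
  "psd_p p B \<longleftrightarrow> (\<forall>x. 0 \<le> quad p B x)"

text \<open>Feasible set of the SDP: B in Span{d_l d_l^T : l < k}, Tr B = 1, B psd.
  (Such B are automatically symmetric and zero outside the index range.)\<close>
definition sdp_feasible :: "nat \<Rightarrow> nat \<Rightarrow> (nat \<Rightarrow> nat \<Rightarrow> real) \<Rightarrow> (nat \<Rightarrow> nat \<Rightarrow> real) \<Rightarrow> bool" where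
  "sdp_feasible p k d B \<longleftrightarrow>
     (\<exists>c::nat \<Rightarrow> real. B = (\<lambda>i j. \<Sum>l<k. c l * rank1 p (d l) i j))
     \<and> trace_p p B = 1 \<and> psd_p p B"

definition sdp_unique_maximizer ::
  "nat \<Rightarrow> nat \<Rightarrow> (nat \<Rightarrow> nat \<Rightarrow> real) \<Rightarrow> (nat \<Rightarrow> nat \<Rightarrow> real) \<Rightarrow> (nat \<Rightarrow> nat \<Rightarrow> real) \<Rightarrow> bool" where
  "sdp_unique_maximizer p k d G B0 \<longleftrightarrow>
     sdp_feasible p k d B0 \<and>
     (\<forall>B. sdp_feasible p k d B \<and> B \<noteq> B0 \<longrightarrow> frob p G B < frob p G B0)"

definition sample_space :: "nat \<Rightarrow> nat \<Rightarrow> ((nat \<Rightarrow> nat \<Rightarrow> real) \<times> (nat \<Rightarrow> real)) measure" where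
  "sample_space p k = (PiM {..<k} (\<lambda>_. unif_sphere p)) \<Otimes>\<^sub>M unif_sphere p"

definition good_event :: "nat \<Rightarrow> nat \<Rightarrow> (nat \<Rightarrow> nat \<Rightarrow> real) \<Rightarrow> (nat \<Rightarrow> real) \<Rightarrow> bool" where
  "good_event p k d u \<longleftrightarrow>
     (\<exists>i<k. (\<forall>j<k. j \<noteq> i \<longrightarrow> quad p (rank1 p u) (d j) < quad p (rank1 p u) (d i))
            \<and> sdp_unique_maximizer p k d (rank1 p u) (rank1 p (d i)))"

end

theory Submission
  imports Defs "HOL-Real_Asymp.Real_Asymp"
begin

text \<open>Write \<open>v l = (u \<cdot> d l)\<^sup>2\<close> and \<open>\<Lambda> = ln k\<close>. If \<open>k < p powr 0.2\<close> the \<open>d l\<close> are nearly orthonormal and every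
  feasible combination has nonnegative coefficients. Otherwise the largest \<open>v l\<close> is at least
  \<open>1.9 \<Lambda> / p\<close>, since \<open>ln k\<close> is of order \<open>ln p\<close>. Let \<open>T\<close> consist of the few indices with
  \<open>v l > 1.7 \<Lambda> / p\<close> (and a few more exceptional ones). Since \<open>\<Sum>c l d l d l\<^sup>T\<close> is positive semidefinite,
  compressing it to the complement of \<open>span T\<close> shows that the coefficients outside \<open>T\<close> have Frobenius
  norm of the order of the trace \<open>s\<close> of the compression. Their share of the objective is compared with
  \<open>s\<close> through the operator \<open>W = \<Sum>(v l - 1/p) d l d l\<^sup>T\<close>, the sum taken outside \<open>T\<close>: replacing the coefficients by the
  weights of \<open>W\<close> only costs lower order terms because the kernel \<open>(d l \<cdot> d m)\<^sup>2 - 1/p\<close> has small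
  operator norm, and \<open>W\<close> is at most \<open>1.84 \<Lambda> / p\<close> up to a direction along \<open>u\<close>: moderately large \<open>v l\<close>
  are few enough for the restricted isometry property, and the truncated remainder is controlled by
  exponential moments. As \<open>1.84 < 1.9\<close>, mass outside \<open>T\<close> strictly lowers the objective.\<close>

section \<open>Lebesgue measure on finite products\<close>

text \<open>The obstacle is accuracy: the gap to be certified is of order
  \<open>\<Lambda> / p\<close>, while the coefficients outside \<open>T\<close> are known only in
  Euclidean norm. Let \<open>H\<close> be the off-diagonal matrix of the kernel, \<open>r\<close>
  the weights of \<open>W\<close> and \<open>e = H r\<close>. Pairing the coefficients with
  \<open>e\<close> by Cauchy-Schwarz costs about \<open>p powr (-0.94)\<close> times
  \<open>s\<close>, which is too much. Hence a second correction, as in a Neumann series for the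
  inverse of \<open>1 + H\<close>: the form with weights \<open>e\<close> is at most the largest
  entry of \<open>e\<close> times a frame bound, and only \<open>H e\<close> is paired by norm. The
  few indices with a large entry of \<open>e\<close> are the exceptional ones in \<open>T\<close>.

  The constants come from the cap estimates: a squared projection of size
  \<open>b * \<Lambda> / p\<close> has probability close to \<open>k powr (- b / 2)\<close>. With
  \<open>b = 1.9\<close> some vector still reaches this size; with \<open>b = 1.7\<close> only about
  \<open>k powr 0.15\<close> vectors do, few enough to be nearly orthonormal. The value 1.84 is
  \<open>1.7 * 1.05 + 0.05\<close> rounded up, with 1.05 from restricted isometry and 0.05 from the
  truncated part.\<close>

definition leb :: "nat set \<Rightarrow> (nat \<Rightarrow> real) measure" where
  "leb I = PiM I (\<lambda>_. lborel)"

definition ip :: "nat set \<Rightarrow> (nat \<Rightarrow> real) \<Rightarrow> (nat \<Rightarrow> real) \<Rightarrow> real" where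
  "ip I x y = (\<Sum>i\<in>I. x i * y i)"

lemma lebesgue_p_eq: "lebesgue_p p = leb {..<p}"
  by (simp add: lebesgue_p_def leb_def)

lemma sqnorm_p_eq: "sqnorm_p p x = ip {..<p} x x"
  by (simp add: sqnorm_p_def ip_def power2_eq_square)

lemma ip_commute: "ip I x y = ip I y x"
  by (simp add: ip_def mult.commute)

lemma ip_self_nonneg: "0 \<le> ip I x x"
  by (simp add: ip_def sum_nonneg)

lemma ip_add_left: "ip I (\<lambda>i. x i + y i) z = ip I x z + ip I y z"
  by (simp add: ip_def algebra_simps sum.distrib)

lemma ip_add_right: "ip I z (\<lambda>i. x i + y i) = ip I z x + ip I z y"
  by (simp add: ip_def algebra_simps sum.distrib)

lemma ip_diff_left: "ip I (\<lambda>i. x i - y i) z = ip I x z - ip I y z"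
  by (simp add: ip_def algebra_simps sum_subtractf)

lemma ip_diff_right: "ip I z (\<lambda>i. x i - y i) = ip I z x - ip I z y"
  by (simp add: ip_def algebra_simps sum_subtractf)

lemma ip_scale_left: "ip I (\<lambda>i. c * x i) z = c * ip I x z"
  by (simp add: ip_def sum_distrib_left mult.assoc)

lemma ip_scale_right: "ip I z (\<lambda>i. c * x i) = c * ip I z x"
  by (simp add: ip_def sum_distrib_left algebra_simps)

lemma ip_sum_left: "ip I (\<lambda>i. \<Sum>j\<in>J. c j * x j i) z = (\<Sum>j\<in>J. c j * ip I (x j) z)"
  unfolding ip_def by (simp add: sum_distrib_left sum_distrib_right mult.assoc) (rule sum.swap)

lemma ip_sum_right: "ip I z (\<lambda>i. \<Sum>j\<in>J. c j * x j i) = (\<Sum>j\<in>J. c j * ip I z (x j))"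
  by (simp add: ip_commute[of I z] ip_sum_left)

lemma ip_cong: "(\<And>i. i \<in> I \<Longrightarrow> x i = x' i) \<Longrightarrow> (\<And>i. i \<in> I \<Longrightarrow> y i = y' i) \<Longrightarrow> ip I x y = ip I x' y'"
  by (simp add: ip_def)

lemma ip_restrict [simp]: "ip I (restrict x I) y = ip I x y" "ip I x (restrict y I) = ip I x y"
  by (auto intro: ip_cong)

lemma ip_zero [simp]: "ip I (\<lambda>_. 0) y = 0" "ip I x (\<lambda>_. 0) = 0"
  by (auto simp: ip_def)

lemma ip_self_eq_0: "finite I \<Longrightarrow> ip I x x = 0 \<longleftrightarrow> (\<forall>i\<in>I. x i = 0)"
  unfolding ip_def by (subst sum_nonneg_eq_0_iff) auto

lemma ip_cauchy_schwarz: "(ip I x y)\<^sup>2 \<le> ip I x x * ip I y y"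
  using Cauchy_Schwarz_ineq_sum[of x y I] by (simp add: ip_def power2_eq_square)

lemma ip_cauchy_schwarz_abs: "\<bar>ip I x y\<bar> \<le> sqrt (ip I x x) * sqrt (ip I y y)"
  by (metis ip_cauchy_schwarz real_sqrt_abs real_sqrt_le_mono real_sqrt_mult)

lemma space_leb: "space (leb I) = (PiE I (\<lambda>_. UNIV))"
  by (simp add: leb_def space_PiM)

lemma sets_leb [measurable_cong]: "sets (leb I) = sets (PiM I (\<lambda>_. borel))"
  unfolding leb_def by (rule sets_PiM_cong) auto

lemma measurable_ip [measurable (raw)]:
  assumes "\<And>i. i \<in> I \<Longrightarrow> (\<lambda>x. f x i) \<in> borel_measurable M" "\<And>i. i \<in> I \<Longrightarrow> (\<lambda>x. g x i) \<in> borel_measurable M"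
  shows "(\<lambda>x. ip I (f x) (g x)) \<in> borel_measurable M"
  unfolding ip_def using assms by (intro borel_measurable_sum borel_measurable_times) auto

interpretation lebp: product_sigma_finite "\<lambda>_::nat. lborel :: real measure"
  by standard

lemma sigma_finite_leb: "finite I \<Longrightarrow> sigma_finite_measure (leb I)"
  unfolding leb_def by (rule lebp.sigma_finite)

lemma nn_integral_leb_insert:
  assumes "finite I" "i \<notin> I" "f \<in> borel_measurable (leb (insert i I))"
  shows "(\<integral>\<^sup>+x. f x \<partial>leb (insert i I)) = (\<integral>\<^sup>+x. (\<integral>\<^sup>+y. f (x(i := y)) \<partial>lborel) \<partial>leb I)"
  unfolding leb_def using assms by (intro lebp.product_nn_integral_insert) (auto simp: leb_def)

text \<open>Induction over the coordinates: the new one is substituted by the one-dimensional rule,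
  the others by the induction hypothesis applied to the inner integral. Used for dilations of balls,
  for translations (\<open>c = 1\<close>) and for point reflections (\<open>c = -1\<close>).\<close>

lemma nn_integral_leb_affine:
  assumes "finite I" "c \<noteq> 0" "f \<in> borel_measurable (leb I)"
  shows "(\<integral>\<^sup>+x. f x \<partial>leb I) = ennreal (\<bar>c\<bar> ^ card I) * (\<integral>\<^sup>+x. f (\<lambda>i\<in>I. a i + c * x i) \<partial>leb I)"
  using assms
proof (induction I arbitrary: f rule: finite_induct)
  case empty
  have "(\<integral>\<^sup>+x. f x \<partial>leb {}) = (\<integral>\<^sup>+x. f (\<lambda>i\<in>{}. a i + c * x i) \<partial>leb {})"
    by (rule nn_integral_cong) (auto simp: leb_def space_PiM restrict_def)
  then show ?case by (simp only: card.empty power_0 ennreal_1 mult_1)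
next
  case (insert i I)
  note [measurable] = insert.prems(2)[unfolded measurable_cong_sets[OF sets_leb refl]]
  have fin: "finite I" "i \<notin> I" by fact+
  have up [measurable]: "(\<lambda>(x, y). x(i := y)) \<in> PiM I (\<lambda>_. borel) \<Otimes>\<^sub>M borel \<rightarrow>\<^sub>M PiM (insert i I) (\<lambda>_. borel :: real measure)"
    using measurable_add_dim[of i I "\<lambda>_. borel :: real measure"] by simp
  have m1: "(\<lambda>(x, y). f (x(i := y))) \<in> borel_measurable (PiM I (\<lambda>_. borel) \<Otimes>\<^sub>M borel)"
    by measurable
  have aff: "(\<lambda>x. \<lambda>j\<in>insert i I. a j + c * x j) \<in> PiM (insert i I) (\<lambda>_. borel) \<rightarrow>\<^sub>M PiM (insert i I) (\<lambda>_. borel :: real measure)"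
    by measurable
  have fa: "(\<lambda>x. f (\<lambda>j\<in>insert i I. a j + c * x j)) \<in> borel_measurable (leb (insert i I))"
    using aff by measurable
  define g where "g x = (\<integral>\<^sup>+y. f (x(i := a i + c * y)) \<partial>lborel)" for x
  have gm: "g \<in> borel_measurable (leb I)"
  proof -
    have e: "(\<lambda>(x, y). f (x(i := a i + c * y))) = (\<lambda>(x, y). f (x(i := y))) \<circ> (\<lambda>(x,y). (x, a i + c * y))"
      by (auto simp: fun_eq_iff)
    have m0: "(\<lambda>(x,y). (x, a i + c * y)) \<in> PiM I (\<lambda>_. borel::real measure) \<Otimes>\<^sub>M (borel :: real measure) \<rightarrow>\<^sub>M PiM I (\<lambda>_. borel) \<Otimes>\<^sub>M borel"
      by measurable
    have "(\<lambda>(x, y). f (x(i := a i + c * y))) \<in> borel_measurable (PiM I (\<lambda>_. borel) \<Otimes>\<^sub>M borel)"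
      unfolding e by (rule measurable_comp[OF m0 m1])
    then have "(\<lambda>(x, y). f (x(i := a i + c * y))) \<in> borel_measurable (PiM I (\<lambda>_. borel) \<Otimes>\<^sub>M lborel)"
      by (simp cong: measurable_cong_sets add: sets_pair_measure_cong[OF refl sets_lborel])
    then have "g \<in> borel_measurable (PiM I (\<lambda>_. borel))"
      unfolding g_def by (intro sigma_finite_measure.borel_measurable_nn_integral[OF sigma_finite_lborel])
    then show ?thesis by (simp add: measurable_cong_sets[OF sets_leb refl])
  qed
  have "(\<integral>\<^sup>+x. f x \<partial>leb (insert i I)) = (\<integral>\<^sup>+x. (\<integral>\<^sup>+y. f (x(i := y)) \<partial>lborel) \<partial>leb I)"
    using insert by (intro nn_integral_leb_insert) auto
  also have "\<dots> = (\<integral>\<^sup>+x. ennreal \<bar>c\<bar> * g x \<partial>leb I)"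
  proof (rule nn_integral_cong)
    fix x assume "x \<in> space (leb I)"
    then have x: "x \<in> space (PiM I (\<lambda>_. borel::real measure))" by (simp add: space_leb space_PiM)
    have "(\<lambda>y. f (x(i := y))) \<in> borel_measurable borel"
      using measurable_compose_Pair1[OF x m1] by simp
    then show "(\<integral>\<^sup>+y. f (x(i := y)) \<partial>lborel) = ennreal \<bar>c\<bar> * g x"
      unfolding g_def using insert.prems(1) by (intro nn_integral_real_affine)
  qed
  also have "\<dots> = ennreal \<bar>c\<bar> * (\<integral>\<^sup>+x. g x \<partial>leb I)"
    using gm by (rule nn_integral_cmult)
  also have "(\<integral>\<^sup>+x. g x \<partial>leb I) = ennreal (\<bar>c\<bar> ^ card I) * (\<integral>\<^sup>+x. g (\<lambda>j\<in>I. a j + c * x j) \<partial>leb I)"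
    using insert.prems gm by (intro insert.IH) auto
  also have "(\<integral>\<^sup>+x. g (\<lambda>j\<in>I. a j + c * x j) \<partial>leb I) =
     (\<integral>\<^sup>+x. (\<integral>\<^sup>+y. f (\<lambda>j\<in>insert i I. a j + c * (x(i := y)) j) \<partial>lborel) \<partial>leb I)"
    unfolding g_def
  proof (intro nn_integral_cong)
    fix x y
    have "(\<lambda>j\<in>I. a j + c * x j)(i := a i + c * y) = (\<lambda>j\<in>insert i I. a j + c * (x(i := y)) j)"
      using fin(2) by (auto simp: fun_eq_iff)
    then show "f ((\<lambda>j\<in>I. a j + c * x j)(i := a i + c * y)) = f (\<lambda>j\<in>insert i I. a j + c * (x(i := y)) j)"
      by simp
  qed
  also have "\<dots> = (\<integral>\<^sup>+x. f (\<lambda>j\<in>insert i I. a j + c * x j) \<partial>leb (insert i I))"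
    using fin fa by (intro nn_integral_leb_insert[symmetric]) auto
  also have "ennreal \<bar>c\<bar> * (ennreal (\<bar>c\<bar> ^ card I) * (\<integral>\<^sup>+x. f (\<lambda>j\<in>insert i I. a j + c * x j) \<partial>leb (insert i I)))
     = ennreal (\<bar>c\<bar> ^ card (insert i I)) * (\<integral>\<^sup>+x. f (\<lambda>j\<in>insert i I. a j + c * x j) \<partial>leb (insert i I))"
    using fin by (simp add: ennreal_mult mult.assoc)
  finally show ?case .
qed

section \<open>Volumes of Euclidean balls\<close>

definition ballI :: "nat set \<Rightarrow> (nat \<Rightarrow> real) \<Rightarrow> real \<Rightarrow> (nat \<Rightarrow> real) set" where
  "ballI I a r = {x \<in> space (leb I). ip I (\<lambda>i. x i - a i) (\<lambda>i. x i - a i) < r\<^sup>2}"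

lemma measurable_component_leb [measurable]: "i \<in> I \<Longrightarrow> (\<lambda>x. x i) \<in> borel_measurable (leb I)"
  by (subst measurable_cong_sets[OF sets_leb refl]) measurable

lemma ballI_sets [measurable]: "ballI I a r \<in> sets (leb I)"
  unfolding ballI_def by measurable

lemma emeasure_leb_box:
  assumes "finite I" "b \<ge> 0" shows "emeasure (leb I) (PiE I (\<lambda>_. {-b..b})) = ennreal ((2*b) ^ card I)"
proof -
  have "emeasure (leb I) (PiE I (\<lambda>_. {-b..b})) = (\<Prod>i\<in>I. emeasure lborel {-b..b})"
    unfolding leb_def using assms by (subst lebp.emeasure_PiM) auto
  then show ?thesis using assms(2) by (auto simp: ennreal_power)
qed

text \<open>The volume of the unit ball is never computed: it only has to be positive and finite, so
  that it cancels in ratios of volumes.\<close>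

definition vol1 :: "nat set \<Rightarrow> ennreal" where "vol1 I = emeasure (leb I) (ballI I (\<lambda>_. 0) 1)"

lemma emeasure_ballI:
  assumes "finite I" "r > 0"
  shows "emeasure (leb I) (ballI I a r) = ennreal (r ^ card I) * vol1 I"
proof -
  have "emeasure (leb I) (ballI I a r) = (\<integral>\<^sup>+x. indicator (ballI I a r) x \<partial>leb I)"
    by simp
  also have "\<dots> = ennreal (\<bar>r\<bar> ^ card I) * (\<integral>\<^sup>+x. indicator (ballI I a r) (\<lambda>i\<in>I. a i + r * x i) \<partial>leb I)"
    using assms by (intro nn_integral_leb_affine) auto
  also have "(\<integral>\<^sup>+x. indicator (ballI I a r) (\<lambda>i\<in>I. a i + r * x i) \<partial>leb I)
     = (\<integral>\<^sup>+x. indicator (ballI I (\<lambda>_. 0) 1) x \<partial>leb I)"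
  proof (rule nn_integral_cong)
    fix x assume x: "x \<in> space (leb I)"
    let ?y = "\<lambda>i\<in>I. a i + r * x i"
    have "ip I (\<lambda>i. ?y i - a i) (\<lambda>i. ?y i - a i) = ip I (\<lambda>i. r * x i) (\<lambda>i. r * x i)"
      by (rule ip_cong) auto
    also have "\<dots> = r\<^sup>2 * ip I x x" by (simp add: ip_scale_left ip_scale_right power2_eq_square)
    finally have "?y \<in> ballI I a r \<longleftrightarrow> x \<in> ballI I (\<lambda>_. 0) 1"
      using assms x by (auto simp: ballI_def space_leb)
    then show "(indicator (ballI I a r) ?y :: ennreal) = indicator (ballI I (\<lambda>_. 0) 1) x"
      by (auto simp: indicator_def)
  qed
  finally show ?thesis using assms by (simp add: vol1_def)
qed

lemma ip_self_le_card: "finite I \<Longrightarrow> (\<And>i. i \<in> I \<Longrightarrow> \<bar>x i\<bar> \<le> b) \<Longrightarrow> ip I x x \<le> real (card I) * b\<^sup>2"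
proof -
  assume "finite I" and b: "\<And>i. i \<in> I \<Longrightarrow> \<bar>x i\<bar> \<le> b"
  have "x i * x i \<le> b\<^sup>2" if "i \<in> I" for i
    using b[OF that] by (metis abs_ge_zero power2_abs power2_eq_square power_mono)
  then have "ip I x x \<le> (\<Sum>i\<in>I. b\<^sup>2)" unfolding ip_def by (intro sum_mono) auto
  then show ?thesis by simp
qed

lemma comp_le_ip: "finite I \<Longrightarrow> i \<in> I \<Longrightarrow> (x i)\<^sup>2 \<le> ip I x x"
  unfolding ip_def by (rule order_trans[OF _ member_le_sum[of i I "\<lambda>i. x i * x i"]]) (auto simp: power2_eq_square)

lemma vol1_pos: assumes "finite I" shows "vol1 I > 0"
proof -
  \<comment> \<open>Half the side of a cube inside the unit ball. The added 1 keeps the quotient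
    meaningful for empty \<open>I\<close>.\<close>
  define b where "b = 1 / (2 * (real (card I) + 1))"
  have b: "b > 0" by (simp add: b_def)
  have b1: "(real (card I) + 1) * b = 1/2" by (simp add: b_def field_simps)
  have "real (card I) * b\<^sup>2 \<le> ((real (card I) + 1) * b) * b"
    using b by (simp add: power2_eq_square algebra_simps)
  moreover have "b \<le> 1/2" by (simp add: b_def field_simps)
  ultimately have b2: "real (card I) * b\<^sup>2 < 1" unfolding b1 by simp
  have "PiE I (\<lambda>_. {-b..b}) \<subseteq> ballI I (\<lambda>_. 0) 1"
  proof
    fix x assume x: "x \<in> PiE I (\<lambda>_. {-b..b})"
    have "ip I x x \<le> real (card I) * b\<^sup>2"
      using x by (intro ip_self_le_card assms) (auto simp: PiE_iff abs_le_iff)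
    also note b2
    finally show "x \<in> ballI I (\<lambda>_. 0) 1" using x by (auto simp: ballI_def space_leb PiE_iff)
  qed
  then have "emeasure (leb I) (PiE I (\<lambda>_. {-b..b})) \<le> vol1 I"
    unfolding vol1_def by (intro emeasure_mono) auto
  moreover have "emeasure (leb I) (PiE I (\<lambda>_. {-b..b})) > 0"
    using b assms by (subst emeasure_leb_box) auto
  ultimately show ?thesis by order
qed

lemma vol1_finite: assumes "finite I" shows "vol1 I < \<infinity>"
proof -
  have "ballI I (\<lambda>_. 0) 1 \<subseteq> PiE I (\<lambda>_. {-1..1})"
  proof
    fix x assume x: "x \<in> ballI I (\<lambda>_. 0) 1"
    then have x1: "(x i)\<^sup>2 \<le> 1" if "i \<in> I" for i
      using comp_le_ip[OF assms that, of x] by (simp add: ballI_def)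
    then have "-1 \<le> x i \<and> x i \<le> 1" if "i \<in> I" for i
      using x1[OF that] abs_square_le_1[of "x i"] by auto
    then show "x \<in> PiE I (\<lambda>_. {-1..1})" using x by (auto simp: ballI_def space_leb PiE_iff)
  qed
  then have "vol1 I \<le> emeasure (leb I) (PiE I (\<lambda>_. {-1..1}))"
    unfolding vol1_def by (intro emeasure_mono sets.sets_into_space) (auto simp: leb_def assms intro!: sets_PiM_I_finite)
  also have "\<dots> < \<infinity>" using assms by (subst emeasure_leb_box) auto
  finally show ?thesis .
qed

lemma measurable_update_borel [measurable]:
  "(\<lambda>(x, y). x(i := y)) \<in> PiM I (\<lambda>_. borel) \<Otimes>\<^sub>M borel \<rightarrow>\<^sub>M PiM (insert i I) (\<lambda>_. borel :: real measure)"
  using measurable_add_dim[of i I "\<lambda>_. borel :: real measure"] by simp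

text \<open>Along a coordinate in which \<open>a\<close> does not vanish, every line meets the
  hyperplane in a single point.\<close>

lemma hyperplane_null:
  assumes "finite I" "i \<in> I" "a i \<noteq> 0"
  shows "emeasure (leb I) {x \<in> space (leb I). ip I a x = b} = 0"
proof -
  define J where "J = I - {i}"
  have J: "finite J" "i \<notin> J" "insert i J = I" using assms by (auto simp: J_def)
  let ?H = "{x \<in> space (leb I). ip I a x = b}"
  have H [measurable]: "?H \<in> sets (leb I)" by measurable
  have "emeasure (leb I) ?H = (\<integral>\<^sup>+x. indicator ?H x \<partial>leb (insert i J))"
    using J by simp
  also have "\<dots> = (\<integral>\<^sup>+x. (\<integral>\<^sup>+y. indicator ?H (x(i := y)) \<partial>lborel) \<partial>leb J)"
    using J H by (intro nn_integral_leb_insert) auto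
  also have "\<dots> = (\<integral>\<^sup>+x. 0 \<partial>leb J)"
  proof (rule nn_integral_cong)
    fix x assume x: "x \<in> space (leb J)"
    have "ip I a (x(i := y)) = ip J a x + a i * y" for y
    proof -
      have "ip I a (x(i := y)) = a i * y + ip J a (x(i := y))"
        unfolding ip_def J(3)[symmetric] using J(1,2) by simp
      also have "ip J a (x(i := y)) = ip J a x" using J by (intro ip_cong) auto
      finally show ?thesis by (simp only: add.commute)
    qed
    then have "(indicator ?H (x(i := y)) :: ennreal) = indicator {(b - ip J a x) / a i} y" for y
      using x assms(3) J by (auto simp: indicator_def space_leb PiE_iff extensional_def field_simps)
    then show "(\<integral>\<^sup>+y. indicator ?H (x(i := y)) \<partial>lborel) = 0" by simp
  qed
  finally show ?thesis by simp
qed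

section \<open>Householder reflections and the invariance of Lebesgue measure\<close>

definition hrefl :: "nat set \<Rightarrow> (nat \<Rightarrow> real) \<Rightarrow> (nat \<Rightarrow> real) \<Rightarrow> nat \<Rightarrow> real" where
  "hrefl I h x = (\<lambda>i\<in>I. x i - 2 * ip I h x / ip I h h * h i)"

lemma measurable_hrefl [measurable]: "hrefl I h \<in> leb I \<rightarrow>\<^sub>M leb I"
proof -
  have "(\<lambda>x. \<lambda>i\<in>I. x i - 2 * ip I h x / ip I h h * h i) \<in> leb I \<rightarrow>\<^sub>M PiM I (\<lambda>_. borel)"
    by (rule measurable_restrict) measurable
  then show ?thesis unfolding hrefl_def by (simp add: measurable_cong_sets[OF refl sets_leb])
qed

lemma ip_hrefl:
  assumes "ip I h h \<noteq> 0" shows "ip I z (hrefl I h x) = ip I (hrefl I h z) x"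
proof -
  have "ip I z (hrefl I h x) = ip I z (\<lambda>i. x i - 2 * ip I h x / ip I h h * h i)"
    unfolding hrefl_def by simp
  moreover have "ip I (hrefl I h z) x = ip I (\<lambda>i. z i - 2 * ip I h z / ip I h h * h i) x"
    unfolding hrefl_def by simp
  ultimately show ?thesis
    by (simp add: ip_diff_right ip_diff_left ip_scale_right ip_scale_left ip_commute[of I z h]
        del: times_divide_eq_left times_divide_eq_right) (simp add: mult.commute)
qed

lemma hrefl_linear: "hrefl I h (\<lambda>i\<in>I. a * x i + b * y i) = (\<lambda>i\<in>I. a * hrefl I h x i + b * hrefl I h y i)"
proof -
  have "ip I h (\<lambda>i\<in>I. a * x i + b * y i) = a * ip I h x + b * ip I h y"
    by (simp add: ip_add_right ip_scale_right)
  then show ?thesis by (auto simp: hrefl_def fun_eq_iff field_simps)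
     (auto simp: add_divide_distrib algebra_simps)
qed

lemma hrefl_hrefl:
  assumes "ip I h h \<noteq> 0" "x \<in> extensional I" shows "hrefl I h (hrefl I h x) = x"
proof -
  have "ip I h (hrefl I h x) = - ip I h x"
    using assms by (simp add: hrefl_def ip_diff_right ip_scale_right del: times_divide_eq_left times_divide_eq_right) simp
  then show ?thesis
    using assms by (auto simp: hrefl_def[of I h "hrefl I h x"] fun_eq_iff extensional_def)
       (auto simp: hrefl_def)
qed

lemma ip_hrefl_hrefl:
  assumes "ip I h h \<noteq> 0" shows "ip I (hrefl I h x) (hrefl I h y) = ip I x y"
proof -
  have "ip I (hrefl I h x) (hrefl I h y) = ip I (hrefl I h (hrefl I h (restrict x I))) (restrict y I)"
    using assms by (subst ip_hrefl) (auto simp: hrefl_def intro!: ip_cong)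
  also have "\<dots> = ip I x y" using assms by (subst hrefl_hrefl) auto
  finally show ?thesis .
qed

lemma hrefl_space: "hrefl I h x \<in> space (leb I)"
  by (auto simp: hrefl_def space_leb)

text \<open>Both \<open>\<mu>\<close> and its image under the reflection \<open>T\<close> are translation invariant, and both give the unit
  ball \<open>B\<close> the same mass; evaluating the double integral of \<open>f(x) 1\<^sub>B(x - T y)\<close> in both orders
  identifies them.\<close>
lemma nn_integral_leb_hrefl:
  assumes I: "finite I" and h: "ip I h h \<noteq> 0" and f: "f \<in> borel_measurable (leb I)"
  shows "(\<integral>\<^sup>+x. f (hrefl I h x) \<partial>leb I) = (\<integral>\<^sup>+x. f x \<partial>leb I)"
proof -
  interpret sigma_finite_measure "leb I" by (rule sigma_finite_leb[OF I])
  interpret pair_sigma_finite "leb I" "leb I" ..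
  note [measurable] = f
  let ?B = "ballI I (\<lambda>_. 0) 1" and ?T = "hrefl I h"
  let ?m = "\<lambda>x y. (\<lambda>i\<in>I. x i - y i) :: nat \<Rightarrow> real" and ?a = "\<lambda>x y. (\<lambda>i\<in>I. x i + y i) :: nat \<Rightarrow> real"
  have mm [measurable]: "(\<lambda>(x, y). ?m x y) \<in> leb I \<Otimes>\<^sub>M leb I \<rightarrow>\<^sub>M leb I"
  proof -
    have "(\<lambda>z. \<lambda>i\<in>I. fst z i - snd z i) \<in> leb I \<Otimes>\<^sub>M leb I \<rightarrow>\<^sub>M PiM I (\<lambda>_. borel :: real measure)"
      by (rule measurable_restrict) measurable
    then show ?thesis by (simp add: measurable_cong_sets[OF refl sets_leb] split_def)
  qed
  have ma [measurable]: "(\<lambda>(x, y). ?a x y) \<in> leb I \<Otimes>\<^sub>M leb I \<rightarrow>\<^sub>M leb I"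
  proof -
    have "(\<lambda>z. \<lambda>i\<in>I. fst z i + snd z i) \<in> leb I \<Otimes>\<^sub>M leb I \<rightarrow>\<^sub>M PiM I (\<lambda>_. borel :: real measure)"
      by (rule measurable_restrict) measurable
    then show ?thesis by (simp add: measurable_cong_sets[OF refl sets_leb] split_def)
  qed
  have mm2 [measurable]: "?m x \<in> leb I \<rightarrow>\<^sub>M leb I" if "x \<in> space (leb I)" for x
    using measurable_compose_Pair1[OF that mm] by simp
  have ma2 [measurable]: "?a x \<in> leb I \<rightarrow>\<^sub>M leb I" if "x \<in> space (leb I)" for x
    using measurable_compose_Pair1[OF that ma] by simp
  have trans: "(\<integral>\<^sup>+x. g (?a c x) \<partial>leb I) = (\<integral>\<^sup>+x. g x \<partial>leb I)" if "g \<in> borel_measurable (leb I)" for g c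
    using nn_integral_leb_affine[OF I, of 1 g c] that by simp
  have refl: "(\<integral>\<^sup>+x. g (?m c x) \<partial>leb I) = (\<integral>\<^sup>+x. g x \<partial>leb I)" if "g \<in> borel_measurable (leb I)" for g c
    using nn_integral_leb_affine[OF I, of "-1" g c] that by simp
  have TB: "?T x \<in> ?B \<longleftrightarrow> x \<in> ?B" if "x \<in> space (leb I)" for x
    using that ip_hrefl_hrefl[OF h, of x x] by (simp add: ballI_def hrefl_space)
  have TT: "?T (?T x) = x" if "x \<in> space (leb I)" for x
    using that by (intro hrefl_hrefl h) (auto simp: space_leb PiE_iff)
  \<comment> \<open>The reflection is a linear involution, so a translation by \<open>?T y\<close>
    can be pulled through it.\<close>
  have lin: "?m x (?T y) = ?T (?m (?T x) y)" "?a x (?T y) = ?T (?a (?T x) y)" if "x \<in> space (leb I)" for x y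
    using hrefl_linear[of I h 1 "?T x" "-1" y] hrefl_linear[of I h 1 "?T x" "1" y] TT[OF that] by auto
  have sp: "?m x y \<in> space (leb I)" "?a x y \<in> space (leb I)" for x y by (auto simp: space_leb)
  have Bm: "(indicator ?B :: _ \<Rightarrow> ennreal) \<in> borel_measurable (leb I)" by measurable
  define J where "J = (\<integral>\<^sup>+y. (\<integral>\<^sup>+x. f x * indicator ?B (?m x (?T y)) \<partial>leb I) \<partial>leb I)"
  have "J = (\<integral>\<^sup>+x. (\<integral>\<^sup>+y. f x * indicator ?B (?m x (?T y)) \<partial>leb I) \<partial>leb I)"
    unfolding J_def by (rule Fubini'[symmetric]) (measurable)
  also have "\<dots> = (\<integral>\<^sup>+x. f x * vol1 I \<partial>leb I)"
  proof (rule nn_integral_cong)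
    fix x assume x [measurable]: "x \<in> space (leb I)"
    have "(\<integral>\<^sup>+y. f x * indicator ?B (?m x (?T y)) \<partial>leb I) = (\<integral>\<^sup>+y. f x * indicator ?B (?m (?T x) y) \<partial>leb I)"
      by (intro nn_integral_cong) (simp add: lin(1)[OF x] indicator_def TB sp)
    also have "\<dots> = f x * (\<integral>\<^sup>+y. indicator ?B (?m (?T x) y) \<partial>leb I)"
      using hrefl_space by (intro nn_integral_cmult) measurable
    also have "(\<integral>\<^sup>+y. indicator ?B (?m (?T x) y) \<partial>leb I) = vol1 I"
      unfolding refl[OF Bm] vol1_def by simp
    finally show "(\<integral>\<^sup>+y. f x * indicator ?B (?m x (?T y)) \<partial>leb I) = f x * vol1 I" .
  qed
  also have "\<dots> = (\<integral>\<^sup>+x. f x \<partial>leb I) * vol1 I" by (rule nn_integral_multc) measurable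
  finally have J1: "J = (\<integral>\<^sup>+x. f x \<partial>leb I) * vol1 I" .
  have "J = (\<integral>\<^sup>+y. (\<integral>\<^sup>+x. f (?a (?T y) x) * indicator ?B x \<partial>leb I) \<partial>leb I)"
    unfolding J_def
  proof (rule nn_integral_cong)
    fix y assume y: "y \<in> space (leb I)"
    have Ty [measurable]: "?T y \<in> space (leb I)" by (rule hrefl_space)
    have "(\<lambda>x. ?m x (?T y)) \<in> leb I \<rightarrow>\<^sub>M leb I" using measurable_compose[OF measurable_Pair2'[OF Ty] mm] by simp
    then have "(\<lambda>x. f x * indicator ?B (?m x (?T y))) \<in> borel_measurable (leb I)" by measurable
    from trans[OF this, of "?T y"]
    have "(\<integral>\<^sup>+x. f x * indicator ?B (?m x (?T y)) \<partial>leb I)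
       = (\<integral>\<^sup>+x. f (?a (?T y) x) * indicator ?B (?m (?a (?T y) x) (?T y)) \<partial>leb I)" by simp
    also have "\<dots> = (\<integral>\<^sup>+x. f (?a (?T y) x) * indicator ?B x \<partial>leb I)"
    proof (rule nn_integral_cong)
      fix x assume "x \<in> space (leb I)"
      then have "?m (?a (?T y) x) (?T y) = x" by (auto simp: fun_eq_iff space_leb PiE_iff extensional_def)
      then show "f (?a (?T y) x) * indicator ?B (?m (?a (?T y) x) (?T y)) = f (?a (?T y) x) * indicator ?B x" by simp
    qed
    finally show "(\<integral>\<^sup>+x. f x * indicator ?B (?m x (?T y)) \<partial>leb I) = (\<integral>\<^sup>+x. f (?a (?T y) x) * indicator ?B x \<partial>leb I)" .
  qed
  also have "\<dots> = (\<integral>\<^sup>+x. (\<integral>\<^sup>+y. f (?a (?T y) x) * indicator ?B x \<partial>leb I) \<partial>leb I)"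
    by (rule Fubini'[symmetric]) measurable
  also have "\<dots> = (\<integral>\<^sup>+x. (\<integral>\<^sup>+y. f (?T y) \<partial>leb I) * indicator ?B x \<partial>leb I)"
  proof (rule nn_integral_cong)
    fix x assume x [measurable]: "x \<in> space (leb I)"
    have Tx [measurable]: "?T x \<in> space (leb I)" by (rule hrefl_space)
    have "(\<integral>\<^sup>+y. f (?a (?T y) x) * indicator ?B x \<partial>leb I) = (\<integral>\<^sup>+y. f (?T (?a (?T x) y)) * indicator ?B x \<partial>leb I)"
      using lin(2)[OF x] by (intro nn_integral_cong) (simp add: add.commute)
    also have "\<dots> = (\<integral>\<^sup>+y. f (?T (?a (?T x) y)) \<partial>leb I) * indicator ?B x"
      by (rule nn_integral_multc) measurable
    also have "(\<integral>\<^sup>+y. f (?T (?a (?T x) y)) \<partial>leb I) = (\<integral>\<^sup>+y. f (?T y) \<partial>leb I)"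
      by (rule trans[of "\<lambda>y. f (?T y)"]) measurable
    finally show "(\<integral>\<^sup>+y. f (?a (?T y) x) * indicator ?B x \<partial>leb I) = (\<integral>\<^sup>+y. f (?T y) \<partial>leb I) * indicator ?B x" .
  qed
  also have "\<dots> = (\<integral>\<^sup>+y. f (?T y) \<partial>leb I) * vol1 I"
    unfolding vol1_def by (rule nn_integral_cmult_indicator) measurable
  finally have "(\<integral>\<^sup>+y. f (?T y) \<partial>leb I) * vol1 I = (\<integral>\<^sup>+x. f x \<partial>leb I) * vol1 I"
    using J1 by simp
  then have "(\<integral>\<^sup>+y. f (?T y) \<partial>leb I) * vol1 I / vol1 I = (\<integral>\<^sup>+x. f x \<partial>leb I) * vol1 I / vol1 I"
    by simp
  then show ?thesis
    using vol1_pos[OF I] vol1_finite[OF I] by (simp add: ennreal_mult_divide_eq)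
qed

section \<open>The uniform distribution on the sphere\<close>

abbreviation dot :: "nat \<Rightarrow> (nat \<Rightarrow> real) \<Rightarrow> (nat \<Rightarrow> real) \<Rightarrow> real" where
  "dot p \<equiv> ip {..<p}"

definition dirn :: "nat \<Rightarrow> (nat \<Rightarrow> real) \<Rightarrow> nat \<Rightarrow> real" where
  "dirn p x = (\<lambda>i\<in>{..<p}. x i / sqrt (dot p x x))"

abbreviation uball :: "nat \<Rightarrow> (nat \<Rightarrow> real) set" where
  "uball p \<equiv> ballI {..<p} (\<lambda>_. 0) 1"

lemma unif_sphere_eq:
  "unif_sphere p = distr (uniform_measure (leb {..<p}) (uball p)) (leb {..<p}) (dirn p)"
  unfolding unif_sphere_def lebesgue_p_eq sqnorm_p_eq dirn_def[abs_def] by (simp add: ballI_def)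

lemma measurable_dirn [measurable]: "dirn p \<in> leb {..<p} \<rightarrow>\<^sub>M leb {..<p}"
proof -
  have "(\<lambda>x. \<lambda>i\<in>{..<p}. x i / sqrt (dot p x x)) \<in> leb {..<p} \<rightarrow>\<^sub>M PiM {..<p} (\<lambda>_. borel)"
    by (rule measurable_restrict) measurable
  then show ?thesis unfolding dirn_def by (simp add: measurable_cong_sets[OF refl sets_leb])
qed

lemma sets_sphere [measurable_cong]: "sets (unif_sphere p) = sets (leb {..<p})"
  by (simp add: unif_sphere_eq)

lemma space_sphere: "space (unif_sphere p) = space (leb {..<p})"
  by (simp add: unif_sphere_eq)

lemma measurable_component_sphere [measurable]: "i < p \<Longrightarrow> (\<lambda>x. x i) \<in> borel_measurable (unif_sphere p)"
  by (subst measurable_cong_sets[OF sets_sphere refl]) measurable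

lemma dirn_space: "dirn p x \<in> space (leb {..<p})"
  by (auto simp: dirn_def space_leb)

lemma ip_dirn: "dot p z (dirn p x) = dot p z x / sqrt (dot p x x)"
  unfolding dirn_def by (simp add: ip_def sum_divide_distrib)

lemma measurable_ip_dirn [measurable]: "(\<lambda>x. dot p z (dirn p x)) \<in> borel_measurable (leb {..<p})"
  unfolding ip_dirn by measurable

lemma ip_dirn_self: "dot p x x \<noteq> 0 \<Longrightarrow> dot p (dirn p x) (dirn p x) = 1"
  using ip_self_nonneg[of "{..<p}" x] unfolding ip_dirn ip_commute[of _ "dirn p x" x] by simp

lemma vol1_nonzero [simp]: "finite I \<Longrightarrow> vol1 I \<noteq> 0" "finite I \<Longrightarrow> vol1 I \<noteq> top"
  "finite I \<Longrightarrow> emeasure (leb I) (ballI I (\<lambda>_. 0) 1) \<noteq> 0"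
  "finite I \<Longrightarrow> emeasure (leb I) (ballI I (\<lambda>_. 0) 1) \<noteq> top"
  using vol1_pos[of I] vol1_finite[of I] by (auto simp: vol1_def)

lemma prob_space_sphere: "prob_space (unif_sphere p)"
proof -
  interpret U: prob_space "uniform_measure (leb {..<p}) (uball p)"
    by (rule prob_space_uniform_measure) auto
  show ?thesis unfolding unif_sphere_eq by (rule U.prob_space_distr) measurable
qed

lemma nn_integral_sphere:
  assumes "f \<in> borel_measurable (leb {..<p})"
  shows "(\<integral>\<^sup>+x. f x \<partial>unif_sphere p) = (\<integral>\<^sup>+x. f (dirn p x) * indicator (uball p) x \<partial>leb {..<p}) / vol1 {..<p}"
proof -
  note [measurable] = assms
  have "(\<integral>\<^sup>+x. f x \<partial>unif_sphere p) = (\<integral>\<^sup>+x. f (dirn p x) \<partial>uniform_measure (leb {..<p}) (uball p))"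
    unfolding unif_sphere_eq by (rule nn_integral_distr) measurable
  then show ?thesis by (simp add: nn_integral_uniform_measure vol1_def)
qed

lemma emeasure_sphere:
  assumes "A \<in> sets (leb {..<p})"
  shows "emeasure (unif_sphere p) A = emeasure (leb {..<p}) {x \<in> uball p. dirn p x \<in> A} / vol1 {..<p}"
proof -
  note [measurable] = assms
  have "emeasure (unif_sphere p) A = (\<integral>\<^sup>+x. indicator A x \<partial>unif_sphere p)"
    using assms by (simp add: sets_sphere)
  also have "\<dots> = (\<integral>\<^sup>+x. indicator A (dirn p x) * indicator (uball p) x \<partial>leb {..<p}) / vol1 {..<p}"
    by (rule nn_integral_sphere) measurable
  also have "(\<integral>\<^sup>+x. indicator A (dirn p x) * indicator (uball p) x \<partial>leb {..<p})
     = (\<integral>\<^sup>+x. indicator {x \<in> uball p. dirn p x \<in> A} x \<partial>leb {..<p})"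
    by (intro nn_integral_cong) (auto simp: indicator_def)
  also have "\<dots> = emeasure (leb {..<p}) {x \<in> uball p. dirn p x \<in> A}"
    by (intro nn_integral_indicator) (auto simp: ballI_def)
  finally show ?thesis .
qed

text \<open>A hyperplane through the origin is a cone, so its preimage under \<open>dirn\<close>
  lies in the hyperplane itself.\<close>

lemma sphere_hyperplane_null:
  assumes "dot p a a \<noteq> 0"
  shows "emeasure (unif_sphere p) {x \<in> space (unif_sphere p). dot p a x = 0} = 0"
proof -
  obtain i where i: "i < p" "a i \<noteq> 0" using assms by (auto simp: ip_self_eq_0)
  have "emeasure (leb {..<p}) {x \<in> uball p. dirn p x \<in> {x \<in> space (leb {..<p}). dot p a x = 0}}
     \<le> emeasure (leb {..<p}) {x \<in> space (leb {..<p}). dot p a x = 0}"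
  proof (intro emeasure_mono subsetI CollectI)
    fix x assume "x \<in> {x \<in> uball p. dirn p x \<in> {x \<in> space (leb {..<p}). dot p a x = 0}}"
    then have x: "x \<in> space (leb {..<p})" "dot p a x / sqrt (dot p x x) = 0"
      by (auto simp: ballI_def ip_dirn)
    moreover have "dot p a x = 0" if "dot p x x = 0"
      using that by (simp add: ip_self_eq_0) (simp add: ip_def)
    ultimately show "x \<in> space (leb {..<p}) \<and> dot p a x = 0" by auto
  qed measurable
  also have "\<dots> = 0" using i by (intro hyperplane_null) auto
  finally show ?thesis by (subst space_sphere, subst emeasure_sphere) auto
qed

text \<open>Normalisation fails only at the origin, where \<open>dirn\<close> has the value 0. The
  origin lies in the null hyperplane with all-ones normal vector, and \<open>p \<ge> 1\<close>
  supplies a coordinate for \<open>hyperplane_null\<close>.\<close>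

lemma AE_sphere_unit:
  assumes "p \<ge> 1" shows "AE x in unif_sphere p. dot p x x = 1"
proof -
  have "emeasure (leb {..<p}) {x \<in> uball p. dirn p x \<in> {x \<in> space (leb {..<p}). dot p x x \<noteq> 1}}
     \<le> emeasure (leb {..<p}) {x \<in> space (leb {..<p}). dot p (\<lambda>_. 1) x = 0}"
  proof (intro emeasure_mono subsetI CollectI)
    fix x assume "x \<in> {x \<in> uball p. dirn p x \<in> {x \<in> space (leb {..<p}). dot p x x \<noteq> 1}}"
    then have x: "x \<in> space (leb {..<p})" "dot p x x = 0"
      using ip_dirn_self[of p x] by (auto simp: ballI_def)
    then show "x \<in> space (leb {..<p}) \<and> dot p (\<lambda>_. 1) x = 0"
      by (simp add: ip_self_eq_0) (simp add: ip_def)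
  qed measurable
  also have "\<dots> = 0" using assms by (intro hyperplane_null[of _ 0]) auto
  finally have "emeasure (unif_sphere p) {x \<in> space (unif_sphere p). dot p x x \<noteq> 1} = 0"
    by (subst space_sphere, subst emeasure_sphere) auto
  then show ?thesis by (intro AE_I[OF order_refl]) auto
qed

text \<open>Single reflections are enough for rotation invariance: the one along
  \<open>z - w\<close> exchanges two vectors of equal length, preserves Lebesgue measure and the
  ball, and commutes with normalisation.\<close>

lemma nn_integral_sphere_rotate:
  assumes f: "f \<in> borel_measurable borel" and zw: "dot p z z = dot p w w"
  shows "(\<integral>\<^sup>+x. f (dot p z x) \<partial>unif_sphere p) = (\<integral>\<^sup>+x. f (dot p w x) \<partial>unif_sphere p)"
proof -
  note [measurable] = f
  define h where "h = (\<lambda>i. z i - w i)"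
  show ?thesis
  proof (cases "dot p h h = 0")
    case True
    then have "dot p z x = dot p w x" for x
      by (intro ip_cong) (auto simp: h_def ip_self_eq_0)
    then show ?thesis by simp
  next
    case False
    let ?T = "hrefl {..<p} h"
    \<comment> \<open>Equal lengths make the reflection coefficient of \<open>z\<close> equal to 1,
      so \<open>z\<close> is sent to \<open>z - h = w\<close>.\<close>
    have hh: "dot p h h = 2 * dot p h z"
      unfolding h_def ip_diff_left ip_diff_right using zw by (simp add: ip_commute[of _ w z])
    have Tz: "dot p (?T z) x = dot p w x" for x
      using False hh by (intro ip_cong) (auto simp: hrefl_def h_def)
    have TB: "?T x \<in> uball p \<longleftrightarrow> x \<in> uball p" if "x \<in> space (leb {..<p})" for x
      using that ip_hrefl_hrefl[OF False, of x x] by (simp add: ballI_def hrefl_space)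
    have "(\<integral>\<^sup>+x. f (dot p z (dirn p x)) * indicator (uball p) x \<partial>leb {..<p})
      = (\<integral>\<^sup>+x. f (dot p z (dirn p (?T x))) * indicator (uball p) (?T x) \<partial>leb {..<p})"
      using False by (intro nn_integral_leb_hrefl[symmetric]) (simp_all, measurable)
    also have "\<dots> = (\<integral>\<^sup>+x. f (dot p w (dirn p x)) * indicator (uball p) x \<partial>leb {..<p})"
    proof (rule nn_integral_cong)
      fix x assume x: "x \<in> space (leb {..<p})"
      have "dot p z (dirn p (?T x)) = dot p w (dirn p x)"
        using ip_hrefl[OF False, of z x] Tz[of x] by (simp add: ip_dirn ip_hrefl_hrefl[OF False])
      then show "f (dot p z (dirn p (?T x))) * indicator (uball p) (?T x) = f (dot p w (dirn p x)) * indicator (uball p) x"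
        using TB[OF x] by (simp add: indicator_def)
    qed
    finally show ?thesis
      by (subst (1 2) nn_integral_sphere) (auto intro!: measurable_compose[OF _ f])
  qed
qed

section \<open>Upper and lower estimates for spherical caps\<close>

lemma sqrt_power_exp_le: assumes "0 \<le> a" "a \<le> 1" shows "(sqrt (1 - a)) ^ p \<le> exp (- (real p * a / 2))"
proof -
  have "1 - a \<le> exp (- a)" using exp_ge_add_one_self[of "- a"] by simp
  then have "sqrt (1 - a) \<le> sqrt (exp (- a))" by simp
  also have "\<dots> = exp (- a / 2)" by (simp add: real_sqrt_unique power2_eq_square flip: exp_add)
  finally have "(sqrt (1 - a)) ^ p \<le> exp (- a / 2) ^ p" using assms by (intro power_mono) auto
  also have "\<dots> = exp (- (real p * a / 2))" by (simp add: flip: exp_of_nat_mult)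
  finally show ?thesis .
qed

lemma emeasure_ennreal_vol:
  assumes "finite I" "emeasure (leb I) A \<le> ennreal c * vol1 I"
  shows "emeasure (leb I) A / vol1 I \<le> ennreal c"
proof -
  have "emeasure (leb I) A / vol1 I \<le> ennreal c * vol1 I / vol1 I"
    by (rule divide_right_mono_ennreal[OF assms(2)])
  then show ?thesis using assms(1) by (simp add: ennreal_mult_divide_eq)
qed

text \<open>The cone over the cap lies in the ball of radius \<open>sqrt (1 - a)\<close> about
  \<open>sqrt a * x\<close>. The restriction \<open>a \<le> 1/2\<close> is what keeps the points
  near the apex of the cone inside that ball.\<close>

lemma sphere_cap_upper_one_sided:
  assumes x: "dot p x x = 1" and a: "0 < a" "a \<le> 1/2"
  shows "emeasure (unif_sphere p) {d \<in> space (unif_sphere p). dot p x d \<ge> sqrt a} \<le> ennreal (exp (- (real p * a / 2)))"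
proof -
  let ?A = "{d \<in> space (leb {..<p}). dot p x d \<ge> sqrt a}"
  let ?N = "{y \<in> space (leb {..<p}). dot p (\<lambda>_. 1) y = 0}"
  let ?r = "sqrt (1 - a)"
  define c where "c = (\<lambda>i. sqrt a * x i)"
  have "{y \<in> uball p. dirn p y \<in> ?A} \<subseteq> ballI {..<p} c ?r"
  proof
    fix y assume "y \<in> {y \<in> uball p. dirn p y \<in> ?A}"
    then have y: "y \<in> space (leb {..<p})" "dot p y y < 1" and *: "sqrt a \<le> dot p x y / sqrt (dot p y y)"
      by (auto simp: ballI_def ip_dirn)
    define r where "r = sqrt (dot p y y)"
    have rr: "r\<^sup>2 = dot p y y" "r \<ge> 0" by (simp_all add: r_def ip_self_nonneg)
    have r1: "r < 1" using y(2) by (simp add: r_def)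
    have "r > 0" using * a rr(2) by (cases "r = 0") (auto simp: r_def)
    then have xy: "sqrt a * r \<le> dot p x y" using * by (simp add: r_def pos_le_divide_eq)
    have "dot p (\<lambda>i. y i - c i) (\<lambda>i. y i - c i) = dot p y y - 2 * sqrt a * dot p x y + a"
      using a x by (simp add: c_def ip_diff_left ip_diff_right ip_scale_left ip_scale_right ip_commute[of _ y x])
    also have "\<dots> \<le> r\<^sup>2 - 2 * sqrt a * (sqrt a * r) + a"
      using xy a rr(1) by (simp add: mult.assoc mult_left_mono)
    also have "\<dots> = r\<^sup>2 - 2 * a * r + a" using a by (simp flip: mult.assoc)
    also have "\<dots> < 1 - a"
    proof -
      have "(1 - r) * (1 + r - 2 * a) > 0" using r1 \<open>r > 0\<close> a by (intro mult_pos_pos) auto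
      then show ?thesis by (simp add: algebra_simps power2_eq_square)
    qed
    finally show "y \<in> ballI {..<p} c ?r" using y a by (auto simp: ballI_def)
  qed
  then have "emeasure (leb {..<p}) {y \<in> uball p. dirn p y \<in> ?A} \<le> emeasure (leb {..<p}) (ballI {..<p} c ?r)"
    by (intro emeasure_mono) auto
  also have "\<dots> = ennreal (?r ^ p) * vol1 {..<p}"
    using a by (subst emeasure_ballI) auto
  also have "\<dots> \<le> ennreal (exp (- (real p * a / 2))) * vol1 {..<p}"
    using sqrt_power_exp_le[of a p] a by (intro mult_right_mono ennreal_leI) auto
  finally have "emeasure (leb {..<p}) {y \<in> uball p. dirn p y \<in> ?A} \<le> ennreal (exp (- (real p * a / 2))) * vol1 {..<p}" .
  from emeasure_ennreal_vol[OF _ this] show ?thesis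
    by (subst space_sphere, subst emeasure_sphere) auto
qed

lemma sphere_cap_upper:
  assumes x: "dot p x x = 1" and a: "0 < a" "a \<le> 1/2"
  shows "emeasure (unif_sphere p) {d \<in> space (unif_sphere p). (dot p x d)\<^sup>2 \<ge> a} \<le> ennreal (2 * exp (- (real p * a / 2)))"
proof -
  let ?A = "\<lambda>x. {d \<in> space (unif_sphere p). dot p x d \<ge> sqrt a}"
  have A [measurable]: "?A x \<in> sets (unif_sphere p)" for x by (subst sets_sphere, subst space_sphere) measurable
  have "{d \<in> space (unif_sphere p). (dot p x d)\<^sup>2 \<ge> a} \<subseteq> ?A x \<union> ?A (\<lambda>i. - x i)"
  proof
    fix d assume d: "d \<in> {d \<in> space (unif_sphere p). (dot p x d)\<^sup>2 \<ge> a}"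
    then have "sqrt a \<le> \<bar>dot p x d\<bar>" using real_sqrt_le_mono by fastforce
    moreover have "dot p (\<lambda>i. - x i) d = - dot p x d" by (simp add: ip_def sum_negf)
    ultimately show "d \<in> ?A x \<union> ?A (\<lambda>i. - x i)" using d by auto
  qed
  then have "emeasure (unif_sphere p) {d \<in> space (unif_sphere p). (dot p x d)\<^sup>2 \<ge> a}
    \<le> emeasure (unif_sphere p) (?A x \<union> ?A (\<lambda>i. - x i))"
    by (intro emeasure_mono) auto
  also have "\<dots> \<le> emeasure (unif_sphere p) (?A x) + emeasure (unif_sphere p) (?A (\<lambda>i. - x i))"
    by (intro emeasure_subadditive) auto
  also have "\<dots> \<le> ennreal (exp (- (real p * a / 2))) + ennreal (exp (- (real p * a / 2)))"
    using x a by (intro add_mono sphere_cap_upper_one_sided) (auto simp: ip_def)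
  also have "\<dots> = ennreal (2 * exp (- (real p * a / 2)))" by (subst ennreal_plus[symmetric]) auto
  finally show ?thesis .
qed

text \<open>Halving the exponent extends the cap estimate to all \<open>a \<ge> 0\<close>: up to 1
  the bound at 1/2 can be reused, and beyond 1 the event is null.\<close>

lemma sphere_tail:
  assumes p: "p \<ge> 1" and x: "dot p x x = 1" and a: "0 \<le> a"
  shows "emeasure (unif_sphere p) {d \<in> space (unif_sphere p). (dot p x d)\<^sup>2 \<ge> a} \<le> ennreal (2 * exp (- (real p * a / 4)))"
proof -
  interpret prob_space "unif_sphere p" by (rule prob_space_sphere)
  consider "a = 0" | "0 < a" "a \<le> 1/2" | "1/2 < a" "a \<le> 1" | "1 < a" using a by linarith
  then show ?thesis
  proof cases
    case 1
    have "emeasure (unif_sphere p) {d \<in> space (unif_sphere p). (dot p x d)\<^sup>2 \<ge> a} \<le> 1"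
      by (rule emeasure_le_1)
    also have "1 \<le> ennreal (2 * exp (- (real p * a / 4)))" using 1 by (simp add: ennreal_ge_1)
    finally show ?thesis .
  next
    case 2
    have "exp (- (real p * a / 2)) \<le> exp (- (real p * a / 4))" using 2 by simp
    then show ?thesis
      using sphere_cap_upper[OF x 2] by (meson ennreal_leI mult_left_mono order_trans zero_le_numeral)
  next
    case 3
    have "emeasure (unif_sphere p) {d \<in> space (unif_sphere p). (dot p x d)\<^sup>2 \<ge> a}
       \<le> emeasure (unif_sphere p) {d \<in> space (unif_sphere p). (dot p x d)\<^sup>2 \<ge> 1/2}"
      using 3 by (intro emeasure_mono) (auto simp: space_sphere sets_sphere)
    also have "\<dots> \<le> ennreal (2 * exp (- (real p * (1/2) / 2)))" by (rule sphere_cap_upper[OF x]) auto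
    also have "\<dots> \<le> ennreal (2 * exp (- (real p * a / 4)))" using 3 p by (intro ennreal_leI) (auto simp: field_simps)
    finally show ?thesis .
  next
    case 4
    have "AE d in unif_sphere p. \<not> (dot p x d)\<^sup>2 \<ge> a"
      using AE_sphere_unit[OF p]
    proof eventually_elim
      case (elim d) then show ?case using ip_cauchy_schwarz[of "{..<p}" x d] x 4 by simp
    qed
    then have "emeasure (unif_sphere p) {d \<in> space (unif_sphere p). (dot p x d)\<^sup>2 \<ge> a} = 0"
      by (subst (asm) AE_iff_measurable[OF _ refl]) (auto simp: space_sphere sets_sphere)
    then show ?thesis by simp
  qed
qed

lemma emeasure_leb_translate:
  assumes I: "finite I" and A: "A \<in> sets (leb I)"
  shows "emeasure (leb I) {x \<in> space (leb I). (\<lambda>i\<in>I. x i - c i) \<in> A} = emeasure (leb I) A"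
proof -
  have m [measurable]: "(\<lambda>x. \<lambda>i\<in>I. x i - c i) \<in> leb I \<rightarrow>\<^sub>M leb I"
  proof -
    have "(\<lambda>x. \<lambda>i\<in>I. x i - c i) \<in> leb I \<rightarrow>\<^sub>M PiM I (\<lambda>_. borel :: real measure)"
      by (rule measurable_restrict) measurable
    then show ?thesis by (simp add: measurable_cong_sets[OF refl sets_leb])
  qed
  note [measurable] = A
  have "emeasure (leb I) {x \<in> space (leb I). (\<lambda>i\<in>I. x i - c i) \<in> A}
    = (\<integral>\<^sup>+x. indicator A (\<lambda>i\<in>I. x i - c i) \<partial>leb I)"
    by (subst nn_integral_indicator[symmetric], measurable)
       (auto intro!: nn_integral_cong simp: indicator_def simp del: nn_integral_indicator)
  also have "\<dots> = (\<integral>\<^sup>+x. indicator A x \<partial>leb I)"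
    using nn_integral_leb_affine[OF I, of 1 "indicator A" "\<lambda>i. - c i"] by simp
  finally show ?thesis using A by simp
qed

text \<open>Shift of the slab \<open>-\<eta>s \<le> x\<cdot>y \<le> 0\<close> of the ball of radius \<open>sqrt (1 - s\<^sup>2)\<close> by \<open>s x\<close>: the
  image stays inside the unit ball and in the cap.\<close>
lemma sphere_cap_lower:
  assumes p: "p \<ge> 1" and x: "dot p x x = 1" and s: "0 < s" "s < 1" and \<eta>: "0 < \<eta>" "\<eta> < 1"
  shows "emeasure (unif_sphere p) {d \<in> space (unif_sphere p). (dot p x d)\<^sup>2 \<ge> ((1 - \<eta>) * s)\<^sup>2}
    \<ge> ennreal (sqrt (1 - s\<^sup>2) ^ p * (1/2 - exp (- (real p * (\<eta> * s)\<^sup>2 / 2))))"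
proof -
  let ?L = "leb {..<p}"
  define \<rho> where "\<rho> = sqrt (1 - s\<^sup>2)"
  define b where "b = \<eta> * s"
  define h where "h y = dot p x y" for y
  have b: "0 < b" "b < 1" using s \<eta> mult_strict_mono[of \<eta> 1 s 1] by (auto simp: b_def)
  have s2: "s\<^sup>2 < 1" using s by (simp add: power_less_one_iff)
  have \<rho>: "0 < \<rho>" "\<rho>\<^sup>2 = 1 - s\<^sup>2" "\<rho> \<le> 1" using s s2 by (auto simp: \<rho>_def)
  have hm [measurable]: "h \<in> borel_measurable ?L" unfolding h_def by measurable
  let ?B = "ballI {..<p} (\<lambda>_. 0) \<rho>"
  define V where "V = emeasure ?L ?B"
  have V: "V = ennreal (\<rho> ^ p) * vol1 {..<p}" unfolding V_def using \<rho> by (subst emeasure_ballI) auto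
  let ?P = "{y \<in> ?B. h y \<le> 0}" and ?Q = "{y \<in> ?B. h y \<ge> 0}" and ?F = "{y \<in> ?B. h y < - b}" and ?S = "{y \<in> ?B. - b \<le> h y \<and> h y \<le> 0}"
  have Bs: "?B = {y \<in> space ?L. dot p y y < \<rho>\<^sup>2}" by (simp add: ballI_def)
  have [measurable]: "?P \<in> sets ?L" "?Q \<in> sets ?L" "?F \<in> sets ?L" "?S \<in> sets ?L"
    unfolding Bs by measurable
  have "emeasure ?L ?P = emeasure ?L ?Q"
  proof -
    have "emeasure ?L ?P = (\<integral>\<^sup>+y. indicator ?P y \<partial>?L)" by simp
    also have "\<dots> = (\<integral>\<^sup>+y. indicator ?P (\<lambda>i\<in>{..<p}. 0 + (-1) * y i) \<partial>?L)"
      using nn_integral_leb_affine[of "{..<p}" "-1" "indicator ?P" "\<lambda>_. 0"] by simp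
    also have "\<dots> = (\<integral>\<^sup>+y. indicator ?Q y \<partial>?L)"
    proof (rule nn_integral_cong)
      fix y assume y: "y \<in> space ?L"
      let ?y = "\<lambda>i\<in>{..<p}. 0 + (-1) * y i"
      have "h ?y = - h y" "dot p ?y ?y = dot p y y" by (simp_all add: h_def ip_def sum_negf)
      then show "(indicator ?P ?y :: ennreal) = indicator ?Q y"
        using y unfolding Bs by (auto simp: indicator_def space_leb)
    qed
    finally show ?thesis by simp
  qed
  moreover have "V \<le> emeasure ?L ?P + emeasure ?L ?Q"
  proof -
    have "V \<le> emeasure ?L (?P \<union> ?Q)" unfolding V_def by (intro emeasure_mono) auto
    then show ?thesis using emeasure_subadditive[of ?P ?L ?Q] by (auto intro: order_trans)
  qed
  ultimately have VP: "V \<le> 2 * emeasure ?L ?P" by (simp add: mult_2)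
  have PFS: "emeasure ?L ?P \<le> emeasure ?L ?F + emeasure ?L ?S"
  proof -
    have "emeasure ?L ?P \<le> emeasure ?L (?F \<union> ?S)" using b by (intro emeasure_mono) auto
    then show ?thesis using emeasure_subadditive[of ?F ?L ?S] by (auto intro: order_trans)
  qed
  \<comment> \<open>The slab is a half ball minus its deep part. The deep part lies in the ball of
    radius \<open>\<rho> * sqrt (1 - b^2)\<close> about \<open>- b * x\<close>, so it is an
    exponentially small fraction of the volume \<open>V\<close>.\<close>
  have F: "emeasure ?L ?F \<le> ennreal (exp (- (real p * b\<^sup>2 / 2))) * V"
  proof -
    have b2: "b\<^sup>2 < 1" using b by (simp add: power_less_one_iff)
    have "?F \<subseteq> ballI {..<p} (\<lambda>i. - b * x i) (\<rho> * sqrt (1 - b\<^sup>2))"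
    proof
      fix y assume y: "y \<in> ?F"
      have "dot p (\<lambda>i. y i - (- b * x i)) (\<lambda>i. y i - (- b * x i)) = dot p y y + 2 * b * h y + b\<^sup>2"
        using x unfolding h_def
        by (simp only: ip_diff_left ip_diff_right ip_scale_left ip_scale_right ip_commute[of _ y x])
           (simp add: power2_eq_square algebra_simps)
      also have "\<dots> < \<rho>\<^sup>2 + 2 * b * (- b) + b\<^sup>2"
        using y b by (intro add_strict_right_mono add_less_le_mono mult_left_mono) (auto simp: Bs)
      also have "\<dots> = \<rho>\<^sup>2 - b\<^sup>2" by (simp add: power2_eq_square)
      also have "\<dots> \<le> \<rho>\<^sup>2 - \<rho>\<^sup>2 * b\<^sup>2" using \<rho> mult_right_mono[of "\<rho>\<^sup>2" 1 "b\<^sup>2"] by simp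
      also have "\<dots> = (\<rho> * sqrt (1 - b\<^sup>2))\<^sup>2" using b2 by (simp add: power_mult_distrib algebra_simps)
      finally show "y \<in> ballI {..<p} (\<lambda>i. - b * x i) (\<rho> * sqrt (1 - b\<^sup>2))"
        using y by (auto simp: ballI_def)
    qed
    then have "emeasure ?L ?F \<le> emeasure ?L (ballI {..<p} (\<lambda>i. - b * x i) (\<rho> * sqrt (1 - b\<^sup>2)))"
      by (intro emeasure_mono) auto
    also have "\<dots> = ennreal ((\<rho> * sqrt (1 - b\<^sup>2)) ^ p) * vol1 {..<p}"
      using \<rho> b2 by (subst emeasure_ballI) auto
    also have "\<dots> = ennreal (sqrt (1 - b\<^sup>2) ^ p) * V"
      using \<rho> b2 by (simp add: V power_mult_distrib ennreal_mult mult.assoc mult.left_commute)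
    also have "\<dots> \<le> ennreal (exp (- (real p * b\<^sup>2 / 2))) * V"
      using b2 by (intro mult_right_mono ennreal_leI sqrt_power_exp_le) auto
    finally show ?thesis .
  qed
  let ?A = "{d \<in> space (unif_sphere p). (dot p x d)\<^sup>2 \<ge> ((1 - \<eta>) * s)\<^sup>2}"
  have A [measurable]: "?A \<in> sets ?L" by (subst space_sphere) measurable
  have "{y \<in> space ?L. (\<lambda>i\<in>{..<p}. y i - s * x i) \<in> ?S} \<subseteq> {y \<in> uball p. dirn p y \<in> ?A}"
  proof
    fix y assume "y \<in> {y \<in> space ?L. (\<lambda>i\<in>{..<p}. y i - s * x i) \<in> ?S}"
    then have y: "y \<in> space ?L" and z: "(\<lambda>i\<in>{..<p}. y i - s * x i) \<in> ?S" by auto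
    have h1: "- b \<le> h y - s" "h y - s \<le> 0"
      using z x by (auto simp: h_def ip_diff_right ip_scale_right)
    have "dot p (\<lambda>i. y i - s * x i) (\<lambda>i. y i - s * x i) < \<rho>\<^sup>2" using z by (auto simp: Bs)
    moreover have "dot p (\<lambda>i. y i - s * x i) (\<lambda>i. y i - s * x i) = dot p y y - 2 * s * h y + s\<^sup>2"
      using x unfolding h_def
      by (simp add: ip_diff_left ip_diff_right ip_scale_left ip_scale_right ip_commute[of _ y x] power2_eq_square)
    moreover have "2 * s * h y \<le> 2 * s * s" using h1 s by (intro mult_left_mono) auto
    ultimately have yy: "dot p y y < 1" using \<rho>(2) by (simp add: power2_eq_square)
    have hy: "(1 - \<eta>) * s \<le> h y" using h1 by (simp add: b_def algebra_simps)
    have "0 < (1 - \<eta>) * s" using \<eta> s by simp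
    then have hp: "h y > 0" using hy by simp
    have y0: "dot p y y \<noteq> 0"
    proof
      assume "dot p y y = 0"
      then have "h y = 0" by (simp add: ip_self_eq_0 h_def) (simp add: ip_def)
      then show False using hp by simp
    qed
    then have sq: "0 < sqrt (dot p y y)" "sqrt (dot p y y) \<le> 1" using yy ip_self_nonneg[of "{..<p}" y] by auto
    \<comment> \<open>Normalising a point of the unit ball can only raise its positive height along
      \<open>x\<close>.\<close>
    have "h y \<le> h y / sqrt (dot p y y)"
      using sq hp by (simp add: pos_le_divide_eq mult_left_le)
    then have "(1 - \<eta>) * s \<le> dot p x (dirn p y)" using hy unfolding ip_dirn h_def by simp
    then have "((1 - \<eta>) * s)\<^sup>2 \<le> (dot p x (dirn p y))\<^sup>2" using \<eta> s by (intro power_mono) auto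
    then show "y \<in> {y \<in> uball p. dirn p y \<in> ?A}"
      using y yy by (auto simp: ballI_def dirn_space space_sphere)
  qed
  then have "emeasure ?L {y \<in> space ?L. (\<lambda>i\<in>{..<p}. y i - s * x i) \<in> ?S} \<le> emeasure ?L {y \<in> uball p. dirn p y \<in> ?A}"
    by (intro emeasure_mono) (auto simp: ballI_def)
  then have S: "emeasure ?L ?S \<le> emeasure ?L {y \<in> uball p. dirn p y \<in> ?A}"
    by (subst (asm) emeasure_leb_translate) auto
  define q where "q = measure (unif_sphere p) ?A"
  interpret prob_space "unif_sphere p" by (rule prob_space_sphere)
  have q: "emeasure (unif_sphere p) ?A = ennreal q" unfolding q_def by (rule emeasure_eq_measure)
  have qv: "emeasure ?L {y \<in> uball p. dirn p y \<in> ?A} = ennreal q * vol1 {..<p}"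
  proof -
    have "ennreal q = emeasure ?L {y \<in> uball p. dirn p y \<in> ?A} / vol1 {..<p}"
      unfolding q[symmetric] by (rule emeasure_sphere) measurable
    then show ?thesis using vol1_finite[of "{..<p}"] by (simp add: ennreal_divide_times ennreal_divide_self less_top)
  qed
  obtain v where v: "vol1 {..<p} = ennreal v" "v > 0"
    using vol1_pos[of "{..<p}"] vol1_finite[of "{..<p}"] by (cases "vol1 {..<p}") auto
  let ?e = "exp (- (real p * b\<^sup>2 / 2))"
  have q0: "q \<ge> 0" by (simp add: q_def)
  have "V \<le> 2 * (ennreal ?e * V + ennreal q * vol1 {..<p})"
    using VP PFS F S unfolding qv by (meson add_mono mult_left_mono order_trans zero_le)
  then have "ennreal (\<rho>^p * v) \<le> 2 * (ennreal (?e * (\<rho>^p * v)) + ennreal (q * v))"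
    using \<rho> v q0 by (simp add: V ennreal_mult)
  also have "\<dots> = ennreal (2 * (?e * (\<rho>^p * v) + q * v))"
    using \<rho> v q0 by (simp add: ennreal_mult ennreal_plus)
  finally have "\<rho>^p * v \<le> 2 * (?e * (\<rho>^p * v) + q * v)"
    using \<rho> v q0 by (subst (asm) ennreal_le_iff) auto
  then have "\<rho>^p * v \<le> (2 * (?e * \<rho>^p + q)) * v" by (simp add: algebra_simps)
  then have "\<rho>^p \<le> 2 * (?e * \<rho>^p + q)" using v by simp
  then have "\<rho>^p * (1/2 - ?e) \<le> q" by (simp add: algebra_simps)
  then show ?thesis unfolding q \<rho>_def b_def by (intro ennreal_leI)
qed

section \<open>Second and fourth moments of projections\<close>

lemma sphere_integrable:
  assumes p: "p \<ge> 1" and f: "f \<in> borel_measurable (unif_sphere p)" and "\<And>d. dot p d d = 1 \<Longrightarrow> \<bar>f d\<bar> \<le> (c::real)"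
  shows "integrable (unif_sphere p) f"
proof -
  interpret prob_space "unif_sphere p" by (rule prob_space_sphere)
  have "AE d in unif_sphere p. norm (f d) \<le> c"
    using AE_sphere_unit[OF p] by eventually_elim (use assms(3) in auto)
  then show ?thesis using f by (intro integrable_const_bound)
qed

lemma integral_sphere_rotate:
  fixes f :: "real \<Rightarrow> real"
  assumes f: "f \<in> borel_measurable borel" "\<And>x. f x \<ge> 0" and zw: "dot p z z = dot p w w"
  shows "(\<integral>x. f (dot p z x) \<partial>unif_sphere p) = (\<integral>x. f (dot p w x) \<partial>unif_sphere p)"
proof -
  have [measurable]: "(\<lambda>x. f (dot p z x)) \<in> borel_measurable (unif_sphere p)" for z
    using f(1) by (rule measurable_compose[rotated]) measurable
  show ?thesis
    using f nn_integral_sphere_rotate[of "\<lambda>x. ennreal (f x)" p z w] zw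
    by (subst (1 2) integral_eq_nn_integral) auto
qed

lemma integrable_sphere_prod:
  assumes p: "p \<ge> 1"
  shows "integrable (unif_sphere p) (\<lambda>d. (dot p x d)^m * (dot p y d)^n)"
proof (rule sphere_integrable[OF p, where c="sqrt (dot p x x)^m * sqrt (dot p y y)^n"])
  fix d assume d: "dot p d d = 1"
  show "\<bar>dot p x d ^ m * dot p y d ^ n\<bar> \<le> sqrt (dot p x x)^m * sqrt (dot p y y)^n"
    unfolding abs_mult power_abs using ip_cauchy_schwarz_abs[of "{..<p}" x d] ip_cauchy_schwarz_abs[of "{..<p}" y d] d
    by (intro mult_mono power_mono) (auto simp: ip_self_nonneg)
qed measurable

lemma dot_unit: "i < p \<Longrightarrow> dot p (\<lambda>j. if j = i then 1 else 0) d = d i"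
proof -
  assume "i < p"
  have "dot p (\<lambda>j. if j = i then 1 else 0) d = (\<Sum>j<p. if j = i then d j else 0)"
    unfolding ip_def by (intro sum.cong) auto
  with \<open>i < p\<close> show ?thesis by simp
qed

lemma sum_dot_unit_sq: "(\<Sum>i<p. (dot p (\<lambda>j. if j = i then 1 else 0) d)\<^sup>2) = dot p d d"
proof -
  have "(\<Sum>i<p. (dot p (\<lambda>j. if j = i then 1 else 0) d)\<^sup>2) = (\<Sum>i<p. d i * d i)"
    by (intro sum.cong refl) (simp add: dot_unit power2_eq_square)
  then show ?thesis by (simp add: ip_def)
qed

lemma sphere_even_moment_scale:
  assumes p: "p \<ge> 1"
  shows "(\<integral>d. (dot p z d)^(2*n) \<partial>unif_sphere p) = (dot p z z)^n * (\<integral>d. (d 0)^(2*n) \<partial>unif_sphere p)"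
proof -
  let ?e = "\<lambda>j. if j = 0 then 1 else 0 :: real" and ?r = "sqrt (dot p z z)"
  have "dot p ?e ?e = 1" using dot_unit[of 0 p ?e] p by simp
  then have "dot p z z = dot p (\<lambda>j. ?r * ?e j) (\<lambda>j. ?r * ?e j)"
    unfolding ip_scale_left ip_scale_right by (simp add: ip_self_nonneg)
  then have "(\<integral>d. (dot p z d)^(2*n) \<partial>unif_sphere p) = (\<integral>d. (dot p (\<lambda>j. ?r * ?e j) d)^(2*n) \<partial>unif_sphere p)"
    by (intro integral_sphere_rotate) auto
  also have "\<dots> = (\<integral>d. ?r^(2*n) * (d 0)^(2*n) \<partial>unif_sphere p)"
    unfolding ip_scale_left using p by (simp add: dot_unit power_mult_distrib)
  also have "?r^(2*n) = (dot p z z)^n" by (simp add: power_mult ip_self_nonneg)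
  finally show ?thesis by simp
qed

text \<open>By rotation all coordinates share one second moment, and their squares sum to 1 almost
  surely.\<close>

lemma sphere_second_moment:
  assumes p: "p \<ge> 1" shows "(\<integral>d. (dot p z d)\<^sup>2 \<partial>unif_sphere p) = dot p z z / real p"
proof -
  interpret prob_space "unif_sphere p" by (rule prob_space_sphere)
  let ?e = "\<lambda>i j. if j = i then 1 else 0 :: real"
  define m where "m = (\<integral>d. (d 0)\<^sup>2 \<partial>unif_sphere p)"
  have z: "(\<integral>d. (dot p z d)\<^sup>2 \<partial>unif_sphere p) = dot p z z * m" for z
    using sphere_even_moment_scale[OF p, of z 1] by (simp add: m_def)
  have ee: "dot p (?e i) (?e i) = 1" if "i < p" for i using dot_unit[OF that, of "?e i"] by simp
  have "(1::real) = (\<integral>d. 1 \<partial>unif_sphere p)" by (simp add: prob_space)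
  also have "\<dots> = (\<integral>d. (\<Sum>i<p. (dot p (?e i) d)\<^sup>2) \<partial>unif_sphere p)"
    using AE_sphere_unit[OF p] unfolding sum_dot_unit_sq by (intro integral_cong_AE) auto
  also have "\<dots> = (\<Sum>i<p. (\<integral>d. (dot p (?e i) d)\<^sup>2 \<partial>unif_sphere p))"
    using integrable_sphere_prod[OF p, of _ 2 _ 0] by (intro Bochner_Integration.integral_sum) auto
  also have "\<dots> = real p * m" unfolding z by (simp add: ee)
  finally have "m = 1 / real p" using p by (simp add: field_simps)
  then show ?thesis using z[of z] by simp
qed

text \<open>Polarisation: 12 times the product of two squares is
  \<open>(a + b)^4 + (a - b)^4 - 2 * a^4 - 2 * b^4\<close>, and a fourth moment depends only on the
  length of the vector. The remaining constant \<open>m\<close> is found by integrating the square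
  of the sum of squared coordinates, which is 1.\<close>

lemma sphere_fourth_moment:
  assumes p: "p \<ge> 1"
  shows "(\<integral>d. (dot p x d)\<^sup>2 * (dot p y d)\<^sup>2 \<partial>unif_sphere p)
     = (dot p x x * dot p y y + 2 * (dot p x y)\<^sup>2) / (real p * (real p + 2))"
proof -
  interpret prob_space "unif_sphere p" by (rule prob_space_sphere)
  let ?e = "\<lambda>i j. if j = i then 1 else 0 :: real"
  define m where "m = (\<integral>d. (d 0)^4 \<partial>unif_sphere p)"
  have z: "(\<integral>d. (dot p z d)^4 \<partial>unif_sphere p) = (dot p z z)\<^sup>2 * m" for z
    using sphere_even_moment_scale[OF p, of z 2] by (simp add: m_def)
  have int4: "integrable (unif_sphere p) (\<lambda>d. (dot p z d)^4)" for z
    using integrable_sphere_prod[OF p, of z 4 z 0] by simp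
  have int22: "integrable (unif_sphere p) (\<lambda>d. (dot p x d)\<^sup>2 * (dot p y d)\<^sup>2)" for x y
    by (rule integrable_sphere_prod[OF p])
  have pol: "(\<integral>d. (dot p x d)\<^sup>2 * (dot p y d)\<^sup>2 \<partial>unif_sphere p) = m / 3 * (dot p x x * dot p y y + 2 * (dot p x y)\<^sup>2)" for x y
  proof -
    have "(\<integral>d. (dot p x d)\<^sup>2 * (dot p y d)\<^sup>2 \<partial>unif_sphere p) =
      (\<integral>d. ((dot p (\<lambda>i. x i + y i) d)^4 + (dot p (\<lambda>i. x i - y i) d)^4 - 2 * (dot p x d)^4 - 2 * (dot p y d)^4) / 12 \<partial>unif_sphere p)"
      unfolding ip_add_left ip_diff_left
      by (intro Bochner_Integration.integral_cong refl) (simp add: power2_eq_square power4_eq_xxxx algebra_simps)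
    also have "\<dots> = ((dot p (\<lambda>i. x i + y i) (\<lambda>i. x i + y i))\<^sup>2 * m + (dot p (\<lambda>i. x i - y i) (\<lambda>i. x i - y i))\<^sup>2 * m - 2 * ((dot p x x)\<^sup>2 * m) - 2 * ((dot p y y)\<^sup>2 * m)) / 12"
      unfolding z[symmetric] using int4 by simp
    also have "\<dots> = m / 3 * (dot p x x * dot p y y + 2 * (dot p x y)\<^sup>2)"
      unfolding ip_add_left ip_diff_left ip_add_right ip_diff_right
      by (simp add: ip_commute[of _ y x] power2_eq_square algebra_simps)
    finally show ?thesis .
  qed
  have ee: "dot p (?e i) (?e j) = ?e j i" if "i < p" for i j using dot_unit[OF that, of "?e j"] by simp
  have "(1::real) = (\<integral>d. 1 \<partial>unif_sphere p)" by (simp add: prob_space)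
  also have "\<dots> = (\<integral>d. (\<Sum>i<p. \<Sum>j<p. (dot p (?e i) d)\<^sup>2 * (dot p (?e j) d)\<^sup>2) \<partial>unif_sphere p)"
    using AE_sphere_unit[OF p] unfolding sum_product[symmetric] sum_dot_unit_sq by (intro integral_cong_AE) auto
  also have "\<dots> = (\<Sum>i<p. \<Sum>j<p. (\<integral>d. (dot p (?e i) d)\<^sup>2 * (dot p (?e j) d)\<^sup>2 \<partial>unif_sphere p))"
    using int22 by (subst Bochner_Integration.integral_sum) (auto intro!: sum.cong Bochner_Integration.integral_sum)
  also have "\<dots> = (\<Sum>i<p. \<Sum>j<p. m / 3 * (1 + 2 * (if i = j then 1 else 0)))"
    unfolding pol by (intro sum.cong refl) (auto simp: ee)
  also have "\<dots> = (\<Sum>i<p. \<Sum>j<p. m / 3 + (if i = j then 2 * m / 3 else 0))"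
    by (intro sum.cong refl) auto
  also have "\<dots> = m / 3 * (real p * (real p + 2))"
    by (simp add: sum.distrib algebra_simps)
  finally have "m / 3 * (real p * (real p + 2)) = 1" by simp
  then have "m / 3 = 1 / (real p * (real p + 2))" using p by (intro eq_divide_imp) auto
  then show ?thesis using pol[of x y] by simp
qed

section \<open>Exponential moments of projections\<close>

lemma exp_le_floor_sum:
  assumes "(z::real) \<ge> 0"
  shows "ennreal (exp z) \<le> (\<Sum>j. ennreal (exp (real j + 1)) * indicator {real j..} z)"
proof -
  let ?f = "\<lambda>j. ennreal (exp (real j + 1)) * indicator {real j..} z"
  define n where "n = nat \<lfloor>z\<rfloor>"
  have n: "real n \<le> z" "z \<le> real n + 1" using assms by (auto simp: n_def)
  have "ennreal (exp z) \<le> ?f n" using n by (simp add: ennreal_leI)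
  also have "\<dots> = sum ?f {n}"
  proof -
    have "sum f {n} = f n" for f :: "nat \<Rightarrow> ennreal" by simp
    then show ?thesis by metis
  qed
  also have "\<dots> \<le> (\<Sum>j. ?f j)" by (rule sum_le_suminf) auto
  finally show ?thesis .
qed

text \<open>Summation over integer levels: at level \<open>j\<close> the exponential is at most
  \<open>exp (j + 1)\<close>, while the factor 1/8 turns \<open>sphere_tail\<close> into
  \<open>2 * exp (- 2 * j)\<close>. The geometric series has sum
  \<open>2 * exp 1 / (1 - exp (-1))\<close>, below 18.\<close>

lemma sphere_mgf_square_unit:
  assumes p: "p \<ge> 1" and x: "dot p x x = 1"
  shows "(\<integral>\<^sup>+d. ennreal (exp (real p * (dot p x d)\<^sup>2 / 8)) \<partial>unif_sphere p) \<le> 18"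
proof -
  define z where "z d = real p * (dot p x d)\<^sup>2 / 8" for d
  have [measurable]: "z \<in> borel_measurable (unif_sphere p)" unfolding z_def by measurable
  have "(\<integral>\<^sup>+d. ennreal (exp (z d)) \<partial>unif_sphere p)
    \<le> (\<integral>\<^sup>+d. (\<Sum>j. ennreal (exp (real j + 1)) * indicator {real j..} (z d)) \<partial>unif_sphere p)"
    by (intro nn_integral_mono exp_le_floor_sum) (auto simp: z_def)
  also have "\<dots> = (\<Sum>j. (\<integral>\<^sup>+d. ennreal (exp (real j + 1)) * indicator {real j..} (z d) \<partial>unif_sphere p))"
    by (rule nn_integral_suminf) measurable
  also have "\<dots> \<le> (\<Sum>j. ennreal (2 * exp 1 * exp (-1) ^ j))"
  proof (intro suminf_le)
    fix j :: nat
    have "(\<integral>\<^sup>+d. ennreal (exp (real j + 1)) * indicator {real j..} (z d) \<partial>unif_sphere p)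
       = (\<integral>\<^sup>+d. ennreal (exp (real j + 1)) * indicator {d \<in> space (unif_sphere p). (dot p x d)\<^sup>2 \<ge> 8 * real j / real p} d \<partial>unif_sphere p)"
      using p by (intro nn_integral_cong) (auto simp: indicator_def z_def field_simps)
    also have "\<dots> = ennreal (exp (real j + 1)) * emeasure (unif_sphere p) {d \<in> space (unif_sphere p). (dot p x d)\<^sup>2 \<ge> 8 * real j / real p}"
      by (intro nn_integral_cmult_indicator) measurable
    also have "\<dots> \<le> ennreal (exp (real j + 1)) * ennreal (2 * exp (- (real p * (8 * real j / real p) / 4)))"
      using p x by (intro mult_left_mono sphere_tail) auto
    also have "\<dots> = ennreal (exp (real j + 1) * (2 * exp (- (2 * real j))))"
      using p by (simp flip: ennreal_mult)
    also have "exp (real j + 1) * (2 * exp (- (2 * real j))) = 2 * exp 1 * exp (-1) ^ j"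
      by (simp flip: exp_of_nat_mult exp_add)
    finally show "(\<integral>\<^sup>+d. ennreal (exp (real j + 1)) * indicator {real j..} (z d) \<partial>unif_sphere p)
       \<le> ennreal (2 * exp 1 * exp (-1) ^ j)" .
  qed auto
  also have "\<dots> = ennreal (\<Sum>j. 2 * exp 1 * exp (-1) ^ j)"
    by (intro suminf_ennreal2 summable_mult summable_geometric) auto
  also have "(\<Sum>j. 2 * exp 1 * exp (-1) ^ j) = 2 * exp 1 * (1 / (1 - exp (-1::real)))"
    by (subst suminf_mult) (auto intro!: summable_geometric simp: suminf_geometric)
  also have "\<dots> \<le> 18"
  proof -
    have e: "exp 1 \<ge> (2::real)" "exp 1 \<le> (3::real)" using exp_ge_add_one_self[of 1] exp_le by auto
    have "exp (-1) \<le> (1/2::real)" using e by (simp add: exp_minus field_simps)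
    then have "1 / (1 - exp (-1)) \<le> (2::real)" by (simp add: field_simps)
    then have "2 * exp 1 * (1 / (1 - exp (-1))) \<le> 2 * 3 * (2::real)"
      using e by (intro mult_mono) auto
    then show ?thesis by simp
  qed
  finally show ?thesis unfolding z_def by (simp add: ennreal_leI)
qed

lemma sphere_mgf_square:
  assumes p: "p \<ge> 1" and x: "dot p x x \<le> 1"
  shows "(\<integral>\<^sup>+d. ennreal (exp (real p * (dot p x d)\<^sup>2 / 8)) \<partial>unif_sphere p) \<le> 18"
proof (cases "dot p x x = 0")
  case True
  interpret prob_space "unif_sphere p" by (rule prob_space_sphere)
  have "dot p x d = 0" for d using True by (simp add: ip_self_eq_0) (simp add: ip_def)
  then show ?thesis by (simp add: emeasure_space_1)
next
  case False
  define r where "r = sqrt (dot p x x)"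
  have r: "r > 0" "r \<le> 1" "r\<^sup>2 = dot p x x" using False x ip_self_nonneg[of "{..<p}" x] by (auto simp: r_def)
  let ?y = "\<lambda>i. (1/r) * x i"
  have y: "dot p ?y ?y = 1"
    unfolding ip_scale_left ip_scale_right using r False by (simp add: field_simps power2_eq_square)
  have "(dot p x d)\<^sup>2 \<le> (dot p ?y d)\<^sup>2" for d
  proof -
    have e: "(dot p ?y d)\<^sup>2 = (dot p x d)\<^sup>2 / r\<^sup>2" unfolding ip_scale_left by (simp add: power_divide)
    have "r\<^sup>2 \<le> 1" using r by (intro power_le_one) auto
    then have "(dot p x d)\<^sup>2 * r\<^sup>2 \<le> (dot p x d)\<^sup>2" by (intro mult_left_le) auto
    moreover have "r\<^sup>2 > 0" using r(1) by simp
    ultimately show ?thesis unfolding e by (simp only: pos_le_divide_eq)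
  qed
  then have "(\<integral>\<^sup>+d. ennreal (exp (real p * (dot p x d)\<^sup>2 / 8)) \<partial>unif_sphere p)
     \<le> (\<integral>\<^sup>+d. ennreal (exp (real p * (dot p ?y d)\<^sup>2 / 8)) \<partial>unif_sphere p)"
    by (intro nn_integral_mono ennreal_leI) (auto intro!: divide_right_mono mult_left_mono)
  also have "\<dots> \<le> 18" by (rule sphere_mgf_square_unit[OF p y])
  finally show ?thesis .
qed

text \<open>If \<open>x\<close> has length \<open>r\<close> and \<open>w\<close> is the projection
  of \<open>d\<close> onto its direction, the arithmetic-geometric inequality gives
  \<open>r * w \<le> p * w^2 / 8 + 2 * r^2 / p\<close>, and the square is covered by the previous
  bound.\<close>

lemma sphere_mgf_linear:
  assumes p: "p \<ge> 1"
  shows "(\<integral>\<^sup>+d. ennreal (exp (dot p x d)) \<partial>unif_sphere p) \<le> 18 * ennreal (exp (2 * dot p x x / real p))"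
proof (cases "dot p x x = 0")
  case True
  interpret prob_space "unif_sphere p" by (rule prob_space_sphere)
  have "dot p x d = 0" for d using True by (simp add: ip_self_eq_0) (simp add: ip_def)
  then show ?thesis using True by (simp add: emeasure_space_1)
next
  case False
  define r where "r = sqrt (dot p x x)"
  have r: "r > 0" "r\<^sup>2 = dot p x x" using False ip_self_nonneg[of "{..<p}" x] by (auto simp: r_def)
  let ?y = "\<lambda>i. (1/r) * x i"
  have y: "dot p ?y ?y = 1"
    unfolding ip_scale_left ip_scale_right using r False by (simp add: field_simps power2_eq_square)
  have "dot p x d \<le> real p * (dot p ?y d)\<^sup>2 / 8 + 2 * dot p x x / real p" for d
  proof -
    define w where "w = dot p ?y d"
    have dx: "dot p x d = r * w" unfolding w_def ip_scale_left using r by simp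
    have "0 \<le> (real p * w - 8 * r / 2)\<^sup>2" by simp
    then have "8 * real p * (r * w) \<le> (real p)\<^sup>2 * w\<^sup>2 + 16 * r\<^sup>2" by (simp add: power2_eq_square algebra_simps)
    then show ?thesis unfolding w_def[symmetric] dx r(2)[symmetric] using p by (simp add: field_simps power2_eq_square)
  qed
  then have "(\<integral>\<^sup>+d. ennreal (exp (dot p x d)) \<partial>unif_sphere p)
     \<le> (\<integral>\<^sup>+d. ennreal (exp (2 * dot p x x / real p)) * ennreal (exp (real p * (dot p ?y d)\<^sup>2 / 8)) \<partial>unif_sphere p)"
    by (intro nn_integral_mono) (auto simp flip: ennreal_mult exp_add intro!: ennreal_leI simp: add.commute)
  also have "\<dots> = ennreal (exp (2 * dot p x x / real p)) * (\<integral>\<^sup>+d. ennreal (exp (real p * (dot p ?y d)\<^sup>2 / 8)) \<partial>unif_sphere p)"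
    by (rule nn_integral_cmult) measurable
  also have "\<dots> \<le> ennreal (exp (2 * dot p x x / real p)) * 18"
    by (intro mult_left_mono sphere_mgf_square_unit p y) auto
  finally show ?thesis by (simp add: mult.commute)
qed

section \<open>Families of independent uniform vectors\<close>

definition sph :: "nat \<Rightarrow> nat set \<Rightarrow> (nat \<Rightarrow> nat \<Rightarrow> real) measure" where
  "sph p I = PiM I (\<lambda>_. unif_sphere p)"

lemma prob_space_sph: "prob_space (sph p I)"
  unfolding sph_def by (intro prob_space_PiM prob_space_sphere)

lemma measurable_sph_component [measurable]: "l \<in> I \<Longrightarrow> (\<lambda>d. d l) \<in> sph p I \<rightarrow>\<^sub>M unif_sphere p"
  unfolding sph_def by measurable

lemma measurable_sph_component2 [measurable]: "l \<in> I \<Longrightarrow> i < p \<Longrightarrow> (\<lambda>d. d l i) \<in> borel_measurable (sph p I)"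
  by measurable

lemma product_sigma_finite_sphere: "product_sigma_finite (\<lambda>_::nat. unif_sphere p)"
  using prob_space_sphere[of p] by (intro product_sigma_finite.intro) (rule prob_space_imp_sigma_finite)

lemma nn_integral_sph_prod:
  assumes "finite I" "\<And>l. l \<in> I \<Longrightarrow> f l \<in> borel_measurable (unif_sphere p)"
  shows "(\<integral>\<^sup>+d. (\<Prod>l\<in>I. f l (d l)) \<partial>sph p I) = (\<Prod>l\<in>I. \<integral>\<^sup>+x. f l x \<partial>unif_sphere p)"
  unfolding sph_def using assms
  by (intro product_sigma_finite.product_nn_integral_prod product_sigma_finite_sphere) auto

lemma sph_mgf_sum:
  assumes "finite I" "f \<in> borel_measurable (unif_sphere p)" "(\<integral>\<^sup>+x. ennreal (exp (f x)) \<partial>unif_sphere p) \<le> c"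
  shows "(\<integral>\<^sup>+d. ennreal (exp (\<Sum>l\<in>I. f (d l))) \<partial>sph p I) \<le> c ^ card I"
proof -
  note [measurable] = assms(2)
  have "(\<integral>\<^sup>+d. ennreal (exp (\<Sum>l\<in>I. f (d l))) \<partial>sph p I) = (\<integral>\<^sup>+d. (\<Prod>l\<in>I. ennreal (exp (f (d l)))) \<partial>sph p I)"
    using assms(1) by (simp add: exp_sum prod_ennreal)
  also have "\<dots> = (\<Prod>l\<in>I. \<integral>\<^sup>+x. ennreal (exp (f x)) \<partial>unif_sphere p)"
    by (intro nn_integral_sph_prod assms(1)) measurable
  also have "\<dots> \<le> c ^ card I" using assms(3) by (simp add: power_mono)
  finally show ?thesis .
qed

section \<open>Suprema of quadratic forms by averaging over small balls\<close>

lemma ballI_triangle: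
  assumes "ip I x0 x0 \<le> 1" "\<eta> > 0" shows "ballI I x0 \<eta> \<subseteq> ballI I (\<lambda>_. 0) (1 + \<eta>)"
proof
  fix y assume y: "y \<in> ballI I x0 \<eta>"
  let ?z = "\<lambda>i. y i - x0 i"
  have z: "ip I ?z ?z < \<eta>\<^sup>2" using y by (simp add: ballI_def)
  have "ip I x0 ?z \<le> sqrt (ip I x0 x0) * sqrt (ip I ?z ?z)"
    using ip_cauchy_schwarz_abs[of I x0 ?z] by simp
  also have "\<dots> \<le> 1 * \<eta>" using assms z by (intro mult_mono) (auto simp: real_le_lsqrt ip_self_nonneg)
  finally have c: "ip I x0 ?z \<le> \<eta>" by simp
  have "ip I y y = ip I (\<lambda>i. x0 i + ?z i) (\<lambda>i. x0 i + ?z i)" by (intro ip_cong) auto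
  also have "\<dots> = ip I x0 x0 + 2 * ip I x0 ?z + ip I ?z ?z"
    unfolding ip_add_left ip_add_right ip_commute[of I ?z x0] by simp
  also have "\<dots> < (1 + \<eta>)\<^sup>2" using c z assms by (simp add: power2_eq_square algebra_simps)
  finally show "y \<in> ballI I (\<lambda>_. 0) (1 + \<eta>)" using y by (simp add: ballI_def)
qed

lemma exp_midpoint: "2 * q \<le> a + b \<Longrightarrow> 2 * exp q \<le> exp a + exp (b::real)"
proof -
  assume "2 * q \<le> a + b"
  then have "exp q \<le> exp (a / 2) * exp (b / 2)" by (simp flip: exp_add)
  then have "2 * exp q \<le> 2 * (exp (a / 2) * exp (b / 2))" by simp
  also have "\<dots> \<le> (exp (a / 2))\<^sup>2 + (exp (b / 2))\<^sup>2" using sum_squares_bound[of "exp (a/2)" "exp (b/2)"] by simp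
  also have "\<dots> = exp a + exp b" by (simp flip: exp_double)
  finally show ?thesis .
qed

text \<open>The points \<open>x0 + z\<close> and \<open>x0 - z\<close> are paired, and convexity of
  the exponential does the rest. Since the hypothesis concerns only symmetric pairs, a form that is
  not convex is admissible at the price of a smaller \<open>q\<close>.\<close>

lemma exp_average_lower:
  assumes I: "finite I" and \<eta>: "\<eta> > 0" and x0: "ip I x0 x0 \<le> 1"
    and Q [measurable]: "Q \<in> borel_measurable (leb I)"
    and q: "\<And>z. ip I z z < \<eta>\<^sup>2 \<Longrightarrow> 2 * q \<le> Q (\<lambda>i\<in>I. x0 i + z i) + Q (\<lambda>i\<in>I. x0 i - z i)"
  shows "ennreal (exp q * \<eta> ^ card I) * vol1 I
    \<le> (\<integral>\<^sup>+x. ennreal (exp (Q x)) * indicator (ballI I (\<lambda>_. 0) (1 + \<eta>)) x \<partial>leb I)"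
proof -
  let ?B = "ballI I (\<lambda>_. 0) \<eta>"
  define g where "g x = ennreal (exp (Q x)) * indicator (ballI I x0 \<eta>) x" for x
  have [measurable]: "g \<in> borel_measurable (leb I)" unfolding g_def by measurable
  have aff [measurable]: "(\<lambda>x. \<lambda>i\<in>I. x0 i + c * x i) \<in> leb I \<rightarrow>\<^sub>M leb I" for c
  proof -
    have "(\<lambda>x. \<lambda>i\<in>I. x0 i + c * x i) \<in> leb I \<rightarrow>\<^sub>M PiM I (\<lambda>_. borel :: real measure)"
      by (rule measurable_restrict) measurable
    then show ?thesis by (simp add: measurable_cong_sets[OF refl sets_leb])
  qed
  have g2: "(\<integral>\<^sup>+x. g (\<lambda>i\<in>I. x0 i + c * x i) \<partial>leb I) = (\<integral>\<^sup>+x. g x \<partial>leb I)" if "\<bar>c\<bar> = 1" for c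
    using nn_integral_leb_affine[OF I, of c g x0] that by auto
  have "2 * (ennreal (exp q * \<eta> ^ card I) * vol1 I) = 2 * (ennreal (exp q) * emeasure (leb I) ?B)"
    using \<eta> by (simp add: emeasure_ballI[OF I] ennreal_mult mult.assoc)
  also have "\<dots> = (\<integral>\<^sup>+z. ennreal (2 * exp q) * indicator ?B z \<partial>leb I)"
    by (subst nn_integral_cmult_indicator) (auto simp: ennreal_mult mult.assoc)
  also have "\<dots> \<le> (\<integral>\<^sup>+z. g (\<lambda>i\<in>I. x0 i + 1 * z i) + g (\<lambda>i\<in>I. x0 i + (-1) * z i) \<partial>leb I)"
  proof (intro nn_integral_mono)
    fix z assume "z \<in> space (leb I)"
    show "ennreal (2 * exp q) * indicator ?B z \<le> g (\<lambda>i\<in>I. x0 i + 1 * z i) + g (\<lambda>i\<in>I. x0 i + (-1) * z i)"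
    proof (cases "z \<in> ?B")
      case True
      then have z: "ip I z z < \<eta>\<^sup>2" by (simp add: ballI_def)
      have i: "ip I (\<lambda>i. (\<lambda>i\<in>I. x0 i + c * z i) i - x0 i) (\<lambda>i. (\<lambda>i\<in>I. x0 i + c * z i) i - x0 i) = c * c * ip I z z" for c
      proof -
        have "ip I (\<lambda>i. (\<lambda>i\<in>I. x0 i + c * z i) i - x0 i) (\<lambda>i. (\<lambda>i\<in>I. x0 i + c * z i) i - x0 i) = ip I (\<lambda>i. c * z i) (\<lambda>i. c * z i)"
          by (intro ip_cong) auto
        then show ?thesis by (simp add: ip_scale_left ip_scale_right)
      qed
      have "(\<lambda>i\<in>I. x0 i + 1 * z i) \<in> ballI I x0 \<eta>" "(\<lambda>i\<in>I. x0 i + (-1) * z i) \<in> ballI I x0 \<eta>"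
        unfolding ballI_def using z i[of 1] i[of "-1"] by (auto simp: space_leb)
      then have "g (\<lambda>i\<in>I. x0 i + 1 * z i) + g (\<lambda>i\<in>I. x0 i + (-1) * z i)
        = ennreal (exp (Q (\<lambda>i\<in>I. x0 i + z i)) + exp (Q (\<lambda>i\<in>I. x0 i - z i)))"
        by (simp add: g_def ennreal_plus)
      then show ?thesis using ennreal_leI[OF exp_midpoint[OF q[OF z]]] True by simp
    qed auto
  qed
  also have "\<dots> = (\<integral>\<^sup>+z. g (\<lambda>i\<in>I. x0 i + 1 * z i) \<partial>leb I) + (\<integral>\<^sup>+z. g (\<lambda>i\<in>I. x0 i + (-1) * z i) \<partial>leb I)"
    by (rule nn_integral_add) measurable
  also have "\<dots> = 2 * (\<integral>\<^sup>+x. g x \<partial>leb I)" by (subst (1 2) g2) (auto simp: mult_2)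
  finally have "ennreal (exp q * \<eta> ^ card I) * vol1 I \<le> (\<integral>\<^sup>+x. g x \<partial>leb I)"
    by (simp add: ennreal_mult_le_mult_iff)
  also have "\<dots> \<le> (\<integral>\<^sup>+x. ennreal (exp (Q x)) * indicator (ballI I (\<lambda>_. 0) (1 + \<eta>)) x \<partial>leb I)"
    using ballI_triangle[OF x0 \<eta>] by (intro nn_integral_mono) (auto simp: g_def indicator_def)
  finally show ?thesis .
qed

text \<open>Replaces an \<open>\<epsilon>\<close>-net: the exponential of a quadratic form at \<open>x0\<close> is dominated by its average
  over a small ball around \<open>x0\<close>, hence by an integral independent of \<open>x0\<close>.\<close>
lemma sup_by_averaging:
  fixes Q :: "'d \<Rightarrow> (nat \<Rightarrow> real) \<Rightarrow> real"
  assumes M: "prob_space M" and I: "finite I" and \<eta>: "\<eta> > 0" and c: "c > 0"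
    and Q [measurable]: "(\<lambda>(d, x). Q d x) \<in> borel_measurable (M \<Otimes>\<^sub>M leb I)"
    and mgf: "\<And>x. ip I x x < (1 + \<eta>)\<^sup>2 \<Longrightarrow> x \<in> space (leb I) \<Longrightarrow> (\<integral>\<^sup>+d. ennreal (exp (Q d x)) \<partial>M) \<le> ennreal C"
  obtains A where "A \<in> sets M" "emeasure M A \<le> ennreal (C / c)"
    "\<And>d x0 q. d \<in> space M - A \<Longrightarrow> ip I x0 x0 \<le> 1 \<Longrightarrow>
      (\<And>z. ip I z z < \<eta>\<^sup>2 \<Longrightarrow> 2 * q \<le> Q d (\<lambda>i\<in>I. x0 i + z i) + Q d (\<lambda>i\<in>I. x0 i - z i)) \<Longrightarrow>
      exp q * \<eta> ^ card I \<le> c * (1 + \<eta>) ^ card I"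
proof -
  interpret M: prob_space M by fact
  interpret L: sigma_finite_measure "leb I" by (rule sigma_finite_leb[OF I])
  interpret P: pair_sigma_finite M "leb I" ..
  let ?B = "ballI I (\<lambda>_. 0) (1 + \<eta>)"
  define F where "F d = (\<integral>\<^sup>+x. ennreal (exp (Q d x)) * indicator ?B x \<partial>leb I)" for d
  have [measurable]: "F \<in> borel_measurable M" unfolding F_def by measurable
  obtain w where v0: "vol1 I = ennreal w" "w > 0"
    using vol1_pos[OF I] vol1_finite[OF I] by (cases "vol1 I") auto
  \<comment> \<open>The ratio of this volume to that of the ball of radius \<open>\<eta>\<close>
    plays the role of the cardinality of a net.\<close>
  define v where "v = (1 + \<eta>) ^ card I * w"
  have v: "v > 0" using v0 \<eta> by (simp add: v_def)
  have vB: "emeasure (leb I) ?B = ennreal v"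
    using \<eta> v0 by (simp add: emeasure_ballI[OF I] v_def ennreal_mult)
  define A where "A = {d \<in> space M. 1 \<le> ennreal (1 / (c * v)) * F d}"
  have A: "A \<in> sets M" unfolding A_def by measurable
  have C: "C \<ge> 0 \<or> ennreal C = 0" by (auto simp: ennreal_eq_0_iff)
  have "(\<integral>\<^sup>+d. F d \<partial>M) = (\<integral>\<^sup>+x. (\<integral>\<^sup>+d. ennreal (exp (Q d x)) * indicator ?B x \<partial>M) \<partial>leb I)"
    unfolding F_def by (rule P.Fubini'[symmetric]) measurable
  also have "\<dots> \<le> (\<integral>\<^sup>+x. ennreal C * indicator ?B x \<partial>leb I)"
  proof (intro nn_integral_mono)
    fix x assume x: "x \<in> space (leb I)"
    then show "(\<integral>\<^sup>+d. ennreal (exp (Q d x)) * indicator ?B x \<partial>M) \<le> ennreal C * indicator ?B x"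
      using mgf[of x] by (cases "x \<in> ?B") (auto simp: ballI_def)
  qed
  also have "\<dots> = ennreal C * ennreal v" by (subst nn_integral_cmult_indicator) (auto simp: vB)
  finally have F: "(\<integral>\<^sup>+d. F d \<partial>M) \<le> ennreal C * ennreal v" .
  have "emeasure M A \<le> ennreal (1 / (c * v)) * (\<integral>\<^sup>+d. F d * indicator (space M) d \<partial>M)"
    unfolding A_def by (rule nn_integral_Markov_inequality) measurable
  also have "(\<integral>\<^sup>+d. F d * indicator (space M) d \<partial>M) = (\<integral>\<^sup>+d. F d \<partial>M)" by (intro nn_integral_cong) auto
  also have "ennreal (1 / (c * v)) * (\<integral>\<^sup>+d. F d \<partial>M) \<le> ennreal (1 / (c * v)) * (ennreal C * ennreal v)"
    by (intro mult_left_mono F) auto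
  also have "\<dots> = ennreal (C / c)"
    using c v C by (cases "C \<ge> 0") (auto simp: ennreal_eq_0_iff divide_le_0_iff ennreal_neg divide_nonpos_pos field_simps simp flip: ennreal_mult)
  finally have m: "emeasure M A \<le> ennreal (C / c)" .
  show thesis
  proof (rule that[OF A m])
    fix d x0 q assume d: "d \<in> space M - A" and x0: "ip I x0 x0 \<le> 1"
      and q: "\<And>z. ip I z z < \<eta>\<^sup>2 \<Longrightarrow> 2 * q \<le> Q d (\<lambda>i\<in>I. x0 i + z i) + Q d (\<lambda>i\<in>I. x0 i - z i)"
    have [measurable]: "d \<in> space M" using d by simp
    have "Q d \<in> borel_measurable (leb I)" by measurable
    from exp_average_lower[OF I \<eta> x0 this q]
    have e: "ennreal (exp q * \<eta> ^ card I) * vol1 I \<le> F d" unfolding F_def .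
    have "ennreal (1 / (c * v)) * F d < 1" using d by (auto simp: A_def)
    moreover have "ennreal (1 / (c * v)) * (ennreal (exp q * \<eta> ^ card I) * vol1 I) \<le> ennreal (1 / (c * v)) * F d"
      by (intro mult_left_mono e) auto
    ultimately have "ennreal (1 / (c * v)) * (ennreal (exp q * \<eta> ^ card I) * vol1 I) < 1" by order
    moreover have "ennreal (1 / (c * v)) * (ennreal (exp q * \<eta> ^ card I) * vol1 I)
        = ennreal (1 / (c * v) * (exp q * \<eta> ^ card I * w))"
      unfolding v0(1) using c v \<eta> v0(2) by (simp del: ennreal_mult'' flip: ennreal_mult)
    ultimately have "ennreal (1 / (c * v) * (exp q * \<eta> ^ card I * w)) < ennreal 1" by simp
    then have "1 / (c * v) * (exp q * \<eta> ^ card I * w) < 1"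
      by (subst (asm) ennreal_less_iff) (use c v \<eta> v0(2) in auto)
    then have "exp q * \<eta> ^ card I * w < c * v" using c v by (simp add: pos_divide_less_eq)
    then have "(exp q * \<eta> ^ card I) * w < (c * (1 + \<eta>) ^ card I) * w"
      by (simp only: v_def mult.assoc)
    then show "exp q * \<eta> ^ card I \<le> c * (1 + \<eta>) ^ card I" using v0 by simp
  qed
qed

section \<open>Frame bound and restricted isometry\<close>

text \<open>18 is the exponential moment of a squared projection; 101 is the ratio
  \<open>(1 + 1/100) / (1/100)\<close> of the radii in the restricted isometry estimate.\<close>

lemma exp_bounds: "exp (1::real) \<ge> 2" "exp (1::real) \<le> 3" "(18::real) \<le> exp 5" "(101::real) \<le> exp 7"
proof -
  show e: "exp (1::real) \<ge> 2" "exp (1::real) \<le> 3" using exp_ge_add_one_self[of 1] exp_le by auto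
  have "(2::real) ^ n \<le> exp 1 ^ n" for n using e by (intro power_mono) auto
  from this[of 5] this[of 7] show "(18::real) \<le> exp 5" "(101::real) \<le> exp 7"
    by (auto simp flip: exp_of_nat_mult)
qed

lemma quad_scale:
  assumes "\<And>x. dot p x x = 1 \<Longrightarrow> (\<Sum>l\<in>S. w l * (dot p x (d l))\<^sup>2) \<le> a * (dot p u x)\<^sup>2 + b"
  shows "(\<Sum>l\<in>S. w l * (dot p x (d l))\<^sup>2) \<le> a * (dot p u x)\<^sup>2 + b * dot p x x"
proof (cases "dot p x x = 0")
  case True
  then have "dot p x y = 0" for y by (simp add: ip_self_eq_0) (simp add: ip_def)
  then show ?thesis by (simp add: ip_commute[of _ u])
next
  case False
  define r where "r = sqrt (dot p x x)"
  have r: "r > 0" "r\<^sup>2 = dot p x x" using False ip_self_nonneg[of "{..<p}" x] by (auto simp: r_def)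
  define y where "y = (\<lambda>i. (1/r) * x i)"
  have xy: "dot p x z = r * dot p y z" for z
    unfolding y_def ip_scale_left using r by simp
  have yy: "dot p y y = 1"
    unfolding y_def ip_scale_left ip_scale_right using r False by (simp add: field_simps power2_eq_square)
  have "(\<Sum>l\<in>S. w l * (dot p x (d l))\<^sup>2) = r\<^sup>2 * (\<Sum>l\<in>S. w l * (dot p y (d l))\<^sup>2)"
    unfolding xy by (simp add: sum_distrib_left power_mult_distrib algebra_simps)
  also have "\<dots> \<le> r\<^sup>2 * (a * (dot p u y)\<^sup>2 + b)" using assms[OF yy] by (intro mult_left_mono) auto
  also have "\<dots> = a * (r * dot p y u)\<^sup>2 + b * r\<^sup>2" by (simp add: algebra_simps power_mult_distrib ip_commute[of _ u])
  also have "\<dots> = a * (dot p u x)\<^sup>2 + b * dot p x x" unfolding xy[symmetric] r(2) by (simp add: ip_commute[of _ u])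
  finally show ?thesis .
qed

lemma ip_restrict_diff [simp]: "dot p (\<lambda>i\<in>{..<p}. x i - z i) y = dot p x y - dot p z y"
  "dot p (\<lambda>i\<in>{..<p}. x i + z i) y = dot p x y + dot p z y"
  by (simp_all add: ip_diff_left ip_add_left)

lemma measurable_dot_pair [measurable]:
  assumes "l \<in> I" shows "(\<lambda>w. dot p (snd w) (fst w l)) \<in> borel_measurable (sph p I \<Otimes>\<^sub>M leb {..<p})"
  using assms by (intro measurable_ip measurable_compose[OF measurable_fst measurable_sph_component2]
    measurable_compose[OF measurable_snd measurable_component_leb]) auto

lemma exp_power_real: "(exp a) ^ n = exp (real n * (a::real))"
  by (rule exp_of_nat_mult[symmetric])

lemma sph_frame_upper:
  assumes p: "p \<ge> 1"
  obtains A where "A \<in> sets (sph p {..<k})" "emeasure (sph p {..<k}) A \<le> ennreal (exp (- real p))"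
    "\<And>d x. d \<in> space (sph p {..<k}) - A \<Longrightarrow>
       (\<Sum>l<k. (dot p x (d l))\<^sup>2) \<le> (160 * real k / real p + 64) * dot p x x"
proof -
  \<comment> \<open>Averaging with \<open>\<eta> = 1\<close> visits vectors of squared length up to
    4, so 1/32 is a quarter of the admissible factor 1/8.\<close>
  define Q where "Q d x = (\<Sum>l<k. real p * (dot p x (d l))\<^sup>2 / 32)" for d :: "nat \<Rightarrow> nat \<Rightarrow> real" and x
  have meas: "(\<lambda>(d, x). Q d x) \<in> borel_measurable (sph p {..<k} \<Otimes>\<^sub>M leb {..<p})"
    unfolding Q_def split_def
    by (intro borel_measurable_sum borel_measurable_divide borel_measurable_times borel_measurable_power
      borel_measurable_const measurable_dot_pair)
  have mgf: "(\<integral>\<^sup>+d. ennreal (exp (Q d x)) \<partial>sph p {..<k}) \<le> ennreal (18 ^ k)" if "dot p x x < (1 + 1)\<^sup>2" for x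
  proof -
    let ?y = "\<lambda>i. (1/2) * x i"
    have y: "dot p ?y ?y \<le> 1" unfolding ip_scale_left ip_scale_right using that by simp
    have e: "real p * (dot p x d)\<^sup>2 / 32 = real p * (dot p ?y d)\<^sup>2 / 8" for d
      unfolding ip_scale_left by (simp add: power2_eq_square)
    show ?thesis
      unfolding Q_def e using sph_mgf_sum[OF _ _ sphere_mgf_square[OF p y], of "{..<k}"]
      by (simp flip: ennreal_power)
  qed
  show thesis
  proof (rule sup_by_averaging[OF prob_space_sph, of "{..<p}" 1 "18 ^ k * exp (real p)" Q p "{..<k}" "18 ^ k"])
    fix A assume A: "A \<in> sets (sph p {..<k})" "emeasure (sph p {..<k}) A \<le> ennreal (18 ^ k / (18 ^ k * exp (real p)))"
      and H: "\<And>d x0 q. d \<in> space (sph p {..<k}) - A \<Longrightarrow> dot p x0 x0 \<le> 1 \<Longrightarrow>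
          (\<And>z. dot p z z < 1\<^sup>2 \<Longrightarrow> 2 * q \<le> Q d (\<lambda>i\<in>{..<p}. x0 i + z i) + Q d (\<lambda>i\<in>{..<p}. x0 i - z i)) \<Longrightarrow>
          exp q * 1 ^ card {..<p} \<le> 18 ^ k * exp (real p) * (1 + 1) ^ card {..<p}"
    show thesis
    proof (rule that[OF A(1)])
      show "emeasure (sph p {..<k}) A \<le> ennreal (exp (- real p))" using A(2) by (simp add: exp_minus field_simps)
      fix d x assume d: "d \<in> space (sph p {..<k}) - A"
      have "(\<Sum>l<k. 1 * (dot p x (d l))\<^sup>2) \<le> 0 * (dot p (\<lambda>_. 0) x)\<^sup>2 + (160 * real k / real p + 64) * dot p x x" for x
      proof (rule quad_scale)
        fix x assume x: "dot p x x = 1"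
        have "exp (Q d x) * 1 ^ card {..<p} \<le> 18 ^ k * exp (real p) * (1 + 1) ^ card {..<p}"
        proof (rule H[OF d])
          fix z
          show "2 * Q d x \<le> Q d (\<lambda>i\<in>{..<p}. x i + z i) + Q d (\<lambda>i\<in>{..<p}. x i - z i)"
            unfolding Q_def ip_restrict_diff sum.distrib[symmetric] sum_distrib_left
          proof (intro sum_mono)
            fix l
            have "2 * (real p * (dot p x (d l))\<^sup>2) \<le> real p * ((dot p x (d l) + dot p z (d l))\<^sup>2 + (dot p x (d l) - dot p z (d l))\<^sup>2)"
              by (simp add: power2_eq_square algebra_simps)
            then show "2 * (real p * (dot p x (d l))\<^sup>2 / 32) \<le> real p * (dot p x (d l) + dot p z (d l))\<^sup>2 / 32 + real p * (dot p x (d l) - dot p z (d l))\<^sup>2 / 32"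
              by (simp add: algebra_simps)
          qed
        qed (simp add: x)
        also have "18 ^ k * exp (real p) * (1 + 1) ^ card {..<p} = 18 ^ k * exp (real p) * 2 ^ p" by simp
        also have "\<dots> \<le> exp 5 ^ k * exp (real p) * exp 1 ^ p"
          using exp_bounds by (intro mult_mono power_mono) auto
        also have "\<dots> = exp (real k * 5 + real p + real p * 1)" by (simp only: exp_power_real exp_add)
        \<comment> \<open>Each of the \<open>k\<close> vectors pays 5 through 18, each dimension
          pays 1 for the threshold and 1 for the factor 2. Multiplying by \<open>32 / p\<close>
          gives the stated 160 and 64.\<close>
        finally have "Q d x \<le> 5 * real k + 2 * real p" by simp
        moreover have "Q d x = real p / 32 * (\<Sum>l<k. (dot p x (d l))\<^sup>2)" by (simp add: Q_def sum_distrib_left)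
        ultimately show "(\<Sum>l<k. 1 * (dot p x (d l))\<^sup>2) \<le> 0 * (dot p (\<lambda>_. 0) x)\<^sup>2 + (160 * real k / real p + 64)"
          using p by (simp add: field_simps)
      qed
      then show "(\<Sum>l<k. (dot p x (d l))\<^sup>2) \<le> (160 * real k / real p + 64) * dot p x x" by simp
    qed
  qed (use meas mgf in auto)
qed

section \<open>Combinations of few vectors and restricted isometry\<close>

definition comb :: "nat set \<Rightarrow> (nat \<Rightarrow> real) \<Rightarrow> (nat \<Rightarrow> nat \<Rightarrow> real) \<Rightarrow> nat \<Rightarrow> real" where
  "comb I c d = (\<lambda>i. \<Sum>l\<in>I. c l * d l i)"

text \<open>The map from \<open>b\<close> to \<open>\<kappa> * b / (1 - 8 * \<kappa> * b)\<close> is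
  a supersolution of the recursion in \<open>sph_mgf_comb\<close>: the increased
  \<open>\<kappa>'\<close> is at most \<open>\<kappa> / (1 - 8 * \<kappa> * c2)\<close>, and
  fractions of this form compose exactly.\<close>

lemma exponent_step:
  assumes "0 \<le> (\<kappa>::real)" "0 \<le> c2" "0 \<le> b'" "8 * \<kappa> * (c2 + b') < 1"
  defines "\<kappa>' \<equiv> \<kappa> + 8 * \<kappa>\<^sup>2 * c2"
  shows "8 * \<kappa>' * b' < 1" "\<kappa> * c2 + \<kappa>' * b' / (1 - 8 * \<kappa>' * b') \<le> \<kappa> * (c2 + b') / (1 - 8 * \<kappa> * (c2 + b'))"
proof -
  define t where "t = 8 * \<kappa> * c2"
  have t: "0 \<le> t" "8 * \<kappa> * b' < 1 - t" "0 \<le> 8 * \<kappa> * b'" using assms by (auto simp: t_def algebra_simps)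
  define \<kappa>'' where "\<kappa>'' = \<kappa> / (1 - t)"
  have t1: "t < 1" using t by linarith
  have "\<kappa>' = \<kappa> * (1 + t)" by (simp add: \<kappa>'_def t_def algebra_simps power2_eq_square)
  moreover have "(1 + t) \<le> 1 / (1 - t)" using t t1 by (simp add: field_simps)
  ultimately have le: "\<kappa>' \<le> \<kappa>''" using assms(1) mult_left_mono[of "1 + t" "1 / (1 - t)" \<kappa>] by (simp add: \<kappa>''_def)
  have k0: "0 \<le> \<kappa>'" using assms by (simp add: \<kappa>'_def)
  have k2: "0 \<le> \<kappa>''" using le k0 by linarith
  have lt: "8 * \<kappa>'' * b' < 1" using t t1 by (simp add: \<kappa>''_def field_simps)
  have le2: "8 * \<kappa>' * b' \<le> 8 * \<kappa>'' * b'" using le assms by (intro mult_right_mono) auto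
  then show "8 * \<kappa>' * b' < 1" using lt by linarith
  have "\<kappa>' * b' / (1 - 8 * \<kappa>' * b') \<le> \<kappa>'' * b' / (1 - 8 * \<kappa>'' * b')"
    using le le2 lt k0 k2 assms(3) by (intro frac_le mult_right_mono mult_nonneg_nonneg) auto
  also have "\<dots> = \<kappa> * b' / (1 - t - 8 * \<kappa> * b')"
    using t t1 by (simp add: \<kappa>''_def divide_simps)
  finally have 1: "\<kappa>' * b' / (1 - 8 * \<kappa>' * b') \<le> \<kappa> * b' / (1 - 8 * \<kappa> * (c2 + b'))"
    by (simp add: t_def algebra_simps)
  have "\<kappa> * c2 \<le> \<kappa> * c2 / (1 - 8 * \<kappa> * (c2 + b'))"
    using assms t by (simp add: pos_le_divide_eq mult_left_le)
  then show "\<kappa> * c2 + \<kappa>' * b' / (1 - 8 * \<kappa>' * b') \<le> \<kappa> * (c2 + b') / (1 - 8 * \<kappa> * (c2 + b'))"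
    using 1 by (simp add: algebra_simps add_divide_distrib)
qed

lemma nn_integral_sph_insert:
  assumes "finite I" "i \<notin> I" "f \<in> borel_measurable (sph p (insert i I))"
  shows "(\<integral>\<^sup>+d. f d \<partial>sph p (insert i I)) = (\<integral>\<^sup>+d. (\<integral>\<^sup>+y. f (d(i := y)) \<partial>unif_sphere p) \<partial>sph p I)"
  unfolding sph_def using assms
  by (intro product_sigma_finite.product_nn_integral_insert product_sigma_finite_sphere) (auto simp: sph_def)

text \<open>The vectors are integrated out one at a time. Given the combination \<open>V\<close> of
  the others, the squared norm of \<open>V + c i * y\<close> is affine in the unit vector
  \<open>y\<close>, and \<open>sphere_mgf_linear\<close> converts the linear term into a multiple of
  the squared norm of \<open>V\<close>, raising \<open>\<kappa>\<close> to \<open>\<kappa>'\<close>.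
  A zero coefficient pays no factor 18, so a subfamily can be treated by extending its coefficients
  by 0.\<close>

lemma sph_mgf_comb:
  assumes p: "p \<ge> 1" and I: "finite I" and k0: "0 \<le> \<kappa>" "8 * \<kappa> * (\<Sum>l\<in>I. (c l)\<^sup>2) < 1"
  shows "(\<integral>\<^sup>+d. ennreal (exp (\<kappa> * real p * dot p (comb I c d) (comb I c d))) \<partial>sph p I)
    \<le> ennreal (18 ^ card {l\<in>I. c l \<noteq> 0} * exp (real p * (\<kappa> * (\<Sum>l\<in>I. (c l)\<^sup>2) / (1 - 8 * \<kappa> * (\<Sum>l\<in>I. (c l)\<^sup>2)))))"
  using I k0
proof (induction I arbitrary: \<kappa> rule: finite_induct)
  case empty
  interpret prob_space "sph p {}" by (rule prob_space_sph)
  show ?case by (simp add: comb_def emeasure_space_1)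
next
  case (insert i I)
  let ?b = "\<Sum>l\<in>I. (c l)\<^sup>2" and ?B = "\<Sum>l\<in>insert i I. (c l)\<^sup>2"
  have B: "?B = (c i)\<^sup>2 + ?b" using insert.hyps by simp
  define \<kappa>' where "\<kappa>' = \<kappa> + 8 * \<kappa>\<^sup>2 * (c i)\<^sup>2"
  have b0: "?b \<ge> 0" by (simp add: sum_nonneg)
  note st = exponent_step[OF insert.prems(1) zero_le_power2[of "c i"] b0 insert.prems(2)[unfolded B], folded \<kappa>'_def]
  have k': "\<kappa>' \<ge> 0" using insert.prems by (simp add: \<kappa>'_def)
  let ?f = "\<lambda>I \<kappa> d. ennreal (exp (\<kappa> * real p * dot p (comb I c d) (comb I c d)))"
  have fm [measurable]: "?f I \<kappa> \<in> borel_measurable (sph p I)" for I \<kappa>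
    unfolding comb_def by measurable
  have upd: "comb (insert i I) c (d(i := y)) j = comb I c d j + c i * y j" for d y j
  proof -
    have "comb I c (d(i := y)) j = comb I c d j" unfolding comb_def using insert.hyps by (intro sum.cong) auto
    then show ?thesis using insert.hyps by (simp add: comb_def)
  qed
  let ?n = "18 ^ (if c i = 0 then 0 else 1) :: real"
  have inner: "(\<integral>\<^sup>+y. ?f (insert i I) \<kappa> (d(i := y)) \<partial>unif_sphere p)
      \<le> ennreal (?n * exp (real p * (\<kappa> * (c i)\<^sup>2))) * ?f I \<kappa>' d" for d
  proof -
    interpret prob_space "unif_sphere p" by (rule prob_space_sphere)
    let ?V = "comb I c d" and ?W = "\<lambda>j. 2 * \<kappa> * real p * c i * comb I c d j"
    have e: "dot p (comb (insert i I) c (d(i := y))) (comb (insert i I) c (d(i := y)))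
       = dot p ?V ?V + 2 * c i * dot p ?V y + (c i)\<^sup>2 * dot p y y" for y
      unfolding ip_def upd by (simp add: power2_eq_square sum.distrib sum_distrib_left algebra_simps)
    have "(\<integral>\<^sup>+y. ?f (insert i I) \<kappa> (d(i := y)) \<partial>unif_sphere p)
       = (\<integral>\<^sup>+y. ennreal (exp (\<kappa> * real p * (dot p ?V ?V + (c i)\<^sup>2))) * ennreal (exp (dot p ?W y)) \<partial>unif_sphere p)"
    proof (rule nn_integral_cong_AE)
      show "AE y in unif_sphere p. ?f (insert i I) \<kappa> (d(i := y)) = ennreal (exp (\<kappa> * real p * (dot p ?V ?V + (c i)\<^sup>2))) * ennreal (exp (dot p ?W y))"
        using AE_sphere_unit[OF p]
      proof eventually_elim
        case (elim y)
        then show ?case unfolding e ip_scale_left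
          by (simp flip: ennreal_mult exp_add) (simp add: algebra_simps)
      qed
    qed
    also have "\<dots> = ennreal (exp (\<kappa> * real p * (dot p ?V ?V + (c i)\<^sup>2))) * (\<integral>\<^sup>+y. ennreal (exp (dot p ?W y)) \<partial>unif_sphere p)"
      by (rule nn_integral_cmult) measurable
    also have "(\<integral>\<^sup>+y. ennreal (exp (dot p ?W y)) \<partial>unif_sphere p) \<le> ennreal (?n * exp (8 * \<kappa>\<^sup>2 * (c i)\<^sup>2 * real p * dot p ?V ?V))"
    proof (cases "c i = 0")
      case True then show ?thesis by (simp add: emeasure_space_1)
    next
      case False
      have "2 * dot p ?W ?W / real p = 8 * \<kappa>\<^sup>2 * (c i)\<^sup>2 * real p * dot p ?V ?V"
        unfolding ip_scale_left ip_scale_right using p by (simp add: power2_eq_square)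
      then show ?thesis using sphere_mgf_linear[OF p, of ?W] False by (simp add: ennreal_mult)
    qed
    also have "ennreal (exp (\<kappa> * real p * (dot p ?V ?V + (c i)\<^sup>2))) * ennreal (?n * exp (8 * \<kappa>\<^sup>2 * (c i)\<^sup>2 * real p * dot p ?V ?V))
      = ennreal (?n * exp (real p * (\<kappa> * (c i)\<^sup>2))) * ?f I \<kappa>' d"
      by (simp flip: ennreal_mult exp_add add: mult.assoc mult.left_commute[of "exp _" ?n]) (simp add: \<kappa>'_def algebra_simps)
    finally show ?thesis by (simp add: mult_left_mono)
  qed
  have "(\<integral>\<^sup>+d. ?f (insert i I) \<kappa> d \<partial>sph p (insert i I)) = (\<integral>\<^sup>+d. (\<integral>\<^sup>+y. ?f (insert i I) \<kappa> (d(i := y)) \<partial>unif_sphere p) \<partial>sph p I)"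
    using insert.hyps by (intro nn_integral_sph_insert fm)
  also have "\<dots> \<le> (\<integral>\<^sup>+d. ennreal (?n * exp (real p * (\<kappa> * (c i)\<^sup>2))) * ?f I \<kappa>' d \<partial>sph p I)"
    by (intro nn_integral_mono inner)
  also have "\<dots> = ennreal (?n * exp (real p * (\<kappa> * (c i)\<^sup>2))) * (\<integral>\<^sup>+d. ?f I \<kappa>' d \<partial>sph p I)"
    by (rule nn_integral_cmult) measurable
  also have "\<dots> \<le> ennreal (?n * exp (real p * (\<kappa> * (c i)\<^sup>2))) *
     ennreal (18 ^ card {l\<in>I. c l \<noteq> 0} * exp (real p * (\<kappa>' * ?b / (1 - 8 * \<kappa>' * ?b))))"
    by (intro mult_left_mono insert.IH k' st) auto
  also have "\<dots> = ennreal ((?n * 18 ^ card {l\<in>I. c l \<noteq> 0}) * exp (real p * (\<kappa> * (c i)\<^sup>2 + \<kappa>' * ?b / (1 - 8 * \<kappa>' * ?b))))"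
    by (simp flip: ennreal_mult add: exp_add distrib_left)
  also have "?n * 18 ^ card {l\<in>I. c l \<noteq> 0} = 18 ^ card {l\<in>insert i I. c l \<noteq> 0}"
  proof (cases "c i = 0")
    case True
    then have "{l\<in>insert i I. c l \<noteq> 0} = {l\<in>I. c l \<noteq> 0}" by auto
    with True show ?thesis by simp
  next
    case False
    then have "{l\<in>insert i I. c l \<noteq> 0} = insert i {l\<in>I. c l \<noteq> 0}" by auto
    with False insert.hyps show ?thesis by simp
  qed
  also have "ennreal (18 ^ card {l\<in>insert i I. c l \<noteq> 0} * exp (real p * (\<kappa> * (c i)\<^sup>2 + \<kappa>' * ?b / (1 - 8 * \<kappa>' * ?b))))
    \<le> ennreal (18 ^ card {l\<in>insert i I. c l \<noteq> 0} * exp (real p * (\<kappa> * ?B / (1 - 8 * \<kappa> * ?B))))"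
    unfolding B by (intro ennreal_leI mult_left_mono iffD2[OF exp_le_cancel_iff] st(2)) auto
  finally show ?case .
qed

text \<open>An operator and its adjoint have the same norm: the hypothesis is tested at the
  normalised coefficients \<open>dot p x (d l)\<close>.\<close>

lemma frame_dual:
  assumes S: "finite S" and B: "\<And>c. ip S c c \<le> 1 \<Longrightarrow> dot p (comb S c d) (comb S c d) \<le> B"
  shows "(\<Sum>l\<in>S. (dot p x (d l))\<^sup>2) \<le> B * dot p x x"
proof -
  define R where "R = (\<Sum>l\<in>S. (dot p x (d l))\<^sup>2)"
  have B0: "B \<ge> 0" using B[of "\<lambda>_. 0"] by (simp add: comb_def)
  have R0: "R \<ge> 0" by (simp add: R_def sum_nonneg)
  show ?thesis
  proof (cases "R = 0")
    case True
    then show ?thesis using B0 ip_self_nonneg[of "{..<p}" x] by (simp add: R_def)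
  next
    case False
    define c where "c l = dot p x (d l) / sqrt R" for l
    have cl: "c l * c l = (dot p x (d l))\<^sup>2 / R" for l using R0 by (simp add: c_def power2_eq_square)
    have "ip S c c = R / R" unfolding ip_def[of S c c] cl by (simp add: R_def flip: sum_divide_distrib)
    then have BB: "dot p (comb S c d) (comb S c d) \<le> B" using False by (intro B) simp
    have "dot p (comb S c d) x = (\<Sum>l\<in>S. c l * dot p (d l) x)" by (simp add: comb_def ip_sum_left)
    also have "\<dots> = R / sqrt R" unfolding c_def R_def by (simp add: sum_divide_distrib power2_eq_square ip_commute[of _ x])
    finally have "dot p (comb S c d) x = sqrt R" using R0 by (simp add: real_div_sqrt)
    then have "R \<le> dot p (comb S c d) (comb S c d) * dot p x x"
      using ip_cauchy_schwarz[of "{..<p}" "comb S c d" x] R0 by simp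
    also have "\<dots> \<le> B * dot p x x" using BB by (intro mult_right_mono) (auto simp: ip_self_nonneg)
    finally show ?thesis by (simp add: R_def)
  qed
qed

text \<open>The averaging takes place over coefficient vectors on \<open>S\<close>, where the volume
  ratio is only \<open>101 ^ card S\<close>; \<open>frame_dual\<close> transports the bound to
  vectors of dimension \<open>p\<close>.\<close>

lemma sph_rip_fixed:
  assumes p: "p \<ge> 1" and S: "S \<subseteq> {..<k}"
  obtains A where "A \<in> sets (sph p {..<k})" "emeasure (sph p {..<k}) A \<le> ennreal (exp (- real p / 100000))"
    "\<And>d x. d \<in> space (sph p {..<k}) - A \<Longrightarrow>
       (\<Sum>l\<in>S. (dot p x (d l))\<^sup>2) \<le> (1.04 + 12000 * real (card S) / real p) * dot p x x"
proof -
  have fS: "finite S" using S finite_subset by blast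
  \<comment> \<open>The small factor keeps the denominator in \<open>sph_mgf_comb\<close> close to
    1. The squared norm of \<open>c\<close> is at most \<open>1.01^2 = 1.0201\<close>, and the
    resulting exponent stays below \<open>0.00103 * p\<close>.\<close>
  define Q where "Q d c = (1/1000) * real p * dot p (comb S c d) (comb S c d)" for d c
  have meas: "(\<lambda>(d, c). Q d c) \<in> borel_measurable (sph p {..<k} \<Otimes>\<^sub>M leb S)"
    unfolding Q_def comb_def split_def using S
    by (intro borel_measurable_times borel_measurable_const measurable_ip borel_measurable_sum
      measurable_compose[OF measurable_fst measurable_sph_component2]
      measurable_compose[OF measurable_snd measurable_component_leb]) auto
  let ?n = "card S"
  have mgf: "(\<integral>\<^sup>+d. ennreal (exp (Q d c)) \<partial>sph p {..<k}) \<le> ennreal (18 ^ ?n * exp (0.00103 * real p))"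
    if "ip S c c < (1 + 1/100)\<^sup>2" for c
  proof -
    define c' where "c' l = (if l \<in> S then c l else 0)" for l
    have cc: "comb {..<k} c' d = comb S c d" for d
      unfolding comb_def c'_def fun_eq_iff using S
      by (auto intro!: sum.mono_neutral_cong_right)
    have s: "(\<Sum>l<k. (c' l)\<^sup>2) = ip S c c"
      unfolding ip_def c'_def power2_eq_square using S by (auto intro!: sum.mono_neutral_cong_right)
    define b where "b = ip S c c"
    have b: "0 \<le> b" "b \<le> 1.0201" using that ip_self_nonneg[of S c] by (auto simp: b_def power2_eq_square)
    have "(1/1000) * b / (1 - 8 * (1/1000) * b) \<le> ((1/1000) * 1.0201) / (1 - 8 * (1/1000) * 1.0201)"
      using b by (intro frac_le) auto
    also have "\<dots> \<le> 0.00103" by simp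
    finally have bb: "(1/1000) * b / (1 - 8 * (1/1000) * b) \<le> 0.00103" .
    have "(\<integral>\<^sup>+d. ennreal (exp (Q d c)) \<partial>sph p {..<k})
      \<le> ennreal (18 ^ card {l\<in>{..<k}. c' l \<noteq> 0} * exp (real p * ((1/1000) * b / (1 - 8 * (1/1000) * b))))"
      using sph_mgf_comb[OF p, of "{..<k}" "1/1000" c'] b unfolding s Q_def cc b_def by simp
    also have "\<dots> \<le> ennreal (18 ^ ?n * exp (real p * 0.00103))"
    proof (intro ennreal_leI mult_mono power_increasing)
      show "card {l\<in>{..<k}. c' l \<noteq> 0} \<le> ?n" by (intro card_mono fS) (auto simp: c'_def)
      show "exp (real p * ((1/1000) * b / (1 - 8 * (1/1000) * b))) \<le> exp (real p * 0.00103)"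
        using mult_left_mono[OF bb, of "real p"] by simp
    qed auto
    finally show ?thesis by (simp add: mult.commute)
  qed
  show thesis
  \<comment> \<open>The threshold exceeds the moment by the factor \<open>exp (p / 100000)\<close>.
    Dividing exponents by 1/1000 turns 0.00104 into 1.04, and the cost \<open>5 + 7\<close> per
    element, from 18 and 101, into 12000.\<close>
  proof (rule sup_by_averaging[OF prob_space_sph fS, of "1/100" "18 ^ ?n * exp (0.00104 * real p)" Q p "{..<k}" "18 ^ ?n * exp (0.00103 * real p)"])
    fix A assume A: "A \<in> sets (sph p {..<k})" "emeasure (sph p {..<k}) A \<le> ennreal (18 ^ ?n * exp (0.00103 * real p) / (18 ^ ?n * exp (0.00104 * real p)))"
      and H: "\<And>d x0 q. d \<in> space (sph p {..<k}) - A \<Longrightarrow> ip S x0 x0 \<le> 1 \<Longrightarrow>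
          (\<And>z. ip S z z < (1/100)\<^sup>2 \<Longrightarrow> 2 * q \<le> Q d (\<lambda>i\<in>S. x0 i + z i) + Q d (\<lambda>i\<in>S. x0 i - z i)) \<Longrightarrow>
          exp q * (1/100) ^ card S \<le> 18 ^ ?n * exp (0.00104 * real p) * (1 + 1/100) ^ card S"
    show thesis
    proof (rule that[OF A(1)])
      have "exp (0.00103 * real p) = exp (0.00104 * real p) * exp (- real p / 100000)"
        unfolding exp_add[symmetric] by simp
      then have "18 ^ ?n * exp (0.00103 * real p) / (18 ^ ?n * exp (0.00104 * real p)) = exp (- real p / 100000)"
        by simp
      then show "emeasure (sph p {..<k}) A \<le> ennreal (exp (- real p / 100000))" using A(2) by simp
      fix d x assume d: "d \<in> space (sph p {..<k}) - A"
      show "(\<Sum>l\<in>S. (dot p x (d l))\<^sup>2) \<le> (1.04 + 12000 * real (card S) / real p) * dot p x x"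
      proof (rule frame_dual[OF fS])
        fix c assume c: "ip S c c \<le> 1"
        have "exp (Q d c) * (1/100) ^ card S \<le> 18 ^ ?n * exp (0.00104 * real p) * (1 + 1/100) ^ card S"
        proof (rule H[OF d c])
          fix z :: "nat \<Rightarrow> real"
          have pm: "comb S (\<lambda>i\<in>S. c i + z i) d = (\<lambda>i. comb S c d i + comb S z d i)" "comb S (\<lambda>i\<in>S. c i - z i) d = (\<lambda>i. comb S c d i - comb S z d i)"
            by (auto simp: comb_def fun_eq_iff algebra_simps sum.distrib sum_subtractf)
          show "2 * Q d c \<le> Q d (\<lambda>i\<in>S. c i + z i) + Q d (\<lambda>i\<in>S. c i - z i)"
            unfolding Q_def pm ip_add_left ip_add_right ip_diff_left ip_diff_right
            using ip_self_nonneg[of "{..<p}" "comb S z d"] by (simp add: algebra_simps)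
        qed
        then have "exp (Q d c) \<le> 18 ^ ?n * exp (0.00104 * real p) * ((1 + 1/100) ^ ?n / (1/100) ^ ?n)"
          by (simp add: field_simps)
        also have "(1 + 1/100) ^ ?n / (1/100) ^ ?n = (101::real) ^ ?n" by (simp flip: power_divide)
        also have "18 ^ ?n * exp (0.00104 * real p) * 101 ^ ?n \<le> exp 5 ^ ?n * exp (0.00104 * real p) * exp 7 ^ ?n"
          using exp_bounds by (intro mult_mono power_mono) auto
        also have "\<dots> = exp (real ?n * 5 + 0.00104 * real p + real ?n * 7)" by (simp only: exp_power_real exp_add)
        finally have "Q d c \<le> 12 * real ?n + 0.00104 * real p" by simp
        then show "dot p (comb S c d) (comb S c d) \<le> 1.04 + 12000 * real (card S) / real p"
          using p by (simp add: Q_def field_simps)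
      qed
    qed
  qed (use meas mgf in auto)
qed

lemma sph_rip:
  assumes p: "p \<ge> 1"
  obtains A where "A \<in> sets (sph p {..<k})" "emeasure (sph p {..<k}) A \<le> ennreal (real k ^ n * exp (- real p / 100000))"
    "\<And>d x S. d \<in> space (sph p {..<k}) - A \<Longrightarrow> S \<subseteq> {..<k} \<Longrightarrow> card S = n \<Longrightarrow>
       (\<Sum>l\<in>S. (dot p x (d l))\<^sup>2) \<le> (1.04 + 12000 * real n / real p) * dot p x x"
proof -
  let ?M = "sph p {..<k}" and ?\<S> = "{S. S \<subseteq> {..<k} \<and> card S = n}"
  have "\<forall>S\<in>?\<S>. \<exists>A. A \<in> sets ?M \<and> emeasure ?M A \<le> ennreal (exp (- real p / 100000)) \<and>
     (\<forall>d x. d \<in> space ?M - A \<longrightarrow> (\<Sum>l\<in>S. (dot p x (d l))\<^sup>2) \<le> (1.04 + 12000 * real (card S) / real p) * dot p x x)"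
  proof
    fix S assume "S \<in> ?\<S>"
    then have S: "S \<subseteq> {..<k}" by auto
    show "\<exists>A. A \<in> sets ?M \<and> emeasure ?M A \<le> ennreal (exp (- real p / 100000)) \<and>
     (\<forall>d x. d \<in> space ?M - A \<longrightarrow> (\<Sum>l\<in>S. (dot p x (d l))\<^sup>2) \<le> (1.04 + 12000 * real (card S) / real p) * dot p x x)"
      by (rule sph_rip_fixed[OF p S]) blast
  qed
  from bchoice[OF this] obtain A where AA: "\<forall>S\<in>?\<S>. A S \<in> sets ?M \<and> emeasure ?M (A S) \<le> ennreal (exp (- real p / 100000)) \<and>
     (\<forall>d x. d \<in> space ?M - A S \<longrightarrow> (\<Sum>l\<in>S. (dot p x (d l))\<^sup>2) \<le> (1.04 + 12000 * real (card S) / real p) * dot p x x)" ..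
  have A: "\<And>S. S \<in> ?\<S> \<Longrightarrow> A S \<in> sets ?M" "\<And>S. S \<in> ?\<S> \<Longrightarrow> emeasure ?M (A S) \<le> ennreal (exp (- real p / 100000))"
     "\<And>S d x. S \<in> ?\<S> \<Longrightarrow> d \<in> space ?M - A S \<Longrightarrow> (\<Sum>l\<in>S. (dot p x (d l))\<^sup>2) \<le> (1.04 + 12000 * real (card S) / real p) * dot p x x"
    using AA by (simp_all only: Ball_def)
  have fin: "finite ?\<S>" by (rule finite_subset[of _ "Pow {..<k}"]) auto
  show thesis
  proof (rule that[of "\<Union>S\<in>?\<S>. A S"])
    show "(\<Union>S\<in>?\<S>. A S) \<in> sets ?M" using A(1) fin by (intro sets.finite_UN) auto
    have "emeasure ?M (\<Union>S\<in>?\<S>. A S) \<le> (\<Sum>S\<in>?\<S>. emeasure ?M (A S))"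
      using A(1) fin by (intro emeasure_subadditive_finite) auto
    also have "\<dots> \<le> (\<Sum>S\<in>?\<S>. ennreal (exp (- real p / 100000)))" by (intro sum_mono A(2))
    also have "\<dots> = ennreal (real (card ?\<S>) * exp (- real p / 100000))"
      by (simp add: ennreal_mult ennreal_of_nat_eq_real_of_nat)
    also have "card ?\<S> = k choose n" by (subst n_subsets) auto
    also have "real (k choose n) \<le> real k ^ n"
    proof (cases "n \<le> k")
      case True then show ?thesis using binomial_le_pow[OF True] by (metis of_nat_le_iff of_nat_power)
    qed (simp add: binomial_eq_0)
    finally show "emeasure ?M (\<Union>S\<in>?\<S>. A S) \<le> ennreal (real k ^ n * exp (- real p / 100000))"
      by (simp add: ennreal_leI mult_right_mono)
  qed (use A(3) in auto)
qed

section \<open>The truncated weighted sum\<close>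

lemma exp_quadratic_bound: "exp y \<le> 1 + y + y\<^sup>2 * exp \<bar>y\<bar>" for y :: real
proof -
  obtain t where t: "\<bar>t\<bar> \<le> \<bar>y\<bar>" "exp y = (\<Sum>m<2. y ^ m / fact m) + exp t / fact 2 * y ^ 2"
    using Maclaurin_exp_le[of y 2] by blast
  have "exp t / fact 2 * y\<^sup>2 \<le> exp \<bar>y\<bar> * y\<^sup>2"
  proof (rule mult_right_mono)
    have "exp t \<le> exp \<bar>y\<bar>" using t(1) by simp
    moreover have "exp t / fact 2 \<le> exp t" using exp_ge_zero[of t] by (simp add: fact_numeral)
    ultimately show "exp t / fact 2 \<le> exp \<bar>y\<bar>" by linarith
  qed simp
  then show ?thesis unfolding t(2) by (simp add: numeral_2_eq_2 mult.commute)
qed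

lemma square_le_exp: "0 \<le> z \<Longrightarrow> z\<^sup>2 \<le> 2 * exp z" for z :: real
  using exp_lower_Taylor_quadratic[of z] by (simp add: field_simps)

text \<open>Truncation and the choice of \<open>\<theta>\<close> give \<bar>y\<bar> \<le> Y / 64, so
  the second-order remainder of the exponential is dominated by exponentials with known means. The
  factor 4 is there because \<open>Y\<close> is formed with half the test vector, and 8404992 is
  \<open>16 * 513 * 2048 / 2\<close>.\<close>

lemma bulk_pointwise:
  fixes G Y \<tau> \<theta> :: real
  assumes "G \<ge> 0" "Y \<ge> 0" "\<tau> \<ge> 1" "\<theta> = 1 / (256 * \<tau>)"
  defines "y \<equiv> \<theta> * (if G \<le> \<tau> then G - 1 else 0) * (4 * Y)"
  shows "exp y \<le> 1 + \<theta> * (G - 1) * (4 * Y) + \<theta>\<^sup>2 * 8404992 * (exp (G / 8) + exp (Y / 8))"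
proof -
  have th: "\<theta> > 0" "\<theta> * \<tau> = 1/256" using assms by auto
  let ?a = "if G \<le> \<tau> then G - 1 else 0"
  have a: "\<bar>?a\<bar> \<le> \<tau>" using assms by auto
  have ay: "\<bar>y\<bar> \<le> Y / 64"
  proof -
    have "\<bar>y\<bar> = \<theta> * \<bar>?a\<bar> * (4 * Y)" using th assms by (simp add: y_def abs_mult)
    also have "\<dots> \<le> \<theta> * \<tau> * (4 * Y)" using a th assms by (intro mult_right_mono mult_left_mono) auto
    finally show ?thesis unfolding th(2) by simp
  qed
  have a2: "?a\<^sup>2 \<le> 513 * exp (G / 16)"
  proof -
    have "?a\<^sup>2 \<le> 1 + G\<^sup>2" using assms(1) by (auto simp: power2_eq_square algebra_simps)
    also have "G\<^sup>2 = 256 * (G / 16)\<^sup>2" by (simp add: power2_eq_square)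
    also have "\<dots> \<le> 256 * (2 * exp (G / 16))" using square_le_exp[of "G / 16"] assms by (intro mult_left_mono) auto
    finally have "?a\<^sup>2 \<le> 1 + 512 * exp (G / 16)" by simp
    moreover have "1 \<le> exp (G / 16)" using assms by simp
    ultimately show ?thesis by linarith
  qed
  have y2: "Y\<^sup>2 \<le> 2048 * exp (Y / 32)"
  proof -
    have "Y\<^sup>2 = 1024 * (Y / 32)\<^sup>2" by (simp add: power2_eq_square)
    also have "\<dots> \<le> 1024 * (2 * exp (Y / 32))" using square_le_exp[of "Y / 32"] assms by (intro mult_left_mono) auto
    finally show ?thesis by simp
  qed
  have "y\<^sup>2 * exp \<bar>y\<bar> = \<theta>\<^sup>2 * 16 * (?a\<^sup>2 * (Y\<^sup>2 * exp \<bar>y\<bar>))" by (simp add: y_def power_mult_distrib)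
  also have "\<dots> \<le> \<theta>\<^sup>2 * 16 * ((513 * exp (G / 16)) * ((2048 * exp (Y / 32)) * exp (Y / 64)))"
    using a2 y2 ay by (intro mult_left_mono mult_mono) auto
  also have "\<dots> = \<theta>\<^sup>2 * 16809984 * (exp (G / 16) * exp (Y / 32 + Y / 64))" unfolding exp_add by simp
  also have "\<dots> \<le> \<theta>\<^sup>2 * 16809984 * (exp (G / 16) * exp (Y / 16))"
    using assms by (intro mult_left_mono) auto
  also have "\<dots> \<le> \<theta>\<^sup>2 * 16809984 * ((exp (G / 8) + exp (Y / 8)) / 2)"
  proof (intro mult_left_mono)
    have "2 * exp (G/16) * exp (Y/16) \<le> (exp (G/16))\<^sup>2 + (exp (Y/16))\<^sup>2" by (rule sum_squares_bound)
    also have "\<dots> = exp (G/8) + exp (Y/8)" by (simp flip: exp_double)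
    finally show "exp (G / 16) * exp (Y / 16) \<le> (exp (G / 8) + exp (Y / 8)) / 2" by simp
  qed auto
  finally have sq: "y\<^sup>2 * exp \<bar>y\<bar> \<le> \<theta>\<^sup>2 * 8404992 * (exp (G / 8) + exp (Y / 8))" by simp
  \<comment> \<open>Truncation discards only weights \<open>G - 1\<close> with
    \<open>G > \<tau> \<ge> 1\<close>. They are positive, so restoring them in the linear term is an
    upper bound.\<close>
  have "y \<le> \<theta> * (G - 1) * (4 * Y)"
    unfolding y_def using th assms by (intro mult_right_mono mult_left_mono) auto
  then show ?thesis using exp_quadratic_bound[of y] sq by linarith
qed

lemma sphere_exp_square_integral:
  assumes p: "p \<ge> 1" and x: "dot p x x \<le> 1"
  shows "integrable (unif_sphere p) (\<lambda>d. exp (real p * (dot p x d)\<^sup>2 / 8))"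
    "(\<integral>d. exp (real p * (dot p x d)\<^sup>2 / 8) \<partial>unif_sphere p) \<le> 18"
proof -
  have n: "(\<integral>\<^sup>+d. ennreal (exp (real p * (dot p x d)\<^sup>2 / 8)) \<partial>unif_sphere p) \<le> 18" by (rule sphere_mgf_square[OF p x])
  show i: "integrable (unif_sphere p) (\<lambda>d. exp (real p * (dot p x d)\<^sup>2 / 8))"
    using n by (intro integrableI_nonneg) (auto simp: le_less_trans)
  have "ennreal (\<integral>d. exp (real p * (dot p x d)\<^sup>2 / 8) \<partial>unif_sphere p) \<le> ennreal 18"
    using n by (subst nn_integral_eq_integral[symmetric]) (auto intro: i)
  then show "(\<integral>d. exp (real p * (dot p x d)\<^sup>2 / 8) \<partial>unif_sphere p) \<le> 18" by (subst (asm) ennreal_le_iff) auto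
qed

text \<open>The weight of \<open>W\<close> multiplied by \<open>p\<close>. It is cut to 0, not to
  the level, since the vectors above the level are handled separately by restricted
  isometry.\<close>

definition trunc_weight :: "nat \<Rightarrow> (nat \<Rightarrow> real) \<Rightarrow> real \<Rightarrow> (nat \<Rightarrow> real) \<Rightarrow> real" where
  "trunc_weight p u \<tau> d = (if real p * (dot p u d)\<^sup>2 \<le> \<tau> then real p * (dot p u d)\<^sup>2 - 1 else 0)"

lemma measurable_trunc_weight [measurable]: "trunc_weight p u \<tau> \<in> borel_measurable (unif_sphere p)"
  unfolding trunc_weight_def by measurable

text \<open>By the fourth moment formula the mean of \<open>(G d - 1) * X d\<close> is at most
  \<open>2 * (dot p u x)^2\<close>. Once this drift is subtracted only the second-order term of
  \<open>bulk_pointwise\<close> remains; its two exponentials have mean at most 18 each, and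
  302579712 is \<open>36 * 8404992\<close>.\<close>

lemma bulk_mgf:
  assumes p: "p \<ge> 1" and u: "dot p u u = 1" and \<tau>: "\<tau> \<ge> 1" and \<theta>: "\<theta> = 1 / (256 * \<tau>)" and x: "dot p x x < 4"
  shows "(\<integral>\<^sup>+d. ennreal (exp (\<theta> * trunc_weight p u \<tau> d * (real p * (dot p x d)\<^sup>2) - 2 * \<theta> * (dot p u x)\<^sup>2)) \<partial>unif_sphere p)
     \<le> ennreal (exp (302579712 * \<theta>\<^sup>2))"
proof -
  interpret prob_space "unif_sphere p" by (rule prob_space_sphere)
  let ?y = "\<lambda>i. (1/2) * x i"
  have y1: "dot p ?y ?y \<le> 1" unfolding ip_scale_left ip_scale_right using x by simp
  define G where "G d = real p * (dot p u d)\<^sup>2" for d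
  define Y where "Y d = real p * (dot p ?y d)\<^sup>2" for d
  define X where "X d = real p * (dot p x d)\<^sup>2" for d
  have XY: "X d = 4 * Y d" for d unfolding X_def Y_def ip_scale_left by (simp add: power2_eq_square)
  have th: "\<theta> > 0" using \<tau> \<theta> by simp
  let ?g = "\<lambda>d. 1 + \<theta> * (G d - 1) * X d + \<theta>\<^sup>2 * 8404992 * (exp (G d / 8) + exp (Y d / 8))"
  have tw: "trunc_weight p u \<tau> d = (if G d \<le> \<tau> then G d - 1 else 0)" for d
    by (simp add: trunc_weight_def G_def)
  have pw: "exp (\<theta> * trunc_weight p u \<tau> d * X d) \<le> ?g d" for d
    unfolding XY tw by (rule bulk_pointwise[OF _ _ \<tau> \<theta>]) (auto simp: G_def Y_def)
  have iG: "integrable (unif_sphere p) (\<lambda>d. exp (G d / 8))" "(\<integral>d. exp (G d / 8) \<partial>unif_sphere p) \<le> 18"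
    unfolding G_def using sphere_exp_square_integral[OF p, of u] u by auto
  have iY: "integrable (unif_sphere p) (\<lambda>d. exp (Y d / 8))" "(\<integral>d. exp (Y d / 8) \<partial>unif_sphere p) \<le> 18"
    unfolding Y_def using sphere_exp_square_integral[OF p y1] by auto
  have iGX: "integrable (unif_sphere p) (\<lambda>d. G d * X d)"
    "(\<integral>d. G d * X d \<partial>unif_sphere p) = (real p)\<^sup>2 * ((dot p u u * dot p x x + 2 * (dot p u x)\<^sup>2) / (real p * (real p + 2)))"
  proof -
    have e: "G d * X d = (real p)\<^sup>2 * ((dot p u d)\<^sup>2 * (dot p x d)\<^sup>2)" for d
      by (simp add: G_def X_def power2_eq_square)
    show "integrable (unif_sphere p) (\<lambda>d. G d * X d)"
      unfolding e by (intro integrable_mult_right integrable_sphere_prod[OF p])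
    show "(\<integral>d. G d * X d \<partial>unif_sphere p) = (real p)\<^sup>2 * ((dot p u u * dot p x x + 2 * (dot p u x)\<^sup>2) / (real p * (real p + 2)))"
      unfolding e by (simp only: integral_mult_right_zero sphere_fourth_moment[OF p])
  qed
  have iX: "integrable (unif_sphere p) X" "(\<integral>d. X d \<partial>unif_sphere p) = dot p x x"
    unfolding X_def using integrable_sphere_prod[OF p, of x 2 x 0] sphere_second_moment[OF p, of x] p by auto
  have mean: "(\<integral>d. (G d - 1) * X d \<partial>unif_sphere p) \<le> 2 * (dot p u x)\<^sup>2"
  proof -
    have "(\<integral>d. (G d - 1) * X d \<partial>unif_sphere p) = (\<integral>d. G d * X d - X d \<partial>unif_sphere p)" by (simp add: algebra_simps)
    also have "\<dots> = (\<integral>d. G d * X d \<partial>unif_sphere p) - (\<integral>d. X d \<partial>unif_sphere p)" using iGX iX by simp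
    also have "\<dots> = (real p)\<^sup>2 * ((dot p x x + 2 * (dot p u x)\<^sup>2) / (real p * (real p + 2))) - dot p x x"
      unfolding iGX(2) iX(2) u by simp
    also have "\<dots> = real p / (real p + 2) * (dot p x x + 2 * (dot p u x)\<^sup>2) - dot p x x"
      using p by (simp add: power2_eq_square)
    also have "\<dots> \<le> 1 * (dot p x x + 2 * (dot p u x)\<^sup>2) - dot p x x"
      by (intro diff_right_mono mult_right_mono add_nonneg_nonneg ip_self_nonneg) auto
    finally show ?thesis by simp
  qed
  have ig: "integrable (unif_sphere p) (\<lambda>d. (G d - 1) * X d)"
    using iGX(1) iX(1) by (simp add: algebra_simps)
  have "(\<integral>d. ?g d \<partial>unif_sphere p) = 1 + \<theta> * (\<integral>d. (G d - 1) * X d \<partial>unif_sphere p) + \<theta>\<^sup>2 * 8404992 * ((\<integral>d. exp (G d / 8) \<partial>unif_sphere p) + (\<integral>d. exp (Y d / 8) \<partial>unif_sphere p))"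
    using ig iG(1) iY(1) by (simp add: mult.assoc prob_space)
  also have "\<dots> \<le> 1 + \<theta> * (2 * (dot p u x)\<^sup>2) + \<theta>\<^sup>2 * 8404992 * (18 + 18)"
    using mean iG(2) iY(2) th by (intro add_mono mult_left_mono) auto
  also have "\<dots> = 1 + (2 * \<theta> * (dot p u x)\<^sup>2 + 302579712 * \<theta>\<^sup>2)" by simp
  also have "\<dots> \<le> exp (2 * \<theta> * (dot p u x)\<^sup>2 + 302579712 * \<theta>\<^sup>2)" by (rule exp_ge_add_one_self)
  finally have I: "(\<integral>d. ?g d \<partial>unif_sphere p) \<le> exp (2 * \<theta> * (dot p u x)\<^sup>2 + 302579712 * \<theta>\<^sup>2)" .
  have gi: "integrable (unif_sphere p) ?g"
    using ig iG(1) iY(1) by (simp add: mult.assoc)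
  have g0: "?g d \<ge> 0" for d using pw[of d] exp_ge_zero order_trans by blast
  let ?e = "exp (- (2 * \<theta> * (dot p u x)\<^sup>2))"
  have "(\<integral>\<^sup>+d. ennreal (exp (\<theta> * trunc_weight p u \<tau> d * (real p * (dot p x d)\<^sup>2) - 2 * \<theta> * (dot p u x)\<^sup>2)) \<partial>unif_sphere p)
    \<le> (\<integral>\<^sup>+d. ennreal (?e * ?g d) \<partial>unif_sphere p)"
  proof (intro nn_integral_mono ennreal_leI)
    fix d
    have "exp (\<theta> * trunc_weight p u \<tau> d * (real p * (dot p x d)\<^sup>2) - 2 * \<theta> * (dot p u x)\<^sup>2) = ?e * exp (\<theta> * trunc_weight p u \<tau> d * X d)"
      by (simp add: X_def exp_diff exp_minus field_simps)
    also have "\<dots> \<le> ?e * ?g d" by (intro mult_left_mono pw) auto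
    finally show "exp (\<theta> * trunc_weight p u \<tau> d * (real p * (dot p x d)\<^sup>2) - 2 * \<theta> * (dot p u x)\<^sup>2) \<le> ?e * ?g d" .
  qed
  also have "\<dots> = ennreal (\<integral>d. ?e * ?g d \<partial>unif_sphere p)"
    using g0 by (intro nn_integral_eq_integral integrable_mult_right gi) auto
  also have "(\<integral>d. ?e * ?g d \<partial>unif_sphere p) = ?e * (\<integral>d. ?g d \<partial>unif_sphere p)" by (rule integral_mult_right_zero)
  also have "\<dots> \<le> ?e * exp (2 * \<theta> * (dot p u x)\<^sup>2 + 302579712 * \<theta>\<^sup>2)" by (intro mult_left_mono I) auto
  also have "\<dots> = exp (302579712 * \<theta>\<^sup>2)" by (simp flip: exp_add)
  finally show ?thesis by (simp add: ennreal_leI)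
qed

text \<open>The form has weights of both signs and is not convex. As no weight is below -1, its
  value at a vector shorter than \<open>\<eta>\<close> is bounded below through the frame bound
  \<open>K\<close>, and averaging is applied with \<open>q\<close> lowered by this amount: hence the
  term with \<open>\<eta>^2\<close>. The logarithm is the volume ratio, multiplied by
  \<open>1 / \<theta> = 256 * \<tau>\<close>.\<close>

lemma sph_bulk:
  assumes p: "p \<ge> 1" and u: "dot p u u = 1" and \<tau>: "\<tau> \<ge> 1" and \<eta>: "0 < \<eta>" "\<eta> \<le> 1"
  obtains A where "A \<in> sets (sph p {..<k})" "emeasure (sph p {..<k}) A \<le> ennreal (exp (- real p))"
    "\<And>d x K. d \<in> space (sph p {..<k}) - A \<Longrightarrow> K \<ge> 0 \<Longrightarrow>
       (\<And>x. (\<Sum>l<k. (dot p x (d l))\<^sup>2) \<le> K * dot p x x) \<Longrightarrow>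
       (\<Sum>l<k. trunc_weight p u \<tau> (d l) * (dot p x (d l))\<^sup>2) \<le> 2 * real k / real p * (dot p u x)\<^sup>2 +
         (\<eta>\<^sup>2 * (K + 2 * real k / real p) + 1181952 * real k / (real p * \<tau>) + 256 * \<tau> * (1 + ln ((1 + \<eta>) / \<eta>))) * dot p x x"
proof -
  define \<theta> where "\<theta> = 1 / (256 * \<tau>)"
  have th: "\<theta> > 0" using \<tau> by (simp add: \<theta>_def)
  define Q where "Q d x = (\<Sum>l<k. \<theta> * trunc_weight p u \<tau> (d l) * (real p * (dot p x (d l))\<^sup>2) - 2 * \<theta> * (dot p u x)\<^sup>2)" for d x
  have meas: "(\<lambda>(d, x). Q d x) \<in> borel_measurable (sph p {..<k} \<Otimes>\<^sub>M leb {..<p})"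
    unfolding Q_def split_def
    by (intro borel_measurable_sum borel_measurable_diff borel_measurable_times borel_measurable_power
      borel_measurable_const measurable_dot_pair
      measurable_compose[OF measurable_compose[OF measurable_fst measurable_sph_component] measurable_trunc_weight]
      measurable_ip measurable_compose[OF measurable_snd measurable_component_leb]) auto
  define C where "C = exp (302579712 * \<theta>\<^sup>2 * real k)"
  have mgf: "(\<integral>\<^sup>+d. ennreal (exp (Q d x)) \<partial>sph p {..<k}) \<le> ennreal C" if "dot p x x < (1 + \<eta>)\<^sup>2" for x
  proof -
    have "(1 + \<eta>)\<^sup>2 \<le> 2\<^sup>2" using \<eta> by (intro power_mono) auto
    then have x: "dot p x x < 4" using that by simp
    have "(\<integral>\<^sup>+d. ennreal (exp (Q d x)) \<partial>sph p {..<k}) \<le> ennreal (exp (302579712 * \<theta>\<^sup>2)) ^ card {..<k}"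
      unfolding Q_def by (rule sph_mgf_sum[OF _ _ bulk_mgf[OF p u \<tau> \<theta>_def x]]) auto
    also have "\<dots> = ennreal C" by (simp add: C_def ennreal_power exp_power_real mult.commute)
    finally show ?thesis .
  qed
  show thesis
  proof (rule sup_by_averaging[OF prob_space_sph, of "{..<p}" \<eta> "C * exp (real p)" Q p "{..<k}" C])
    fix A assume A: "A \<in> sets (sph p {..<k})" "emeasure (sph p {..<k}) A \<le> ennreal (C / (C * exp (real p)))"
      and H: "\<And>d x0 q. d \<in> space (sph p {..<k}) - A \<Longrightarrow> dot p x0 x0 \<le> 1 \<Longrightarrow>
          (\<And>z. dot p z z < \<eta>\<^sup>2 \<Longrightarrow> 2 * q \<le> Q d (\<lambda>i\<in>{..<p}. x0 i + z i) + Q d (\<lambda>i\<in>{..<p}. x0 i - z i)) \<Longrightarrow>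
          exp q * \<eta> ^ card {..<p} \<le> C * exp (real p) * (1 + \<eta>) ^ card {..<p}"
    show thesis
    proof (rule that[OF A(1)])
      show "emeasure (sph p {..<k}) A \<le> ennreal (exp (- real p))" using A(2) by (simp add: C_def exp_minus field_simps)
      fix d x K assume d: "d \<in> space (sph p {..<k}) - A" and K: "K \<ge> 0" "\<And>x. (\<Sum>l<k. (dot p x (d l))\<^sup>2) \<le> K * dot p x x"
      let ?B = "\<eta>\<^sup>2 * (K + 2 * real k / real p) + 1181952 * real k / (real p * \<tau>) + 256 * \<tau> * (1 + ln ((1 + \<eta>) / \<eta>))"
      show "(\<Sum>l<k. trunc_weight p u \<tau> (d l) * (dot p x (d l))\<^sup>2) \<le> 2 * real k / real p * (dot p u x)\<^sup>2 + ?B * dot p x x"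
      proof (rule quad_scale)
        fix x assume x: "dot p x x = 1"
        define R where "R = (\<Sum>l<k. trunc_weight p u \<tau> (d l) * (dot p x (d l))\<^sup>2)"
        define w where "w l = \<theta> * trunc_weight p u \<tau> (d l) * real p" for l
        have Qw: "Q d y = (\<Sum>l<k. w l * (dot p y (d l))\<^sup>2) - 2 * \<theta> * real k * (dot p u y)\<^sup>2" for y
          by (simp add: Q_def w_def sum_subtractf algebra_simps)
        define q where "q = Q d x - \<theta> * \<eta>\<^sup>2 * (real p * K + 2 * real k)"
        have "exp q * \<eta> ^ card {..<p} \<le> C * exp (real p) * (1 + \<eta>) ^ card {..<p}"
        proof (rule H[OF d])
          fix z assume z: "dot p z z < \<eta>\<^sup>2"
          have e: "dot p u (\<lambda>i\<in>{..<p}. x i + z i) = dot p u x + dot p u z" "dot p u (\<lambda>i\<in>{..<p}. x i - z i) = dot p u x - dot p u z"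
            by (simp_all add: ip_add_right ip_diff_right)
          have "Q d (\<lambda>i\<in>{..<p}. x i + z i) + Q d (\<lambda>i\<in>{..<p}. x i - z i) = 2 * Q d x + 2 * Q d z"
            unfolding Qw ip_restrict_diff e
            by (simp add: power2_eq_square algebra_simps sum.distrib sum_subtractf flip: sum_distrib_left)
          moreover have "Q d z \<ge> - (\<theta> * \<eta>\<^sup>2 * (real p * K + 2 * real k))"
          proof -
            have "trunc_weight p u \<tau> (d l) \<ge> -1" for l by (simp add: trunc_weight_def)
            then have "w l \<ge> - (\<theta> * real p)" for l
              using th mult_left_mono[of "-1" "trunc_weight p u \<tau> (d l)" "\<theta> * real p"] by (simp add: w_def algebra_simps)
            then have "(\<Sum>l<k. w l * (dot p z (d l))\<^sup>2) \<ge> (\<Sum>l<k. - (\<theta> * real p) * (dot p z (d l))\<^sup>2)"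
              by (intro sum_mono mult_right_mono) auto
            also have "(\<Sum>l<k. - (\<theta> * real p) * (dot p z (d l))\<^sup>2) = - (\<theta> * real p) * (\<Sum>l<k. (dot p z (d l))\<^sup>2)"
              by (simp only: sum_distrib_left)
            finally have 1: "(\<Sum>l<k. w l * (dot p z (d l))\<^sup>2) \<ge> - (\<theta> * real p * (\<Sum>l<k. (dot p z (d l))\<^sup>2))" by simp
            have "(\<Sum>l<k. (dot p z (d l))\<^sup>2) \<le> K * \<eta>\<^sup>2"
              using K(2)[of z] mult_left_mono[OF less_imp_le[OF z] K(1)] by linarith
            then have 2: "\<theta> * real p * (\<Sum>l<k. (dot p z (d l))\<^sup>2) \<le> \<theta> * real p * (K * \<eta>\<^sup>2)"
              using th by (intro mult_left_mono) auto
            have "(dot p u z)\<^sup>2 \<le> \<eta>\<^sup>2" using ip_cauchy_schwarz[of "{..<p}" u z] u z by simp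
            then have 3: "2 * \<theta> * real k * (dot p u z)\<^sup>2 \<le> 2 * \<theta> * real k * \<eta>\<^sup>2"
              using th by (intro mult_left_mono) auto
            show ?thesis unfolding Qw using 1 2 3 by (simp add: algebra_simps)
          qed
          ultimately show "2 * q \<le> Q d (\<lambda>i\<in>{..<p}. x i + z i) + Q d (\<lambda>i\<in>{..<p}. x i - z i)"
            by (simp add: q_def)
        qed (simp add: x)
        then have "exp q \<le> C * exp (real p) * ((1 + \<eta>) ^ p / \<eta> ^ p)" using \<eta> by (simp add: pos_le_divide_eq)
        also have "(1 + \<eta>) ^ p / \<eta> ^ p = exp (ln ((1 + \<eta>) / \<eta>)) ^ p"
          using \<eta> by (simp add: power_divide)
        also have "C * exp (real p) * exp (ln ((1 + \<eta>) / \<eta>)) ^ p = exp (302579712 * \<theta>\<^sup>2 * real k + real p + real p * ln ((1 + \<eta>) / \<eta>))"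
          unfolding C_def by (simp only: exp_power_real exp_add)
        finally have "q \<le> 302579712 * \<theta>\<^sup>2 * real k + real p + real p * ln ((1 + \<eta>) / \<eta>)" by simp
        moreover have "Q d x = \<theta> * real p * R - 2 * \<theta> * real k * (dot p u x)\<^sup>2"
          unfolding Qw R_def w_def by (simp add: sum_distrib_left algebra_simps)
        ultimately have "\<theta> * real p * R \<le> 2 * \<theta> * real k * (dot p u x)\<^sup>2 + \<theta> * \<eta>\<^sup>2 * (real p * K + 2 * real k)
            + 302579712 * \<theta>\<^sup>2 * real k + real p + real p * ln ((1 + \<eta>) / \<eta>)"
          by (simp add: q_def)
        also have "\<dots> = \<theta> * real p * (2 * real k / real p * (dot p u x)\<^sup>2 + \<eta>\<^sup>2 * (K + 2 * real k / real p)
            + 302579712 * \<theta> * real k / real p + 1 / \<theta> * (1 + ln ((1 + \<eta>) / \<eta>)))"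
          using th p by (simp add: field_simps power2_eq_square)
        finally have "R \<le> 2 * real k / real p * (dot p u x)\<^sup>2 + \<eta>\<^sup>2 * (K + 2 * real k / real p)
            + 302579712 * \<theta> * real k / real p + 1 / \<theta> * (1 + ln ((1 + \<eta>) / \<eta>))"
          using th p by simp
        also have "302579712 * \<theta> * real k / real p = 1181952 * real k / (real p * \<tau>)" by (simp add: \<theta>_def)
        also have "1 / \<theta> = 256 * \<tau>" by (simp add: \<theta>_def)
        finally show "(\<Sum>l<k. trunc_weight p u \<tau> (d l) * (dot p x (d l))\<^sup>2) \<le> 2 * real k / real p * (dot p u x)\<^sup>2 + ?B"
          by (simp add: R_def)
      qed
    qed
  qed (use meas mgf \<eta> in \<open>auto simp: C_def\<close>)
qed

section \<open>Second moments of the centred Gram kernel\<close>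

lemma nn_integral_sph_insert_rev:
  assumes "finite I" "i \<notin> I" "f \<in> borel_measurable (sph p (insert i I))"
  shows "(\<integral>\<^sup>+d. f d \<partial>sph p (insert i I)) = (\<integral>\<^sup>+y. (\<integral>\<^sup>+d. f (d(i := y)) \<partial>sph p I) \<partial>unif_sphere p)"
  unfolding sph_def using assms
  by (intro product_sigma_finite.product_nn_integral_insert_rev product_sigma_finite_sphere) (auto simp: sph_def)

lemma nn_integral_sph_component:
  assumes "l \<in> I" "f \<in> borel_measurable (unif_sphere p)"
  shows "(\<integral>\<^sup>+d. f (d l) \<partial>sph p I) = (\<integral>\<^sup>+x. f x \<partial>unif_sphere p)"
proof -
  have "distr (sph p I) (unif_sphere p) (\<lambda>d. d l) = unif_sphere p"
    unfolding sph_def using assms(1) by (intro distr_PiM_component prob_space_sphere)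
  then have "(\<integral>\<^sup>+x. f x \<partial>unif_sphere p) = (\<integral>\<^sup>+x. f x \<partial>distr (sph p I) (unif_sphere p) (\<lambda>d. d l))" by simp
  also have "\<dots> = (\<integral>\<^sup>+d. f (d l) \<partial>sph p I)" using assms by (intro nn_integral_distr measurable_sph_component) simp_all
  finally show ?thesis ..
qed

lemma AE_sph_unit:
  assumes "p \<ge> 1" "finite I" shows "AE d in sph p I. \<forall>l\<in>I. dot p (d l) (d l) = 1"
  unfolding sph_def using assms
  by (intro AE_finite_allI AE_PiM_component[where P = "\<lambda>x. dot p x x = 1"] prob_space_sphere AE_sphere_unit)

text \<open>For unit vectors this is the Frobenius inner product of the traceless matrices
  \<open>x x^T - I / p\<close> and \<open>y y^T - I / p\<close>.\<close>

definition hh :: "nat \<Rightarrow> (nat \<Rightarrow> real) \<Rightarrow> (nat \<Rightarrow> real) \<Rightarrow> real" where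
  "hh p x y = (dot p x y)\<^sup>2 - 1 / real p"

text \<open>Eigenvalue of \<open>hh\<close> as an integral operator on the sphere, with the
  functions \<open>hh p x\<close> as eigenfunctions.\<close>

definition cc :: "nat \<Rightarrow> real" where "cc p = 2 / (real p * (real p + 2))"

lemma hh_commute: "hh p x y = hh p y x" by (simp add: hh_def ip_commute)

lemma cc_nonneg: "cc p \<ge> 0" by (simp add: cc_def)

lemma measurable_hh [measurable (raw)]:
  assumes "\<And>i. i < p \<Longrightarrow> (\<lambda>x. f x i) \<in> borel_measurable M" "\<And>i. i < p \<Longrightarrow> (\<lambda>x. g x i) \<in> borel_measurable M"
  shows "(\<lambda>x. hh p (f x) (g x)) \<in> borel_measurable M"
  unfolding hh_def using assms by (intro borel_measurable_diff borel_measurable_power measurable_ip) auto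

lemma hh_bound: "dot p x x = 1 \<Longrightarrow> dot p y y = 1 \<Longrightarrow> p \<ge> 1 \<Longrightarrow> \<bar>hh p x y\<bar> \<le> 1"
proof -
  assume a: "dot p x x = 1" "dot p y y = 1" "p \<ge> 1"
  have "(dot p x y)\<^sup>2 \<le> 1" using ip_cauchy_schwarz[of "{..<p}" x y] a by simp
  moreover have "0 \<le> 1 / real p" "1 / real p \<le> 1" using a by auto
  ultimately show ?thesis unfolding hh_def using zero_le_power2[of "dot p x y"] by linarith
qed

lemma integrable_hh_mult:
  assumes p: "p \<ge> 1" and x: "dot p x x = 1" "dot p y y = 1"
  shows "integrable (unif_sphere p) (\<lambda>d. hh p x d ^ m * hh p y d ^ n)"
proof (rule sphere_integrable[OF p, where c = 1])
  show "\<bar>hh p x d ^ m * hh p y d ^ n\<bar> \<le> 1" if "dot p d d = 1" for d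
    using hh_bound[OF x(1) that p] hh_bound[OF x(2) that p] by (simp add: abs_mult power_abs mult_le_one power_le_one)
qed measurable

lemma integral_hh:
  assumes p: "p \<ge> 1" and x: "dot p x x = 1" shows "(\<integral>d. hh p x d \<partial>unif_sphere p) = 0"
proof -
  interpret prob_space "unif_sphere p" by (rule prob_space_sphere)
  have "integrable (unif_sphere p) (\<lambda>d. (dot p x d)\<^sup>2)" using integrable_sphere_prod[OF p, of x 2 x 0] by simp
  then have "(\<integral>d. hh p x d \<partial>unif_sphere p) = (\<integral>d. (dot p x d)\<^sup>2 \<partial>unif_sphere p) - (\<integral>d. 1 / real p \<partial>unif_sphere p)"
    unfolding hh_def by (intro Bochner_Integration.integral_diff) auto
  then show ?thesis using sphere_second_moment[OF p, of x] x prob_space by simp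
qed

lemma integral_hh_mult:
  assumes p: "p \<ge> 1" and x: "dot p x x = 1" "dot p y y = 1"
  shows "(\<integral>d. hh p x d * hh p y d \<partial>unif_sphere p) = cc p * hh p x y"
proof -
  interpret prob_space "unif_sphere p" by (rule prob_space_sphere)
  have i: "integrable (unif_sphere p) (\<lambda>d. (dot p x d)\<^sup>2)" "integrable (unif_sphere p) (\<lambda>d. (dot p y d)\<^sup>2)"
     "integrable (unif_sphere p) (\<lambda>d. (dot p x d)\<^sup>2 * (dot p y d)\<^sup>2)"
    using integrable_sphere_prod[OF p, of x 2 x 0] integrable_sphere_prod[OF p, of y 2 x 0] integrable_sphere_prod[OF p, of x 2 y 2] by auto
  have "(\<integral>d. hh p x d * hh p y d \<partial>unif_sphere p)
    = (\<integral>d. (dot p x d)\<^sup>2 * (dot p y d)\<^sup>2 - (dot p x d)\<^sup>2 * (1 / real p) - (dot p y d)\<^sup>2 * (1 / real p) + 1 / (real p)\<^sup>2 \<partial>unif_sphere p)"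
    unfolding hh_def by (intro Bochner_Integration.integral_cong) (auto simp: algebra_simps power2_eq_square)
  also have "\<dots> = (1 + 2 * (dot p x y)\<^sup>2) / (real p * (real p + 2)) - 1 / real p * (1 / real p) - 1 / real p * (1 / real p) + 1 / (real p)\<^sup>2"
    using i sphere_second_moment[OF p] sphere_fourth_moment[OF p, of x y] x prob_space by simp
  also have "\<dots> = cc p * hh p x y"
  proof -
    define P where "P = real p"
    have P: "P > 0" "P + 2 > 0" using p by (auto simp: P_def)
    have "(1 + 2 * t) / (P * (P + 2)) - 1 / P * (1 / P) - 1 / P * (1 / P) + 1 / P\<^sup>2 = 2 / (P * (P + 2)) * (t - 1 / P)" for t
      using P by (simp add: divide_simps) (simp add: algebra_simps power2_eq_square)
    then show ?thesis unfolding cc_def hh_def P_def .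
  qed
  finally show ?thesis .
qed

lemma integral_hh_sq_le:
  assumes p: "p \<ge> 1" and x: "dot p x x = 1"
  shows "(\<integral>d. (hh p x d)\<^sup>2 \<partial>unif_sphere p) \<le> cc p"
proof -
  have "(\<integral>d. (hh p x d)\<^sup>2 \<partial>unif_sphere p) = cc p * hh p x x"
    using integral_hh_mult[OF p x x] by (simp add: power2_eq_square)
  also have "\<dots> \<le> cc p * 1" using hh_bound[OF x x p] cc_nonneg[of p] by (intro mult_left_mono) auto
  finally show ?thesis by simp
qed

lemma nn_integral_hh_sq_le:
  assumes p: "p \<ge> 1" and x: "dot p x x = 1"
  shows "(\<integral>\<^sup>+d. ennreal ((hh p x d)\<^sup>2) \<partial>unif_sphere p) \<le> ennreal (cc p)"
proof -
  have "integrable (unif_sphere p) (\<lambda>d. (hh p x d)\<^sup>2)" using integrable_hh_mult[OF p x x, of 2 0] by simp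
  then show ?thesis using integral_hh_sq_le[OF p x] by (subst nn_integral_eq_integral) (auto intro: ennreal_leI)
qed

text \<open>The shift \<open>a\<close> is general because integrating out one vector replaces it by
  \<open>a + \<mu>\<close>, at the cost of one further \<open>s\<close>.\<close>

lemma iid_sum_square:
  assumes \<xi>: "integrable (unif_sphere p) \<xi>" "integrable (unif_sphere p) (\<lambda>d. (\<xi> d)\<^sup>2)" and J: "finite J"
    and \<mu>: "\<mu> = (\<integral>d. \<xi> d \<partial>unif_sphere p)" and s: "s = (\<integral>d. (\<xi> d)\<^sup>2 \<partial>unif_sphere p)"
  shows "(\<integral>\<^sup>+d. ennreal ((a + (\<Sum>l\<in>J. \<xi> (d l)))\<^sup>2) \<partial>sph p J) \<le> ennreal ((a + real (card J) * \<mu>)\<^sup>2 + real (card J) * s)"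
  using J
proof (induction J arbitrary: a rule: finite_induct)
  case empty
  interpret prob_space "sph p {}" by (rule prob_space_sph)
  show ?case by (simp add: emeasure_space_1)
next
  case (insert i J)
  interpret prob_space "unif_sphere p" by (rule prob_space_sphere)
  have [measurable]: "\<xi> \<in> borel_measurable (unif_sphere p)" using \<xi>(1) by auto
  have fm: "(\<lambda>d. ennreal ((a + (\<Sum>l\<in>I. \<xi> (d l)))\<^sup>2)) \<in> borel_measurable (sph p I)" for I a by measurable
  have s0: "s \<ge> 0" by (simp add: s)
  have inner: "(\<integral>\<^sup>+y. ennreal ((b + \<xi> y)\<^sup>2) \<partial>unif_sphere p) \<le> ennreal ((b + \<mu>)\<^sup>2) + ennreal s" for b
  proof -
    have e: "(b + \<xi> y)\<^sup>2 = b\<^sup>2 + 2 * b * \<xi> y + (\<xi> y)\<^sup>2" for y by (simp add: power2_eq_square algebra_simps)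
    have "(\<integral>\<^sup>+y. ennreal ((b + \<xi> y)\<^sup>2) \<partial>unif_sphere p) = ennreal (\<integral>y. (b + \<xi> y)\<^sup>2 \<partial>unif_sphere p)"
    proof (rule nn_integral_eq_integral)
      show "integrable (unif_sphere p) (\<lambda>y. (b + \<xi> y)\<^sup>2)" unfolding e
        using \<xi> by (intro Bochner_Integration.integrable_add integrable_mult_right) auto
    qed auto
    also have "(\<integral>y. (b + \<xi> y)\<^sup>2 \<partial>unif_sphere p) = b\<^sup>2 + 2 * b * \<mu> + s"
      unfolding e using \<xi> by (simp add: \<mu> s prob_space)
    also have "\<dots> \<le> (b + \<mu>)\<^sup>2 + s" by (simp add: power2_eq_square algebra_simps)
    finally show ?thesis using s0 by (simp add: ennreal_leI flip: ennreal_plus)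
  qed
  have "(\<integral>\<^sup>+d. ennreal ((a + (\<Sum>l\<in>insert i J. \<xi> (d l)))\<^sup>2) \<partial>sph p (insert i J))
    = (\<integral>\<^sup>+d. (\<integral>\<^sup>+y. ennreal ((a + (\<Sum>l\<in>insert i J. \<xi> ((d(i := y)) l)))\<^sup>2) \<partial>unif_sphere p) \<partial>sph p J)"
    using insert.hyps by (intro nn_integral_sph_insert fm)
  also have "\<dots> = (\<integral>\<^sup>+d. (\<integral>\<^sup>+y. ennreal (((a + (\<Sum>l\<in>J. \<xi> (d l))) + \<xi> y)\<^sup>2) \<partial>unif_sphere p) \<partial>sph p J)"
  proof (intro nn_integral_cong)
    fix d y
    have "(\<Sum>l\<in>J. \<xi> ((d(i := y)) l)) = (\<Sum>l\<in>J. \<xi> (d l))" using insert.hyps by (intro sum.cong) auto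
    then show "ennreal ((a + (\<Sum>l\<in>insert i J. \<xi> ((d(i := y)) l)))\<^sup>2) = ennreal (((a + (\<Sum>l\<in>J. \<xi> (d l))) + \<xi> y)\<^sup>2)"
      using insert.hyps by (simp add: algebra_simps)
  qed
  also have "\<dots> \<le> (\<integral>\<^sup>+d. ennreal (((a + \<mu>) + (\<Sum>l\<in>J. \<xi> (d l)))\<^sup>2) + ennreal s \<partial>sph p J)"
  proof (intro nn_integral_mono)
    fix d
    show "(\<integral>\<^sup>+y. ennreal (((a + (\<Sum>l\<in>J. \<xi> (d l))) + \<xi> y)\<^sup>2) \<partial>unif_sphere p) \<le> ennreal (((a + \<mu>) + (\<Sum>l\<in>J. \<xi> (d l)))\<^sup>2) + ennreal s"
      using inner[of "a + (\<Sum>l\<in>J. \<xi> (d l))"] by (simp add: ac_simps)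
  qed
  also have "\<dots> = (\<integral>\<^sup>+d. ennreal (((a + \<mu>) + (\<Sum>l\<in>J. \<xi> (d l)))\<^sup>2) \<partial>sph p J) + ennreal s"
    using prob_space.emeasure_space_1[OF prob_space_sph, of p J] by (subst nn_integral_add[OF fm]) auto
  also have "\<dots> \<le> ennreal (((a + \<mu>) + real (card J) * \<mu>)\<^sup>2 + real (card J) * s) + ennreal s"
    by (intro add_right_mono insert.IH)
  also have "\<dots> = ennreal ((a + real (card (insert i J)) * \<mu>)\<^sup>2 + real (card (insert i J)) * s)"
    using insert.hyps s0 by (simp add: algebra_simps flip: ennreal_plus)
  finally show ?case .
qed

text \<open>The fourth moment formula makes \<open>hh\<close> self-reproducing: \<open>E hh(x,d) hh(d,y) = cc \<cdot> hh(x,y)\<close>.\<close>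
lemma path_square_moment:
  assumes p: "p \<ge> 1" and J: "finite J" "m \<notin> J" and u: "dot p u u = 1"
  shows "(\<integral>\<^sup>+d. ennreal ((\<Sum>l\<in>J. hh p u (d l) * hh p (d l) (d m))\<^sup>2) \<partial>sph p (insert m J))
    \<le> ennreal (real (card J) * (cc p)\<^sup>2 + (real (card J))\<^sup>2 * (cc p)^3)"
proof -
  let ?n = "real (card J)" and ?M = "unif_sphere p"
  interpret prob_space ?M by (rule prob_space_sphere)
  interpret PP: pair_sigma_finite ?M ?M ..
  have fm: "(\<lambda>d. ennreal ((\<Sum>l\<in>J. hh p u (d l) * hh p (d l) (d m))\<^sup>2)) \<in> borel_measurable (sph p (insert m J))"
    by measurable
  define s where "s y = (\<integral>d. (hh p u d * hh p d y)\<^sup>2 \<partial>?M)" for y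
  have "(\<integral>\<^sup>+d. ennreal ((\<Sum>l\<in>J. hh p u (d l) * hh p (d l) (d m))\<^sup>2) \<partial>sph p (insert m J))
    = (\<integral>\<^sup>+y. (\<integral>\<^sup>+d. ennreal ((\<Sum>l\<in>J. hh p u ((d(m := y)) l) * hh p ((d(m := y)) l) ((d(m := y)) m))\<^sup>2) \<partial>sph p J) \<partial>?M)"
    using J by (intro nn_integral_sph_insert_rev fm)
  also have "\<dots> = (\<integral>\<^sup>+y. (\<integral>\<^sup>+d. ennreal ((0 + (\<Sum>l\<in>J. hh p u (d l) * hh p (d l) y))\<^sup>2) \<partial>sph p J) \<partial>?M)"
  proof (intro nn_integral_cong)
    fix y d
    have "(\<Sum>l\<in>J. hh p u ((d(m := y)) l) * hh p ((d(m := y)) l) ((d(m := y)) m)) = (\<Sum>l\<in>J. hh p u (d l) * hh p (d l) y)"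
      using J by (intro sum.cong) auto
    then show "ennreal ((\<Sum>l\<in>J. hh p u ((d(m := y)) l) * hh p ((d(m := y)) l) ((d(m := y)) m))\<^sup>2) = ennreal ((0 + (\<Sum>l\<in>J. hh p u (d l) * hh p (d l) y))\<^sup>2)"
      by simp
  qed
  \<comment> \<open>For fixed \<open>y\<close> the summands are independent with common mean
    \<open>cc p * hh p u y\<close>, which gives a squared mean plus second moments. The second
    moments are afterwards integrated over \<open>y\<close> first, where each integral is at most
    \<open>cc p\<close>.\<close>
  also have "\<dots> \<le> (\<integral>\<^sup>+y. ennreal (?n\<^sup>2 * (cc p)\<^sup>2) * ennreal ((hh p u y)\<^sup>2) + ennreal ?n * (\<integral>\<^sup>+d. ennreal ((hh p u d)\<^sup>2 * (hh p d y)\<^sup>2) \<partial>?M) \<partial>?M)"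
  proof (rule nn_integral_mono_AE)
    show "AE y in ?M. (\<integral>\<^sup>+d. ennreal ((0 + (\<Sum>l\<in>J. hh p u (d l) * hh p (d l) y))\<^sup>2) \<partial>sph p J)
      \<le> ennreal (?n\<^sup>2 * (cc p)\<^sup>2) * ennreal ((hh p u y)\<^sup>2) + ennreal ?n * (\<integral>\<^sup>+d. ennreal ((hh p u d)\<^sup>2 * (hh p d y)\<^sup>2) \<partial>?M)"
      using AE_sphere_unit[OF p]
    proof eventually_elim
      case (elim y)
      have i1: "integrable ?M (\<lambda>d. hh p u d * hh p d y)"
        using integrable_hh_mult[OF p u elim, of 1 1] by (simp add: hh_commute[of p _ y])
      have i2: "integrable ?M (\<lambda>d. (hh p u d * hh p d y)\<^sup>2)"
        using integrable_hh_mult[OF p u elim, of 2 2] by (simp add: hh_commute[of p _ y] power_mult_distrib)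
      have mu: "cc p * hh p u y = (\<integral>d. hh p u d * hh p d y \<partial>?M)"
        using integral_hh_mult[OF p u elim] by (simp add: hh_commute[of p _ y])
      have "(\<integral>\<^sup>+d. ennreal ((0 + (\<Sum>l\<in>J. hh p u (d l) * hh p (d l) y))\<^sup>2) \<partial>sph p J)
         \<le> ennreal ((0 + ?n * (cc p * hh p u y))\<^sup>2 + ?n * s y)"
        using iid_sum_square[OF i1 i2 J(1) mu refl, of 0] by (simp add: s_def)
      also have "\<dots> = ennreal (?n\<^sup>2 * (cc p)\<^sup>2) * ennreal ((hh p u y)\<^sup>2) + ennreal ?n * ennreal (s y)"
        by (subst ennreal_plus) (auto simp: s_def power_mult_distrib mult.assoc simp flip: ennreal_mult)
      also have "ennreal (s y) = (\<integral>\<^sup>+d. ennreal ((hh p u d)\<^sup>2 * (hh p d y)\<^sup>2) \<partial>?M)"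
        unfolding s_def using i2 by (subst nn_integral_eq_integral[symmetric]) (auto simp: power_mult_distrib)
      finally show ?case .
    qed
  qed
  also have "\<dots> = ennreal (?n\<^sup>2 * (cc p)\<^sup>2) * (\<integral>\<^sup>+y. ennreal ((hh p u y)\<^sup>2) \<partial>?M) + ennreal ?n * (\<integral>\<^sup>+y. (\<integral>\<^sup>+d. ennreal ((hh p u d)\<^sup>2 * (hh p d y)\<^sup>2) \<partial>?M) \<partial>?M)"
    by (subst nn_integral_add; (subst nn_integral_cmult)?) (measurable, auto intro!: nn_integral_cmult)
  also have "(\<integral>\<^sup>+y. (\<integral>\<^sup>+d. ennreal ((hh p u d)\<^sup>2 * (hh p d y)\<^sup>2) \<partial>?M) \<partial>?M) = (\<integral>\<^sup>+d. (\<integral>\<^sup>+y. ennreal ((hh p u d)\<^sup>2 * (hh p d y)\<^sup>2) \<partial>?M) \<partial>?M)"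
    by (rule PP.Fubini') measurable
  also have "\<dots> \<le> (\<integral>\<^sup>+d. ennreal ((hh p u d)\<^sup>2) * ennreal (cc p) \<partial>?M)"
  proof (rule nn_integral_mono_AE)
    show "AE d in ?M. (\<integral>\<^sup>+y. ennreal ((hh p u d)\<^sup>2 * (hh p d y)\<^sup>2) \<partial>?M) \<le> ennreal ((hh p u d)\<^sup>2) * ennreal (cc p)"
      using AE_sphere_unit[OF p]
    proof eventually_elim
      case (elim d)
      have "(\<integral>\<^sup>+y. ennreal ((hh p u d)\<^sup>2 * (hh p d y)\<^sup>2) \<partial>?M) = ennreal ((hh p u d)\<^sup>2) * (\<integral>\<^sup>+y. ennreal ((hh p d y)\<^sup>2) \<partial>?M)"
        by (simp add: ennreal_mult nn_integral_cmult)
      then show ?case using nn_integral_hh_sq_le[OF p elim] by (simp add: mult_left_mono)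
    qed
  qed
  also have "\<dots> = (\<integral>\<^sup>+d. ennreal ((hh p u d)\<^sup>2) \<partial>?M) * ennreal (cc p)" by (rule nn_integral_multc) measurable
  finally have "(\<integral>\<^sup>+d. ennreal ((\<Sum>l\<in>J. hh p u (d l) * hh p (d l) (d m))\<^sup>2) \<partial>sph p (insert m J))
    \<le> ennreal (?n\<^sup>2 * (cc p)\<^sup>2) * (\<integral>\<^sup>+y. ennreal ((hh p u y)\<^sup>2) \<partial>?M) + ennreal ?n * ((\<integral>\<^sup>+d. ennreal ((hh p u d)\<^sup>2) \<partial>?M) * ennreal (cc p))"
    by (simp add: add_left_mono mult_left_mono)
  also have "\<dots> \<le> ennreal (?n\<^sup>2 * (cc p)\<^sup>2) * ennreal (cc p) + ennreal ?n * (ennreal (cc p) * ennreal (cc p))"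
    by (intro add_mono mult_left_mono mult_right_mono nn_integral_hh_sq_le p u) auto
  also have "\<dots> = ennreal (?n * (cc p)\<^sup>2 + ?n\<^sup>2 * (cc p)^3)"
    using cc_nonneg[of p] by (simp add: power2_eq_square power3_eq_cube algebra_simps flip: ennreal_mult ennreal_plus)
  finally show ?thesis .
qed

section \<open>Estimates from Markov's inequality and union bounds\<close>

lemma markov_real:
  assumes M: "prob_space M" and f [measurable]: "f \<in> borel_measurable M" and C: "(\<integral>\<^sup>+d. ennreal (f d) \<partial>M) \<le> ennreal C" and t: "t > 0" and C0: "C \<ge> 0"
  obtains A where "A \<in> sets M" "emeasure M A \<le> ennreal (C / t)" "\<And>d. d \<in> space M - A \<Longrightarrow> f d \<le> t"
proof (rule that[of "{d \<in> space M. 1 \<le> ennreal (1/t) * ennreal (f d)}"])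
  show "{d \<in> space M. 1 \<le> ennreal (1/t) * ennreal (f d)} \<in> sets M" by measurable
  have "emeasure M {d \<in> space M. 1 \<le> ennreal (1/t) * ennreal (f d)} \<le> ennreal (1/t) * (\<integral>\<^sup>+d. ennreal (f d) * indicator (space M) d \<partial>M)"
    by (rule nn_integral_Markov_inequality) measurable
  also have "(\<integral>\<^sup>+d. ennreal (f d) * indicator (space M) d \<partial>M) = (\<integral>\<^sup>+d. ennreal (f d) \<partial>M)" by (intro nn_integral_cong) auto
  also have "ennreal (1/t) * \<dots> \<le> ennreal (1/t) * ennreal C" by (intro mult_left_mono C) auto
  also have "\<dots> = ennreal (C / t)" using t C0 by (simp flip: ennreal_mult)
  finally show "emeasure M {d \<in> space M. 1 \<le> ennreal (1/t) * ennreal (f d)} \<le> ennreal (C / t)" .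
  fix d assume d: "d \<in> space M - {d \<in> space M. 1 \<le> ennreal (1/t) * ennreal (f d)}"
  show "f d \<le> t"
  proof (rule ccontr)
    assume "\<not> f d \<le> t"
    then have "1 \<le> 1 / t * f d" "f d > 0" using t by (auto simp: field_simps)
    then have "ennreal 1 \<le> ennreal (1/t * f d)" by (intro ennreal_leI)
    then have "1 \<le> ennreal (1/t) * ennreal (f d)" using t \<open>f d > 0\<close> by (subst ennreal_mult[symmetric]) auto
    then show False using d by auto
  qed
qed

text \<open>The off-diagonal kernel matrix applied to the vector of weights
  \<open>hh p u (d l)\<close>: the first-order error when the quadratic form of \<open>W\<close> is
  replaced by its weights.\<close>

definition evec :: "nat \<Rightarrow> nat \<Rightarrow> (nat \<Rightarrow> real) \<Rightarrow> (nat \<Rightarrow> nat \<Rightarrow> real) \<Rightarrow> nat \<Rightarrow> real" where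
  "evec p k u d m = (\<Sum>l\<in>{..<k} - {m}. hh p u (d l) * hh p (d l) (d m))"

lemma sph_evec:
  assumes p: "p \<ge> 1" and u: "dot p u u = 1" and t: "t > 0"
  obtains A where "A \<in> sets (sph p {..<k})" "emeasure (sph p {..<k}) A \<le> ennreal (real k * (real k * (cc p)\<^sup>2 + (real k)\<^sup>2 * (cc p)^3) / t)"
    "\<And>d. d \<in> space (sph p {..<k}) - A \<Longrightarrow> (\<Sum>m<k. (evec p k u d m)\<^sup>2) \<le> t"
proof (rule markov_real[OF prob_space_sph, of "\<lambda>d. \<Sum>m<k. (evec p k u d m)\<^sup>2" p "{..<k}"])
  show "(\<lambda>d. \<Sum>m<k. (evec p k u d m)\<^sup>2) \<in> borel_measurable (sph p {..<k})" unfolding evec_def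
    by (intro borel_measurable_sum borel_measurable_power borel_measurable_times measurable_hh measurable_sph_component2 borel_measurable_const) auto
  have em: "(\<lambda>d. ennreal ((evec p k u d m)\<^sup>2)) \<in> borel_measurable (sph p {..<k})" if "m < k" for m using that unfolding evec_def
    by (intro measurable_compose[OF _ measurable_ennreal] borel_measurable_sum borel_measurable_power borel_measurable_times measurable_hh measurable_sph_component2 borel_measurable_const) auto
  have c0: "cc p \<ge> 0" by (rule cc_nonneg)
  have "(\<integral>\<^sup>+d. ennreal (\<Sum>m<k. (evec p k u d m)\<^sup>2) \<partial>sph p {..<k}) = (\<Sum>m<k. (\<integral>\<^sup>+d. ennreal ((evec p k u d m)\<^sup>2) \<partial>sph p {..<k}))"
    using em by (subst nn_integral_sum[symmetric]) (auto simp: sum_ennreal)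
  also have "\<dots> \<le> (\<Sum>m<k. ennreal (real k * (cc p)\<^sup>2 + (real k)\<^sup>2 * (cc p)^3))"
  proof (rule sum_mono)
    fix m assume "m \<in> {..<k}"
    then have e: "insert m ({..<k} - {m}) = {..<k}" by auto
    have "(\<integral>\<^sup>+d. ennreal ((evec p k u d m)\<^sup>2) \<partial>sph p {..<k}) \<le> ennreal (real (card ({..<k} - {m})) * (cc p)\<^sup>2 + (real (card ({..<k} - {m})))\<^sup>2 * (cc p)^3)"
      using path_square_moment[OF p _ _ u, of "{..<k} - {m}" m] unfolding e evec_def by simp
    also have "\<dots> \<le> ennreal (real k * (cc p)\<^sup>2 + (real k)\<^sup>2 * (cc p)^3)"
      using c0 card_mono[of "{..<k}" "{..<k} - {m}"] by (intro ennreal_leI add_mono mult_right_mono power_mono) auto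
    finally show "(\<integral>\<^sup>+d. ennreal ((evec p k u d m)\<^sup>2) \<partial>sph p {..<k}) \<le> ennreal (real k * (cc p)\<^sup>2 + (real k)\<^sup>2 * (cc p)^3)" .
  qed
  also have "\<dots> = ennreal (real k * (real k * (cc p)\<^sup>2 + (real k)\<^sup>2 * (cc p)^3))"
    using c0 by (simp add: ennreal_mult ennreal_of_nat_eq_real_of_nat)
  finally show "(\<integral>\<^sup>+d. ennreal (\<Sum>m<k. (evec p k u d m)\<^sup>2) \<partial>sph p {..<k}) \<le> ennreal (real k * (real k * (cc p)\<^sup>2 + (real k)\<^sup>2 * (cc p)^3))" .
  show "0 \<le> real k * (real k * (cc p)\<^sup>2 + (real k)\<^sup>2 * (cc p)^3)" using c0 by simp
qed (use t that in blast)+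

text \<open>The square of the kernel matrix is examined because its off-diagonal part has small
  Hilbert-Schmidt norm, whereas the Hilbert-Schmidt norm of the matrix itself is of order
  \<open>k / p\<close>, which is not small.\<close>

definition mvec :: "nat \<Rightarrow> nat \<Rightarrow> (nat \<Rightarrow> nat \<Rightarrow> real) \<Rightarrow> nat \<Rightarrow> nat \<Rightarrow> real" where
  "mvec p k d l n = (\<Sum>m\<in>{..<k} - {l, n}. hh p (d l) (d m) * hh p (d m) (d n))"

lemma sph_mvec:
  assumes p: "p \<ge> 1" and t: "t > 0"
  obtains A where "A \<in> sets (sph p {..<k})" "emeasure (sph p {..<k}) A \<le> ennreal ((real k)\<^sup>2 * (real k * (cc p)\<^sup>2 + (real k)\<^sup>2 * (cc p)^3) / t)"
    "\<And>d. d \<in> space (sph p {..<k}) - A \<Longrightarrow> (\<Sum>(l, n)\<in>{..<k} \<times> {..<k} - Id. (mvec p k d l n)\<^sup>2) \<le> t"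
proof (rule markov_real[OF prob_space_sph, of "\<lambda>d. \<Sum>(l, n)\<in>{..<k} \<times> {..<k} - Id. (mvec p k d l n)\<^sup>2" p "{..<k}"])
  let ?S = "{..<k} \<times> {..<k} - Id" and ?B = "real k * (cc p)\<^sup>2 + (real k)\<^sup>2 * (cc p)^3"
  have mm: "(\<lambda>d. (mvec p k d l n)\<^sup>2) \<in> borel_measurable (sph p {..<k})" if "l < k" "n < k" for l n using that unfolding mvec_def
    by (intro borel_measurable_sum borel_measurable_power borel_measurable_times measurable_hh measurable_sph_component2) auto
  show "(\<lambda>d. \<Sum>(l, n)\<in>?S. (mvec p k d l n)\<^sup>2) \<in> borel_measurable (sph p {..<k})" using mm by (intro borel_measurable_sum) auto
  have c0: "cc p \<ge> 0" by (rule cc_nonneg)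
  have "(\<integral>\<^sup>+d. ennreal (\<Sum>(l, n)\<in>?S. (mvec p k d l n)\<^sup>2) \<partial>sph p {..<k}) = (\<integral>\<^sup>+d. (\<Sum>(l, n)\<in>?S. ennreal ((mvec p k d l n)\<^sup>2)) \<partial>sph p {..<k})"
    by (simp add: split_def sum_ennreal)
  also have "\<dots> = (\<Sum>(l, n)\<in>?S. (\<integral>\<^sup>+d. ennreal ((mvec p k d l n)\<^sup>2) \<partial>sph p {..<k}))"
    unfolding split_def using mm by (intro nn_integral_sum measurable_compose[OF _ measurable_ennreal]) auto
  also have "\<dots> \<le> (\<Sum>(l, n)\<in>?S. ennreal ?B)"
  proof (rule sum_mono)
    fix x assume "x \<in> ?S"
    then obtain l n where x: "x = (l, n)" and ln: "l < k" "n < k" "(l, n) \<notin> Id" by auto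
    define J where "J = {..<k} - {l, n}"
    have e: "insert l (insert n J) = {..<k}" "l \<notin> insert n J" "finite (insert n J)" "n \<notin> J" using ln by (auto simp: J_def)
    have cJ: "card J \<le> k" using card_mono[of "{..<k}" J] by (auto simp: J_def)
    have fm: "(\<lambda>d. ennreal ((mvec p k d l n)\<^sup>2)) \<in> borel_measurable (sph p (insert l (insert n J)))" using mm ln e(1) by simp
    have "(\<integral>\<^sup>+d. ennreal ((mvec p k d l n)\<^sup>2) \<partial>sph p {..<k}) = (\<integral>\<^sup>+x. (\<integral>\<^sup>+d. ennreal ((mvec p k (d(l := x)) l n)\<^sup>2) \<partial>sph p (insert n J)) \<partial>unif_sphere p)"
      unfolding e(1)[symmetric] using e by (intro nn_integral_sph_insert_rev fm)
    also have "\<dots> \<le> (\<integral>\<^sup>+x. ennreal ?B \<partial>unif_sphere p)"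
    proof (rule nn_integral_mono_AE)
      show "AE x in unif_sphere p. (\<integral>\<^sup>+d. ennreal ((mvec p k (d(l := x)) l n)\<^sup>2) \<partial>sph p (insert n J)) \<le> ennreal ?B"
        using AE_sphere_unit[OF p]
      proof eventually_elim
        case (elim x)
        have "mvec p k (d(l := x)) l n = (\<Sum>m\<in>J. hh p x (d m) * hh p (d m) (d n))" for d
          unfolding mvec_def J_def[symmetric] using ln by (intro sum.cong) (auto simp: J_def)
        then have "(\<integral>\<^sup>+d. ennreal ((mvec p k (d(l := x)) l n)\<^sup>2) \<partial>sph p (insert n J)) \<le> ennreal (real (card J) * (cc p)\<^sup>2 + (real (card J))\<^sup>2 * (cc p)^3)"
          using path_square_moment[OF p _ e(4) elim] by (simp add: J_def)
        also have "\<dots> \<le> ennreal ?B" using c0 cJ by (intro ennreal_leI add_mono mult_right_mono power_mono) auto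
        finally show ?case .
      qed
    qed
    also have "\<dots> = ennreal ?B" using prob_space.emeasure_space_1[OF prob_space_sphere, of p] by simp
    finally show "(case x of (l, n) \<Rightarrow> (\<integral>\<^sup>+d. ennreal ((mvec p k d l n)\<^sup>2) \<partial>sph p {..<k})) \<le> (case x of (l, n) \<Rightarrow> ennreal ?B)"
      by (simp add: x)
  qed
  also have "\<dots> = ennreal (real (card ?S) * ?B)"
    using c0 by (simp add: ennreal_mult ennreal_of_nat_eq_real_of_nat split_def)
  also have "\<dots> \<le> ennreal ((real k)\<^sup>2 * ?B)"
  proof (intro ennreal_leI mult_right_mono)
    have "card ?S \<le> card ({..<k} \<times> {..<k})" by (intro card_mono) auto
    then have "card ?S \<le> k^2" by (simp add: power2_eq_square)
    then show "real (card ?S) \<le> (real k)\<^sup>2" by (metis of_nat_le_iff of_nat_power)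
  qed (use c0 in auto)
  finally show "(\<integral>\<^sup>+d. ennreal (\<Sum>(l, n)\<in>?S. (mvec p k d l n)\<^sup>2) \<partial>sph p {..<k}) \<le> ennreal ((real k)\<^sup>2 * ?B)" .
  show "0 \<le> (real k)\<^sup>2 * ?B" using c0 by simp
qed (use t that in blast)+

lemma sph_hh_sum:
  assumes p: "p \<ge> 1" and u: "dot p u u = 1" and t: "t > 0"
  obtains A where "A \<in> sets (sph p {..<k})" "emeasure (sph p {..<k}) A \<le> ennreal (real k * cc p / t)"
    "\<And>d. d \<in> space (sph p {..<k}) - A \<Longrightarrow> (\<Sum>l<k. hh p u (d l))\<^sup>2 \<le> t"
proof (rule markov_real[OF prob_space_sph, of "\<lambda>d. (\<Sum>l<k. hh p u (d l))\<^sup>2" p "{..<k}"])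
  show "(\<lambda>d. (\<Sum>l<k. hh p u (d l))\<^sup>2) \<in> borel_measurable (sph p {..<k})" by measurable
  have i: "integrable (unif_sphere p) (\<lambda>d. hh p u d)" "integrable (unif_sphere p) (\<lambda>d. (hh p u d)\<^sup>2)"
    using integrable_hh_mult[OF p u u, of 1 0] integrable_hh_mult[OF p u u, of 2 0] by auto
  have "(\<integral>\<^sup>+d. ennreal ((0 + (\<Sum>l<k. hh p u (d l)))\<^sup>2) \<partial>sph p {..<k}) \<le> ennreal ((0 + real (card {..<k}) * 0)\<^sup>2 + real (card {..<k}) * (\<integral>d. (hh p u d)\<^sup>2 \<partial>unif_sphere p))"
    by (rule iid_sum_square[OF i]) (auto simp: integral_hh[OF p u])
  also have "\<dots> \<le> ennreal (real k * cc p)" using integral_hh_sq_le[OF p u] by (intro ennreal_leI) (auto intro: mult_left_mono)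
  finally show "(\<integral>\<^sup>+d. ennreal ((\<Sum>l<k. hh p u (d l))\<^sup>2) \<partial>sph p {..<k}) \<le> ennreal (real k * cc p)" by simp
  show "0 \<le> real k * cc p" using cc_nonneg by simp
qed (use t that in blast)+

lemma sph_incoherent:
  assumes p: "p \<ge> 1" and u: "dot p u u = 1" and a: "a > 0"
  obtains A where "A \<in> sets (sph p {..<k})" "emeasure (sph p {..<k}) A \<le> ennreal (((real k)\<^sup>2 + real k) * (2 * exp (- (real p * a / 4))))"
    "\<And>d l. d \<in> space (sph p {..<k}) - A \<Longrightarrow> l < k \<Longrightarrow> (dot p u (d l))\<^sup>2 \<le> a"
    "\<And>d l m. d \<in> space (sph p {..<k}) - A \<Longrightarrow> l < k \<Longrightarrow> m < k \<Longrightarrow> l \<noteq> m \<Longrightarrow> (dot p (d l) (d m))\<^sup>2 \<le> a"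
proof -
  let ?M = "sph p {..<k}" and ?q = "2 * exp (- (real p * a / 4))" and ?S = "{..<k} \<times> {..<k} - Id"
  define B where "B l = {d \<in> space ?M. (dot p u (d l))\<^sup>2 \<ge> a}" for l
  define C where "C x = {d \<in> space ?M. (dot p (d (fst x)) (d (snd x)))\<^sup>2 \<ge> a}" for x
  have B: "B l \<in> sets ?M" if "l < k" for l unfolding B_def using that
    by (intro borel_measurable_le borel_measurable_const borel_measurable_power measurable_ip measurable_sph_component2) auto
  have C: "C x \<in> sets ?M" if "x \<in> ?S" for x unfolding C_def using that
    by (intro borel_measurable_le borel_measurable_const borel_measurable_power measurable_ip measurable_sph_component2) auto
  have T: "(\<integral>\<^sup>+x. indicator {a..} ((dot p u x)\<^sup>2) \<partial>unif_sphere p) \<le> ennreal ?q" if "dot p u u = 1" for u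
  proof -
    have "(\<integral>\<^sup>+x. indicator {a..} ((dot p u x)\<^sup>2) \<partial>unif_sphere p) = (\<integral>\<^sup>+x. indicator {x \<in> space (unif_sphere p). (dot p u x)\<^sup>2 \<ge> a} x \<partial>unif_sphere p)"
      by (intro nn_integral_cong) (auto simp: indicator_def)
    also have "\<dots> = emeasure (unif_sphere p) {x \<in> space (unif_sphere p). (dot p u x)\<^sup>2 \<ge> a}"
      by (rule nn_integral_indicator) measurable
    also have "\<dots> \<le> ennreal ?q" using a by (intro sphere_tail p that) auto
    finally show ?thesis .
  qed
  have im: "(\<lambda>x. indicator {a..} x :: ennreal) \<in> borel_measurable borel" by measurable
  have Bq: "emeasure ?M (B l) \<le> ennreal ?q" if l: "l < k" for l
  proof -
    have "emeasure ?M (B l) = (\<integral>\<^sup>+d. indicator (B l) d \<partial>?M)" using B[OF l] by simp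
    also have "\<dots> = (\<integral>\<^sup>+d. indicator {a..} ((dot p u (d l))\<^sup>2) \<partial>?M)"
      by (intro nn_integral_cong) (auto simp: B_def indicator_def)
    also have "\<dots> = (\<integral>\<^sup>+x. indicator {a..} ((dot p u x)\<^sup>2) \<partial>unif_sphere p)"
      using l by (intro nn_integral_sph_component[of l "{..<k}" "\<lambda>x. indicator {a..} ((dot p u x)\<^sup>2)"] measurable_compose[OF _ im]) auto
    finally show ?thesis using T[OF u] by simp
  qed
  have Cq: "emeasure ?M (C x) \<le> ennreal ?q" if x: "x \<in> ?S" for x
  proof -
    obtain l m where lm: "x = (l, m)" "l < k" "m < k" "l \<noteq> m" using x by auto
    define J where "J = {..<k} - {l}"
    have J: "finite J" "l \<notin> J" "insert l J = {..<k}" "m \<in> J" using lm by (auto simp: J_def)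
    have fm: "(\<lambda>d. indicator {a..} ((dot p (d l) (d m))\<^sup>2) :: ennreal) \<in> borel_measurable (sph p (insert l J))"
      using J by (intro measurable_compose[OF _ im] borel_measurable_power measurable_ip measurable_sph_component2) auto
    have "emeasure ?M (C x) = (\<integral>\<^sup>+d. indicator (C x) d \<partial>?M)" using C[OF x] by simp
    also have "\<dots> = (\<integral>\<^sup>+d. indicator {a..} ((dot p (d l) (d m))\<^sup>2) \<partial>sph p (insert l J))"
      unfolding J(3) by (intro nn_integral_cong) (auto simp: C_def indicator_def lm)
    also have "\<dots> = (\<integral>\<^sup>+d. (\<integral>\<^sup>+y. indicator {a..} ((dot p ((d(l := y)) l) ((d(l := y)) m))\<^sup>2) \<partial>unif_sphere p) \<partial>sph p J)"
      using J by (intro nn_integral_sph_insert fm)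
    also have "\<dots> \<le> (\<integral>\<^sup>+d. ennreal ?q \<partial>sph p J)"
    proof (rule nn_integral_mono_AE)
      show "AE d in sph p J. (\<integral>\<^sup>+y. indicator {a..} ((dot p ((d(l := y)) l) ((d(l := y)) m))\<^sup>2) \<partial>unif_sphere p) \<le> ennreal ?q"
        using AE_sph_unit[OF p J(1)]
      proof eventually_elim
        case (elim d)
        have "dot p ((d(l := y)) l) ((d(l := y)) m) = dot p (d m) y" for y
          using lm by (simp add: ip_commute[of _ y "d m"])
        then show ?case using elim T[of "d m"] J(4) by simp
      qed
    qed
    also have "\<dots> = ennreal ?q" using prob_space.emeasure_space_1[OF prob_space_sph, of p J] by simp
    finally show ?thesis .
  qed
  have cS: "real (card ?S) \<le> (real k)\<^sup>2"
  proof -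
    have "card ?S \<le> card ({..<k} \<times> {..<k})" by (intro card_mono) auto
    then have "card ?S \<le> k^2" by (simp add: power2_eq_square)
    then show ?thesis by (metis of_nat_le_iff of_nat_power)
  qed
  show thesis
  proof (rule that[of "(\<Union>l\<in>{..<k}. B l) \<union> (\<Union>x\<in>?S. C x)"])
    show m: "(\<Union>l\<in>{..<k}. B l) \<union> (\<Union>x\<in>?S. C x) \<in> sets ?M" using B C by (intro sets.Un sets.finite_UN) auto
    have "emeasure ?M ((\<Union>l\<in>{..<k}. B l) \<union> (\<Union>x\<in>?S. C x)) \<le> emeasure ?M (\<Union>l\<in>{..<k}. B l) + emeasure ?M (\<Union>x\<in>?S. C x)"
      using B C by (intro emeasure_subadditive sets.finite_UN) auto
    also have "\<dots> \<le> (\<Sum>l\<in>{..<k}. emeasure ?M (B l)) + (\<Sum>x\<in>?S. emeasure ?M (C x))"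
      using B C by (intro add_mono emeasure_subadditive_finite) auto
    also have "\<dots> \<le> (\<Sum>l\<in>{..<k}. ennreal ?q) + (\<Sum>x\<in>?S. ennreal ?q)"
      using Bq Cq by (intro add_mono sum_mono) auto
    also have "\<dots> = ennreal ((real (card ?S) + real k) * ?q)"
    proof -
      have s: "(\<Sum>x\<in>X. ennreal ?q) = ennreal (real (card X) * ?q)" for X :: "(nat \<times> nat) set"
        by (simp add: ennreal_mult ennreal_of_nat_eq_real_of_nat)
      have s': "(\<Sum>x\<in>X. ennreal ?q) = ennreal (real (card X) * ?q)" for X :: "nat set"
        by (simp add: ennreal_mult ennreal_of_nat_eq_real_of_nat)
      show ?thesis unfolding s s'
        by (subst ennreal_plus[symmetric]) (auto simp: distrib_right)
    qed
    also have "\<dots> \<le> ennreal (((real k)\<^sup>2 + real k) * ?q)" using cS by (intro ennreal_leI mult_right_mono) auto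
    finally show "emeasure ?M ((\<Union>l\<in>{..<k}. B l) \<union> (\<Union>x\<in>?S. C x)) \<le> ennreal (((real k)\<^sup>2 + real k) * ?q)" .
  next
    fix d l assume "d \<in> space ?M - ((\<Union>l\<in>{..<k}. B l) \<union> (\<Union>x\<in>?S. C x))" "l < k"
    then show "(dot p u (d l))\<^sup>2 \<le> a" by (auto simp: B_def not_le less_imp_le)
  next
    fix d l m assume d: "d \<in> space ?M - ((\<Union>l\<in>{..<k}. B l) \<union> (\<Union>x\<in>?S. C x))" and lm: "l < k" "m < k" "l \<noteq> m"
    then have "(l, m) \<in> ?S" by auto
    then have "d \<notin> C (l, m)" using d by blast
    then show "(dot p (d l) (d m))\<^sup>2 \<le> a" using d by (auto simp: C_def not_le less_imp_le)
  qed
qed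

text \<open>The sharper exponent \<open>p * a / 2\<close> of \<open>sphere_cap_upper\<close> is kept
  here, unlike in \<open>sph_incoherent\<close>: it fixes the power of \<open>k\<close> that bounds
  the number of large projections.\<close>

lemma sph_count_large:
  assumes p: "p \<ge> 1" and u: "dot p u u = 1" and a: "0 < a" "a \<le> 1/2" and t: "t > 0"
  obtains A where "A \<in> sets (sph p {..<k})" "emeasure (sph p {..<k}) A \<le> ennreal (real k * (2 * exp (- (real p * a / 2))) / t)"
    "\<And>d. d \<in> space (sph p {..<k}) - A \<Longrightarrow> real (card {l. l < k \<and> (dot p u (d l))\<^sup>2 > a}) \<le> t"
proof -
  let ?q = "2 * exp (- (real p * a / 2))"
  define f :: "(nat \<Rightarrow> real) \<Rightarrow> real" where "f x = indicator {a..} ((dot p u x)\<^sup>2)" for x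
  have fm [measurable]: "f \<in> borel_measurable (unif_sphere p)" unfolding f_def by measurable
  show thesis
  proof (rule markov_real[OF prob_space_sph, of "\<lambda>d. \<Sum>l<k. f (d l)" p "{..<k}"])
    show "(\<lambda>d. \<Sum>l<k. f (d l)) \<in> borel_measurable (sph p {..<k})" by measurable
    have "(\<integral>\<^sup>+x. ennreal (f x) \<partial>unif_sphere p) = (\<integral>\<^sup>+x. indicator {x \<in> space (unif_sphere p). (dot p u x)\<^sup>2 \<ge> a} x \<partial>unif_sphere p)"
      by (intro nn_integral_cong) (auto simp: indicator_def f_def)
    also have "\<dots> = emeasure (unif_sphere p) {x \<in> space (unif_sphere p). (dot p u x)\<^sup>2 \<ge> a}"
      by (rule nn_integral_indicator) measurable
    also have "\<dots> \<le> ennreal ?q" by (intro sphere_cap_upper u a)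
    finally have F: "(\<integral>\<^sup>+x. ennreal (f x) \<partial>unif_sphere p) \<le> ennreal ?q" .
    have "(\<integral>\<^sup>+d. ennreal (\<Sum>l<k. f (d l)) \<partial>sph p {..<k}) = (\<integral>\<^sup>+d. (\<Sum>l<k. ennreal (f (d l))) \<partial>sph p {..<k})"
      by (simp add: sum_ennreal f_def)
    also have "\<dots> = (\<Sum>l<k. (\<integral>\<^sup>+d. ennreal (f (d l)) \<partial>sph p {..<k}))"
      by (intro nn_integral_sum) measurable
    also have "\<dots> = (\<Sum>l<k. (\<integral>\<^sup>+x. ennreal (f x) \<partial>unif_sphere p))"
      by (intro sum.cong refl nn_integral_sph_component[where f = "\<lambda>x. ennreal (f x)"]) auto
    also have "\<dots> \<le> (\<Sum>l<k. ennreal ?q)" by (intro sum_mono F)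
    also have "\<dots> = ennreal (real k * ?q)" by (simp add: ennreal_mult ennreal_of_nat_eq_real_of_nat)
    finally show "(\<integral>\<^sup>+d. ennreal (\<Sum>l<k. f (d l)) \<partial>sph p {..<k}) \<le> ennreal (real k * ?q)" .
    show "t > 0" by fact
    show "0 \<le> real k * ?q" by simp
    fix A assume A: "A \<in> sets (sph p {..<k})" "emeasure (sph p {..<k}) A \<le> ennreal (real k * ?q / t)"
      "\<And>d. d \<in> space (sph p {..<k}) - A \<Longrightarrow> (\<Sum>l<k. f (d l)) \<le> t"
    show thesis
    proof (rule that[OF A(1,2)])
      fix d assume d: "d \<in> space (sph p {..<k}) - A"
      have "real (card {l. l < k \<and> (dot p u (d l))\<^sup>2 > a}) = (\<Sum>l | l < k \<and> (dot p u (d l))\<^sup>2 > a. 1)" by simp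
      also have "\<dots> \<le> (\<Sum>l<k. f (d l))"
        by (intro sum_le_included[where i = id]) (auto simp: f_def indicator_def)
      also have "\<dots> \<le> t" by (rule A(3)[OF d])
      finally show "real (card {l. l < k \<and> (dot p u (d l))\<^sup>2 > a}) \<le> t" .
    qed
  qed
qed

lemma sph_some_large:
  assumes p: "p \<ge> 1" and u: "dot p u u = 1" and q: "ennreal q \<le> emeasure (unif_sphere p) {x \<in> space (unif_sphere p). (dot p u x)\<^sup>2 \<ge> a}" "q \<ge> 0"
  obtains A where "A \<in> sets (sph p {..<k})" "emeasure (sph p {..<k}) A \<le> ennreal (exp (- (real k * q)))"
    "\<And>d. d \<in> space (sph p {..<k}) - A \<Longrightarrow> \<exists>l<k. (dot p u (d l))\<^sup>2 \<ge> a"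
proof -
  let ?M = "sph p {..<k}" and ?U = "unif_sphere p"
  let ?B = "{x \<in> space ?U. (dot p u x)\<^sup>2 \<ge> a}" and ?C = "{x \<in> space ?U. \<not> (dot p u x)\<^sup>2 \<ge> a}"
  interpret prob_space ?U by (rule prob_space_sphere)
  define A where "A = {d \<in> space ?M. \<forall>l\<in>{..<k}. \<not> (dot p u (d l))\<^sup>2 \<ge> a}"
  have A: "A \<in> sets ?M" unfolding A_def
    by (intro sets.sets_Collect_finite_All sets.sets_Collect_neg borel_measurable_le borel_measurable_const borel_measurable_power measurable_ip measurable_sph_component2) auto
  have C: "?C \<in> sets ?U" and B: "?B \<in> sets ?U" by measurable
  have qB: "q \<le> prob ?B" using q by (simp add: emeasure_eq_measure)
  have "?C = space ?U - ?B" by auto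
  then have "prob ?C = 1 - prob ?B" using prob_compl[OF B] by simp
  then have pC: "emeasure ?U ?C \<le> ennreal (1 - q)" using qB by (simp add: emeasure_eq_measure ennreal_leI)
  have q1: "q \<le> 1" using qB prob_le_1[of ?B] by linarith
  have "emeasure ?M A = (\<integral>\<^sup>+d. indicator A d \<partial>?M)" using A by simp
  also have "\<dots> = (\<integral>\<^sup>+d. (\<Prod>l\<in>{..<k}. indicator ?C (d l)) \<partial>?M)"
  proof (rule nn_integral_cong)
    fix d assume d: "d \<in> space ?M"
    then have sp: "d l \<in> space ?U" if "l < k" for l using that by (auto simp: sph_def space_PiM PiE_iff)
    show "indicator A d = (\<Prod>l\<in>{..<k}. indicator ?C (d l) :: ennreal)"
    proof (cases "d \<in> A")
      case True
      then have "indicator ?C (d l) = (1 :: ennreal)" if "l \<in> {..<k}" for l using that sp by (auto simp: A_def)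
      then show ?thesis using True by simp
    next
      case False
      then obtain l where "l < k" "(dot p u (d l))\<^sup>2 \<ge> a" using d by (auto simp: A_def)
      then have "\<exists>l\<in>{..<k}. indicator ?C (d l) = (0 :: ennreal)" by (intro bexI[of _ l]) auto
      then have "(\<Prod>l\<in>{..<k}. indicator ?C (d l) :: ennreal) = 0" by (intro prod_zero) auto
      then show ?thesis using False by simp
    qed
  qed
  also have "\<dots> = (\<Prod>l\<in>{..<k}. \<integral>\<^sup>+x. indicator ?C x \<partial>?U)"
    using C by (intro nn_integral_sph_prod) auto
  also have "\<dots> = emeasure ?U ?C ^ k" using C by simp
  also have "\<dots> \<le> ennreal (1 - q) ^ k" by (intro power_mono pC) auto
  also have "\<dots> = ennreal ((1 - q) ^ k)" using q1 by (simp add: ennreal_power)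
  also have "\<dots> \<le> ennreal (exp (- q) ^ k)"
    using exp_ge_add_one_self[of "- q"] q1 by (intro ennreal_leI power_mono) auto
  also have "exp (- q) ^ k = exp (- (real k * q))" by (simp add: exp_power_real)
  finally have "emeasure ?M A \<le> ennreal (exp (- (real k * q)))" .
  then show thesis by (rule that[OF A]) (auto simp: A_def)
qed

section \<open>Nearly orthogonal systems\<close>

text \<open>Cholesky factorisation by Schur complements, with the inserted index \<open>q\<close> as
  pivot. A zero pivot forces its column to vanish, and division by 0 then gives the correct value
  0.\<close>

lemma psd_decomp:
  fixes B :: "nat \<Rightarrow> nat \<Rightarrow> real"
  assumes "finite I" "\<And>i j. B i j = B j i" "\<And>x. 0 \<le> (\<Sum>i\<in>I. \<Sum>j\<in>I. x i * B i j * x j)"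
  shows "\<exists>Y :: nat \<Rightarrow> nat \<Rightarrow> real. \<forall>i\<in>I. \<forall>j\<in>I. B i j = (\<Sum>t\<in>I. Y t i * Y t j)"
  using assms
proof (induction I arbitrary: B rule: finite_induct)
  case empty then show ?case by simp
next
  case (insert q I)
  note fin = insert.hyps
  define a where "a = B q q"
  let ?Q = "\<lambda>x. \<Sum>i\<in>I. \<Sum>j\<in>I. x i * B i j * x j" and ?b = "\<lambda>x. \<Sum>i\<in>I. x i * B i q"
  have full: "0 \<le> y\<^sup>2 * a + 2 * y * ?b x + ?Q x" for x y
  proof -
    let ?z = "x(q := y)"
    have ne: "?z i = x i" if "i \<in> I" for i using that fin by auto
    have s: "(\<Sum>i\<in>I. ?z i * B i q * y) = (\<Sum>i\<in>I. x i * B i q * y)" "(\<Sum>j\<in>I. y * B q j * ?z j) = (\<Sum>j\<in>I. y * B q j * x j)"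
       "(\<Sum>i\<in>I. \<Sum>j\<in>I. ?z i * B i j * ?z j) = ?Q x"
      by (intro sum.cong refl; simp only: ne)+
    have "(\<Sum>i\<in>insert q I. \<Sum>j\<in>insert q I. ?z i * B i j * ?z j)
      = y * a * y + (\<Sum>j\<in>I. y * B q j * x j) + ((\<Sum>i\<in>I. x i * B i q * y) + ?Q x)"
      by (simp only: sum.insert[OF fin] sum.distrib fun_upd_same a_def s)
    also have "(\<Sum>j\<in>I. y * B q j * x j) = y * ?b x" unfolding sum_distrib_left by (intro sum.cong) (simp_all add: insert.prems(1)[of q])
    also have "(\<Sum>i\<in>I. x i * B i q * y) = y * ?b x" unfolding sum_distrib_left by (intro sum.cong) simp_all
    finally show ?thesis using insert.prems(2)[of ?z] by (simp add: power2_eq_square algebra_simps)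
  qed
  have a0: "a \<ge> 0" using full[of 1 "\<lambda>_. 0"] by simp
  have aq: "B i q = 0" if i: "i \<in> I" and "a = 0" for i
  proof (rule ccontr)
    assume ne: "B i q \<noteq> 0"
    let ?x = "\<lambda>j. if j = i then 1 else 0 :: real"
    have "?b ?x = (\<Sum>j\<in>I. if j = i then B j q else 0)" by (intro sum.cong) auto
    then have b: "?b ?x = B i q" using fin(1) i by simp
    define Q0 where "Q0 = ?Q ?x"
    have h: "0 \<le> 2 * y * B i q + Q0" for y
      using full[of y ?x] \<open>a = 0\<close> unfolding b Q0_def[symmetric] by simp
    \<comment> \<open>With a zero pivot the form is affine in \<open>y\<close>, and this value of
      \<open>y\<close> would make it equal to -1.\<close>
    have "2 * (- (Q0 + 1) / (2 * B i q)) * B i q = - (Q0 + 1)" using ne by simp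
    then show False using h[of "- (Q0 + 1) / (2 * B i q)"] by simp
  qed
  define B' where "B' i j = B i j - B i q * B j q / a" for i j
  have "\<exists>Y :: nat \<Rightarrow> nat \<Rightarrow> real. \<forall>i\<in>I. \<forall>j\<in>I. B' i j = (\<Sum>t\<in>I. Y t i * Y t j)"
  proof (rule insert.IH)
    show "B' i j = B' j i" for i j by (simp add: B'_def insert.prems(1)[of i j])
    fix x :: "nat \<Rightarrow> real"
    have "(\<Sum>i\<in>I. \<Sum>j\<in>I. x i * B' i j * x j) = ?Q x - (?b x * ?b x) / a"
      unfolding B'_def sum_product sum_divide_distrib
      by (simp add: algebra_simps sum_subtractf)
    also have "\<dots> \<ge> 0"
      \<comment> \<open>Completing the square: this \<open>y\<close> minimises the form in the pivot
        direction.\<close>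
      using full[of "- ?b x / a" x] by (cases "a = 0") (simp_all add: power2_eq_square field_simps)
    finally show "0 \<le> (\<Sum>i\<in>I. \<Sum>j\<in>I. x i * B' i j * x j)" .
  qed
  then obtain Y where Y: "\<And>i j. i \<in> I \<Longrightarrow> j \<in> I \<Longrightarrow> B' i j = (\<Sum>t\<in>I. Y t i * Y t j)" by blast
  define Y' where "Y' t i = (if t = q then B i q / sqrt a else if i = q then 0 else Y t i)" for t i
  have S: "(\<Sum>t\<in>insert q I. Y' t i * Y' t j) = B i q * B j q / a + (\<Sum>t\<in>I. if i = q \<or> j = q then 0 else Y t i * Y t j)" for i j
  proof -
    have "(\<Sum>t\<in>I. Y' t i * Y' t j) = (\<Sum>t\<in>I. if i = q \<or> j = q then 0 else Y t i * Y t j)"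
      using fin by (intro sum.cong) (auto simp: Y'_def)
    then show ?thesis using fin a0 by (simp add: Y'_def)
  qed
  have "B i j = (\<Sum>t\<in>insert q I. Y' t i * Y' t j)" if "i \<in> insert q I" "j \<in> insert q I" for i j
  proof (cases "i = q \<or> j = q")
    case True
    have "a = 0 \<Longrightarrow> B i j = 0" using True that aq[of i] aq[of j] insert.prems(1)[of i j] by (auto simp: a_def)
    then show ?thesis unfolding S using True insert.prems(1)[of i j] by (cases "a = 0") (auto simp: a_def)
  next
    case False
    then have "i \<in> I" "j \<in> I" using that by auto
    then show ?thesis unfolding S using False Y[of i j] by (simp add: B'_def)
  qed
  then show ?case by blast
qed

lemma dot_comb: "dot p (comb S c d) x = (\<Sum>l\<in>S. c l * dot p (d l) x)" "dot p x (comb S c d) = (\<Sum>l\<in>S. c l * dot p x (d l))"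
  by (simp_all add: comb_def ip_sum_left ip_sum_right)

text \<open>Gram-Schmidt without linear independence. The vector \<open>x\<close> is arbitrary in
  the induction because the step needs residuals of both \<open>x\<close> and the new
  \<open>d t\<close>. If the residual \<open>z\<close> of \<open>d t\<close> has norm 0, then
  \<open>c\<close> is 0 by division by 0, and the required inner product vanishes already.\<close>

lemma residual_exists:
  assumes "finite T"
  shows "\<exists>a. \<forall>t\<in>T. dot p (\<lambda>i. x i - comb T a d i) (d t) = 0"
  using assms
proof (induction T arbitrary: x rule: finite_induct)
  case (insert t T)
  obtain a where a: "\<And>s. s \<in> T \<Longrightarrow> dot p (\<lambda>i. x i - comb T a d i) (d s) = 0" using insert.IH by blast
  obtain b where b: "\<And>s. s \<in> T \<Longrightarrow> dot p (\<lambda>i. d t i - comb T b d i) (d s) = 0" using insert.IH by blast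
  define y where "y = (\<lambda>i. x i - comb T a d i)"
  define z where "z = (\<lambda>i. d t i - comb T b d i)"
  define c where "c = dot p y (d t) / dot p z z"
  define a' where "a' s = (if s = t then c else a s - c * b s)" for s
  have y0: "dot p y (d s) = 0" and z0: "dot p z (d s) = 0" if "s \<in> T" for s using a[OF that] b[OF that] by (simp_all add: y_def z_def)
  have "comb (insert t T) a' d i = comb T a d i + c * z i" for i
  proof -
    have "(\<Sum>l\<in>T. a' l * d l i) = (\<Sum>l\<in>T. a l * d l i - c * (b l * d l i))"
      using insert.hyps by (intro sum.cong) (auto simp: a'_def algebra_simps)
    then show ?thesis using insert.hyps by (simp add: comb_def a'_def z_def sum_subtractf sum_distrib_left algebra_simps)
  qed
  then have e: "dot p (\<lambda>i. x i - comb (insert t T) a' d i) w = dot p y w - c * dot p z w" for w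
    unfolding y_def by (simp add: ip_diff_left ip_scale_left ip_add_left)
  have yz: "dot p w (comb T b d) = 0" if "\<And>s. s \<in> T \<Longrightarrow> dot p w (d s) = 0" for w
    using that by (simp add: dot_comb)
  have zz: "dot p z (d t) = dot p z z"
    using yz[of z] z0 ip_diff_right[of "{..<p}" z "d t" "comb T b d"] by (simp add: z_def)
  have yy: "dot p y (d t) = dot p y z"
    using yz[of y] y0 ip_diff_right[of "{..<p}" y "d t" "comb T b d"] by (simp add: z_def)
  have "dot p (\<lambda>i. x i - comb (insert t T) a' d i) (d s) = 0" if "s \<in> insert t T" for s
  proof (cases "s = t")
    case True
    have "dot p y (d t) = 0" if "dot p z z = 0"
    proof -
      have "z i = 0" if "i < p" for i using \<open>dot p z z = 0\<close> that by (simp add: ip_self_eq_0)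
      then show ?thesis unfolding yy by (simp add: ip_def)
    qed
    then show ?thesis unfolding e True zz c_def by auto
  next
    case False
    then show ?thesis unfolding e using that y0 z0 by simp
  qed
  then show ?case by blast
qed simp

lemma sum_abs_le_sqrt:
  fixes f :: "'a \<Rightarrow> real"
  assumes "finite S" shows "(\<Sum>i\<in>S. \<bar>f i\<bar>) \<le> sqrt (real (card S)) * sqrt (\<Sum>i\<in>S. (f i)\<^sup>2)"
proof -
  have "(\<Sum>i\<in>S. \<bar>f i\<bar>)\<^sup>2 \<le> real (card S) * (\<Sum>i\<in>S. (f i)\<^sup>2)"
    using Cauchy_Schwarz_ineq_sum[of "\<lambda>_. 1" "\<lambda>i. \<bar>f i\<bar>" S] by simp
  then have "\<bar>\<Sum>i\<in>S. \<bar>f i\<bar>\<bar> \<le> sqrt (real (card S) * (\<Sum>i\<in>S. (f i)\<^sup>2))" by (simp add: real_le_rsqrt)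
  then show ?thesis by (simp add: real_sqrt_mult)
qed

lemma abs_sum_mult_le:
  fixes f :: "'a \<Rightarrow> real"
  shows "\<bar>\<Sum>i\<in>S. f i * g i\<bar> \<le> sqrt (\<Sum>i\<in>S. (f i)\<^sup>2) * sqrt (\<Sum>i\<in>S. (g i)\<^sup>2)"
  using Cauchy_Schwarz_ineq_sum[of f g S] by (metis real_sqrt_abs real_sqrt_le_mono real_sqrt_mult)

lemma abs_sum_mult_le_sup:
  fixes f :: "'a \<Rightarrow> real"
  assumes "finite S" "\<And>i. i \<in> S \<Longrightarrow> \<bar>g i\<bar> \<le> b" "b \<ge> 0"
  shows "\<bar>\<Sum>i\<in>S. f i * g i\<bar> \<le> sqrt (\<Sum>i\<in>S. (f i)\<^sup>2) * (sqrt (real (card S)) * b)"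
proof -
  have "(g i)\<^sup>2 \<le> b\<^sup>2" if "i \<in> S" for i using assms(2)[OF that] assms(3) abs_le_square_iff[of "g i" b] by auto
  then have "(\<Sum>i\<in>S. (g i)\<^sup>2) \<le> real (card S) * b\<^sup>2" using sum_mono[of S "\<lambda>i. (g i)\<^sup>2" "\<lambda>_. b\<^sup>2"] by simp
  then have "sqrt (\<Sum>i\<in>S. (g i)\<^sup>2) \<le> sqrt (real (card S)) * b"
    using assms(3) by (metis real_sqrt_le_mono real_sqrt_mult real_sqrt_pow2 real_sqrt_power abs_of_nonneg real_sqrt_abs)
  then show ?thesis using abs_sum_mult_le[of f g S] by (meson mult_left_mono order_trans real_sqrt_ge_zero sum_nonneg zero_le_power2)
qed

section \<open>Projection onto the span of a nearly orthonormal family\<close>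

locale near_orth =
  fixes p k :: nat and d :: "nat \<Rightarrow> nat \<Rightarrow> real" and T :: "nat set" and \<alpha> :: real
  assumes unit: "\<And>l. l < k \<Longrightarrow> dot p (d l) (d l) = 1"
    and T: "T \<subseteq> {..<k}" and \<alpha>: "\<alpha> \<ge> 0"
    and incoh: "\<And>l m. l < k \<Longrightarrow> m < k \<Longrightarrow> l \<noteq> m \<Longrightarrow> \<bar>dot p (d l) (d m)\<bar> \<le> \<alpha>"
    and small: "real (card T) * \<alpha> \<le> 1/2"
begin

abbreviation "n \<equiv> real (card T)"

lemma finT: "finite T" using T finite_subset by blast

text \<open>Diagonal dominance: the off-diagonal part of the Gram matrix contributes at most
  \<open>n * \<alpha> \<le> 1/2\<close> times the squared norm of the coefficients.\<close>

lemma gershgorin: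
  assumes S: "S \<subseteq> T" shows "(\<Sum>l\<in>S. (c l)\<^sup>2) \<le> 2 * dot p (comb S c d) (comb S c d)"
proof -
  have fS: "finite S" using S finT finite_subset by blast
  have "dot p (comb S c d) (comb S c d) = (\<Sum>l\<in>S. \<Sum>m\<in>S. c l * c m * dot p (d l) (d m))"
    by (subst dot_comb(1)) (simp add: dot_comb(2) sum_distrib_left mult.assoc)
  also have "\<dots> \<ge> (\<Sum>l\<in>S. \<Sum>m\<in>S. (if l = m then (c l)\<^sup>2 else 0) - \<alpha> * (\<bar>c l\<bar> * \<bar>c m\<bar>))"
  proof (intro sum_mono)
    fix l m assume lm: "l \<in> S" "m \<in> S"
    then have lk: "l < k" "m < k" using S T by auto
    show "(if l = m then (c l)\<^sup>2 else 0) - \<alpha> * (\<bar>c l\<bar> * \<bar>c m\<bar>) \<le> c l * c m * dot p (d l) (d m)"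
    proof (cases "l = m")
      case True then show ?thesis using unit lk \<alpha> by (simp add: power2_eq_square)
    next
      case False
      have "\<bar>c l * c m * dot p (d l) (d m)\<bar> \<le> \<bar>c l\<bar> * \<bar>c m\<bar> * \<alpha>"
        unfolding abs_mult by (intro mult_left_mono incoh lk False) auto
      then show ?thesis using False by (simp add: mult.commute)
    qed
  qed
  also have "(\<Sum>l\<in>S. \<Sum>m\<in>S. (if l = m then (c l)\<^sup>2 else 0) - \<alpha> * (\<bar>c l\<bar> * \<bar>c m\<bar>)) = (\<Sum>l\<in>S. (c l)\<^sup>2) - \<alpha> * (\<Sum>l\<in>S. \<bar>c l\<bar>)\<^sup>2"
    using fS by (simp add: sum_subtractf sum_distrib_left[symmetric] sum_product power2_eq_square)
  finally have 1: "(\<Sum>l\<in>S. (c l)\<^sup>2) - \<alpha> * (\<Sum>l\<in>S. \<bar>c l\<bar>)\<^sup>2 \<le> dot p (comb S c d) (comb S c d)" .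
  have "(\<Sum>l\<in>S. \<bar>c l\<bar>)\<^sup>2 \<le> real (card S) * (\<Sum>l\<in>S. (c l)\<^sup>2)"
    using Cauchy_Schwarz_ineq_sum[of "\<lambda>_. 1" "\<lambda>i. \<bar>c i\<bar>" S] by simp
  also have "\<dots> \<le> n * (\<Sum>l\<in>S. (c l)\<^sup>2)" using card_mono[OF finT S] by (intro mult_right_mono sum_nonneg) auto
  finally have "\<alpha> * (\<Sum>l\<in>S. \<bar>c l\<bar>)\<^sup>2 \<le> \<alpha> * (n * (\<Sum>l\<in>S. (c l)\<^sup>2))" using \<alpha> by (rule mult_left_mono)
  also have "\<dots> = n * \<alpha> * (\<Sum>l\<in>S. (c l)\<^sup>2)" by simp
  also have "\<dots> \<le> 1/2 * (\<Sum>l\<in>S. (c l)\<^sup>2)" using small by (intro mult_right_mono sum_nonneg) auto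
  finally show ?thesis using 1 by simp
qed

text \<open>Coefficients of the orthogonal projection \<open>pr\<close> onto the span of
  \<open>T\<close>, with \<open>res\<close> as the complementary projection. Choosing them by
  \<open>residual_exists\<close> avoids inverting the Gram matrix.\<close>

definition coef :: "(nat \<Rightarrow> real) \<Rightarrow> nat \<Rightarrow> real" where
  "coef x = (SOME a. \<forall>t\<in>T. dot p (\<lambda>i. x i - comb T a d i) (d t) = 0)"

definition pr :: "(nat \<Rightarrow> real) \<Rightarrow> nat \<Rightarrow> real" where "pr x = comb T (coef x) d"

definition res :: "(nat \<Rightarrow> real) \<Rightarrow> nat \<Rightarrow> real" where "res x = (\<lambda>i. x i - pr x i)"

lemma res_orth: "t \<in> T \<Longrightarrow> dot p (res x) (d t) = 0"
  using someI_ex[OF residual_exists[OF finT, of p x d]] unfolding res_def pr_def coef_def by blast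

lemma res_pr: "dot p (res x) (pr y) = 0"
  unfolding pr_def dot_comb using res_orth by simp

lemma res_left: "dot p (res x) y = dot p (res x) (res y)"
  using res_pr[of x y] unfolding res_def[of y] ip_diff_right by simp

lemma res_swap: "dot p (res x) y = dot p x (res y)"
  using res_left[of x y] res_left[of y x] by (simp add: ip_commute)

lemma res_T: "t \<in> T \<Longrightarrow> dot p (res (d t)) x = 0"
  using res_swap[of "d t" x] res_orth[of t x] by (simp add: ip_commute)

lemma dot_res: "dot p (res x) (res y) = dot p x y - dot p (pr x) (pr y)"
proof -
  have "dot p (res x) (res y) = dot p x y - dot p (pr x) y"
    unfolding res_left[symmetric] by (simp add: res_def ip_diff_left)
  also have "dot p (pr x) y = dot p (pr x) (pr y) + dot p (res y) (pr x)"
    by (simp add: res_def ip_diff_left ip_commute[of _ "pr x"])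
  finally show ?thesis using res_pr[of y x] by simp
qed

lemma pr_self: "dot p (pr x) (pr x) = dot p (pr x) x"
  using res_pr[of x x] by (simp add: res_def ip_diff_left ip_commute[of _ x])

text \<open>The squared norm of the projection is the pairing of the coefficients with the products
  \<open>dot p (d t) x\<close>, hence at most \<open>\<alpha>\<close> times their sum of absolute
  values; \<open>gershgorin\<close> bounds the coefficients back by that squared norm.
  Cauchy-Schwarz closes the circle.\<close>

lemma pr_bounds:
  assumes x: "\<And>t. t \<in> T \<Longrightarrow> \<bar>dot p (d t) x\<bar> \<le> \<alpha>"
  shows "(\<Sum>t\<in>T. (coef x t)\<^sup>2) \<le> 4 * n * \<alpha>\<^sup>2" "(\<Sum>t\<in>T. \<bar>coef x t\<bar>) \<le> 2 * n * \<alpha>" "dot p (pr x) (pr x) \<le> 2 * n * \<alpha>\<^sup>2"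
proof -
  define A where "A = (\<Sum>t\<in>T. (coef x t)\<^sup>2)"
  define S where "S = (\<Sum>t\<in>T. \<bar>coef x t\<bar>)"
  have A0: "A \<ge> 0" by (simp add: A_def sum_nonneg)
  have A1: "A \<le> 2 * dot p (pr x) (pr x)" unfolding A_def pr_def by (rule gershgorin) simp
  have "dot p (pr x) (pr x) = (\<Sum>t\<in>T. coef x t * dot p (d t) x)" unfolding pr_self by (simp add: pr_def dot_comb)
  also have "\<dots> \<le> (\<Sum>t\<in>T. \<bar>coef x t\<bar> * \<alpha>)"
    using x by (intro sum_mono) (metis abs_ge_self abs_ge_zero abs_mult mult_left_mono order_trans)
  finally have 2: "dot p (pr x) (pr x) \<le> \<alpha> * S" by (simp add: S_def sum_distrib_left mult.commute)
  have S: "S \<le> sqrt n * sqrt A" unfolding S_def A_def by (rule sum_abs_le_sqrt[OF finT])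
  have "A \<le> 2 * \<alpha> * (sqrt n * sqrt A)" using A1 2 mult_left_mono[OF S \<alpha>] by simp
  then have "sqrt A * sqrt A \<le> (2 * \<alpha> * sqrt n) * sqrt A" using A0 by (simp only: real_sqrt_mult_self abs_of_nonneg mult.assoc)
  then have sA: "sqrt A \<le> 2 * \<alpha> * sqrt n"
  proof (cases "sqrt A > 0")
    case True
    with \<open>sqrt A * sqrt A \<le> _\<close> show ?thesis by (rule mult_right_le_imp_le)
  next
    case False
    moreover have "0 \<le> 2 * \<alpha> * sqrt n" using \<alpha> by simp
    ultimately show ?thesis by linarith
  qed
  then have "(sqrt A)\<^sup>2 \<le> (2 * \<alpha> * sqrt n)\<^sup>2" using A0 by (intro power_mono) auto
  then show "A \<le> 4 * n * \<alpha>\<^sup>2" using A0 by (simp add: power_mult_distrib mult.commute mult.left_commute)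
  have "S \<le> sqrt n * (2 * \<alpha> * sqrt n)" using S sA by (meson mult_left_mono order_trans real_sqrt_ge_zero of_nat_0_le_iff)
  then show S2: "S \<le> 2 * n * \<alpha>" by (simp add: mult.commute mult.left_commute)
  show "dot p (pr x) (pr x) \<le> 2 * n * \<alpha>\<^sup>2" using 2 mult_left_mono[OF S2 \<alpha>] by (simp add: power2_eq_square algebra_simps)
qed

text \<open>Element of the dual basis: the residual of \<open>d m\<close> against the rest of
  \<open>T\<close>, rescaled. Before rescaling its coefficient at \<open>m\<close> is 1, so
  \<open>gershgorin\<close> keeps its squared norm at least 1/2.\<close>

lemma dual_exists:
  assumes m: "m \<in> T"
  obtains f where "\<And>t. t \<in> T \<Longrightarrow> dot p (comb T f d) (d t) = (if t = m then 1 else 0)" "(\<Sum>t\<in>T. (f t)\<^sup>2) \<le> 4"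
proof -
  have "finite (T - {m})" using finT by simp
  from residual_exists[OF this, of p "d m" d] obtain a where a: "\<And>t. t \<in> T - {m} \<Longrightarrow> dot p (\<lambda>i. d m i - comb (T - {m}) a d i) (d t) = 0" by blast
  define g where "g t = (if t = m then 1 else - a t)" for t
  define z where "z = comb T g d"
  have zi: "z i = d m i - comb (T - {m}) a d i" for i
  proof -
    have "(\<Sum>t\<in>T - {m}. g t * d t i) = (\<Sum>t\<in>T - {m}. - (a t * d t i))" by (intro sum.cong) (auto simp: g_def)
    then show ?thesis using m finT by (simp add: z_def comb_def sum.remove[of T m] g_def sum_negf)
  qed
  have z0: "dot p z (d t) = 0" if "t \<in> T" "t \<noteq> m" for t
    using a[of t] that unfolding zi[symmetric] by simp
  have zz: "dot p z (d m) = dot p z z"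
  proof -
    have "dot p z z = (\<Sum>t\<in>T. g t * dot p z (d t))" by (subst (2) z_def) (simp add: dot_comb)
    also have "\<dots> = (\<Sum>t\<in>T. if t = m then dot p z (d m) else 0)" using z0 by (intro sum.cong) (auto simp: g_def)
    finally show ?thesis using m finT by simp
  qed
  have "1 \<le> (\<Sum>t\<in>T. (g t)\<^sup>2)"
    using member_le_sum[of m T "\<lambda>t. (g t)\<^sup>2"] m finT by (simp add: g_def)
  then have z1: "1 \<le> 2 * dot p z z" using gershgorin[of T g] by (simp add: z_def)
  define f where "f t = g t / dot p z z" for t
  have fz: "comb T f d = (\<lambda>i. (1 / dot p z z) * z i)"
    by (auto simp: z_def comb_def f_def fun_eq_iff sum_divide_distrib)
  show thesis
  proof
    show "dot p (comb T f d) (d t) = (if t = m then 1 else 0)" if "t \<in> T" for t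
      unfolding fz ip_scale_left using that z0 zz z1 by auto
    have "(\<Sum>t\<in>T. (f t)\<^sup>2) \<le> 2 * dot p (comb T f d) (comb T f d)" by (rule gershgorin) simp
    also have "\<dots> = 2 / dot p z z" unfolding fz ip_scale_left ip_scale_right using z1 by simp
    also have "\<dots> \<le> 4" using z1 by (simp add: field_simps)
    finally show "(\<Sum>t\<in>T. (f t)\<^sup>2) \<le> 4" .
  qed
qed

text \<open>Positivity at the dual vector of \<open>m\<close> isolates \<open>c m\<close> up to a
  leak from indices outside \<open>T\<close>, and \<open>\<eta>\<close> collects these leaks with
  the weights \<open>w\<close>. A dual vector has coefficients of squared norm at most 4, so its
  squared product with an outside vector is at most \<open>4 * n * \<alpha>^2\<close>; summing over
  \<open>T\<close> adds a factor \<open>n\<close>.\<close>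

lemma nonneg_on_T:
  assumes psd: "\<And>x. 0 \<le> (\<Sum>l<k. c l * (dot p (d l) x)\<^sup>2)" and w: "\<And>t. t \<in> T \<Longrightarrow> 0 \<le> w t" "\<And>t. t \<in> T \<Longrightarrow> w t \<le> L"
  obtains \<eta> where "\<And>l. l \<in> {..<k} - T \<Longrightarrow> 0 \<le> \<eta> l" "\<And>l. l \<in> {..<k} - T \<Longrightarrow> \<eta> l \<le> 4 * n\<^sup>2 * \<alpha>\<^sup>2 * L"
    "0 \<le> (\<Sum>t\<in>T. w t * c t) + (\<Sum>l\<in>{..<k} - T. c l * \<eta> l)"
proof -
  have "\<forall>m\<in>T. \<exists>f. (\<forall>t\<in>T. dot p (comb T f d) (d t) = (if t = m then 1 else 0)) \<and> (\<Sum>t\<in>T. (f t)\<^sup>2) \<le> 4"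
    using dual_exists by metis
  from bchoice[OF this] obtain f where f: "\<And>m t. m \<in> T \<Longrightarrow> t \<in> T \<Longrightarrow> dot p (comb T (f m) d) (d t) = (if t = m then 1 else 0)"
    "\<And>m. m \<in> T \<Longrightarrow> (\<Sum>t\<in>T. (f m t)\<^sup>2) \<le> 4" by metis
  define e where "e m = comb T (f m) d" for m
  define \<eta> where "\<eta> l = (\<Sum>m\<in>T. w m * (dot p (e m) (d l))\<^sup>2)" for l
  show thesis
  proof
    show "0 \<le> \<eta> l" if "l \<in> {..<k} - T" for l unfolding \<eta>_def using w by (intro sum_nonneg mult_nonneg_nonneg) auto
    show "\<eta> l \<le> 4 * n\<^sup>2 * \<alpha>\<^sup>2 * L" if l: "l \<in> {..<k} - T" for l
    proof -
      have b: "(dot p (e m) (d l))\<^sup>2 \<le> 4 * n * \<alpha>\<^sup>2" if m: "m \<in> T" for m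
      proof -
        have "\<bar>dot p (e m) (d l)\<bar> = \<bar>\<Sum>t\<in>T. f m t * dot p (d t) (d l)\<bar>" by (simp add: e_def dot_comb)
        also have "\<dots> \<le> sqrt (\<Sum>t\<in>T. (f m t)\<^sup>2) * (sqrt n * \<alpha>)"
          using l T by (intro abs_sum_mult_le_sup finT incoh \<alpha>) auto
        also have "\<dots> \<le> sqrt 4 * (sqrt n * \<alpha>)" using f(2)[OF m] \<alpha> by (intro mult_right_mono real_sqrt_le_mono) auto
        finally have "\<bar>dot p (e m) (d l)\<bar>\<^sup>2 \<le> (sqrt 4 * (sqrt n * \<alpha>))\<^sup>2" by (intro power_mono) auto
        then show ?thesis by (simp add: power_mult_distrib)
      qed
      have "\<eta> l \<le> (\<Sum>m\<in>T. L * (4 * n * \<alpha>\<^sup>2))" unfolding \<eta>_def using w b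
        by (intro sum_mono mult_mono) (auto intro: order_trans)
      then show ?thesis by (simp add: power2_eq_square algebra_simps)
    qed
    have "0 \<le> (\<Sum>m\<in>T. w m * (\<Sum>l<k. c l * (dot p (d l) (e m))\<^sup>2))"
      by (rule sum_nonneg) (rule mult_nonneg_nonneg[OF w(1) psd])
    also have "\<dots> = (\<Sum>m\<in>T. w m * (c m + (\<Sum>l\<in>{..<k} - T. c l * (dot p (e m) (d l))\<^sup>2)))"
    proof (intro sum.cong refl arg_cong2[where f="(*)"])
      fix m assume m: "m \<in> T"
      have "(\<Sum>l<k. c l * (dot p (d l) (e m))\<^sup>2) = (\<Sum>l<k. c l * (dot p (e m) (d l))\<^sup>2)" by (simp add: ip_commute)
      also have "\<dots> = (\<Sum>l\<in>{..<k} - T. c l * (dot p (e m) (d l))\<^sup>2) + (\<Sum>l\<in>T. c l * (dot p (e m) (d l))\<^sup>2)"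
        by (rule sum.subset_diff) (use T in auto)
      also have "(\<Sum>l\<in>T. c l * (dot p (e m) (d l))\<^sup>2) = (\<Sum>l\<in>T. if l = m then c l else 0)"
        using f(1)[OF m] by (intro sum.cong) (auto simp: e_def)
      also have "\<dots> = c m" using m finT by simp
      finally show "(\<Sum>l<k. c l * (dot p (d l) (e m))\<^sup>2) = c m + (\<Sum>l\<in>{..<k} - T. c l * (dot p (e m) (d l))\<^sup>2)" by simp
    qed
    also have "\<dots> = (\<Sum>t\<in>T. w t * c t) + (\<Sum>m\<in>T. \<Sum>l\<in>{..<k} - T. c l * (w m * (dot p (e m) (d l))\<^sup>2))"
      by (simp add: distrib_left sum.distrib sum_distrib_left mult.left_commute)
    also have "(\<Sum>m\<in>T. \<Sum>l\<in>{..<k} - T. c l * (w m * (dot p (e m) (d l))\<^sup>2)) = (\<Sum>l\<in>{..<k} - T. c l * \<eta> l)"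
      unfolding \<eta>_def sum_distrib_left by (rule sum.swap)
    finally show "0 \<le> (\<Sum>t\<in>T. w t * c t) + (\<Sum>l\<in>{..<k} - T. c l * \<eta> l)" .
  qed
qed

end

section \<open>Compression of a positive semidefinite combination\<close>

text \<open>\<open>decomp\<close> factors the positive semidefinite combination through the vectors
  \<open>y\<close>, \<open>K\<close> is an upper frame bound, and \<open>hop\<close> says that the
  off-diagonal kernel matrix has operator norm at most \<open>h\<close>.\<close>

locale sdp_point = near_orth +
  fixes c :: "nat \<Rightarrow> real" and y :: "nat \<Rightarrow> nat \<Rightarrow> real" and K h :: real
  assumes decomp: "\<And>a b. (\<Sum>l<k. c l * (dot p (d l) a * dot p (d l) b)) = (\<Sum>t<p. dot p (y t) a * dot p (y t) b)"
    and frame: "\<And>x. (\<Sum>l<k. (dot p x (d l))\<^sup>2) \<le> K * dot p x x" and K: "K \<ge> 0"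
    and hop: "\<And>b. (\<Sum>l<k. (\<Sum>m\<in>{..<k} - {l}. hh p (d l) (d m) * b m)\<^sup>2) \<le> h\<^sup>2 * (\<Sum>m<k. (b m)\<^sup>2)" and h: "h \<ge> 0"
begin

definition N where "N = {..<k} - T"
definition s where "s = (\<Sum>t<p. dot p (res (y t)) (res (y t)))"
definition C where "C = (\<Sum>m\<in>N. (c m)\<^sup>2)"

lemma finN: "finite N" and N_lt: "l \<in> N \<Longrightarrow> l < k" and N_notT: "l \<in> N \<Longrightarrow> l \<notin> T" and cardN: "card N \<le> k"
  using card_mono[of "{..<k}" N] by (auto simp: N_def)

lemma s0: "s \<ge> 0" by (simp add: s_def sum_nonneg ip_self_nonneg)
lemma C0: "C \<ge> 0" by (simp add: C_def sum_nonneg)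

text \<open>Both sides describe the compression to the complement of the span of \<open>T\<close>:
  \<open>res\<close> is self-adjoint and annihilates the vectors of \<open>T\<close>, so only
  \<open>N\<close> survives.\<close>

lemma star: "(\<Sum>m\<in>N. c m * (dot p (res (d m)) a * dot p (res (d m)) b)) = (\<Sum>t<p. dot p (res (y t)) a * dot p (res (y t)) b)"
proof -
  have "(\<Sum>m\<in>N. c m * (dot p (res (d m)) a * dot p (res (d m)) b)) = (\<Sum>m<k. c m * (dot p (res (d m)) a * dot p (res (d m)) b))"
    using T by (intro sum.mono_neutral_left) (auto simp: N_def res_T)
  also have "\<dots> = (\<Sum>t<p. dot p (res (y t)) a * dot p (res (y t)) b)"
    unfolding res_swap by (rule decomp)
  finally show ?thesis .
qed

lemma star_sq: "(\<Sum>m\<in>N. c m * (dot p (res (d m)) a)\<^sup>2) = (\<Sum>t<p. (dot p (res (y t)) a)\<^sup>2)"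
  using star[of a a] by (simp add: power2_eq_square)

lemma s_eq: "s = (\<Sum>m\<in>N. c m * dot p (res (d m)) (res (d m)))"
proof -
  let ?e = "\<lambda>i j. if j = i then 1 else 0 :: real"
  have e: "dot p x x = (\<Sum>i<p. (dot p x (?e i))\<^sup>2)" for x
    by (subst sum_dot_unit_sq[symmetric]) (intro sum.cong refl arg_cong[where f = "\<lambda>z. z\<^sup>2"] ip_commute)
  have "s = (\<Sum>t<p. \<Sum>i<p. (dot p (res (y t)) (?e i))\<^sup>2)" unfolding s_def by (intro sum.cong refl e)
  also have "\<dots> = (\<Sum>i<p. \<Sum>t<p. (dot p (res (y t)) (?e i))\<^sup>2)" by (rule sum.swap)
  also have "\<dots> = (\<Sum>i<p. \<Sum>m\<in>N. c m * (dot p (res (d m)) (?e i))\<^sup>2)" unfolding star_sq ..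
  also have "\<dots> = (\<Sum>m\<in>N. \<Sum>i<p. c m * (dot p (res (d m)) (?e i))\<^sup>2)" by (rule sum.swap)
  also have "\<dots> = (\<Sum>m\<in>N. c m * dot p (res (d m)) (res (d m)))"
    by (intro sum.cong refl) (subst e, rule sum_distrib_left[symmetric])
  finally show ?thesis .
qed

text \<open>The left side is the squared Frobenius norm of the compression, which for a positive
  semidefinite matrix is at most its squared trace.\<close>

lemma gram_le: "(\<Sum>l\<in>N. \<Sum>m\<in>N. c l * c m * (dot p (res (d l)) (res (d m)))\<^sup>2) \<le> s\<^sup>2"
proof -
  have "(\<Sum>l\<in>N. \<Sum>m\<in>N. c l * c m * (dot p (res (d l)) (res (d m)))\<^sup>2) = (\<Sum>l\<in>N. c l * (\<Sum>m\<in>N. c m * (dot p (res (d m)) (res (d l)))\<^sup>2))"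
    by (simp add: sum_distrib_left mult.assoc ip_commute)
  also have "\<dots> = (\<Sum>l\<in>N. \<Sum>t<p. c l * (dot p (res (d l)) (res (y t)))\<^sup>2)"
    unfolding star_sq by (simp add: sum_distrib_left ip_commute)
  also have "\<dots> = (\<Sum>t<p. \<Sum>l\<in>N. c l * (dot p (res (d l)) (res (y t)))\<^sup>2)" by (rule sum.swap)
  also have "\<dots> = (\<Sum>t<p. \<Sum>t'<p. (dot p (res (y t')) (res (y t)))\<^sup>2)" unfolding star_sq ..
  also have "\<dots> \<le> (\<Sum>t<p. \<Sum>t'<p. dot p (res (y t')) (res (y t')) * dot p (res (y t)) (res (y t)))"
    by (intro sum_mono ip_cauchy_schwarz)
  also have "\<dots> = s\<^sup>2" by (simp add: s_def power2_eq_square sum_product mult.commute)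
  finally show ?thesis .
qed

lemma pr_d_bounds:
  assumes "m \<in> N"
  shows "(\<Sum>t\<in>T. (coef (d m) t)\<^sup>2) \<le> 4 * n * \<alpha>\<^sup>2" "(\<Sum>t\<in>T. \<bar>coef (d m) t\<bar>) \<le> 2 * n * \<alpha>" "dot p (pr (d m)) (pr (d m)) \<le> 2 * n * \<alpha>\<^sup>2"
  using T assms by (intro pr_bounds incoh; auto simp: N_def)+

text \<open>Entrywise cost of undoing the compression in a squared off-diagonal inner product:
  \<open>2 * \<alpha> * q + q^2\<close> with \<open>q = 2 * n * \<alpha>^2\<close>, the bound for
  the product of two projections.\<close>

definition \<delta> where "\<delta> = 4 * n * \<alpha>^3 + 4 * n\<^sup>2 * \<alpha>^4"

lemma \<delta>0: "\<delta> \<ge> 0" using \<alpha> by (simp add: \<delta>_def)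

lemma square_diff_le:
  assumes "\<bar>g\<bar> \<le> \<alpha>" "\<bar>q\<bar> \<le> 2 * n * \<alpha>\<^sup>2" shows "\<bar>(g - q)\<^sup>2 - g\<^sup>2\<bar> \<le> \<delta>"
proof -
  have "(g - q)\<^sup>2 - g\<^sup>2 = q * q - 2 * (g * q)" by (simp add: power2_eq_square algebra_simps)
  moreover have "\<bar>q * q\<bar> \<le> (2 * n * \<alpha>\<^sup>2) * (2 * n * \<alpha>\<^sup>2)" unfolding abs_mult using assms by (intro mult_mono) auto
  moreover have "\<bar>g * q\<bar> \<le> \<alpha> * (2 * n * \<alpha>\<^sup>2)" unfolding abs_mult using assms \<alpha> by (intro mult_mono) auto
  moreover have "(2 * n * \<alpha>\<^sup>2) * (2 * n * \<alpha>\<^sup>2) + 2 * (\<alpha> * (2 * n * \<alpha>\<^sup>2)) = \<delta>"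
    by (simp add: \<delta>_def power2_eq_square power3_eq_cube power4_eq_xxxx algebra_simps)
  ultimately show ?thesis by linarith
qed

lemma off_T_sum:
  assumes "l \<in> N" shows "(\<Sum>m\<in>{..<k} - {l}. hh p (d l) (d m) * (if m \<in> N then b m else 0)) = (\<Sum>m\<in>N - {l}. hh p (d l) (d m) * b m)"
proof -
  have "(\<Sum>m\<in>{..<k} - {l}. hh p (d l) (d m) * (if m \<in> N then b m else 0)) = (\<Sum>m\<in>N - {l}. hh p (d l) (d m) * (if m \<in> N then b m else 0))"
    by (rule sum.mono_neutral_right) (auto simp: N_def)
  also have "\<dots> = (\<Sum>m\<in>N - {l}. hh p (d l) (d m) * b m)" by (intro sum.cong) auto
  finally show ?thesis .
qed

lemma hop_N: "(\<Sum>l\<in>N. (\<Sum>m\<in>N - {l}. hh p (d l) (d m) * b m)\<^sup>2) \<le> h\<^sup>2 * (\<Sum>m\<in>N. (b m)\<^sup>2)"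
proof -
  let ?b = "\<lambda>m. if m \<in> N then b m else 0"
  have "(\<Sum>l\<in>N. (\<Sum>m\<in>N - {l}. hh p (d l) (d m) * b m)\<^sup>2) = (\<Sum>l\<in>N. (\<Sum>m\<in>{..<k} - {l}. hh p (d l) (d m) * ?b m)\<^sup>2)"
    by (intro sum.cong refl) (simp only: off_T_sum)
  also have "\<dots> \<le> (\<Sum>l<k. (\<Sum>m\<in>{..<k} - {l}. hh p (d l) (d m) * ?b m)\<^sup>2)"
    by (intro sum_mono2) (auto simp: N_def)
  also have "\<dots> \<le> h\<^sup>2 * (\<Sum>m<k. (?b m)\<^sup>2)" by (rule hop)
  also have "(\<Sum>m<k. (?b m)\<^sup>2) = (\<Sum>m\<in>N. (b m)\<^sup>2)"
    by (rule sum.mono_neutral_cong_right) (auto simp: N_def)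
  finally show ?thesis .
qed

lemma hop_N_ip: "\<bar>\<Sum>l\<in>N. a l * (\<Sum>m\<in>N - {l}. hh p (d l) (d m) * b m)\<bar> \<le> sqrt (\<Sum>l\<in>N. (a l)\<^sup>2) * (h * sqrt (\<Sum>m\<in>N. (b m)\<^sup>2))"
proof -
  have "sqrt (\<Sum>l\<in>N. (\<Sum>m\<in>N - {l}. hh p (d l) (d m) * b m)\<^sup>2) \<le> sqrt (h\<^sup>2 * (\<Sum>m\<in>N. (b m)\<^sup>2))"
    by (intro real_sqrt_le_mono hop_N)
  also have "\<dots> = h * sqrt (\<Sum>m\<in>N. (b m)\<^sup>2)" using h by (simp add: real_sqrt_mult)
  finally show ?thesis
    using abs_sum_mult_le[of a "\<lambda>l. \<Sum>m\<in>N - {l}. hh p (d l) (d m) * b m" N]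
    by (meson mult_left_mono order_trans real_sqrt_ge_zero sum_nonneg zero_le_power2)
qed

lemma l1_le: "(\<Sum>m\<in>N. \<bar>c m\<bar>) \<le> sqrt (real k) * sqrt C"
proof -
  have "(\<Sum>m\<in>N. \<bar>c m\<bar>) \<le> sqrt (real (card N)) * sqrt C" unfolding C_def by (rule sum_abs_le_sqrt[OF finN])
  also have "\<dots> \<le> sqrt (real k) * sqrt C" using cardN C0 by (intro mult_right_mono) auto
  finally show ?thesis .
qed

text \<open>In \<open>gram_le\<close> the diagonal yields almost \<open>C\<close>. Off the diagonal
  the constant part \<open>1 / p\<close> of the squares adds a nonnegative square, the centred
  kernel costs at most \<open>h * C\<close>, and undoing the compression costs at most
  \<open>\<delta> * k * C\<close>. At least a quarter of \<open>C\<close> is left.\<close>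

lemma C_le:
  assumes sm: "4 * n * \<alpha>\<^sup>2 + h + 1 / real p + \<delta> * real k \<le> 3/4"
  shows "sqrt C \<le> 2 * s"
proof -
  let ?hs = "\<Sum>l\<in>N. c l * (\<Sum>m\<in>N - {l}. hh p (d l) (d m) * c m)"
  have pt: "(if l = m then (c l)\<^sup>2 * (1 - 4 * n * \<alpha>\<^sup>2 - 1 / real p) else 0) + c l * c m / real p
      + c l * (if m = l then 0 else hh p (d l) (d m) * c m) - \<delta> * (\<bar>c l\<bar> * \<bar>c m\<bar>) \<le> c l * c m * (dot p (res (d l)) (res (d m)))\<^sup>2"
    if "l \<in> N" "m \<in> N" for l m
  proof (cases "l = m")
    case True
    define q where "q = dot p (pr (d l)) (pr (d l))"
    have q: "q \<le> 2 * n * \<alpha>\<^sup>2" using pr_d_bounds(3)[OF that(1)] by (simp add: q_def)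
    have "1 - 4 * n * \<alpha>\<^sup>2 \<le> 1 - 2 * q" using q by simp
    also have "\<dots> \<le> (1 - q)\<^sup>2" using zero_le_power2[of q] by (simp add: power2_eq_square algebra_simps)
    also have "\<dots> = (dot p (res (d l)) (res (d l)))\<^sup>2" using unit N_lt that by (simp add: dot_res q_def)
    finally have "(c l)\<^sup>2 * (1 - 4 * n * \<alpha>\<^sup>2) \<le> (c l)\<^sup>2 * (dot p (res (d l)) (res (d l)))\<^sup>2" by (intro mult_left_mono) auto
    moreover have "0 \<le> \<delta> * (\<bar>c l\<bar> * \<bar>c m\<bar>)" using \<delta>0 by simp
    ultimately show ?thesis using True by (simp add: power2_eq_square algebra_simps)
  next
    case False
    define g where "g = dot p (d l) (d m)"
    define q where "q = dot p (pr (d l)) (pr (d m))"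
    have g: "\<bar>g\<bar> \<le> \<alpha>" unfolding g_def using that False by (intro incoh N_lt) auto
    have "\<bar>q\<bar> \<le> sqrt (dot p (pr (d l)) (pr (d l))) * sqrt (dot p (pr (d m)) (pr (d m)))" unfolding q_def by (rule ip_cauchy_schwarz_abs)
    also have "\<dots> \<le> sqrt (2 * n * \<alpha>\<^sup>2) * sqrt (2 * n * \<alpha>\<^sup>2)" using pr_d_bounds(3) that by (intro mult_mono real_sqrt_le_mono) (auto simp: ip_self_nonneg)
    also have "\<dots> = 2 * n * \<alpha>\<^sup>2" by simp
    finally have q: "\<bar>q\<bar> \<le> 2 * n * \<alpha>\<^sup>2" .
    have "\<bar>c l * c m * ((g - q)\<^sup>2 - g\<^sup>2)\<bar> \<le> \<bar>c l\<bar> * \<bar>c m\<bar> * \<delta>"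
      unfolding abs_mult by (intro mult_left_mono square_diff_le g q) auto
    then have "c l * c m * g\<^sup>2 - \<delta> * (\<bar>c l\<bar> * \<bar>c m\<bar>) \<le> c l * c m * (g - q)\<^sup>2" by (simp add: algebra_simps)
    then show ?thesis using False by (simp add: dot_res g_def[symmetric] q_def[symmetric] hh_def algebra_simps)
  qed
  have "(\<Sum>l\<in>N. \<Sum>m\<in>N. (if l = m then (c l)\<^sup>2 * (1 - 4 * n * \<alpha>\<^sup>2 - 1 / real p) else 0) + c l * c m / real p
      + c l * (if m = l then 0 else hh p (d l) (d m) * c m) - \<delta> * (\<bar>c l\<bar> * \<bar>c m\<bar>)) \<le> s\<^sup>2"
    using gram_le by (rule order_trans[rotated]) (intro sum_mono pt)
  also have "(\<Sum>l\<in>N. \<Sum>m\<in>N. (if l = m then (c l)\<^sup>2 * (1 - 4 * n * \<alpha>\<^sup>2 - 1 / real p) else 0) + c l * c m / real p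
      + c l * (if m = l then 0 else hh p (d l) (d m) * c m) - \<delta> * (\<bar>c l\<bar> * \<bar>c m\<bar>))
    = C * (1 - 4 * n * \<alpha>\<^sup>2 - 1 / real p) + (\<Sum>l\<in>N. c l)\<^sup>2 / real p + ?hs - \<delta> * (\<Sum>l\<in>N. \<bar>c l\<bar>)\<^sup>2"
  proof -
    have 1: "(\<Sum>l\<in>N. \<Sum>m\<in>N. (if l = m then (c l)\<^sup>2 * (1 - 4 * n * \<alpha>\<^sup>2 - 1 / real p) else 0)) = C * (1 - 4 * n * \<alpha>\<^sup>2 - 1 / real p)"
      using finN by (simp add: C_def sum_distrib_right)
    have 2: "(\<Sum>l\<in>N. \<Sum>m\<in>N. c l * c m / real p) = (\<Sum>l\<in>N. c l)\<^sup>2 / real p"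
      by (simp add: power2_eq_square sum_product sum_divide_distrib)
    have 3: "(\<Sum>l\<in>N. \<Sum>m\<in>N. c l * (if m = l then 0 else hh p (d l) (d m) * c m)) = ?hs"
    proof (intro sum.cong refl)
      fix l assume "l \<in> N"
      have "(\<Sum>m\<in>N. if m = l then 0 else hh p (d l) (d m) * c m) = (\<Sum>m\<in>N - {l}. hh p (d l) (d m) * c m)"
        using finN by (intro sum.mono_neutral_cong_right) auto
      then show "(\<Sum>m\<in>N. c l * (if m = l then 0 else hh p (d l) (d m) * c m)) = c l * (\<Sum>m\<in>N - {l}. hh p (d l) (d m) * c m)"
        by (simp only: sum_distrib_left[symmetric])
    qed
    have 4: "(\<Sum>l\<in>N. \<Sum>m\<in>N. \<delta> * (\<bar>c l\<bar> * \<bar>c m\<bar>)) = \<delta> * (\<Sum>l\<in>N. \<bar>c l\<bar>)\<^sup>2"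
      unfolding power2_eq_square sum_product unfolding sum_distrib_left ..
    show ?thesis by (simp only: sum_subtractf sum.distrib 1 2 3 4)
  qed
  finally have main: "C * (1 - 4 * n * \<alpha>\<^sup>2 - 1 / real p) + (\<Sum>l\<in>N. c l)\<^sup>2 / real p + ?hs - \<delta> * (\<Sum>l\<in>N. \<bar>c l\<bar>)\<^sup>2 \<le> s\<^sup>2" .
  have "\<bar>?hs\<bar> \<le> sqrt C * (h * sqrt C)" using hop_N_ip[of c c] by (simp add: C_def)
  also have "\<dots> = h * C" using C0 by simp
  finally have hs: "- (h * C) \<le> ?hs" by linarith
  have "(\<Sum>l\<in>N. \<bar>c l\<bar>)\<^sup>2 \<le> (sqrt (real k) * sqrt C)\<^sup>2" by (intro power_mono l1_le) (simp add: sum_nonneg)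
  also have "\<dots> = real k * C" using C0 by (simp add: power_mult_distrib)
  finally have "\<delta> * (\<Sum>l\<in>N. \<bar>c l\<bar>)\<^sup>2 \<le> \<delta> * (real k * C)" using \<delta>0 by (intro mult_left_mono)
  moreover have "0 \<le> (\<Sum>l\<in>N. c l)\<^sup>2 / real p" by simp
  ultimately have "C * (1 - 4 * n * \<alpha>\<^sup>2 - 1 / real p) - h * C - \<delta> * (real k * C) \<le> s\<^sup>2"
    using main hs by linarith
  then have "C * (1 - (4 * n * \<alpha>\<^sup>2 + h + 1 / real p + \<delta> * real k)) \<le> s\<^sup>2" by (simp add: algebra_simps)
  moreover have "C * (1/4) \<le> C * (1 - (4 * n * \<alpha>\<^sup>2 + h + 1 / real p + \<delta> * real k))"
    using sm C0 by (intro mult_left_mono) auto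
  ultimately have "C * (1/4) \<le> s\<^sup>2" by (rule order_trans[rotated])
  then have "C \<le> (2 * s)\<^sup>2" by (simp add: power_mult_distrib)
  then show ?thesis using s0 by (simp add: real_le_lsqrt C0)
qed

text \<open>Dual form of \<open>frame\<close>, by Cauchy-Schwarz for the squared norm of the
  combination.\<close>

lemma frame_comb: assumes S: "S \<subseteq> {..<k}" shows "dot p (comb S b d) (comb S b d) \<le> K * (\<Sum>l\<in>S. (b l)\<^sup>2)"
proof -
  define x where "x = comb S b d"
  define X where "X = dot p x x"
  have X0: "X \<ge> 0" by (simp add: X_def ip_self_nonneg)
  have "X = (\<Sum>l\<in>S. b l * dot p x (d l))" unfolding X_def by (subst (2) x_def) (simp add: dot_comb)
  then have "X\<^sup>2 \<le> (\<Sum>l\<in>S. (b l)\<^sup>2) * (\<Sum>l\<in>S. (dot p x (d l))\<^sup>2)" using Cauchy_Schwarz_ineq_sum[of b "\<lambda>l. dot p x (d l)" S] by simp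
  also have "\<dots> \<le> (\<Sum>l\<in>S. (b l)\<^sup>2) * (K * X)"
  proof (intro mult_left_mono)
    have "(\<Sum>l\<in>S. (dot p x (d l))\<^sup>2) \<le> (\<Sum>l<k. (dot p x (d l))\<^sup>2)" using S by (intro sum_mono2) auto
    then show "(\<Sum>l\<in>S. (dot p x (d l))\<^sup>2) \<le> K * X" using frame[of x] by (simp add: X_def)
  qed (simp add: sum_nonneg)
  finally have "X * X \<le> (K * (\<Sum>l\<in>S. (b l)\<^sup>2)) * X" by (simp add: power2_eq_square mult.commute mult.left_commute)
  then have "X \<le> K * (\<Sum>l\<in>S. (b l)\<^sup>2)"
  proof (cases "X > 0")
    case True
    with \<open>X * X \<le> _\<close> show ?thesis by (rule mult_right_le_imp_le)
  next
    case False
    moreover have "0 \<le> K * (\<Sum>l\<in>S. (b l)\<^sup>2)" using K by (simp add: sum_nonneg)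
    ultimately show ?thesis by linarith
  qed
  then show ?thesis by (simp add: X_def x_def)
qed

definition \<Xi> where "\<Xi> = sqrt (32 * n\<^sup>2 * \<alpha>\<^sup>2 * K^3 + 8 * real k * K\<^sup>2 * n\<^sup>2 * \<alpha>^4)"

text \<open>The difference of squares is \<open>A2 m - 2 * A1 m\<close>, quadratic and linear in the
  projection of \<open>d m\<close>. Writing the linear part through the auxiliary vectors
  \<open>z t\<close> makes it a combination of inner products with \<open>d m\<close>, so that
  \<open>frame\<close> controls its sum over all \<open>m\<close> at once.\<close>

lemma projection_error:
  assumes \<rho>: "\<And>l. l \<in> N \<Longrightarrow> \<bar>\<rho> l\<bar> \<le> R" and R: "R \<ge> 0"
  shows "sqrt (\<Sum>m\<in>N. (\<Sum>l\<in>N. \<rho> l * ((dot p (d l) (res (d m)))\<^sup>2 - (dot p (d l) (d m))\<^sup>2))\<^sup>2) \<le> R * \<Xi>"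
proof -
  define z where "z t = comb N (\<lambda>l. \<rho> l * dot p (d l) (d t)) d" for t
  define A1 where "A1 m = (\<Sum>l\<in>N. \<rho> l * (dot p (d l) (pr (d m)) * dot p (d l) (d m)))" for m
  define A2 where "A2 m = (\<Sum>l\<in>N. \<rho> l * (dot p (d l) (pr (d m)))\<^sup>2)" for m
  have E: "(\<Sum>l\<in>N. \<rho> l * ((dot p (d l) (res (d m)))\<^sup>2 - (dot p (d l) (d m))\<^sup>2)) = A2 m - 2 * A1 m" for m
    unfolding A1_def A2_def res_def[of "d m"] ip_diff_right sum_distrib_left sum_subtractf[symmetric]
    by (intro sum.cong) (auto simp: power2_eq_square algebra_simps)
  have NS: "N \<subseteq> {..<k}" by (auto simp: N_def)
  have frN: "(\<Sum>l\<in>N. (dot p x (d l))\<^sup>2) \<le> K * dot p x x" for x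
    using frame[of x] sum_mono2[of "{..<k}" N "\<lambda>l. (dot p x (d l))\<^sup>2"] NS by auto
  have z: "dot p (z t) (z t) \<le> K\<^sup>2 * R\<^sup>2" if t: "t \<in> T" for t
  proof -
    have tk: "t < k" using t T by auto
    have "(\<Sum>l\<in>N. (\<rho> l * dot p (d l) (d t))\<^sup>2) \<le> (\<Sum>l\<in>N. R\<^sup>2 * (dot p (d t) (d l))\<^sup>2)"
      unfolding power_mult_distrib ip_commute[of _ _ "d t"]
      using \<rho> R by (intro sum_mono mult_right_mono) (auto simp: abs_le_square_iff[symmetric])
    also have "\<dots> = R\<^sup>2 * (\<Sum>l\<in>N. (dot p (d t) (d l))\<^sup>2)" by (simp add: sum_distrib_left)
    also have "\<dots> \<le> R\<^sup>2 * (K * 1)" using frN[of "d t"] unit[OF tk] by (intro mult_left_mono) auto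
    finally have "K * (\<Sum>l\<in>N. (\<rho> l * dot p (d l) (d t))\<^sup>2) \<le> K * (R\<^sup>2 * (K * 1))" using K by (intro mult_left_mono)
    then show ?thesis using frame_comb[OF NS, of "\<lambda>l. \<rho> l * dot p (d l) (d t)"] by (simp add: z_def power2_eq_square algebra_simps)
  qed
  have A1z: "A1 m = (\<Sum>t\<in>T. coef (d m) t * dot p (z t) (d m))" for m
  proof -
    have "A1 m = (\<Sum>l\<in>N. \<Sum>t\<in>T. coef (d m) t * (\<rho> l * dot p (d l) (d t) * dot p (d l) (d m)))"
      unfolding A1_def pr_def dot_comb by (simp add: sum_distrib_left sum_distrib_right algebra_simps)
    also have "\<dots> = (\<Sum>t\<in>T. \<Sum>l\<in>N. coef (d m) t * (\<rho> l * dot p (d l) (d t) * dot p (d l) (d m)))" by (rule sum.swap)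
    also have "\<dots> = (\<Sum>t\<in>T. coef (d m) t * dot p (z t) (d m))" unfolding z_def dot_comb sum_distrib_left ..
    finally show ?thesis .
  qed
  have "(\<Sum>m\<in>N. (A1 m)\<^sup>2) \<le> (\<Sum>m\<in>N. (4 * n * \<alpha>\<^sup>2) * (\<Sum>t\<in>T. (dot p (z t) (d m))\<^sup>2))"
  proof (intro sum_mono)
    fix m assume m: "m \<in> N"
    have "(A1 m)\<^sup>2 \<le> (\<Sum>t\<in>T. (coef (d m) t)\<^sup>2) * (\<Sum>t\<in>T. (dot p (z t) (d m))\<^sup>2)" unfolding A1z by (rule Cauchy_Schwarz_ineq_sum)
    also have "\<dots> \<le> (4 * n * \<alpha>\<^sup>2) * (\<Sum>t\<in>T. (dot p (z t) (d m))\<^sup>2)" using pr_d_bounds(1)[OF m] by (intro mult_right_mono) (auto simp: sum_nonneg)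
    finally show "(A1 m)\<^sup>2 \<le> (4 * n * \<alpha>\<^sup>2) * (\<Sum>t\<in>T. (dot p (z t) (d m))\<^sup>2)" .
  qed
  also have "\<dots> = (4 * n * \<alpha>\<^sup>2) * (\<Sum>t\<in>T. \<Sum>m\<in>N. (dot p (z t) (d m))\<^sup>2)" unfolding sum_distrib_left[symmetric] by (subst sum.swap) simp
  also have "\<dots> \<le> (4 * n * \<alpha>\<^sup>2) * (\<Sum>t\<in>T. K * (K\<^sup>2 * R\<^sup>2))"
    using z frN K by (intro mult_left_mono sum_mono) (auto intro!: order_trans[OF frN] mult_left_mono)
  also have "\<dots> = 4 * n\<^sup>2 * \<alpha>\<^sup>2 * K^3 * R\<^sup>2" by (simp add: power2_eq_square power3_eq_cube)
  finally have S1: "(\<Sum>m\<in>N. (A1 m)\<^sup>2) \<le> 4 * n\<^sup>2 * \<alpha>\<^sup>2 * K^3 * R\<^sup>2" .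
  have "(A2 m)\<^sup>2 \<le> (R * (K * (2 * n * \<alpha>\<^sup>2)))\<^sup>2" if m: "m \<in> N" for m
  proof -
    have "\<bar>A2 m\<bar> \<le> (\<Sum>l\<in>N. \<bar>\<rho> l * (dot p (d l) (pr (d m)))\<^sup>2\<bar>)" unfolding A2_def by (rule sum_abs)
    also have "\<dots> \<le> (\<Sum>l\<in>N. R * (dot p (pr (d m)) (d l))\<^sup>2)"
      unfolding abs_mult ip_commute[of _ _ "pr (d m)"] using \<rho> by (intro sum_mono) (auto intro: mult_right_mono)
    also have "\<dots> \<le> R * (K * dot p (pr (d m)) (pr (d m)))" unfolding sum_distrib_left[symmetric] using R by (intro mult_left_mono frN)
    also have "\<dots> \<le> R * (K * (2 * n * \<alpha>\<^sup>2))" using R K pr_d_bounds(3)[OF m] by (intro mult_left_mono)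
    finally have "\<bar>A2 m\<bar>\<^sup>2 \<le> (R * (K * (2 * n * \<alpha>\<^sup>2)))\<^sup>2" by (intro power_mono) auto
    then show ?thesis by simp
  qed
  then have "(\<Sum>m\<in>N. (A2 m)\<^sup>2) \<le> real (card N) * (R * (K * (2 * n * \<alpha>\<^sup>2)))\<^sup>2" using sum_mono[of N "\<lambda>m. (A2 m)\<^sup>2" "\<lambda>_. (R * (K * (2 * n * \<alpha>\<^sup>2)))\<^sup>2"] by simp
  also have "\<dots> \<le> real k * (R * (K * (2 * n * \<alpha>\<^sup>2)))\<^sup>2" using cardN by (intro mult_right_mono) auto
  finally have S2: "(\<Sum>m\<in>N. (A2 m)\<^sup>2) \<le> real k * (R * (K * (2 * n * \<alpha>\<^sup>2)))\<^sup>2" .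
  have "(A2 m - 2 * A1 m)\<^sup>2 \<le> 2 * (A2 m)\<^sup>2 + 8 * (A1 m)\<^sup>2" for m
    using zero_le_power2[of "A2 m + 2 * A1 m"] by (simp add: power2_eq_square algebra_simps)
  then have "(\<Sum>m\<in>N. (A2 m - 2 * A1 m)\<^sup>2) \<le> (\<Sum>m\<in>N. 2 * (A2 m)\<^sup>2 + 8 * (A1 m)\<^sup>2)" by (intro sum_mono)
  also have "\<dots> = 2 * (\<Sum>m\<in>N. (A2 m)\<^sup>2) + 8 * (\<Sum>m\<in>N. (A1 m)\<^sup>2)" by (simp add: sum.distrib sum_distrib_left)
  also have "\<dots> \<le> 2 * (real k * (R * (K * (2 * n * \<alpha>\<^sup>2)))\<^sup>2) + 8 * (4 * n\<^sup>2 * \<alpha>\<^sup>2 * K^3 * R\<^sup>2)" using S1 S2 by simp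
  also have "\<dots> = R\<^sup>2 * (32 * n\<^sup>2 * \<alpha>\<^sup>2 * K^3 + 8 * real k * K\<^sup>2 * n\<^sup>2 * \<alpha>^4)"
    by (simp add: power2_eq_square power4_eq_xxxx algebra_simps)
  finally have "sqrt (\<Sum>m\<in>N. (A2 m - 2 * A1 m)\<^sup>2) \<le> sqrt (R\<^sup>2 * (32 * n\<^sup>2 * \<alpha>\<^sup>2 * K^3 + 8 * real k * K\<^sup>2 * n\<^sup>2 * \<alpha>^4))" by (rule real_sqrt_le_mono)
  then show ?thesis unfolding E \<Xi>_def using R by (simp add: real_sqrt_mult)
qed

text \<open>The trace pairing of the compression with the matrix of weights \<open>\<rho>\<close>,
  computed once through the factors \<open>y\<close> and once through the coefficients
  \<open>c\<close>.\<close>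

lemma qform_eq: "(\<Sum>t<p. \<Sum>l\<in>N. \<rho> l * (dot p (d l) (res (y t)))\<^sup>2) = (\<Sum>m\<in>N. c m * (\<Sum>l\<in>N. \<rho> l * (dot p (d l) (res (d m)))\<^sup>2))"
proof -
  have "(\<Sum>t<p. \<Sum>l\<in>N. \<rho> l * (dot p (d l) (res (y t)))\<^sup>2) = (\<Sum>l\<in>N. \<Sum>t<p. \<rho> l * (dot p (d l) (res (y t)))\<^sup>2)" by (rule sum.swap)
  also have "\<dots> = (\<Sum>l\<in>N. \<rho> l * (\<Sum>m\<in>N. c m * (dot p (res (d m)) (d l))\<^sup>2))" unfolding star_sq by (simp add: sum_distrib_left ip_commute)
  also have "\<dots> = (\<Sum>l\<in>N. \<Sum>m\<in>N. c m * (\<rho> l * (dot p (d l) (res (d m)))\<^sup>2))" by (simp add: sum_distrib_left ip_commute mult.left_commute)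
  also have "\<dots> = (\<Sum>m\<in>N. \<Sum>l\<in>N. c m * (\<rho> l * (dot p (d l) (res (d m)))\<^sup>2))" by (rule sum.swap)
  finally show ?thesis by (simp only: sum_distrib_left)
qed

text \<open>Up to errors the pairing is that of \<open>c\<close> with \<open>(1 + H) \<rho>\<close>,
  where \<open>H\<close> is the off-diagonal kernel matrix. Besides the projection error there is
  the constant part \<open>1 / p\<close> of the squared inner products: summed over all pairs it
  gives the product of two sums, and its removal on the diagonal gives the term with
  \<open>sqrt (real k)\<close>.\<close>

lemma qform_approx:
  assumes \<rho>: "\<And>l. l \<in> N \<Longrightarrow> \<bar>\<rho> l\<bar> \<le> R" and R: "R \<ge> 0"
  shows "\<bar>(\<Sum>t<p. \<Sum>l\<in>N. \<rho> l * (dot p (d l) (res (y t)))\<^sup>2) - (\<Sum>m\<in>N. c m * (\<rho> m + (\<Sum>l\<in>N - {m}. hh p (d m) (d l) * \<rho> l)))\<bar>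
     \<le> sqrt C * (R * \<Xi> + sqrt (real k) * R / real p) + \<bar>\<Sum>m\<in>N. c m\<bar> * \<bar>\<Sum>l\<in>N. \<rho> l\<bar> / real p"
proof -
  define E where "E m = (\<Sum>l\<in>N. \<rho> l * ((dot p (d l) (res (d m)))\<^sup>2 - (dot p (d l) (d m))\<^sup>2))" for m
  let ?S = "\<Sum>l\<in>N. \<rho> l"
  have e: "(\<Sum>l\<in>N. \<rho> l * (dot p (d l) (res (d m)))\<^sup>2) = (\<rho> m + (\<Sum>l\<in>N - {m}. hh p (d m) (d l) * \<rho> l)) + E m + ?S / real p - \<rho> m / real p"
    if m: "m \<in> N" for m
  proof -
    have "(\<Sum>l\<in>N. \<rho> l * (dot p (d l) (res (d m)))\<^sup>2) = E m + (\<Sum>l\<in>N. \<rho> l * (dot p (d l) (d m))\<^sup>2)"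
      by (simp add: E_def sum.distrib[symmetric] algebra_simps)
    also have "(\<Sum>l\<in>N. \<rho> l * (dot p (d l) (d m))\<^sup>2) = \<rho> m + (\<Sum>l\<in>N - {m}. \<rho> l * (dot p (d l) (d m))\<^sup>2)"
      using unit[OF N_lt[OF m]] by (simp add: sum.remove[OF finN m])
    also have "(\<Sum>l\<in>N - {m}. \<rho> l * (dot p (d l) (d m))\<^sup>2) = (\<Sum>l\<in>N - {m}. hh p (d m) (d l) * \<rho> l + \<rho> l / real p)"
      by (intro sum.cong refl) (simp add: hh_def ip_commute algebra_simps)
    also have "\<dots> = (\<Sum>l\<in>N - {m}. hh p (d m) (d l) * \<rho> l) + (?S - \<rho> m) / real p"
      by (simp add: sum.distrib sum_divide_distrib[symmetric] sum.remove[OF finN m])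
    finally show ?thesis by (simp add: diff_divide_distrib)
  qed
  have "(\<Sum>m\<in>N. c m * (\<Sum>l\<in>N. \<rho> l * (dot p (d l) (res (d m)))\<^sup>2)) = (\<Sum>m\<in>N. c m * (\<rho> m + (\<Sum>l\<in>N - {m}. hh p (d m) (d l) * \<rho> l))
     + c m * E m + c m * ?S / real p - c m * (\<rho> m / real p))"
    by (intro sum.cong refl) (simp add: e algebra_simps)
  also have "\<dots> = (\<Sum>m\<in>N. c m * (\<rho> m + (\<Sum>l\<in>N - {m}. hh p (d m) (d l) * \<rho> l))) + (\<Sum>m\<in>N. c m * E m) + (\<Sum>m\<in>N. c m) * ?S / real p - (\<Sum>m\<in>N. c m * (\<rho> m / real p))"
    by (simp only: sum.distrib sum_subtractf sum_distrib_right sum_divide_distrib)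
  finally have "(\<Sum>t<p. \<Sum>l\<in>N. \<rho> l * (dot p (d l) (res (y t)))\<^sup>2) - (\<Sum>m\<in>N. c m * (\<rho> m + (\<Sum>l\<in>N - {m}. hh p (d m) (d l) * \<rho> l)))
     = (\<Sum>m\<in>N. c m * E m) + (\<Sum>m\<in>N. c m) * ?S / real p - (\<Sum>m\<in>N. c m * (\<rho> m / real p))"
    unfolding qform_eq by simp
  moreover have "\<bar>\<Sum>m\<in>N. c m * E m\<bar> \<le> sqrt C * (R * \<Xi>)"
  proof -
    have "\<bar>\<Sum>m\<in>N. c m * E m\<bar> \<le> sqrt C * sqrt (\<Sum>m\<in>N. (E m)\<^sup>2)" unfolding C_def by (rule abs_sum_mult_le)
    also have "\<dots> \<le> sqrt C * (R * \<Xi>)" unfolding E_def using C0 by (intro mult_left_mono projection_error \<rho> R) auto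
    finally show ?thesis .
  qed
  moreover have "\<bar>\<Sum>m\<in>N. c m * (\<rho> m / real p)\<bar> \<le> sqrt C * (sqrt (real k) * R / real p)"
  proof -
    have "\<bar>\<Sum>m\<in>N. c m * (\<rho> m / real p)\<bar> \<le> sqrt C * (sqrt (real (card N)) * (R / real p))"
      unfolding C_def using \<rho> R by (intro abs_sum_mult_le_sup finN) (auto intro: divide_right_mono)
    also have "\<dots> \<le> sqrt C * (sqrt (real k) * (R / real p))" using cardN R C0 by (intro mult_left_mono mult_right_mono) auto
    finally show ?thesis by simp
  qed
  moreover have "\<bar>(\<Sum>m\<in>N. c m) * ?S / real p\<bar> = \<bar>\<Sum>m\<in>N. c m\<bar> * \<bar>?S\<bar> / real p" by (simp add: abs_mult)
  ultimately show ?thesis unfolding distrib_left by linarith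
qed

end

context near_orth
begin

lemma hh_d_bound: "l < k \<Longrightarrow> m < k \<Longrightarrow> l \<noteq> m \<Longrightarrow> 1 / real p \<le> \<alpha>\<^sup>2 \<Longrightarrow> \<bar>hh p (d l) (d m)\<bar> \<le> \<alpha>\<^sup>2"
proof -
  assume a: "l < k" "m < k" "l \<noteq> m" "1 / real p \<le> \<alpha>\<^sup>2"
  have "(dot p (d l) (d m))\<^sup>2 \<le> \<alpha>\<^sup>2" using power_mono[OF incoh[OF a(1-3)], of 2] by simp
  then show ?thesis unfolding hh_def using a(4) zero_le_power2[of "dot p (d l) (d m)"]
    divide_nonneg_nonneg[of 1 "real p"] abs_le_iff by linarith
qed

text \<open>All the weight in \<open>nonneg_on_T\<close> is put on \<open>m\<close>, and nothing
  leaks since the coefficients vanish outside \<open>T\<close>.\<close>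

lemma coef_nonneg:
  assumes psd: "\<And>x. 0 \<le> (\<Sum>l<k. c l * (dot p (d l) x)\<^sup>2)" and c0: "\<And>l. l \<in> {..<k} - T \<Longrightarrow> c l = 0" and m: "m \<in> T"
  shows "0 \<le> c m"
proof -
  obtain \<eta> where "0 \<le> (\<Sum>t\<in>T. (if t = m then 1 else 0) * c t) + (\<Sum>l\<in>{..<k} - T. c l * \<eta> l)"
    by (rule nonneg_on_T[OF psd, of "\<lambda>t. if t = m then 1 else 0" 1]) (auto split: if_splits)
  moreover have "(\<Sum>t\<in>T. (if t = m then 1 else 0) * c t) = (\<Sum>t\<in>T. if t = m then c t else 0)" by (intro sum.cong) auto
  ultimately show ?thesis using c0 m finT by simp
qed

end

section \<open>The share of the objective outside \<open>T\<close> and the resulting gap\<close>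

locale sdp_cert = sdp_point +
  fixes u :: "nat \<Rightarrow> real" and \<tau> E2 \<rho>0 \<mu> \<nu> :: real
  assumes u_inc: "\<And>l. l < k \<Longrightarrow> \<bar>dot p u (d l)\<bar> \<le> \<alpha>"
    and p\<alpha>: "1 / real p \<le> \<alpha>\<^sup>2"
    and e_sup: "\<And>m. m \<in> {..<k} - T \<Longrightarrow> \<bar>evec p k u d m\<bar> \<le> \<tau>" and \<tau>: "\<tau> \<ge> 0"
    and e_l2: "(\<Sum>m<k. (evec p k u d m)\<^sup>2) \<le> E2\<^sup>2" and E2: "E2 \<ge> 0"
    and rsum: "\<bar>\<Sum>l<k. hh p u (d l)\<bar> \<le> \<rho>0"
    and wop: "\<And>x. (\<Sum>l\<in>{..<k} - T. hh p u (d l) * (dot p x (d l))\<^sup>2) \<le> \<mu> * dot p x x + \<nu> * (dot p u x)\<^sup>2"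
    and \<mu>: "\<mu> \<ge> 0" and \<nu>: "0 \<le> \<nu>" "\<nu> < 1"
    and sm1: "4 * n * \<alpha>\<^sup>2 + h + 1 / real p + (4 * n * \<alpha>^3 + 4 * n\<^sup>2 * \<alpha>^4) * real k \<le> 3/4"
    and sm2: "4 * sqrt (real k) * n * \<alpha>\<^sup>2 \<le> 1"
begin

lemma sC: "sqrt C \<le> 2 * s" using C_le sm1 by (simp add: \<delta>_def)

lemma hu: "l < k \<Longrightarrow> \<bar>hh p u (d l)\<bar> \<le> \<alpha>\<^sup>2"
proof -
  assume a: "l < k"
  have "(dot p u (d l))\<^sup>2 \<le> \<alpha>\<^sup>2" using power_mono[OF u_inc[OF a], of 2] by simp
  then show ?thesis unfolding hh_def using p\<alpha> zero_le_power2[of "dot p u (d l)"]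
    divide_nonneg_nonneg[of 1 "real p"] abs_le_iff by linarith
qed

text \<open>The trace \<open>s\<close> weighs \<open>c m\<close> by the squared norm of
  \<open>res (d m)\<close>, which differs from 1 only by that of the projection.\<close>

lemma csum: "\<bar>(\<Sum>m\<in>N. c m) - s\<bar> \<le> 4 * sqrt (real k) * n * \<alpha>\<^sup>2 * s"
proof -
  have "(\<Sum>m\<in>N. c m) - s = (\<Sum>m\<in>N. c m * dot p (pr (d m)) (pr (d m)))"
    unfolding s_eq sum_subtractf[symmetric] using unit N_lt
    by (intro sum.cong refl) (simp add: dot_res algebra_simps)
  also have "\<bar>\<dots>\<bar> \<le> sqrt C * (sqrt (real (card N)) * (2 * n * \<alpha>\<^sup>2))"
    unfolding C_def using pr_d_bounds(3) by (intro abs_sum_mult_le_sup finN) (auto simp: ip_self_nonneg)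
  also have "\<dots> \<le> (2 * s) * (sqrt (real k) * (2 * n * \<alpha>\<^sup>2))"
    using cardN by (intro mult_mono sC mult_right_mono) (auto simp: s0)
  finally show ?thesis by (simp add: algebra_simps)
qed

lemma csum_abs: "\<bar>\<Sum>m\<in>N. c m\<bar> \<le> 2 * s"
proof -
  have "4 * sqrt (real k) * n * \<alpha>\<^sup>2 * s \<le> 1 * s" by (intro mult_right_mono sm2 s0)
  then show ?thesis using csum s0 by linarith
qed

definition X where "X = (\<Sum>m\<in>N. c m * (dot p u (d m))\<^sup>2)"

definition Z where "Z = \<mu> + 2 * \<nu> * sqrt (real k) * (4 * n * \<alpha>^3 + 4 * n\<^sup>2 * \<alpha>^4) + \<tau> * K + 2 * h * E2
   + 2 * (\<tau> * \<Xi> + sqrt (real k) * \<tau> / real p) + 2 * real k * \<tau> / real p + 2 * sqrt (real k) * n * \<alpha>^4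
   + 2 * (\<alpha>\<^sup>2 * \<Xi> + sqrt (real k) * \<alpha>\<^sup>2 / real p) + 2 * (\<rho>0 + n * \<alpha>\<^sup>2) / real p + 2 / real p"

lemma \<Xi>0: "\<Xi> \<ge> 0" using K by (simp add: \<Xi>_def)

text \<open>\<open>qform_approx\<close> is used twice: the form with weights \<open>r\<close> pairs
  \<open>c\<close> with \<open>r + e - g\<close>, the form with weights \<open>e\<close> pairs it
  with \<open>e + H e\<close>, and the difference eliminates the pairing with \<open>e\<close>. The
  first form is bounded by \<open>wop\<close>, the second by \<open>\<tau>\<close> and the frame
  bound. The component along \<open>u\<close> allowed in \<open>wop\<close> reproduces
  \<open>X\<close> itself, which accounts for the factor \<open>1 - \<nu>\<close>.\<close>

lemma X_le: "X * (1 - \<nu>) \<le> s * Z"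
proof -
  let ?r = "\<lambda>l. hh p u (d l)" and ?e = "evec p k u d"
  let ?QF = "\<lambda>\<rho>. \<Sum>t<p. \<Sum>l\<in>N. \<rho> l * (dot p (d l) (res (y t)))\<^sup>2"
  have NT: "N = {..<k} - T" by (rule N_def)
  have rb: "\<bar>?r l\<bar> \<le> \<alpha>\<^sup>2" if "l \<in> N" for l using hu N_lt that by auto
  have eb: "\<bar>?e l\<bar> \<le> \<tau>" if "l \<in> N" for l using e_sup that by (auto simp: NT)
  \<comment> \<open>\<open>evec\<close> sums over all other indices, whereas the forms live on
    \<open>N\<close>; this is the part contributed by \<open>T\<close>.\<close>
  define g where "g m = (\<Sum>l\<in>T. hh p u (d l) * hh p (d l) (d m))" for m
  have dec: "(\<Sum>l\<in>N - {m}. hh p (d m) (d l) * ?r l) = ?e m - g m" if m: "m \<in> N" for m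
  proof -
    have "{..<k} - {m} = (N - {m}) \<union> T" "(N - {m}) \<inter> T = {}" using T m by (auto simp: NT)
    then have "?e m = (\<Sum>l\<in>N - {m}. hh p u (d l) * hh p (d l) (d m)) + g m"
      unfolding evec_def g_def using finN finT by (simp add: sum.union_disjoint)
    moreover have "(\<Sum>l\<in>N - {m}. hh p u (d l) * hh p (d l) (d m)) = (\<Sum>l\<in>N - {m}. hh p (d m) (d l) * ?r l)"
      by (intro sum.cong refl) (simp add: hh_commute[of p "d m"])
    ultimately show ?thesis by simp
  qed
  have gb: "\<bar>g m\<bar> \<le> n * \<alpha>^4" if m: "m \<in> N" for m
  proof -
    have "\<bar>g m\<bar> \<le> (\<Sum>l\<in>T. \<bar>hh p u (d l) * hh p (d l) (d m)\<bar>)" unfolding g_def by (rule sum_abs)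
    also have "\<dots> \<le> (\<Sum>l\<in>T. \<alpha>\<^sup>2 * \<alpha>\<^sup>2)"
      unfolding abs_mult using T m N_notT[OF m] by (intro sum_mono mult_mono hu hh_d_bound p\<alpha>) (auto simp: NT)
    finally show ?thesis by (simp add: power2_eq_square power4_eq_xxxx mult.assoc)
  qed
  have rs: "\<bar>\<Sum>l\<in>N. ?r l\<bar> \<le> \<rho>0 + n * \<alpha>\<^sup>2"
  proof -
    have "(\<Sum>l<k. ?r l) = (\<Sum>l\<in>N. ?r l) + (\<Sum>l\<in>T. ?r l)" unfolding NT by (rule sum.subset_diff) (use T in auto)
    moreover have "\<bar>\<Sum>l\<in>T. ?r l\<bar> \<le> n * \<alpha>\<^sup>2"
    proof -
      have "(\<Sum>l\<in>T. \<bar>?r l\<bar>) \<le> (\<Sum>l\<in>T. \<alpha>\<^sup>2)" using hu T by (intro sum_mono) auto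
      then show ?thesis by (intro order_trans[OF sum_abs]) simp
    qed
    ultimately show ?thesis using rsum by linarith
  qed
  have es: "\<bar>\<Sum>l\<in>N. ?e l\<bar> \<le> real k * \<tau>"
  proof -
    have "\<bar>\<Sum>l\<in>N. ?e l\<bar> \<le> (\<Sum>l\<in>N. \<tau>)" by (intro order_trans[OF sum_abs] sum_mono eb)
    also have "\<dots> \<le> real k * \<tau>" using cardN \<tau> by (simp add: mult_right_mono)
    finally show ?thesis .
  qed
  have ss: "sqrt C \<ge> 0" using C0 by simp
  have scale: "sqrt C * a \<le> 2 * s * a" if "a \<ge> 0" for a using sC that by (rule mult_right_mono)
  have 1: "\<bar>?QF ?r - (\<Sum>m\<in>N. c m * (?r m + (?e m - g m)))\<bar> \<le> 2 * s * (\<alpha>\<^sup>2 * \<Xi> + sqrt (real k) * \<alpha>\<^sup>2 / real p) + 2 * s * (\<rho>0 + n * \<alpha>\<^sup>2) / real p"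
  proof -
    have "(\<Sum>m\<in>N. c m * (?r m + (?e m - g m))) = (\<Sum>m\<in>N. c m * (?r m + (\<Sum>l\<in>N - {m}. hh p (d m) (d l) * ?r l)))"
      by (intro sum.cong refl) (simp add: dec)
    then have "\<bar>?QF ?r - (\<Sum>m\<in>N. c m * (?r m + (?e m - g m)))\<bar> \<le> sqrt C * (\<alpha>\<^sup>2 * \<Xi> + sqrt (real k) * \<alpha>\<^sup>2 / real p) + \<bar>\<Sum>m\<in>N. c m\<bar> * \<bar>\<Sum>l\<in>N. ?r l\<bar> / real p"
      using qform_approx[OF rb] by simp
    also have "\<dots> \<le> 2 * s * (\<alpha>\<^sup>2 * \<Xi> + sqrt (real k) * \<alpha>\<^sup>2 / real p) + 2 * s * (\<rho>0 + n * \<alpha>\<^sup>2) / real p"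
      using csum_abs rs s0 \<Xi>0 by (intro add_mono scale divide_right_mono mult_mono) auto
    finally show ?thesis .
  qed
  have 2: "\<bar>?QF ?e - (\<Sum>m\<in>N. c m * (?e m + (\<Sum>l\<in>N - {m}. hh p (d m) (d l) * ?e l)))\<bar> \<le> 2 * s * (\<tau> * \<Xi> + sqrt (real k) * \<tau> / real p) + 2 * s * (real k * \<tau>) / real p"
  proof -
    have "\<bar>?QF ?e - (\<Sum>m\<in>N. c m * (?e m + (\<Sum>l\<in>N - {m}. hh p (d m) (d l) * ?e l)))\<bar> \<le> sqrt C * (\<tau> * \<Xi> + sqrt (real k) * \<tau> / real p) + \<bar>\<Sum>m\<in>N. c m\<bar> * \<bar>\<Sum>l\<in>N. ?e l\<bar> / real p"
      by (rule qform_approx[OF eb \<tau>])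
    also have "\<dots> \<le> 2 * s * (\<tau> * \<Xi> + sqrt (real k) * \<tau> / real p) + 2 * s * (real k * \<tau>) / real p"
      using csum_abs es s0 \<tau> \<Xi>0 by (intro add_mono scale divide_right_mono mult_mono) auto
    finally show ?thesis .
  qed
  have 3: "\<bar>\<Sum>m\<in>N. c m * (\<Sum>l\<in>N - {m}. hh p (d m) (d l) * ?e l)\<bar> \<le> 2 * s * (h * E2)"
  proof -
    have "(\<Sum>m\<in>N. (?e m)\<^sup>2) \<le> (\<Sum>m<k. (?e m)\<^sup>2)" by (intro sum_mono2) (auto simp: NT)
    then have "sqrt (\<Sum>m\<in>N. (?e m)\<^sup>2) \<le> E2" using e_l2 E2 by (intro real_le_lsqrt) (auto simp: sum_nonneg)
    then have "sqrt C * (h * sqrt (\<Sum>m\<in>N. (?e m)\<^sup>2)) \<le> sqrt C * (h * E2)" using h ss by (intro mult_left_mono)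
    then show ?thesis using hop_N_ip[of c ?e] scale[of "h * E2"] h E2 by (simp add: C_def)
  qed
  have 4: "\<bar>\<Sum>m\<in>N. c m * g m\<bar> \<le> 2 * s * (sqrt (real k) * (n * \<alpha>^4))"
  proof -
    have "\<bar>\<Sum>m\<in>N. c m * g m\<bar> \<le> sqrt C * (sqrt (real (card N)) * (n * \<alpha>^4))"
      unfolding C_def by (intro abs_sum_mult_le_sup finN gb) auto
    also have "\<dots> \<le> 2 * s * (sqrt (real k) * (n * \<alpha>^4))"
      using cardN by (intro mult_mono sC mult_right_mono) (auto simp: s0)
    finally show ?thesis .
  qed
  have frN: "(\<Sum>l\<in>N. (dot p x (d l))\<^sup>2) \<le> K * dot p x x" for x
    using frame[of x] sum_mono2[of "{..<k}" N "\<lambda>l. (dot p x (d l))\<^sup>2"] by (auto simp: NT)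
  have 5: "\<bar>?QF ?e\<bar> \<le> s * (\<tau> * K)"
  proof -
    have "\<bar>?QF ?e\<bar> \<le> (\<Sum>t<p. \<bar>\<Sum>l\<in>N. ?e l * (dot p (d l) (res (y t)))\<^sup>2\<bar>)" by (rule sum_abs)
    also have "\<dots> \<le> (\<Sum>t<p. \<tau> * (K * dot p (res (y t)) (res (y t))))"
    proof (rule sum_mono)
      fix t
      have "\<bar>\<Sum>l\<in>N. ?e l * (dot p (d l) (res (y t)))\<^sup>2\<bar> \<le> (\<Sum>l\<in>N. \<bar>?e l * (dot p (d l) (res (y t)))\<^sup>2\<bar>)" by (rule sum_abs)
      also have "\<dots> \<le> (\<Sum>l\<in>N. \<tau> * (dot p (res (y t)) (d l))\<^sup>2)"
        using eb by (intro sum_mono) (auto simp: abs_mult ip_commute[of _ "d _"] intro: mult_right_mono)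
      also have "\<dots> \<le> \<tau> * (K * dot p (res (y t)) (res (y t)))"
        unfolding sum_distrib_left[symmetric] using \<tau> by (intro mult_left_mono frN)
      finally show "\<bar>\<Sum>l\<in>N. ?e l * (dot p (d l) (res (y t)))\<^sup>2\<bar> \<le> \<tau> * (K * dot p (res (y t)) (res (y t)))" .
    qed
    also have "\<dots> = s * (\<tau> * K)" unfolding s_def sum_distrib_right by (intro sum.cong) simp_all
    finally show ?thesis .
  qed
  define U where "U = (\<Sum>t<p. (dot p u (res (y t)))\<^sup>2)"
  have 6: "?QF ?r \<le> \<mu> * s + \<nu> * U"
  proof -
    have "?QF ?r \<le> (\<Sum>t<p. \<mu> * dot p (res (y t)) (res (y t)) + \<nu> * (dot p u (res (y t)))\<^sup>2)"
      using wop by (intro sum_mono) (simp add: NT ip_commute[of _ "d _"])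
    then show ?thesis by (simp add: s_def U_def sum.distrib sum_distrib_left)
  qed
  \<comment> \<open>The compression evaluated at \<open>u\<close> is again the objective outside
    \<open>T\<close>, up to the error of projecting \<open>d m\<close>.\<close>
  have 7: "U \<le> X + 2 * s * (sqrt (real k) * \<delta>)"
  proof -
    define w where "w m = (dot p (res (d m)) u)\<^sup>2 - (dot p u (d m))\<^sup>2" for m
    have wb: "\<bar>w m\<bar> \<le> \<delta>" if m: "m \<in> N" for m
    proof -
      have "\<bar>dot p (pr (d m)) u\<bar> \<le> (\<Sum>t\<in>T. \<bar>coef (d m) t * dot p (d t) u\<bar>)" unfolding pr_def dot_comb by (rule sum_abs)
      also have "\<dots> \<le> (\<Sum>t\<in>T. \<bar>coef (d m) t\<bar> * \<alpha>)"
        unfolding abs_mult using u_inc T by (intro sum_mono mult_left_mono) (auto simp: ip_commute[of _ _ u])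
      also have "\<dots> \<le> 2 * n * \<alpha> * \<alpha>" unfolding sum_distrib_right[symmetric] by (intro mult_right_mono pr_d_bounds m \<alpha>)
      finally have q: "\<bar>dot p (pr (d m)) u\<bar> \<le> 2 * n * \<alpha>\<^sup>2" by (simp add: power2_eq_square mult.assoc)
      have g: "\<bar>dot p u (d m)\<bar> \<le> \<alpha>" using u_inc N_lt[OF m] by simp
      have "dot p (res (d m)) u = dot p u (d m) - dot p (pr (d m)) u" by (simp add: res_def ip_diff_left ip_commute[of _ "d m"])
      then show ?thesis unfolding w_def using square_diff_le[OF g q] by simp
    qed
    have "U = (\<Sum>m\<in>N. c m * (dot p (res (d m)) u)\<^sup>2)" unfolding star_sq U_def by (simp add: ip_commute)
    also have "\<dots> = X + (\<Sum>m\<in>N. c m * w m)" by (simp add: X_def w_def algebra_simps sum_subtractf)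
    also have "(\<Sum>m\<in>N. c m * w m) \<le> sqrt C * (sqrt (real (card N)) * \<delta>)"
      unfolding C_def by (rule order_trans[OF abs_ge_self abs_sum_mult_le_sup[OF finN wb \<delta>0]])
    also have "\<dots> \<le> 2 * s * (sqrt (real k) * \<delta>)" using cardN \<delta>0 by (intro mult_mono sC mult_right_mono) (auto simp: s0)
    finally show ?thesis by simp
  qed
  have 8: "X = (\<Sum>m\<in>N. c m * ?r m) + (\<Sum>m\<in>N. c m) / real p"
    by (simp add: X_def hh_def algebra_simps sum_subtractf sum_divide_distrib)
  have 9: "(\<Sum>m\<in>N. c m) / real p \<le> 2 * s / real p" using csum_abs by (intro divide_right_mono) auto
  have 10: "(\<Sum>m\<in>N. c m * (?r m + (?e m - g m))) = (\<Sum>m\<in>N. c m * ?r m) + (\<Sum>m\<in>N. c m * ?e m) - (\<Sum>m\<in>N. c m * g m)"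
    by (simp add: distrib_left right_diff_distrib sum.distrib sum_subtractf)
  have 11: "(\<Sum>m\<in>N. c m * (?e m + (\<Sum>l\<in>N - {m}. hh p (d m) (d l) * ?e l))) = (\<Sum>m\<in>N. c m * ?e m) + (\<Sum>m\<in>N. c m * (\<Sum>l\<in>N - {m}. hh p (d m) (d l) * ?e l))"
    by (simp add: distrib_left sum.distrib)
  have 12: "\<nu> * U \<le> \<nu> * X + \<nu> * (2 * s * (sqrt (real k) * \<delta>))"
    using mult_left_mono[OF 7 \<nu>(1)] by (simp add: distrib_left)
  have "X \<le> \<nu> * X + (\<mu> * s + \<nu> * (2 * s * (sqrt (real k) * \<delta>)) + s * (\<tau> * K) + 2 * s * (h * E2)
     + (2 * s * (\<tau> * \<Xi> + sqrt (real k) * \<tau> / real p) + 2 * s * (real k * \<tau>) / real p) + 2 * s * (sqrt (real k) * (n * \<alpha>^4))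
     + (2 * s * (\<alpha>\<^sup>2 * \<Xi> + sqrt (real k) * \<alpha>\<^sup>2 / real p) + 2 * s * (\<rho>0 + n * \<alpha>\<^sup>2) / real p) + 2 * s / real p)"
    using 1 2 3 4 5 6 8 9 10 11 12 by linarith
  also have "\<dots> = \<nu> * X + s * Z" by (simp add: Z_def \<delta>_def algebra_simps)
  finally show ?thesis by (simp add: algebra_simps)
qed

text \<open>On \<open>T\<close> the slacks \<open>L - (dot p u (d l))^2\<close> are admissible
  weights for \<open>nonneg_on_T\<close>, so only a leak of order \<open>s\<close> can be lost
  there. On \<open>N\<close> the coefficients sum to nearly \<open>s\<close>, which is worth
  \<open>L * s\<close>, while \<open>X_le\<close> keeps their objective strictly below this by more
  than the leak.\<close>

lemma objective_gap:
  assumes psd: "\<And>x. 0 \<le> (\<Sum>l<k. c l * (dot p (d l) x)\<^sup>2)"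
    and L: "\<And>l. l < k \<Longrightarrow> (dot p u (d l))\<^sup>2 \<le> L" and L0: "L \<ge> 0"
    and gap: "Z < (1 - \<nu>) * (L * (1 - 4 * sqrt (real k) * n * \<alpha>\<^sup>2 - 8 * sqrt (real k) * n\<^sup>2 * \<alpha>\<^sup>2))" and s: "s > 0"
  shows "0 < (\<Sum>l<k. c l * (L - (dot p u (d l))\<^sup>2))"
proof -
  let ?w = "\<lambda>l. L - (dot p u (d l))\<^sup>2"
  have NT: "N = {..<k} - T" by (rule N_def)
  obtain \<eta> where \<eta>: "\<And>l. l \<in> {..<k} - T \<Longrightarrow> 0 \<le> \<eta> l" "\<And>l. l \<in> {..<k} - T \<Longrightarrow> \<eta> l \<le> 4 * n\<^sup>2 * \<alpha>\<^sup>2 * L"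
    "0 \<le> (\<Sum>t\<in>T. ?w t * c t) + (\<Sum>l\<in>{..<k} - T. c l * \<eta> l)"
    by (rule nonneg_on_T[OF psd, of ?w L]) (use L T in auto)
  have "\<bar>\<Sum>l\<in>N. c l * \<eta> l\<bar> \<le> sqrt C * (sqrt (real (card N)) * (4 * n\<^sup>2 * \<alpha>\<^sup>2 * L))"
    unfolding C_def using \<eta> L0 by (intro abs_sum_mult_le_sup finN) (auto simp: NT)
  also have "\<dots> \<le> 2 * s * (sqrt (real k) * (4 * n\<^sup>2 * \<alpha>\<^sup>2 * L))"
    using cardN L0 by (intro mult_mono sC mult_right_mono) (auto simp: s0)
  finally have e: "(\<Sum>l\<in>N. c l * \<eta> l) \<le> s * (L * (8 * sqrt (real k) * n\<^sup>2 * \<alpha>\<^sup>2))" by (simp add: algebra_simps)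
  have "s * (1 - 4 * sqrt (real k) * n * \<alpha>\<^sup>2) \<le> (\<Sum>m\<in>N. c m)" using csum by (simp add: algebra_simps abs_le_iff)
  then have c: "L * (s * (1 - 4 * sqrt (real k) * n * \<alpha>\<^sup>2)) \<le> L * (\<Sum>m\<in>N. c m)" using L0 by (intro mult_left_mono)
  have "X * (1 - \<nu>) < (s * (L * (1 - 4 * sqrt (real k) * n * \<alpha>\<^sup>2 - 8 * sqrt (real k) * n\<^sup>2 * \<alpha>\<^sup>2))) * (1 - \<nu>)"
    using X_le mult_strict_left_mono[OF gap s] by (simp add: mult.commute mult.left_commute)
  then have x: "X < s * (L * (1 - 4 * sqrt (real k) * n * \<alpha>\<^sup>2 - 8 * sqrt (real k) * n\<^sup>2 * \<alpha>\<^sup>2))"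
    using \<nu> by simp
  have "(\<Sum>l<k. c l * ?w l) = (\<Sum>l\<in>N. c l * ?w l) + (\<Sum>l\<in>T. c l * ?w l)" unfolding NT by (rule sum.subset_diff) (use T in auto)
  also have "(\<Sum>l\<in>N. c l * ?w l) = L * (\<Sum>l\<in>N. c l) - X" by (simp add: X_def algebra_simps sum_subtractf sum_distrib_left)
  also have "(\<Sum>l\<in>T. c l * ?w l) = (\<Sum>t\<in>T. ?w t * c t)" by (simp add: mult.commute)
  finally have f: "(\<Sum>l<k. c l * ?w l) = L * (\<Sum>l\<in>N. c l) - X + (\<Sum>t\<in>T. ?w t * c t)" .
  have "s * (L * (1 - 4 * sqrt (real k) * n * \<alpha>\<^sup>2 - 8 * sqrt (real k) * n\<^sup>2 * \<alpha>\<^sup>2))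
     = L * (s * (1 - 4 * sqrt (real k) * n * \<alpha>\<^sup>2)) - s * (L * (8 * sqrt (real k) * n\<^sup>2 * \<alpha>\<^sup>2))" by (simp add: algebra_simps)
  then show ?thesis unfolding f using x c e \<eta>(3) unfolding NT by linarith
qed

lemma s_zero: "s = 0 \<Longrightarrow> l \<in> {..<k} - T \<Longrightarrow> c l = 0"
proof -
  assume "s = 0" "l \<in> {..<k} - T"
  then have "C = 0" using sC C0 by (simp add: real_sqrt_le_iff)
  then show "c l = 0" using finN \<open>l \<in> _\<close> unfolding C_def by (subst (asm) sum_nonneg_eq_0_iff) (auto simp: N_def)
qed

end

section \<open>The matrices of the program expressed through coefficients\<close>

lemma sum_prod_scale: "(\<Sum>i\<in>A. \<Sum>j\<in>B. c * (f i * g j)) = c * (sum f A * sum g B)" for c :: real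
  unfolding sum_product unfolding sum_distrib_left ..

lemma quad_comb:
  "quad p (\<lambda>i j. \<Sum>l<k. c l * rank1 p (d l) i j) x = (\<Sum>l<k. c l * (dot p (d l) x)\<^sup>2)"
proof -
  have "quad p (\<lambda>i j. \<Sum>l<k. c l * rank1 p (d l) i j) x = (\<Sum>i<p. \<Sum>j<p. \<Sum>l<k. c l * ((d l i * x i) * (d l j * x j)))"
    unfolding quad_def rank1_def by (intro sum.cong refl) (auto simp: sum_distrib_left sum_distrib_right intro!: sum.cong)
  also have "\<dots> = (\<Sum>i<p. \<Sum>l<k. \<Sum>j<p. c l * ((d l i * x i) * (d l j * x j)))" by (intro sum.cong refl sum.swap)
  also have "\<dots> = (\<Sum>l<k. \<Sum>i<p. \<Sum>j<p. c l * ((d l i * x i) * (d l j * x j)))" by (rule sum.swap)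
  also have "\<dots> = (\<Sum>l<k. c l * (dot p (d l) x)\<^sup>2)"
    by (simp only: ip_def power2_eq_square sum_prod_scale)
  finally show ?thesis .
qed

lemma frob_comb:
  "frob p (rank1 p u) (\<lambda>i j. \<Sum>l<k. c l * rank1 p (d l) i j) = (\<Sum>l<k. c l * (dot p u (d l))\<^sup>2)"
proof -
  have "frob p (rank1 p u) (\<lambda>i j. \<Sum>l<k. c l * rank1 p (d l) i j) = quad p (\<lambda>i j. \<Sum>l<k. c l * rank1 p (d l) i j) u"
    unfolding frob_def quad_def rank1_def by (intro sum.cong refl) auto
  then show ?thesis unfolding quad_comb by (simp add: ip_commute)
qed

lemma trace_comb: "trace_p p (\<lambda>i j. \<Sum>l<k. c l * rank1 p (d l) i j) = (\<Sum>l<k. c l * dot p (d l) (d l))"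
proof -
  have "trace_p p (\<lambda>i j. \<Sum>l<k. c l * rank1 p (d l) i j) = (\<Sum>i<p. \<Sum>l<k. c l * (d l i * d l i))"
    unfolding trace_p_def rank1_def by (intro sum.cong refl) auto
  also have "\<dots> = (\<Sum>l<k. \<Sum>i<p. c l * (d l i * d l i))" by (rule sum.swap)
  finally show ?thesis by (simp add: ip_def sum_distrib_left)
qed

lemma rank1_as_comb: "(i::nat) < k \<Longrightarrow> rank1 p (d i) = (\<lambda>a b. \<Sum>l<k. (if l = i then 1 else 0) * rank1 p (d l) a b)"
proof -
  assume i: "i < k"
  have "(\<Sum>l<k. (if l = i then 1 else 0) * f l) = f i" for f :: "nat \<Rightarrow> real"
  proof -
    have "(\<Sum>l<k. (if l = i then 1 else 0) * f l) = (\<Sum>l<k. if l = i then f l else 0)" by (intro sum.cong) auto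
    then show ?thesis using i by simp
  qed
  then show ?thesis by simp
qed

lemma quad_rank1: "quad p (rank1 p u) x = (dot p u x)\<^sup>2"
  using quad_comb[of p "\<lambda>_. 1" "\<lambda>_. u" "Suc 0" x] by simp

lemma psd_comb_decomp:
  assumes psd: "\<And>x. 0 \<le> (\<Sum>l<k. c l * (dot p (d l) x)\<^sup>2)"
  obtains y where "\<And>a b. (\<Sum>l<k. c l * (dot p (d l) a * dot p (d l) b)) = (\<Sum>t<p. dot p (y t) a * dot p (y t) b)"
proof -
  define B where "B i j = (\<Sum>l<k. c l * (d l i * d l j))" for i j
  have form: "(\<Sum>i<p. \<Sum>j<p. a i * B i j * b j) = (\<Sum>l<k. c l * (dot p (d l) a * dot p (d l) b))" for a b
  proof -
    have "(\<Sum>i<p. \<Sum>j<p. a i * B i j * b j) = (\<Sum>i<p. \<Sum>j<p. \<Sum>l<k. c l * ((d l i * a i) * (d l j * b j)))"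
      unfolding B_def by (intro sum.cong refl) (auto simp: sum_distrib_left sum_distrib_right intro!: sum.cong)
    also have "\<dots> = (\<Sum>i<p. \<Sum>l<k. \<Sum>j<p. c l * ((d l i * a i) * (d l j * b j)))" by (intro sum.cong refl sum.swap)
    also have "\<dots> = (\<Sum>l<k. \<Sum>i<p. \<Sum>j<p. c l * ((d l i * a i) * (d l j * b j)))" by (rule sum.swap)
    finally show ?thesis by (simp only: ip_def sum_prod_scale)
  qed
  have "\<exists>Y :: nat \<Rightarrow> nat \<Rightarrow> real. \<forall>i\<in>{..<p}. \<forall>j\<in>{..<p}. B i j = (\<Sum>t\<in>{..<p}. Y t i * Y t j)"
  proof (rule psd_decomp)
    show "B i j = B j i" for i j by (simp add: B_def mult.commute)
    show "0 \<le> (\<Sum>i<p. \<Sum>j<p. x i * B i j * x j)" for x unfolding form using psd[of x] by (simp add: power2_eq_square)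
  qed simp
  then obtain Y where Y: "\<And>i j. i < p \<Longrightarrow> j < p \<Longrightarrow> B i j = (\<Sum>t<p. Y t i * Y t j)" by auto
  show thesis
  proof (rule that[of Y])
    fix a b
    have "(\<Sum>l<k. c l * (dot p (d l) a * dot p (d l) b)) = (\<Sum>i<p. \<Sum>j<p. a i * B i j * b j)" by (rule form[symmetric])
    also have "\<dots> = (\<Sum>i<p. \<Sum>j<p. \<Sum>t<p. (Y t i * a i) * (Y t j * b j))"
      by (intro sum.cong refl) (auto simp: Y sum_distrib_left sum_distrib_right intro!: sum.cong)
    also have "\<dots> = (\<Sum>i<p. \<Sum>t<p. \<Sum>j<p. (Y t i * a i) * (Y t j * b j))" by (intro sum.cong refl sum.swap)
    also have "\<dots> = (\<Sum>t<p. \<Sum>i<p. \<Sum>j<p. (Y t i * a i) * (Y t j * b j))" by (rule sum.swap)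
    finally show "(\<Sum>l<k. c l * (dot p (d l) a * dot p (d l) b)) = (\<Sum>t<p. dot p (Y t) a * dot p (Y t) b)" by (simp add: ip_def sum_product)
  qed
qed

text \<open>A feasible combination supported on \<open>T\<close> has nonnegative coefficients, so it loses by convexity.\<close>
lemma unique_maximizer_if_gap:
  assumes no: "near_orth p k d T \<alpha>" and i: "i < k" and mx: "\<And>j. j < k \<Longrightarrow> j \<noteq> i \<Longrightarrow> (dot p u (d j))\<^sup>2 < (dot p u (d i))\<^sup>2"
    and gap: "\<And>c. (\<And>x. 0 \<le> (\<Sum>l<k. c l * (dot p (d l) x)\<^sup>2)) \<Longrightarrow>
        (\<forall>l\<in>{..<k} - T. c l = 0) \<or> 0 < (\<Sum>l<k. c l * ((dot p u (d i))\<^sup>2 - (dot p u (d l))\<^sup>2))"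
  shows "sdp_unique_maximizer p k d (rank1 p u) (rank1 p (d i))"
proof -
  interpret near_orth p k d T \<alpha> by fact
  let ?v = "\<lambda>l. (dot p u (d l))\<^sup>2" and ?i = "\<lambda>l. if l = i then 1 else 0 :: real"
  have r1: "rank1 p (d i) = (\<lambda>a b. \<Sum>l<k. ?i l * rank1 p (d l) a b)" by (rule rank1_as_comb[OF i])
  have si: "(\<Sum>l<k. ?i l * f l) = f i" for f
  proof -
    have "(\<Sum>l<k. ?i l * f l) = (\<Sum>l<k. if l = i then f l else 0)" by (intro sum.cong) auto
    then show ?thesis using i by simp
  qed
  have f0: "sdp_feasible p k d (rank1 p (d i))"
    unfolding sdp_feasible_def psd_p_def
  proof (intro conjI allI)
    show "\<exists>c. rank1 p (d i) = (\<lambda>a b. \<Sum>l<k. c l * rank1 p (d l) a b)" by (rule exI[of _ ?i]) (rule r1)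
    show "trace_p p (rank1 p (d i)) = 1" by (subst r1, subst trace_comb, subst si) (rule unit[OF i])
    show "0 \<le> quad p (rank1 p (d i)) x" for x by (simp add: quad_rank1)
  qed
  have obj: "frob p (rank1 p u) (rank1 p (d i)) = ?v i" by (subst r1, subst frob_comb, subst si) (rule refl)
  have "frob p (rank1 p u) B < ?v i" if B: "sdp_feasible p k d B" "B \<noteq> rank1 p (d i)" for B
  proof -
    obtain c where Bc: "B = (\<lambda>a b. \<Sum>l<k. c l * rank1 p (d l) a b)" using B by (auto simp: sdp_feasible_def)
    have psd: "0 \<le> (\<Sum>l<k. c l * (dot p (d l) x)\<^sup>2)" for x
      using B unfolding sdp_feasible_def psd_p_def Bc quad_comb by blast
    have "(\<Sum>l<k. c l * dot p (d l) (d l)) = 1" using B unfolding sdp_feasible_def Bc trace_comb by blast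
    then have c1: "(\<Sum>l<k. c l) = 1" using unit by simp
    have fr: "?v i - frob p (rank1 p u) B = (\<Sum>l<k. c l * (?v i - ?v l))"
      unfolding Bc frob_comb by (simp add: right_diff_distrib sum_subtractf sum_distrib_right[symmetric] c1)
    have "0 < (\<Sum>l<k. c l * (?v i - ?v l))"
    proof (cases "\<forall>l\<in>{..<k} - T. c l = 0")
      case False
      then show ?thesis using gap[OF psd] by blast
    next
      case True
      have cn: "0 \<le> c l" if "l < k" for l using coef_nonneg[OF psd, of l] True that by (cases "l \<in> T") auto
      have tn: "0 \<le> c l * (?v i - ?v l)" if "l < k" for l
        using cn[OF that] mx[OF that] by (cases "l = i") (auto intro!: mult_nonneg_nonneg less_imp_le)
      have "(\<Sum>l<k. c l * (?v i - ?v l)) \<noteq> 0"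
      proof
        assume "(\<Sum>l<k. c l * (?v i - ?v l)) = 0"
        then have z: "c l * (?v i - ?v l) = 0" if "l < k" for l
          using that tn by (subst (asm) sum_nonneg_eq_0_iff) auto
        have ci: "c l = (if l = i then c i else 0)" if "l < k" for l using z[OF that] mx[OF that] by auto
        have "(\<Sum>l<k. c l) = (\<Sum>l<k. if l = i then c i else 0)" by (intro sum.cong refl ci) auto
        then have "c i = 1" using c1 i by simp
        then have "c l = ?i l" if "l < k" for l using ci[OF that] by auto
        then have "B = rank1 p (d i)" unfolding Bc by (subst r1) (auto simp: fun_eq_iff intro!: sum.cong)
        then show False using B by simp
      qed
      moreover have "0 \<le> (\<Sum>l<k. c l * (?v i - ?v l))" using tn by (intro sum_nonneg) auto
      ultimately show ?thesis by simp
    qed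
    then show ?thesis using fr by simp
  qed
  then show ?thesis unfolding sdp_unique_maximizer_def obj using f0 by blast
qed

section \<open>Measurability of the good event\<close>

text \<open>Rational lists form a countable type, so quantifying over them preserves measurability;
  lists of length \<open>p\<close> already supply a dense set of test vectors.\<close>

definition rvec :: "rat list \<Rightarrow> nat \<Rightarrow> real" where "rvec xs = (\<lambda>i. of_rat (xs ! i))"

text \<open>For measurability of the good event: by compactness, a feasible point other than \<open>rank1 (d i)\<close> that
  is at least as good exists iff for some box, entry \<open>(a, b)\<close> and \<open>n\<close> each \<open>\<delta>\<close>-relaxation has a solution
  on a grid, and testing positivity on rational vectors makes every relaxation measurable.\<close>
definition competitor :: "nat \<Rightarrow> nat \<Rightarrow> (nat \<Rightarrow> nat \<Rightarrow> real) \<Rightarrow> (nat \<Rightarrow> real) \<Rightarrow> nat \<Rightarrow> nat \<Rightarrow> nat \<Rightarrow> nat \<Rightarrow> real \<Rightarrow> (nat \<Rightarrow> real) \<Rightarrow> bool" where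
  "competitor p k d u i n a b \<delta> c \<longleftrightarrow>
     (\<forall>xs. - \<delta> * (\<Sum>l<k. (dot p (d l) (rvec xs))\<^sup>2) \<le> (\<Sum>l<k. c l * (dot p (d l) (rvec xs))\<^sup>2)) \<and>
     \<bar>(\<Sum>l<k. c l * dot p (d l) (d l)) - 1\<bar> \<le> \<delta> \<and>
     (dot p u (d i))\<^sup>2 - \<delta> \<le> (\<Sum>l<k. c l * (dot p u (d l))\<^sup>2) \<and>
     1 / real (Suc n) - \<delta> \<le> \<bar>(\<Sum>l<k. c l * (d l a * d l b)) - d i a * d i b\<bar>"

text \<open>Coordinates from \<open>k\<close> on are pinned to 0, so that the box is a product of
  compact sets in the space of all functions.\<close>

definition gbox :: "nat \<Rightarrow> nat \<Rightarrow> (nat \<Rightarrow> real) set" where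
  "gbox k n = PiE UNIV (\<lambda>l. if l < k then {- real n..real n} else {0})"

lemma compact_gbox: "compact (gbox k n)"
proof -
  have "compactin (product_topology (\<lambda>i. euclidean) UNIV) (gbox k n)"
    unfolding gbox_def by (subst compactin_PiE) auto
  then show ?thesis by (simp add: euclidean_product_topology)
qed

lemma continuous_lin: "continuous_on UNIV (\<lambda>c :: nat \<Rightarrow> real. \<Sum>l<k. c l * w l)"
  by (intro continuous_on_sum continuous_on_mult continuous_on_const continuous_on_product_coordinates)

lemma closed_competitor: "closed {c. competitor p k d u i n a b \<delta> c}"
  unfolding competitor_def
  by (intro closed_Collect_conj closed_Collect_all closed_Collect_le continuous_on_const continuous_on_diff continuous_lin
    continuous_on_rabs)

lemma competitor_mono: "\<delta> \<le> \<delta>' \<Longrightarrow> competitor p k d u i n a b \<delta> c \<Longrightarrow> competitor p k d u i n a b \<delta>' c"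
proof -
  assume le: "\<delta> \<le> \<delta>'" and c: "competitor p k d u i n a b \<delta> c"
  have m: "\<delta> * (\<Sum>l<k. (dot p (d l) x)\<^sup>2) \<le> \<delta>' * (\<Sum>l<k. (dot p (d l) x)\<^sup>2)" for x
    by (intro mult_right_mono le sum_nonneg) auto
  show ?thesis
    unfolding competitor_def
  proof (intro conjI allI)
    fix xs
    have "- \<delta> * (\<Sum>l<k. (dot p (d l) (rvec xs))\<^sup>2) \<le> (\<Sum>l<k. c l * (dot p (d l) (rvec xs))\<^sup>2)"
      using c unfolding competitor_def by blast
    then show "- \<delta>' * (\<Sum>l<k. (dot p (d l) (rvec xs))\<^sup>2) \<le> (\<Sum>l<k. c l * (dot p (d l) (rvec xs))\<^sup>2)"
      using m[of "rvec xs"] by linarith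
  qed (use le c in \<open>unfold competitor_def, linarith+\<close>)
qed

definition grid :: "nat \<Rightarrow> nat \<Rightarrow> nat \<Rightarrow> (nat \<Rightarrow> int) set" where
  "grid k n m = PiE {..<k} (\<lambda>_. {- int (n * Suc m)..int (n * Suc m)})"

definition gpt :: "nat \<Rightarrow> nat \<Rightarrow> (nat \<Rightarrow> int) \<Rightarrow> nat \<Rightarrow> real" where
  "gpt k m z = (\<lambda>l. if l < k then of_int (z l) / real (Suc m) else 0)"

lemma finite_grid: "finite (grid k n m)"
  unfolding grid_def by (intro finite_PiE) auto

lemma gpt_gbox: "z \<in> grid k n m \<Longrightarrow> gpt k m z \<in> gbox k n"
proof -
  assume z: "z \<in> grid k n m"
  have zb: "\<bar>of_int (z l) / real (Suc m)\<bar> \<le> real n" if "l < k" for l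
  proof -
    have "z l \<in> {- int (n * Suc m)..int (n * Suc m)}" using z that unfolding grid_def by (auto simp only: PiE_iff lessThan_iff)
    then have "- int (n * Suc m) \<le> z l" "z l \<le> int (n * Suc m)" by (simp_all only: atLeastAtMost_iff)
    then have "\<bar>z l\<bar> \<le> int (n * Suc m)" by linarith
    then have "real_of_int \<bar>z l\<bar> \<le> real (n * Suc m)" by (metis of_int_le_iff of_int_of_nat_eq)
    then show ?thesis by (simp add: pos_divide_le_eq distrib_left)
  qed
  have "- real n \<le> gpt k m z l \<and> gpt k m z l \<le> real n" if "l < k" for l
  proof -
    have "gpt k m z l = of_int (z l) / real (Suc m)" using that by (simp add: gpt_def)
    then show ?thesis using zb[OF that] by linarith
  qed
  then show ?thesis by (auto simp: gbox_def PiE_iff) (auto simp: gpt_def)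
qed

lemma grid_approx:
  assumes c: "c \<in> gbox k n"
  obtains z where "z \<in> grid k n m" "\<And>l. l < k \<Longrightarrow> \<bar>c l - gpt k m z l\<bar> \<le> 1 / real (Suc m)"
proof
  let ?M = "real (Suc m)"
  define z where "z = (\<lambda>l\<in>{..<k}. \<lfloor>c l * ?M\<rfloor>)"
  have b: "- real n \<le> c l" "c l \<le> real n" if "l < k" for l
    using c that by (auto simp: gbox_def PiE_iff split: if_splits)
  show "z \<in> grid k n m"
    unfolding grid_def
  proof (rule PiE_I)
    fix l assume l: "l \<in> {..<k}"
    have "- real n * ?M \<le> c l * ?M" "c l * ?M \<le> real n * ?M" using b[of l] l by (intro mult_right_mono; simp)+
    then have "- int (n * Suc m) \<le> \<lfloor>c l * ?M\<rfloor>" "\<lfloor>c l * ?M\<rfloor> \<le> int (n * Suc m)"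
    proof -
      assume a: "- real n * ?M \<le> c l * ?M" "c l * ?M \<le> real n * ?M"
      have e: "real_of_int (int (n * Suc m)) = real n * ?M" by (rule trans[OF of_int_of_nat_eq of_nat_mult])
      have "real_of_int (- int (n * Suc m)) \<le> c l * ?M" using a(1) by (simp only: of_int_minus e mult_minus_left)
      then show "- int (n * Suc m) \<le> \<lfloor>c l * ?M\<rfloor>" by (simp only: le_floor_iff)
      have "c l * ?M \<le> real_of_int (int (n * Suc m))" using a(2) by (simp only: e)
      then show "\<lfloor>c l * ?M\<rfloor> \<le> int (n * Suc m)" using floor_mono floor_of_int by metis
    qed
    then show "z l \<in> {- int (n * Suc m)..int (n * Suc m)}" using l by (simp add: z_def)
  qed (auto simp: z_def)
  show "\<bar>c l - gpt k m z l\<bar> \<le> 1 / ?M" if l: "l < k" for l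
  proof -
    have "\<bar>c l * ?M - of_int \<lfloor>c l * ?M\<rfloor>\<bar> \<le> 1" by linarith
    then have "\<bar>c l * ?M - of_int \<lfloor>c l * ?M\<rfloor>\<bar> / ?M \<le> 1 / ?M" by (intro divide_right_mono) auto
    moreover have "c l - gpt k m z l = (c l * ?M - of_int \<lfloor>c l * ?M\<rfloor>) / ?M" using l by (simp add: gpt_def z_def diff_divide_distrib)
    ultimately show ?thesis by (simp add: abs_divide del: of_nat_Suc)
  qed
qed

text \<open>From left to right a true competitor is rounded to a fine grid. Conversely, the
  relaxations are closed and decrease with the slack, so by compactness of the box they have a
  common point, and letting the slack tend to 0 gives an exact competitor.\<close>

lemma competitor_grid:
  "(\<exists>c\<in>gbox k n. competitor p k d u i n a b 0 c) \<longleftrightarrow> (\<forall>j. \<exists>m. \<exists>z\<in>grid k n m. competitor p k d u i n a b (1 / real (Suc j)) (gpt k m z))"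
proof
  assume "\<exists>c\<in>gbox k n. competitor p k d u i n a b 0 c"
  then obtain c where c: "c \<in> gbox k n" "competitor p k d u i n a b 0 c" by blast
  show "\<forall>j. \<exists>m. \<exists>z\<in>grid k n m. competitor p k d u i n a b (1 / real (Suc j)) (gpt k m z)"
  proof
    fix j
    let ?\<delta> = "1 / real (Suc j)"
    \<comment> \<open>Bounds the effect of rounding on the three affine constraints; the added 1
      makes the mesh itself at most \<open>?\<delta>\<close>.\<close>
    define S where "S = 1 + (\<Sum>l<k. \<bar>dot p (d l) (d l)\<bar>) + (\<Sum>l<k. \<bar>(dot p u (d l))\<^sup>2\<bar>) + (\<Sum>l<k. \<bar>d l a * d l b\<bar>)"
    obtain m where m: "S * real (Suc j) \<le> real (Suc m)" using real_arch_simple[of "S * real (Suc j)"] by (metis of_nat_Suc le_add_same_cancel1 order_trans zero_le_one add.commute)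
    have S: "S \<ge> 1" "(\<Sum>l<k. \<bar>dot p (d l) (d l)\<bar>) \<le> S" "(\<Sum>l<k. \<bar>(dot p u (d l))\<^sup>2\<bar>) \<le> S" "(\<Sum>l<k. \<bar>d l a * d l b\<bar>) \<le> S"
    proof -
      have "(\<Sum>l<k. \<bar>dot p (d l) (d l)\<bar>) \<ge> 0" "(\<Sum>l<k. \<bar>(dot p u (d l))\<^sup>2\<bar>) \<ge> 0" "(\<Sum>l<k. \<bar>d l a * d l b\<bar>) \<ge> 0" by (auto intro: sum_nonneg)
      then show "S \<ge> 1" "(\<Sum>l<k. \<bar>dot p (d l) (d l)\<bar>) \<le> S" "(\<Sum>l<k. \<bar>(dot p u (d l))\<^sup>2\<bar>) \<le> S" "(\<Sum>l<k. \<bar>d l a * d l b\<bar>) \<le> S"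
        unfolding S_def by linarith+
    qed
    have Sm: "1 / real (Suc m) * S \<le> ?\<delta>" using m by (simp add: divide_simps mult.commute)
    have m\<delta>: "1 / real (Suc m) \<le> ?\<delta>" using Sm mult_left_mono[OF S(1), of "1 / real (Suc m)"] by simp
    obtain z where z: "z \<in> grid k n m" "\<And>l. l < k \<Longrightarrow> \<bar>c l - gpt k m z l\<bar> \<le> 1 / real (Suc m)"
      using grid_approx[OF c(1)] by blast
    let ?g = "gpt k m z"
    have lin: "\<bar>(\<Sum>l<k. c l * w l) - (\<Sum>l<k. ?g l * w l)\<bar> \<le> 1 / real (Suc m) * (\<Sum>l<k. \<bar>w l\<bar>)" for w
    proof -
      have "(\<Sum>l<k. c l * w l) - (\<Sum>l<k. ?g l * w l) = (\<Sum>l<k. (c l - ?g l) * w l)" by (simp add: sum_subtractf left_diff_distrib)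
      also have "\<bar>\<dots>\<bar> \<le> (\<Sum>l<k. \<bar>(c l - ?g l) * w l\<bar>)" by (rule sum_abs)
      also have "\<dots> \<le> (\<Sum>l<k. 1 / real (Suc m) * \<bar>w l\<bar>)"
        unfolding abs_mult using z(2) by (intro sum_mono mult_right_mono) auto
      finally show ?thesis by (simp only: sum_distrib_left)
    qed
    have lin2: "\<bar>(\<Sum>l<k. c l * w l) - (\<Sum>l<k. ?g l * w l)\<bar> \<le> ?\<delta>" if "(\<Sum>l<k. \<bar>w l\<bar>) \<le> S" for w
    proof -
      have "1 / real (Suc m) * (\<Sum>l<k. \<bar>w l\<bar>) \<le> 1 / real (Suc m) * S" by (intro mult_left_mono that) simp
      then show ?thesis using lin[of w] Sm by linarith
    qed
    have "competitor p k d u i n a b ?\<delta> ?g"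
      unfolding competitor_def
    proof (intro conjI allI)
      fix xs
      let ?w = "\<lambda>l. (dot p (d l) (rvec xs))\<^sup>2"
      have "0 \<le> (\<Sum>l<k. c l * ?w l)" using c(2) unfolding competitor_def by simp
      \<comment> \<open>Test vectors are unbounded, and the rounding error at a vector scales with
        the sum of squares: this is why relaxed positivity has a slack proportional to that
        sum.\<close>
      moreover have "1 / real (Suc m) * (\<Sum>l<k. \<bar>?w l\<bar>) \<le> ?\<delta> * (\<Sum>l<k. ?w l)"
        using m\<delta> by (simp only: abs_power2) (intro mult_right_mono sum_nonneg, auto)
      ultimately show "- ?\<delta> * (\<Sum>l<k. ?w l) \<le> (\<Sum>l<k. ?g l * ?w l)" using lin[of ?w] by linarith
    next
      show "\<bar>(\<Sum>l<k. ?g l * dot p (d l) (d l)) - 1\<bar> \<le> ?\<delta>" using c(2) lin2[OF S(2)] unfolding competitor_def by linarith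
      show "(dot p u (d i))\<^sup>2 - ?\<delta> \<le> (\<Sum>l<k. ?g l * (dot p u (d l))\<^sup>2)" using c(2) lin2[OF S(3)] unfolding competitor_def by linarith
      show "1 / real (Suc n) - ?\<delta> \<le> \<bar>(\<Sum>l<k. ?g l * (d l a * d l b)) - d i a * d i b\<bar>" using c(2) lin2[OF S(4)] unfolding competitor_def by linarith
    qed
    then show "\<exists>m. \<exists>z\<in>grid k n m. competitor p k d u i n a b ?\<delta> (gpt k m z)" using z(1) by blast
  qed
next
  assume A: "\<forall>j. \<exists>m. \<exists>z\<in>grid k n m. competitor p k d u i n a b (1 / real (Suc j)) (gpt k m z)"
  let ?F = "\<lambda>j. {c. competitor p k d u i n a b (1 / real (Suc j)) c}"
  have ne: "\<exists>c\<in>gbox k n. c \<in> ?F j" for j using A gpt_gbox by blast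
  have "gbox k n \<inter> (\<Inter>(range ?F)) \<noteq> {}"
  proof (rule compact_imp_fip[OF compact_gbox])
    show "closed T" if "T \<in> range ?F" for T using that closed_competitor by auto
    fix F' assume F': "finite F'" "F' \<subseteq> range ?F"
    then obtain J where J: "finite J" "F' = ?F ` J" by (meson finite_subset_image)
    obtain j where j: "\<And>j'. j' \<in> J \<Longrightarrow> j' \<le> j" using J(1) by (metis finite_nat_set_iff_bounded_le)
    obtain c where c: "c \<in> gbox k n" "competitor p k d u i n a b (1 / real (Suc j)) c" using ne[of j] by auto
    have "c \<in> ?F j'" if "j' \<in> J" for j'
    proof -
      have "1 / real (Suc j) \<le> 1 / real (Suc j')" using j[OF that] by (intro divide_left_mono) auto
      then show ?thesis using competitor_mono c(2) by blast
    qed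
    then show "gbox k n \<inter> \<Inter>F' \<noteq> {}" using c(1) J(2) by blast
  qed
  then obtain c where c: "c \<in> gbox k n" "\<And>j. competitor p k d u i n a b (1 / real (Suc j)) c" by auto
  have lim: "x \<le> y" if "\<And>j. x \<le> y + 1 / real (Suc j) * r" for x y r :: real
  proof -
    have "(\<lambda>j. y + 1 / real (Suc j) * r) \<longlonglongrightarrow> y + 0 * r"
      by (intro tendsto_intros LIMSEQ_Suc[OF lim_1_over_n])
    then show ?thesis using that by (intro LIMSEQ_le_const[of _ y x]) auto
  qed
  have "competitor p k d u i n a b 0 c"
    unfolding competitor_def
  proof (intro conjI allI)
    fix xs
    show "- 0 * (\<Sum>l<k. (dot p (d l) (rvec xs))\<^sup>2) \<le> (\<Sum>l<k. c l * (dot p (d l) (rvec xs))\<^sup>2)"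
    proof (rule lim[of _ _ "\<Sum>l<k. (dot p (d l) (rvec xs))\<^sup>2"])
      fix j
      have "- (1 / real (Suc j)) * (\<Sum>l<k. (dot p (d l) (rvec xs))\<^sup>2) \<le> (\<Sum>l<k. c l * (dot p (d l) (rvec xs))\<^sup>2)"
        using c(2)[of j] unfolding competitor_def by blast
      then show "- 0 * (\<Sum>l<k. (dot p (d l) (rvec xs))\<^sup>2) \<le> (\<Sum>l<k. c l * (dot p (d l) (rvec xs))\<^sup>2) + 1 / real (Suc j) * (\<Sum>l<k. (dot p (d l) (rvec xs))\<^sup>2)" by simp
    qed
  next
    show "\<bar>(\<Sum>l<k. c l * dot p (d l) (d l)) - 1\<bar> \<le> 0"
      by (rule lim[of _ _ 1]) (use c(2) in \<open>simp add: competitor_def\<close>)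
    show "(dot p u (d i))\<^sup>2 - 0 \<le> (\<Sum>l<k. c l * (dot p u (d l))\<^sup>2)"
      by (rule lim[of _ _ 1]) (use c(2) in \<open>simp add: competitor_def diff_le_eq\<close>)
    show "1 / real (Suc n) - 0 \<le> \<bar>(\<Sum>l<k. c l * (d l a * d l b)) - d i a * d i b\<bar>"
      by (rule lim[of _ _ 1]) (use c(2) in \<open>simp add: competitor_def diff_le_eq\<close>)
  qed
  then show "\<exists>c\<in>gbox k n. competitor p k d u i n a b 0 c" using c(1) by blast
qed

lemma psd_rvec:
  assumes "\<And>xs. 0 \<le> (\<Sum>l<k. c l * (dot p (d l) (rvec xs))\<^sup>2)"
  shows "0 \<le> (\<Sum>l<k. c l * (dot p (d l) x)\<^sup>2)"
proof -
  have "\<exists>f. \<forall>N::nat. \<bar>real_of_rat (f N) - x i\<bar> \<le> 1 / real (Suc N)" for i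
  proof -
    have "\<exists>q. \<bar>real_of_rat q - x i\<bar> \<le> 1 / real (Suc N)" for N
    proof -
      obtain q where "x i < real_of_rat q" "real_of_rat q < x i + 1 / real (Suc N)"
        using of_rat_dense[of "x i" "x i + 1 / real (Suc N)"] by auto
      then show ?thesis by (intro exI[of _ q]) (auto simp: abs_le_iff)
    qed
    then show ?thesis by metis
  qed
  then obtain f where f: "\<And>i N. \<bar>real_of_rat (f i N) - x i\<bar> \<le> 1 / real (Suc N)" by metis
  have lf: "(\<lambda>N. real_of_rat (f i N)) \<longlonglongrightarrow> x i" for i
  proof -
    have "(\<lambda>N. real_of_rat (f i N) - x i) \<longlonglongrightarrow> 0"
      by (rule Lim_null_comparison[OF _ LIMSEQ_Suc[OF lim_1_over_n]]) (use f in auto)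
    then show ?thesis by (simp add: LIM_zero_iff)
  qed
  have e: "dot p (d l) (rvec (map (\<lambda>i. f i N) [0..<p])) = dot p (d l) (\<lambda>i. real_of_rat (f i N))" for l N
    by (intro ip_cong) (auto simp: rvec_def)
  have "(\<lambda>N. \<Sum>l<k. c l * (dot p (d l) (\<lambda>i. real_of_rat (f i N)))\<^sup>2) \<longlonglongrightarrow> (\<Sum>l<k. c l * (dot p (d l) x)\<^sup>2)"
    unfolding ip_def by (intro tendsto_intros lf)
  moreover have "0 \<le> (\<Sum>l<k. c l * (dot p (d l) (\<lambda>i. real_of_rat (f i N)))\<^sup>2)" for N
    using assms[of "map (\<lambda>i. f i N) [0..<p]"] unfolding e .
  ultimately show ?thesis by (intro LIMSEQ_le_const) auto
qed

text \<open>Failure of unique optimality is written as a countable union: a rival differs from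
  \<open>rank1 p (d i)\<close> in some entry \<open>(a, b)\<close>, and one number \<open>n\<close>
  serves both as a bound on its coefficients and as the reciprocal of that difference.\<close>

lemma unique_maximizer_iff:
  assumes i: "i < k"
  shows "sdp_unique_maximizer p k d (rank1 p u) (rank1 p (d i)) \<longleftrightarrow>
    dot p (d i) (d i) = 1 \<and> \<not> (\<exists>n. \<exists>a\<in>{..<p}. \<exists>b\<in>{..<p}. \<exists>c\<in>gbox k n. competitor p k d u i n a b 0 c)"
proof -
  let ?i = "\<lambda>l. if l = i then 1 else 0 :: real"
  have r1: "rank1 p (d i) = (\<lambda>a b. \<Sum>l<k. ?i l * rank1 p (d l) a b)" by (rule rank1_as_comb[OF i])
  have si: "(\<Sum>l<k. ?i l * f l) = f i" for f
  proof -
    have "(\<Sum>l<k. ?i l * f l) = (\<Sum>l<k. if l = i then f l else 0)" by (intro sum.cong) auto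
    then show ?thesis using i by simp
  qed
  have tr: "trace_p p (rank1 p (d i)) = dot p (d i) (d i)" by (subst r1, subst trace_comb, subst si) (rule refl)
  have f0: "sdp_feasible p k d (rank1 p (d i)) \<longleftrightarrow> dot p (d i) (d i) = 1"
    unfolding sdp_feasible_def psd_p_def tr quad_rank1 using r1 by (auto intro!: exI[of _ ?i])
  have obj: "frob p (rank1 p u) (rank1 p (d i)) = (dot p u (d i))\<^sup>2" by (subst r1, subst frob_comb, subst si) (rule refl)
  let ?comb = "\<lambda>c. (\<lambda>a b. \<Sum>l<k. c l * rank1 p (d l) a b)"
  have fc: "sdp_feasible p k d (?comb c) \<longleftrightarrow> (\<Sum>l<k. c l * dot p (d l) (d l)) = 1 \<and> (\<forall>x. 0 \<le> (\<Sum>l<k. c l * (dot p (d l) x)\<^sup>2))" for c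
    unfolding sdp_feasible_def psd_p_def trace_comb quad_comb by blast
  have "(\<exists>B. sdp_feasible p k d B \<and> B \<noteq> rank1 p (d i) \<and> (dot p u (d i))\<^sup>2 \<le> frob p (rank1 p u) B)
     \<longleftrightarrow> (\<exists>n. \<exists>a\<in>{..<p}. \<exists>b\<in>{..<p}. \<exists>c\<in>gbox k n. competitor p k d u i n a b 0 c)" (is "?L \<longleftrightarrow> ?R")
  proof
    assume ?L
    then obtain B where B: "sdp_feasible p k d B" "B \<noteq> rank1 p (d i)" "(dot p u (d i))\<^sup>2 \<le> frob p (rank1 p u) B" by blast
    then obtain c' where Bc': "B = ?comb c'" by (auto simp: sdp_feasible_def)
    define c where "c l = (if l < k then c' l else 0)" for l
    have Bc: "B = ?comb c" unfolding Bc' c_def by (auto intro!: sum.cong)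
    obtain a b where ab: "B a b \<noteq> rank1 p (d i) a b" using B(2) by (auto simp: fun_eq_iff)
    have abp: "a < p" "b < p"
    proof -
      have "a < p \<and> b < p"
      proof (rule ccontr)
        assume "\<not> (a < p \<and> b < p)"
        then have "rank1 p y a b = 0" for y by (auto simp: rank1_def)
        then show False using ab by (simp add: Bc)
      qed
      then show "a < p" "b < p" by auto
    qed
    define D where "D = \<bar>(\<Sum>l<k. c l * (d l a * d l b)) - d i a * d i b\<bar>"
    have D: "D > 0" using ab abp by (simp add: Bc rank1_def D_def)
    obtain n1 where n1: "1 / D \<le> real n1" using real_arch_simple by blast
    obtain n2 where n2: "(\<Sum>l<k. \<bar>c l\<bar>) \<le> real n2" using real_arch_simple by blast
    \<comment> \<open>The sum meets both demands on \<open>n\<close>: separation from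
      \<open>rank1 p (d i)\<close> and size of the box.\<close>
    define n where "n = n1 + n2"
    have "1 / real (Suc n) \<le> D"
    proof -
      have "1 / D \<le> real (Suc n)" using n1 by (simp add: n_def)
      then show ?thesis using D by (simp add: divide_simps mult.commute)
    qed
    moreover have "c \<in> gbox k n"
    proof -
      have cl: "\<bar>c l\<bar> \<le> real n" if "l < k" for l
        using member_le_sum[of l "{..<k}" "\<lambda>l. \<bar>c l\<bar>"] that n2 by (simp add: n_def)
      then have "- real n \<le> c l \<and> c l \<le> real n" if "l < k" for l using cl[OF that] by linarith
      then show ?thesis by (auto simp: gbox_def PiE_iff c_def)
    qed
    moreover have "competitor p k d u i n a b 0 c"
      unfolding competitor_def using B fc[of c] \<open>1 / real (Suc n) \<le> D\<close> by (simp add: Bc frob_comb D_def)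
    ultimately show ?R using abp by blast
  next
    assume ?R
    then obtain n a b c where n: "a < p" "b < p" "competitor p k d u i n a b 0 c" by blast
    note cd = n(3)[unfolded competitor_def]
    have "- 0 * (\<Sum>l<k. (dot p (d l) (rvec xs))\<^sup>2) \<le> (\<Sum>l<k. c l * (dot p (d l) (rvec xs))\<^sup>2)" for xs
      using cd by blast
    then have "0 \<le> (\<Sum>l<k. c l * (dot p (d l) (rvec xs))\<^sup>2)" for xs by (simp only: minus_zero mult_zero_left)
    then have "0 \<le> (\<Sum>l<k. c l * (dot p (d l) x)\<^sup>2)" for x by (rule psd_rvec)
    moreover have "(\<Sum>l<k. c l * dot p (d l) (d l)) = 1" using cd by linarith
    ultimately have "sdp_feasible p k d (?comb c)" unfolding fc by blast
    moreover have "?comb c \<noteq> rank1 p (d i)"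
    proof
      assume eq: "?comb c = rank1 p (d i)"
      have "?comb c a b = rank1 p (d i) a b" by (rule fun_cong[OF fun_cong[OF eq]])
      then have "(\<Sum>l<k. c l * (d l a * d l b)) = d i a * d i b" using n by (simp add: rank1_def)
      moreover have "0 < 1 / real (Suc n)" by simp
      ultimately show False using cd by linarith
    qed
    moreover have "(dot p u (d i))\<^sup>2 \<le> frob p (rank1 p u) (?comb c)" unfolding frob_comb using cd by linarith
    ultimately show ?L by blast
  qed
  then show ?thesis unfolding sdp_unique_maximizer_def f0 obj by (metis not_le)
qed

lemma sample_space_eq: "sample_space p k = sph p {..<k} \<Otimes>\<^sub>M unif_sphere p"
  by (simp add: sample_space_def sph_def)

text \<open>Needed because \<open>measure\<close> is 0 on sets that are not measurable, so the limit
  claim really depends on measurability.\<close>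

lemma good_event_sets:
  "{\<omega> \<in> space (sample_space p k). good_event p k (fst \<omega>) (snd \<omega>)} \<in> sets (sample_space p k)"
proof -
  let ?M = "sample_space p k"
  have m1: "(\<lambda>\<omega>. fst \<omega> l a) \<in> borel_measurable ?M" if "l < k" "a < p" for l a
    unfolding sample_space_eq using that by (intro measurable_compose[OF measurable_fst measurable_sph_component2]) auto
  have m2: "(\<lambda>\<omega>. snd \<omega> a) \<in> borel_measurable ?M" if "a < p" for a
    unfolding sample_space_eq using that by (intro measurable_compose[OF measurable_snd measurable_component_sphere]) auto
  have comp: "{\<omega> \<in> space ?M. competitor p k (fst \<omega>) (snd \<omega>) i n a b \<delta> c} \<in> sets ?M" if "i < k" "a < p" "b < p" for i n a b \<delta> c
    unfolding competitor_def using that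
    by (intro sets.sets_Collect_conj sets.sets_Collect_countable_All borel_measurable_le borel_measurable_const borel_measurable_times
      borel_measurable_sum borel_measurable_diff borel_measurable_abs borel_measurable_power measurable_ip m1 m2) auto
  have uq: "{\<omega> \<in> space ?M. sdp_unique_maximizer p k (fst \<omega>) (rank1 p (snd \<omega>)) (rank1 p (fst \<omega> i))} \<in> sets ?M" if i: "i < k" for i
  proof -
    have g: "{\<omega> \<in> space ?M. \<exists>z\<in>grid k n m. competitor p k (fst \<omega>) (snd \<omega>) i n a b \<delta> (gpt k m z)} \<in> sets ?M"
      if "a < p" "b < p" for n m a b \<delta>
      by (rule sets.sets_Collect_finite_Ex[OF _ finite_grid]) (rule comp[OF i that])
    have g2: "{\<omega> \<in> space ?M. \<exists>c\<in>gbox k n. competitor p k (fst \<omega>) (snd \<omega>) i n a b 0 c} \<in> sets ?M"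
      if "a < p" "b < p" for n a b
      unfolding competitor_grid by (rule sets.sets_Collect_countable_All, rule sets.sets_Collect_countable_Ex, rule g[OF that])
    have g3: "{\<omega> \<in> space ?M. \<exists>b\<in>{..<p}. \<exists>c\<in>gbox k n. competitor p k (fst \<omega>) (snd \<omega>) i n a b 0 c} \<in> sets ?M" if "a < p" for n a
      by (rule sets.sets_Collect_finite_Ex) (use g2 that in auto)
    have g4: "{\<omega> \<in> space ?M. \<exists>a\<in>{..<p}. \<exists>b\<in>{..<p}. \<exists>c\<in>gbox k n. competitor p k (fst \<omega>) (snd \<omega>) i n a b 0 c} \<in> sets ?M" for n
      by (rule sets.sets_Collect_finite_Ex) (use g3 in auto)
    have g5: "{\<omega> \<in> space ?M. \<exists>n. \<exists>a\<in>{..<p}. \<exists>b\<in>{..<p}. \<exists>c\<in>gbox k n. competitor p k (fst \<omega>) (snd \<omega>) i n a b 0 c} \<in> sets ?M"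
      by (rule sets.sets_Collect_countable_Ex) (rule g4)
    have g6: "{\<omega> \<in> space ?M. dot p (fst \<omega> i) (fst \<omega> i) = 1} \<in> sets ?M"
      using i by (intro borel_measurable_eq borel_measurable_const measurable_ip m1) auto
    from sets.sets_Collect_conj[OF sets.sets_Collect_neg[OF g5] g6] show ?thesis
      unfolding unique_maximizer_iff[OF i] .
  qed
  show ?thesis
    unfolding good_event_def quad_rank1
  proof -
    have pe: "(\<exists>i<k. (\<forall>j<k. j \<noteq> i \<longrightarrow> f j < f i) \<and> U i) \<longleftrightarrow> (\<exists>i\<in>{..<k}. (\<forall>j\<in>{..<k} - {i}. f j < f i) \<and> U i)"
      for f :: "nat \<Rightarrow> real" and U by auto
    have e: "{\<omega> \<in> space ?M. \<exists>i<k. (\<forall>j<k. j \<noteq> i \<longrightarrow> (dot p (snd \<omega>) (fst \<omega> j))\<^sup>2 < (dot p (snd \<omega>) (fst \<omega> i))\<^sup>2) \<and>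
        sdp_unique_maximizer p k (fst \<omega>) (rank1 p (snd \<omega>)) (rank1 p (fst \<omega> i))} =
      {\<omega> \<in> space ?M. \<exists>i\<in>{..<k}. (\<forall>j\<in>{..<k} - {i}. (dot p (snd \<omega>) (fst \<omega> j))\<^sup>2 < (dot p (snd \<omega>) (fst \<omega> i))\<^sup>2) \<and>
        sdp_unique_maximizer p k (fst \<omega>) (rank1 p (snd \<omega>)) (rank1 p (fst \<omega> i))}"
      by (intro Collect_cong conj_cong refl pe)
    show "{\<omega> \<in> space ?M. \<exists>i<k. (\<forall>j<k. j \<noteq> i \<longrightarrow> (dot p (snd \<omega>) (fst \<omega> j))\<^sup>2 < (dot p (snd \<omega>) (fst \<omega> i))\<^sup>2) \<and>
        sdp_unique_maximizer p k (fst \<omega>) (rank1 p (snd \<omega>)) (rank1 p (fst \<omega> i))} \<in> sets ?M"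
      unfolding e
    proof (rule sets.sets_Collect_finite_Ex)
      fix i assume "i \<in> {..<k}"
      then have i: "i < k" by simp
      have v: "(\<lambda>\<omega>. (dot p (snd \<omega>) (fst \<omega> j))\<^sup>2) \<in> borel_measurable ?M" if "j < k" for j
        using that by (intro borel_measurable_power measurable_ip m1 m2) auto
      have "{\<omega> \<in> space ?M. \<forall>j\<in>{..<k} - {i}. (dot p (snd \<omega>) (fst \<omega> j))\<^sup>2 < (dot p (snd \<omega>) (fst \<omega> i))\<^sup>2} \<in> sets ?M"
        by (rule sets.sets_Collect_finite_All) (use v i in \<open>auto intro!: borel_measurable_less\<close>)
      from sets.sets_Collect_conj[OF uq[OF i] this]
      show "{\<omega> \<in> space ?M. (\<forall>j\<in>{..<k} - {i}. (dot p (snd \<omega>) (fst \<omega> j))\<^sup>2 < (dot p (snd \<omega>) (fst \<omega> i))\<^sup>2) \<and>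
        sdp_unique_maximizer p k (fst \<omega>) (rank1 p (snd \<omega>)) (rank1 p (fst \<omega> i))} \<in> sets ?M" .
    qed simp
  qed
qed

section \<open>Events of high probability\<close>

text \<open>The exceptional set is measurable and its probability is bounded uniformly in the fixed unit vector
  \<open>u\<close>, so that \<open>u\<close> can be integrated out at the end.\<close>
definition whp :: "(nat \<Rightarrow> nat) \<Rightarrow> (nat \<Rightarrow> (nat \<Rightarrow> real) \<Rightarrow> (nat \<Rightarrow> nat \<Rightarrow> real) \<Rightarrow> bool) \<Rightarrow> bool" where
  "whp k P \<longleftrightarrow> (\<forall>\<eta>>0. \<forall>\<^sub>F p in sequentially. \<forall>u. dot p u u = 1 \<longrightarrow>
     (\<exists>A\<in>sets (sph p {..<k p}). emeasure (sph p {..<k p}) A \<le> ennreal \<eta> \<and> (\<forall>d\<in>space (sph p {..<k p}) - A. P p u d)))"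

lemma whpI:
  assumes f: "f \<longlonglongrightarrow> 0"
    and P: "\<forall>\<^sub>F p in sequentially. \<forall>u. dot p u u = 1 \<longrightarrow> Q p \<longrightarrow>
     (\<exists>A\<in>sets (sph p {..<k p}). emeasure (sph p {..<k p}) A \<le> ennreal (f p) \<and> (\<forall>d\<in>space (sph p {..<k p}) - A. P p u d))"
  shows "whp k (\<lambda>p u d. Q p \<longrightarrow> P p u d)"
  unfolding whp_def
proof (intro allI impI)
  fix \<eta> :: real assume "\<eta> > 0"
  then have "\<forall>\<^sub>F p in sequentially. f p < \<eta>" using f by (rule order_tendstoD(2)[rotated])
  with P show "\<forall>\<^sub>F p in sequentially. \<forall>u. dot p u u = 1 \<longrightarrow>
     (\<exists>A\<in>sets (sph p {..<k p}). emeasure (sph p {..<k p}) A \<le> ennreal \<eta> \<and> (\<forall>d\<in>space (sph p {..<k p}) - A. Q p \<longrightarrow> P p u d))"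
  proof eventually_elim
    case (elim p)
    show ?case
    proof (intro allI impI)
      fix u assume u: "dot p u u = 1"
      show "\<exists>A\<in>sets (sph p {..<k p}). emeasure (sph p {..<k p}) A \<le> ennreal \<eta> \<and> (\<forall>d\<in>space (sph p {..<k p}) - A. Q p \<longrightarrow> P p u d)"
      proof (cases "Q p")
        case True
        then obtain A where A: "A \<in> sets (sph p {..<k p})" "emeasure (sph p {..<k p}) A \<le> ennreal (f p)" "\<forall>d\<in>space (sph p {..<k p}) - A. P p u d"
          using elim(1) u by blast
        then show ?thesis using elim(2) by (intro bexI[of _ A]) (auto intro: order_trans[OF _ ennreal_leI[OF less_imp_le]])
      qed (auto intro!: bexI[of _ "{}"])
    qed
  qed
qed

lemma whp_conj:
  assumes "whp k P" "whp k Q" shows "whp k (\<lambda>p u d. P p u d \<and> Q p u d)"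
  unfolding whp_def
proof (intro allI impI)
  fix \<eta> :: real assume "\<eta> > 0"
  then have "\<eta> / 2 > 0" by simp
  with assms have "\<forall>\<^sub>F p in sequentially. \<forall>u. dot p u u = 1 \<longrightarrow>
     (\<exists>A\<in>sets (sph p {..<k p}). emeasure (sph p {..<k p}) A \<le> ennreal (\<eta> / 2) \<and> (\<forall>d\<in>space (sph p {..<k p}) - A. P p u d))"
    "\<forall>\<^sub>F p in sequentially. \<forall>u. dot p u u = 1 \<longrightarrow>
     (\<exists>A\<in>sets (sph p {..<k p}). emeasure (sph p {..<k p}) A \<le> ennreal (\<eta> / 2) \<and> (\<forall>d\<in>space (sph p {..<k p}) - A. Q p u d))"
    unfolding whp_def by blast+
  then show "\<forall>\<^sub>F p in sequentially. \<forall>u. dot p u u = 1 \<longrightarrow>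
     (\<exists>A\<in>sets (sph p {..<k p}). emeasure (sph p {..<k p}) A \<le> ennreal \<eta> \<and> (\<forall>d\<in>space (sph p {..<k p}) - A. P p u d \<and> Q p u d))"
  proof eventually_elim
    case (elim p)
    show ?case
    proof (intro allI impI)
      fix u assume u: "dot p u u = 1"
      let ?M = "sph p {..<k p}"
      obtain A where A: "A \<in> sets ?M" "emeasure ?M A \<le> ennreal (\<eta> / 2)" "\<forall>d\<in>space ?M - A. P p u d" using elim(1) u by blast
      obtain B where B: "B \<in> sets ?M" "emeasure ?M B \<le> ennreal (\<eta> / 2)" "\<forall>d\<in>space ?M - B. Q p u d" using elim(2) u by blast
      have "emeasure ?M (A \<union> B) \<le> emeasure ?M A + emeasure ?M B" using A B by (intro emeasure_subadditive)
      also have "\<dots> \<le> ennreal (\<eta> / 2) + ennreal (\<eta> / 2)" using A B by (intro add_mono)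
      also have "\<dots> = ennreal \<eta>" using \<open>\<eta> > 0\<close> by (subst ennreal_plus[symmetric]) auto
      finally show "\<exists>A\<in>sets ?M. emeasure ?M A \<le> ennreal \<eta> \<and> (\<forall>d\<in>space ?M - A. P p u d \<and> Q p u d)"
        using A B by (intro bexI[of _ "A \<union> B"]) auto
    qed
  qed
qed

lemma whp_mono:
  assumes "whp k P" "\<forall>\<^sub>F p in sequentially. \<forall>u d. dot p u u = 1 \<longrightarrow> P p u d \<longrightarrow> Q p u d" shows "whp k Q"
  unfolding whp_def
proof (intro allI impI)
  fix \<eta> :: real assume "\<eta> > 0"
  with assms(1) have "\<forall>\<^sub>F p in sequentially. \<forall>u. dot p u u = 1 \<longrightarrow>
     (\<exists>A\<in>sets (sph p {..<k p}). emeasure (sph p {..<k p}) A \<le> ennreal \<eta> \<and> (\<forall>d\<in>space (sph p {..<k p}) - A. P p u d))"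
    unfolding whp_def by blast
  with assms(2) show "\<forall>\<^sub>F p in sequentially. \<forall>u. dot p u u = 1 \<longrightarrow>
     (\<exists>A\<in>sets (sph p {..<k p}). emeasure (sph p {..<k p}) A \<le> ennreal \<eta> \<and> (\<forall>d\<in>space (sph p {..<k p}) - A. Q p u d))"
    by eventually_elim blast
qed

section \<open>Probabilistic estimates for the given growth of \<open>k\<close>\<close>

locale growth =
  fixes k :: "nat \<Rightarrow> nat"
  assumes kpos: "\<forall>\<^sub>F p in sequentially. 0 < k p"
    and kup: "\<forall>\<^sub>F p in sequentially. real (k p) \<le> 2 * real p * ln (real p)"
begin

text \<open>Below the threshold \<open>k * p powr (-0.49)\<close> is small and the whole family is
  nearly orthonormal. Above it \<open>\<Lambda> \<ge> 0.2 * ln p\<close>, so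
  \<open>k / p \<le> 10 * \<Lambda>\<close> and additive constants are negligible against
  \<open>\<Lambda>\<close>.\<close>

definition large :: "nat \<Rightarrow> bool" where "large p \<longleftrightarrow> real p powr 0.2 \<le> real (k p)"

definition \<Lambda> :: "nat \<Rightarrow> real" where "\<Lambda> p = ln (real (k p))"

lemma basics: "\<forall>\<^sub>F p in sequentially. p \<ge> 2 \<and> k p > 0 \<and> real (k p) \<le> 2 * real p * ln (real p) \<and> real (k p) \<le> real p powr 1.01
   \<and> \<Lambda> p \<le> 1.01 * ln (real p) \<and> (large p \<longrightarrow> 0.2 * ln (real p) \<le> \<Lambda> p)"
proof -
  have "\<forall>\<^sub>F p in sequentially. 2 * real p * ln (real p) \<le> real p powr 1.01" by real_asymp
  with kpos kup eventually_ge_at_top[of 2] show ?thesis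
  proof eventually_elim
    case (elim p)
    have k1: "real (k p) \<le> real p powr 1.01" using elim by linarith
    have kp: "real (k p) > 0" using elim by simp
    have p0: "real p > 0" using elim by simp
    have "\<Lambda> p \<le> ln (real p powr 1.01)" unfolding \<Lambda>_def using k1 kp by (intro ln_mono) auto
    then have l1: "\<Lambda> p \<le> 1.01 * ln (real p)" using p0 by (simp add: ln_powr)
    have "0.2 * ln (real p) \<le> \<Lambda> p" if "large p"
    proof -
      have "ln (real p powr 0.2) \<le> \<Lambda> p" unfolding \<Lambda>_def by (rule ln_mono[OF that[unfolded large_def]]) (use p0 in auto)
      moreover have "ln (real p powr 0.2) = 0.2 * ln (real p)" by (simp only: ln_powr)
      ultimately show ?thesis by linarith
    qed
    then show ?case using elim k1 l1 by auto
  qed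
qed

lemma k_powr: "0 < k p \<Longrightarrow> real (k p) powr a = exp (a * \<Lambda> p)"
  by (simp add: powr_def \<Lambda>_def)

lemma whp_unit: "whp k (\<lambda>p u d. True \<longrightarrow> (\<forall>l<k p. dot p (d l) (d l) = 1))"
proof (rule whpI[of "\<lambda>_. 0"])
  show "\<forall>\<^sub>F p in sequentially. \<forall>u. dot p u u = 1 \<longrightarrow> True \<longrightarrow> (\<exists>A\<in>sets (sph p {..<k p}). emeasure (sph p {..<k p}) A \<le> ennreal 0 \<and>
     (\<forall>d\<in>space (sph p {..<k p}) - A. \<forall>l<k p. dot p (d l) (d l) = 1))"
    using eventually_ge_at_top[of 1]
  proof eventually_elim
    case (elim p)
    have "AE d in sph p {..<k p}. \<forall>l\<in>{..<k p}. dot p (d l) (d l) = 1" using elim by (intro AE_sph_unit) auto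
    then obtain A where "{d \<in> space (sph p {..<k p}). \<not> (\<forall>l\<in>{..<k p}. dot p (d l) (d l) = 1)} \<subseteq> A" "emeasure (sph p {..<k p}) A = 0" "A \<in> sets (sph p {..<k p})"
      by (rule AE_E)
    then show ?case by (intro allI impI bexI[of _ A]) auto
  qed
qed simp

text \<open>The exponent -0.98 leaves \<open>p powr 0.02\<close> in the exponential, which beats the
  polynomial number of pairs.\<close>

lemma whp_incoherent: "whp k (\<lambda>p u d. True \<longrightarrow> (\<forall>l<k p. (dot p u (d l))\<^sup>2 \<le> real p powr (-0.98)) \<and>
    (\<forall>l<k p. \<forall>m<k p. l \<noteq> m \<longrightarrow> (dot p (d l) (d m))\<^sup>2 \<le> real p powr (-0.98)))"
proof (rule whpI[of "\<lambda>p. ((real p powr 1.01)\<^sup>2 + real p powr 1.01) * (2 * exp (- (real p * real p powr (-0.98) / 4)))"])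
  show "(\<lambda>p. ((real p powr 1.01)\<^sup>2 + real p powr 1.01) * (2 * exp (- (real p * real p powr (-0.98) / 4)))) \<longlonglongrightarrow> 0" by real_asymp
  show "\<forall>\<^sub>F p in sequentially. \<forall>u. dot p u u = 1 \<longrightarrow> True \<longrightarrow> (\<exists>A\<in>sets (sph p {..<k p}). emeasure (sph p {..<k p}) A \<le>
      ennreal (((real p powr 1.01)\<^sup>2 + real p powr 1.01) * (2 * exp (- (real p * real p powr (-0.98) / 4)))) \<and>
     (\<forall>d\<in>space (sph p {..<k p}) - A. (\<forall>l<k p. (dot p u (d l))\<^sup>2 \<le> real p powr (-0.98)) \<and>
    (\<forall>l<k p. \<forall>m<k p. l \<noteq> m \<longrightarrow> (dot p (d l) (d m))\<^sup>2 \<le> real p powr (-0.98))))"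
    using basics
  proof eventually_elim
    case (elim p)
    show ?case
    proof (intro allI impI)
      fix u assume u: "dot p u u = 1"
      have p: "p \<ge> 1" and a: "real p powr (-0.98) > 0" using elim by auto
      have kk: "(real (k p))\<^sup>2 + real (k p) \<le> (real p powr 1.01)\<^sup>2 + real p powr 1.01" using elim by (intro add_mono power_mono) auto
      show "\<exists>A\<in>sets (sph p {..<k p}). emeasure (sph p {..<k p}) A \<le>
      ennreal (((real p powr 1.01)\<^sup>2 + real p powr 1.01) * (2 * exp (- (real p * real p powr (-0.98) / 4)))) \<and>
     (\<forall>d\<in>space (sph p {..<k p}) - A. (\<forall>l<k p. (dot p u (d l))\<^sup>2 \<le> real p powr (-0.98)) \<and>
    (\<forall>l<k p. \<forall>m<k p. l \<noteq> m \<longrightarrow> (dot p (d l) (d m))\<^sup>2 \<le> real p powr (-0.98)))"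
      proof (rule sph_incoherent[OF p u a, of "k p"])
        fix A assume A: "A \<in> sets (sph p {..<k p})"
          "emeasure (sph p {..<k p}) A \<le> ennreal (((real (k p))\<^sup>2 + real (k p)) * (2 * exp (- (real p * real p powr (-0.98) / 4))))"
          "\<And>d l. d \<in> space (sph p {..<k p}) - A \<Longrightarrow> l < k p \<Longrightarrow> (dot p u (d l))\<^sup>2 \<le> real p powr (-0.98)"
          "\<And>d l m. d \<in> space (sph p {..<k p}) - A \<Longrightarrow> l < k p \<Longrightarrow> m < k p \<Longrightarrow> l \<noteq> m \<Longrightarrow> (dot p (d l) (d m))\<^sup>2 \<le> real p powr (-0.98)"
        show ?thesis
        proof (intro bexI[OF _ A(1)] conjI ballI allI impI)
          show "emeasure (sph p {..<k p}) A \<le> ennreal (((real p powr 1.01)\<^sup>2 + real p powr 1.01) * (2 * exp (- (real p * real p powr (-0.98) / 4))))"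
            by (rule order_trans[OF A(2)]) (intro ennreal_leI mult_right_mono kk, simp)
        qed (use A(3,4) in auto)
      qed
    qed
  qed
qed

lemma powr_le_k: "large p \<Longrightarrow> p \<ge> 2 \<Longrightarrow> a \<ge> 0 \<Longrightarrow> real p powr (0.2 * a) \<le> real (k p) powr a"
  unfolding large_def powr_powr[symmetric] by (rule powr_mono2) auto

text \<open>Some \<open>k powr (-0.99)\<close> of the sphere must reach the height, so that
  \<open>k\<close> independent vectors hit it. The cap is aimed a little higher, at 1.96, to pay for
  the loss of one percent of the height in \<open>sphere_cap_lower\<close>.\<close>

lemma cap_prob_lower:
  "\<forall>\<^sub>F p in sequentially. large p \<longrightarrow> (\<forall>u. dot p u u = 1 \<longrightarrow>
     ennreal (exp (- 0.99 * \<Lambda> p) / 4) \<le> emeasure (unif_sphere p) {x \<in> space (unif_sphere p). (dot p u x)\<^sup>2 \<ge> 1.9 * \<Lambda> p / real p})"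
proof -
  have "\<forall>\<^sub>F p in sequentially. 1.96 * (1.01 * ln (real p)) / real p \<le> 1/2" "\<forall>\<^sub>F p in sequentially. 1.96\<^sup>2 * (1.01 * ln (real p)) / real p \<le> 0.01"
    "\<forall>\<^sub>F p in sequentially. 0.2 * ln (real p) \<ge> 20000" by real_asymp+
  with basics show ?thesis
  proof eventually_elim
    case (elim p)
    show ?case
    proof (intro impI allI)
      fix u assume lg: "large p" and u: "dot p u u = 1"
      let ?L = "\<Lambda> p" and ?p = "real p"
      have L: "?L \<ge> 20000" "?L \<le> 1.01 * ln ?p" using elim lg by auto
      have p0: "?p > 0" using elim by simp
      \<comment> \<open>The square of the shift. Half of 1.96 gives the exponent
        \<open>0.98 * \<Lambda>\<close>, the quadratic term of the logarithm costs another
        \<open>0.01 * \<Lambda>\<close>, and \<open>0.99^2 * 1.96\<close> is still above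
        1.9.\<close>
      define x where "x = 1.96 * ?L / ?p"
      have "x \<le> 1.96 * (1.01 * ln ?p) / ?p" unfolding x_def using L p0 by (intro divide_right_mono mult_left_mono) auto
      then have x: "0 < x" "x \<le> 1/2" using L p0 elim by (auto simp: x_def)
      have x2: "?p * x\<^sup>2 \<le> 0.01 * ?L"
      proof -
        have "?p * x\<^sup>2 = (1.96\<^sup>2 * ?L / ?p) * ?L" using p0 by (simp add: x_def power2_eq_square field_simps)
        also have "\<dots> \<le> (1.96\<^sup>2 * (1.01 * ln ?p) / ?p) * ?L" using L p0 by (intro mult_right_mono divide_right_mono mult_left_mono) auto
        also have "\<dots> \<le> 0.01 * ?L" using elim L by (intro mult_right_mono) auto
        finally show ?thesis .
      qed
      define s where "s = sqrt x"
      have s: "0 < s" "s < 1" "s\<^sup>2 = x" using x by (auto simp: s_def)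
      have cap: "ennreal (sqrt (1 - s\<^sup>2) ^ p * (1/2 - exp (- (?p * ((1/100) * s)\<^sup>2 / 2))))
         \<le> emeasure (unif_sphere p) {d \<in> space (unif_sphere p). (dot p u d)\<^sup>2 \<ge> ((1 - 1/100) * s)\<^sup>2}"
        using elim u s by (intro sphere_cap_lower) auto
      have "exp (- 0.99 * ?L) / 4 \<le> sqrt (1 - s\<^sup>2) ^ p * (1/2 - exp (- (?p * ((1/100) * s)\<^sup>2 / 2)))"
      proof -
        have "- x - 2 * x\<^sup>2 \<le> ln (1 - x)" using ln_one_minus_pos_lower_bound[of x] x by auto
        then have "exp (- x - 2 * x\<^sup>2) \<le> 1 - x" using x by (subst (asm) ln_ge_iff) auto
        then have "exp ((- x - 2 * x\<^sup>2) / 2) \<le> sqrt (1 - x)"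
          by (intro real_le_rsqrt) (simp add: power2_eq_square flip: exp_add)
        then have "exp ((- x - 2 * x\<^sup>2) / 2) ^ p \<le> sqrt (1 - s\<^sup>2) ^ p" unfolding s(3) by (intro power_mono) auto
        moreover have "exp (- 0.99 * ?L) \<le> exp ((- x - 2 * x\<^sup>2) / 2) ^ p"
        proof -
          have "?p * ((- x - 2 * x\<^sup>2) / 2) = - 0.98 * ?L - ?p * x\<^sup>2" using p0 by (simp add: x_def field_simps power2_eq_square)
          then show ?thesis unfolding exp_power_real using x2 by simp
        qed
        ultimately have 1: "exp (- 0.99 * ?L) \<le> sqrt (1 - s\<^sup>2) ^ p" by linarith
        have "?p * ((1/100) * s)\<^sup>2 / 2 = 0.98 / 10000 * ?L" unfolding power_mult_distrib s(3) using p0 by (simp add: x_def power2_eq_square)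
        then have "?p * ((1/100) * s)\<^sup>2 / 2 \<ge> 1.9" using L by simp
        then have "exp (- (?p * ((1/100) * s)\<^sup>2 / 2)) \<le> exp (- 1.9)" by simp
        also have "exp (- 1.9) \<le> (1/4 :: real)"
        proof -
          have "(4 :: real) \<le> 1 + 1.9 + 1.9\<^sup>2 / 2" by (simp add: power2_eq_square)
          also have "\<dots> \<le> exp 1.9" by (rule exp_lower_Taylor_quadratic) simp
          finally show ?thesis by (simp add: exp_minus field_simps)
        qed
        finally have 2: "1/4 \<le> 1/2 - exp (- (?p * ((1/100) * s)\<^sup>2 / 2))" by simp
        have "exp (- 0.99 * ?L) * (1/4) \<le> sqrt (1 - s\<^sup>2) ^ p * (1/2 - exp (- (?p * ((1/100) * s)\<^sup>2 / 2)))"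
          using 1 2 s x by (intro mult_mono) auto
        then show ?thesis by simp
      qed
      then have "ennreal (exp (- 0.99 * ?L) / 4) \<le> emeasure (unif_sphere p) {d \<in> space (unif_sphere p). (dot p u d)\<^sup>2 \<ge> ((1 - 1/100) * s)\<^sup>2}"
        using cap by (meson ennreal_leI order_trans)
      also have "\<dots> \<le> emeasure (unif_sphere p) {x \<in> space (unif_sphere p). (dot p u x)\<^sup>2 \<ge> 1.9 * ?L / ?p}"
      proof (intro emeasure_mono subsetI CollectI conjI; (elim CollectE conjE)?)
        have e: "1.9 * ?L / ?p \<le> ((1 - 1/100) * s)\<^sup>2"
        proof -
          have "1.9 * ?L / ?p \<le> (0.9801 * (1.96 * ?L)) / ?p" using p0 L(1) by (intro divide_right_mono) auto
          then show ?thesis unfolding power_mult_distrib s(3) x_def by (simp add: power2_eq_square)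
        qed
        fix y assume "((1 - 1/100) * s)\<^sup>2 \<le> (dot p u y)\<^sup>2"
        then show "(dot p u y)\<^sup>2 \<ge> 1.9 * ?L / ?p" using e by linarith
      qed (auto simp: sets_sphere space_sphere)
      finally show "ennreal (exp (- 0.99 * ?L) / 4) \<le> emeasure (unif_sphere p) {x \<in> space (unif_sphere p). (dot p u x)\<^sup>2 \<ge> 1.9 * ?L / ?p}" .
    qed
  qed
qed

text \<open>The expected number of hits is at least \<open>k powr 0.01 / 4\<close>, and
  \<open>0.2 * 0.01 = 0.002\<close> is the resulting power of \<open>p\<close>.\<close>

lemma whp_some_large: "whp k (\<lambda>p u d. large p \<longrightarrow> (\<exists>l<k p. (dot p u (d l))\<^sup>2 \<ge> 1.9 * \<Lambda> p / real p))"
proof (rule whpI[of "\<lambda>p. exp (- (real p powr 0.002 / 4))"])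
  show "(\<lambda>p. exp (- (real p powr 0.002 / 4))) \<longlonglongrightarrow> 0" by real_asymp
  show "\<forall>\<^sub>F p in sequentially. \<forall>u. dot p u u = 1 \<longrightarrow> large p \<longrightarrow> (\<exists>A\<in>sets (sph p {..<k p}). emeasure (sph p {..<k p}) A \<le> ennreal (exp (- (real p powr 0.002 / 4))) \<and>
     (\<forall>d\<in>space (sph p {..<k p}) - A. \<exists>l<k p. (dot p u (d l))\<^sup>2 \<ge> 1.9 * \<Lambda> p / real p))"
    using basics cap_prob_lower
  proof eventually_elim
    case (elim p)
    show ?case
    proof (intro allI impI)
      fix u assume u: "dot p u u = 1" and lg: "large p"
      have p: "p \<ge> 1" and kp: "0 < k p" and p2: "p \<ge> 2" using elim by auto
      have q: "ennreal (exp (- 0.99 * \<Lambda> p) / 4) \<le> emeasure (unif_sphere p) {x \<in> space (unif_sphere p). (dot p u x)\<^sup>2 \<ge> 1.9 * \<Lambda> p / real p}"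
        using elim u lg by blast
      show "\<exists>A\<in>sets (sph p {..<k p}). emeasure (sph p {..<k p}) A \<le> ennreal (exp (- (real p powr 0.002 / 4))) \<and>
     (\<forall>d\<in>space (sph p {..<k p}) - A. \<exists>l<k p. (dot p u (d l))\<^sup>2 \<ge> 1.9 * \<Lambda> p / real p)"
      proof (rule sph_some_large[OF p u q, of "k p"])
        fix A assume A: "A \<in> sets (sph p {..<k p})" "emeasure (sph p {..<k p}) A \<le> ennreal (exp (- (real (k p) * (exp (- 0.99 * \<Lambda> p) / 4))))"
          "\<And>d. d \<in> space (sph p {..<k p}) - A \<Longrightarrow> \<exists>l<k p. (dot p u (d l))\<^sup>2 \<ge> 1.9 * \<Lambda> p / real p"
        have "real (k p) = exp (\<Lambda> p)" using kp by (simp add: \<Lambda>_def)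
        then have "real (k p) * exp (- 0.99 * \<Lambda> p) = real (k p) powr 0.01" unfolding k_powr[OF kp] by (simp flip: exp_add)
        then have "real p powr 0.002 \<le> real (k p) * exp (- 0.99 * \<Lambda> p)" using powr_le_k[OF lg p2, of "0.01"] by simp
        then have "ennreal (exp (- (real (k p) * (exp (- 0.99 * \<Lambda> p) / 4)))) \<le> ennreal (exp (- (real p powr 0.002 / 4)))" by (intro ennreal_leI) simp
        then show ?thesis using A by (intro bexI[OF _ A(1)]) (auto intro: order_trans)
      qed simp
    qed
  qed
qed

text \<open>Since \<open>k = exp \<Lambda>\<close>, the expected number of vectors above the level
  \<open>b * \<Lambda> / p\<close> is at most \<open>2 * k powr (1 - b / 2)\<close>; the rest is
  Markov's inequality with threshold \<open>t p\<close>.\<close>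

lemma count_event:
  assumes b: "0 < b" "b \<le> 2" and f: "(\<lambda>p. 2 * (2 * real p * ln (real p)) powr (1 - b / 2) / t p) \<longlonglongrightarrow> 0" and t: "\<And>p. p \<ge> 2 \<Longrightarrow> t p > 0"
  shows "whp k (\<lambda>p u d. large p \<longrightarrow> real (card {l. l < k p \<and> (dot p u (d l))\<^sup>2 > b * \<Lambda> p / real p}) \<le> t p)"
proof (rule whpI[OF f])
  have "\<forall>\<^sub>F p in sequentially. 2 * (1.01 * ln (real p)) / real p \<le> 1/2" "\<forall>\<^sub>F p in sequentially. 0.2 * ln (real p) > 0" by real_asymp+
  with basics show "\<forall>\<^sub>F p in sequentially. \<forall>u. dot p u u = 1 \<longrightarrow> large p \<longrightarrow> (\<exists>A\<in>sets (sph p {..<k p}). emeasure (sph p {..<k p}) A \<le> ennreal (2 * (2 * real p * ln (real p)) powr (1 - b / 2) / t p) \<and>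
     (\<forall>d\<in>space (sph p {..<k p}) - A. real (card {l. l < k p \<and> (dot p u (d l))\<^sup>2 > b * \<Lambda> p / real p}) \<le> t p))"
  proof eventually_elim
    case (elim p)
    show ?case
    proof (intro allI impI)
      fix u assume u: "dot p u u = 1" and lg: "large p"
      have p: "p \<ge> 1" and kp: "0 < k p" and tp: "t p > 0" and p0: "real p > 0" using elim t by auto
      have L: "\<Lambda> p > 0" "\<Lambda> p \<le> 1.01 * ln (real p)"
      proof -
        have "0.2 * ln (real p) \<le> \<Lambda> p" "0.2 * ln (real p) > 0" using elim lg by blast+
        then show "\<Lambda> p > 0" by linarith
      qed (use elim in blast)
      have a: "0 < b * \<Lambda> p / real p" using L b p0 by simp
      have "b * \<Lambda> p / real p \<le> 2 * (1.01 * ln (real p)) / real p" using L b p0 by (intro divide_right_mono mult_mono) auto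
      then have a2: "b * \<Lambda> p / real p \<le> 1/2" using elim by linarith
      show "\<exists>A\<in>sets (sph p {..<k p}). emeasure (sph p {..<k p}) A \<le> ennreal (2 * (2 * real p * ln (real p)) powr (1 - b / 2) / t p) \<and>
     (\<forall>d\<in>space (sph p {..<k p}) - A. real (card {l. l < k p \<and> (dot p u (d l))\<^sup>2 > b * \<Lambda> p / real p}) \<le> t p)"
      proof (rule sph_count_large[OF p u a a2 tp, of "k p"])
        fix A assume A: "A \<in> sets (sph p {..<k p})" "emeasure (sph p {..<k p}) A \<le> ennreal (real (k p) * (2 * exp (- (real p * (b * \<Lambda> p / real p) / 2))) / t p)"
          "\<And>d. d \<in> space (sph p {..<k p}) - A \<Longrightarrow> real (card {l. l < k p \<and> (dot p u (d l))\<^sup>2 > b * \<Lambda> p / real p}) \<le> t p"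
        have "real (k p) = exp (\<Lambda> p)" using kp by (simp add: \<Lambda>_def)
        then have "real (k p) * (2 * exp (- (real p * (b * \<Lambda> p / real p) / 2))) = 2 * real (k p) powr (1 - b / 2)"
          unfolding k_powr[OF kp] using p0 by (simp add: algebra_simps flip: exp_add)
        also have "\<dots> \<le> 2 * (2 * real p * ln (real p)) powr (1 - b / 2)" using elim b by (intro mult_left_mono powr_mono2) auto
        finally have "ennreal (real (k p) * (2 * exp (- (real p * (b * \<Lambda> p / real p) / 2))) / t p) \<le> ennreal (2 * (2 * real p * ln (real p)) powr (1 - b / 2) / t p)"
          using tp by (intro ennreal_leI divide_right_mono) auto
        then show ?thesis using A by (intro bexI[OF _ A(1)]) (auto intro: order_trans)
      qed
    qed
  qed
qed

text \<open>The expected number is about \<open>k powr 0.15\<close>; raising the power of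
  \<open>p\<close> to 0.18 absorbs the logarithm and gives room for Markov's inequality.\<close>

lemma whp_count_top: "whp k (\<lambda>p u d. large p \<longrightarrow> real (card {l. l < k p \<and> (dot p u (d l))\<^sup>2 > 1.7 * \<Lambda> p / real p}) \<le> real p powr 0.18)"
  by (rule count_event) (simp, simp, real_asymp, simp)

text \<open>The level gives the power \<open>1 - 1/500000\<close> of \<open>k\<close>. Half of this
  saving is kept, enough for the moderately large projections to be within reach of restricted
  isometry.\<close>

lemma whp_count_mid: "whp k (\<lambda>p u d. large p \<longrightarrow> real (card {l. l < k p \<and> (dot p u (d l))\<^sup>2 > 1/250000 * \<Lambda> p / real p}) \<le> real p powr (1 - 1/1000000))"
  by (rule count_event) (simp, simp, real_asymp, simp)

lemma whpI_on:
  assumes f: "f \<longlonglongrightarrow> 0" and B: "\<forall>\<^sub>F p in sequentially. B p"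
    and A: "\<And>p u. B p \<Longrightarrow> Q p \<Longrightarrow> dot p u u = 1 \<Longrightarrow> \<exists>A\<in>sets (sph p {..<k p}). emeasure (sph p {..<k p}) A \<le> ennreal (g p) \<and> (\<forall>d\<in>space (sph p {..<k p}) - A. P p u d)"
    and g: "\<And>p. B p \<Longrightarrow> Q p \<Longrightarrow> g p \<le> f p"
  shows "whp k (\<lambda>p u d. Q p \<longrightarrow> P p u d)"
proof (rule whpI[OF f])
  show "\<forall>\<^sub>F p in sequentially. \<forall>u. dot p u u = 1 \<longrightarrow> Q p \<longrightarrow>
     (\<exists>A\<in>sets (sph p {..<k p}). emeasure (sph p {..<k p}) A \<le> ennreal (f p) \<and> (\<forall>d\<in>space (sph p {..<k p}) - A. P p u d))"
    using B
  proof eventually_elim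
    case (elim p)
    show ?case
    proof (intro allI impI)
      fix u assume u: "dot p u u = 1" and q: "Q p"
      obtain A where "A\<in>sets (sph p {..<k p})" "emeasure (sph p {..<k p}) A \<le> ennreal (g p)" "\<forall>d\<in>space (sph p {..<k p}) - A. P p u d"
        using A[OF elim q u] by blast
      then show "\<exists>A\<in>sets (sph p {..<k p}). emeasure (sph p {..<k p}) A \<le> ennreal (f p) \<and> (\<forall>d\<in>space (sph p {..<k p}) - A. P p u d)"
        using ennreal_leI[OF g[OF elim q]] by (meson order_trans)
    qed
  qed
qed

definition fb :: "nat \<Rightarrow> real" where "fb p = 160 * real (k p) / real p + 64"

lemma whp_frame: "whp k (\<lambda>p u d. True \<longrightarrow> (\<forall>x. (\<Sum>l<k p. (dot p x (d l))\<^sup>2) \<le> fb p * dot p x x))"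
proof (rule whpI_on[of "\<lambda>p. exp (- real p)" "\<lambda>p. p \<ge> 1" _ "\<lambda>p. exp (- real p)"])
  show "\<exists>A\<in>sets (sph p {..<k p}). emeasure (sph p {..<k p}) A \<le> ennreal (exp (- real p)) \<and>
      (\<forall>d\<in>space (sph p {..<k p}) - A. \<forall>x. (\<Sum>l<k p. (dot p x (d l))\<^sup>2) \<le> fb p * dot p x x)" if "p \<ge> 1" for p
    unfolding fb_def using sph_frame_upper[OF that, of "k p"] by metis
qed (real_asymp, rule eventually_ge_at_top, simp)

lemma cc_le: "p \<ge> 1 \<Longrightarrow> cc p \<le> 2 / (real p)\<^sup>2"
  unfolding cc_def power2_eq_square by (intro divide_left_mono mult_left_mono) auto

lemma path_bound:
  assumes "p \<ge> 2" "real (k p) \<le> real p powr 1.01"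
  shows "real (k p) * (cc p)\<^sup>2 + (real (k p))\<^sup>2 * (cc p)^3 \<le> real p powr 1.01 * (2 / (real p)\<^sup>2)\<^sup>2 + (real p powr 1.01)\<^sup>2 * (2 / (real p)\<^sup>2)^3"
  using cc_le[of p] cc_nonneg assms by (intro add_mono mult_mono power_mono) auto

text \<open>The expectation is about \<open>p powr (-1.98)\<close>, so -1.9 leaves room for Markov's
  inequality.\<close>

lemma whp_evec: "whp k (\<lambda>p u d. True \<longrightarrow> (\<Sum>m<k p. (evec p (k p) u d m)\<^sup>2) \<le> real p powr (-1.9))"
proof (rule whpI_on[OF _ basics, of "\<lambda>p. real p powr 1.01 * (real p powr 1.01 * (2 / (real p)\<^sup>2)\<^sup>2 + (real p powr 1.01)\<^sup>2 * (2 / (real p)\<^sup>2)^3) / real p powr (-1.9)"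
    _ "\<lambda>p. real (k p) * (real (k p) * (cc p)\<^sup>2 + (real (k p))\<^sup>2 * (cc p)^3) / real p powr (-1.9)"])
  fix p u assume B: "p \<ge> 2 \<and> k p > 0 \<and> real (k p) \<le> 2 * real p * ln (real p) \<and> real (k p) \<le> real p powr 1.01 \<and> \<Lambda> p \<le> 1.01 * ln (real p) \<and> (large p \<longrightarrow> 0.2 * ln (real p) \<le> \<Lambda> p)"
    and u: "dot p u u = 1"
  have p: "p \<ge> 1" "real p powr (-1.9) > 0" using B by auto
  show "\<exists>A\<in>sets (sph p {..<k p}). emeasure (sph p {..<k p}) A \<le> ennreal (real (k p) * (real (k p) * (cc p)\<^sup>2 + (real (k p))\<^sup>2 * (cc p)^3) / real p powr (-1.9)) \<and>
      (\<forall>d\<in>space (sph p {..<k p}) - A. (\<Sum>m<k p. (evec p (k p) u d m)\<^sup>2) \<le> real p powr (-1.9))"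
    using sph_evec[OF p(1) u p(2), of "k p"] by metis
next
  fix p assume B: "p \<ge> 2 \<and> k p > 0 \<and> real (k p) \<le> 2 * real p * ln (real p) \<and> real (k p) \<le> real p powr 1.01 \<and> \<Lambda> p \<le> 1.01 * ln (real p) \<and> (large p \<longrightarrow> 0.2 * ln (real p) \<le> \<Lambda> p)"
  show "real (k p) * (real (k p) * (cc p)\<^sup>2 + (real (k p))\<^sup>2 * (cc p)^3) / real p powr (-1.9) \<le>
    real p powr 1.01 * (real p powr 1.01 * (2 / (real p)\<^sup>2)\<^sup>2 + (real p powr 1.01)\<^sup>2 * (2 / (real p)\<^sup>2)^3) / real p powr (-1.9)"
    using B path_bound[of p] cc_nonneg[of p] by (intro divide_right_mono mult_mono) auto
qed real_asymp

text \<open>The expectation is about \<open>p powr (-0.97)\<close>; the square root of the bound is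
  later compared with the square of the operator norm.\<close>

lemma whp_mvec: "whp k (\<lambda>p u d. True \<longrightarrow> (\<Sum>(l, n)\<in>{..<k p} \<times> {..<k p} - Id. (mvec p (k p) d l n)\<^sup>2) \<le> real p powr (-0.5))"
proof (rule whpI_on[OF _ basics, of "\<lambda>p. (real p powr 1.01)\<^sup>2 * (real p powr 1.01 * (2 / (real p)\<^sup>2)\<^sup>2 + (real p powr 1.01)\<^sup>2 * (2 / (real p)\<^sup>2)^3) / real p powr (-0.5)"
    _ "\<lambda>p. (real (k p))\<^sup>2 * (real (k p) * (cc p)\<^sup>2 + (real (k p))\<^sup>2 * (cc p)^3) / real p powr (-0.5)"])
  fix p u assume B: "p \<ge> 2 \<and> k p > 0 \<and> real (k p) \<le> 2 * real p * ln (real p) \<and> real (k p) \<le> real p powr 1.01 \<and> \<Lambda> p \<le> 1.01 * ln (real p) \<and> (large p \<longrightarrow> 0.2 * ln (real p) \<le> \<Lambda> p)"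
  have p: "p \<ge> 1" "real p powr (-0.5) > 0" using B by auto
  show "\<exists>A\<in>sets (sph p {..<k p}). emeasure (sph p {..<k p}) A \<le> ennreal ((real (k p))\<^sup>2 * (real (k p) * (cc p)\<^sup>2 + (real (k p))\<^sup>2 * (cc p)^3) / real p powr (-0.5)) \<and>
      (\<forall>d\<in>space (sph p {..<k p}) - A. (\<Sum>(l, n)\<in>{..<k p} \<times> {..<k p} - Id. (mvec p (k p) d l n)\<^sup>2) \<le> real p powr (-0.5))"
    using sph_mvec[OF p, of "k p"] by metis
next
  fix p assume B: "p \<ge> 2 \<and> k p > 0 \<and> real (k p) \<le> 2 * real p * ln (real p) \<and> real (k p) \<le> real p powr 1.01 \<and> \<Lambda> p \<le> 1.01 * ln (real p) \<and> (large p \<longrightarrow> 0.2 * ln (real p) \<le> \<Lambda> p)"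
  show "(real (k p))\<^sup>2 * (real (k p) * (cc p)\<^sup>2 + (real (k p))\<^sup>2 * (cc p)^3) / real p powr (-0.5) \<le>
    (real p powr 1.01)\<^sup>2 * (real p powr 1.01 * (2 / (real p)\<^sup>2)\<^sup>2 + (real p powr 1.01)\<^sup>2 * (2 / (real p)\<^sup>2)^3) / real p powr (-0.5)"
    using B path_bound[of p] cc_nonneg[of p] by (intro divide_right_mono mult_mono power_mono) auto
qed real_asymp

lemma whp_hh_sum: "whp k (\<lambda>p u d. True \<longrightarrow> (\<Sum>l<k p. hh p u (d l))\<^sup>2 \<le> real p powr (-0.2))"
proof (rule whpI_on[OF _ basics, of "\<lambda>p. real p powr 1.01 * (2 / (real p)\<^sup>2) / real p powr (-0.2)" _ "\<lambda>p. real (k p) * cc p / real p powr (-0.2)"])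
  fix p u assume B: "p \<ge> 2 \<and> k p > 0 \<and> real (k p) \<le> 2 * real p * ln (real p) \<and> real (k p) \<le> real p powr 1.01 \<and> \<Lambda> p \<le> 1.01 * ln (real p) \<and> (large p \<longrightarrow> 0.2 * ln (real p) \<le> \<Lambda> p)"
    and u: "dot p u u = 1"
  have p: "p \<ge> 1" "real p powr (-0.2) > 0" using B by auto
  show "\<exists>A\<in>sets (sph p {..<k p}). emeasure (sph p {..<k p}) A \<le> ennreal (real (k p) * cc p / real p powr (-0.2)) \<and>
      (\<forall>d\<in>space (sph p {..<k p}) - A. (\<Sum>l<k p. hh p u (d l))\<^sup>2 \<le> real p powr (-0.2))"
    using sph_hh_sum[OF p(1) u p(2), of "k p"] by metis
next
  fix p assume B: "p \<ge> 2 \<and> k p > 0 \<and> real (k p) \<le> 2 * real p * ln (real p) \<and> real (k p) \<le> real p powr 1.01 \<and> \<Lambda> p \<le> 1.01 * ln (real p) \<and> (large p \<longrightarrow> 0.2 * ln (real p) \<le> \<Lambda> p)"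
  show "real (k p) * cc p / real p powr (-0.2) \<le> real p powr 1.01 * (2 / (real p)\<^sup>2) / real p powr (-0.2)"
    using B cc_le[of p] cc_nonneg[of p] by (intro divide_right_mono mult_mono) auto
qed real_asymp

text \<open>The union over sets costs \<open>exp\<close> of \<open>p powr (1 - 1/1000000)\<close>
  times a logarithm, which is sublinear in \<open>p\<close> and loses against
  \<open>exp (- p / 100000)\<close>.\<close>

lemma whp_rip: "whp k (\<lambda>p u d. True \<longrightarrow> (\<forall>S x. S \<subseteq> {..<k p} \<longrightarrow> real (card S) \<le> real p powr (1 - 1/1000000) \<longrightarrow> (\<Sum>l\<in>S. (dot p x (d l))\<^sup>2) \<le> 1.05 * dot p x x))"
proof -
  \<comment> \<open>The cap at \<open>k p\<close> guarantees that a smaller set can be enlarged to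
    exactly \<open>n p\<close> elements.\<close>
  define n where "n p = min (nat \<lfloor>real p powr (1 - 1/1000000)\<rfloor>) (k p)" for p
  have n: "real (n p) \<le> real p powr (1 - 1/1000000)" for p by (simp add: n_def min_def) linarith
  have e: "\<forall>\<^sub>F p in sequentially. 12000 * real p powr (1 - 1/1000000) / real p \<le> 0.01" by real_asymp
  show ?thesis
  proof (rule whpI_on[OF _ eventually_conj[OF basics e], of "\<lambda>p. exp (real p powr (1 - 1/1000000) * (1.01 * ln (real p)) - real p / 100000)" _ "\<lambda>p. real (k p) ^ n p * exp (- real p / 100000)"])
    fix p u assume B: "(p \<ge> 2 \<and> k p > 0 \<and> real (k p) \<le> 2 * real p * ln (real p) \<and> real (k p) \<le> real p powr 1.01 \<and> \<Lambda> p \<le> 1.01 * ln (real p) \<and> (large p \<longrightarrow> 0.2 * ln (real p) \<le> \<Lambda> p))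
      \<and> 12000 * real p powr (1 - 1/1000000) / real p \<le> 0.01"
    have p: "p \<ge> 1" using B by auto
    have c: "1.04 + 12000 * real (n p) / real p \<le> 1.05"
    proof -
      have "12000 * real (n p) / real p \<le> 12000 * real p powr (1 - 1/1000000) / real p" using n[of p] by (intro divide_right_mono mult_left_mono) auto
      then show ?thesis using B by linarith
    qed
    show "\<exists>A\<in>sets (sph p {..<k p}). emeasure (sph p {..<k p}) A \<le> ennreal (real (k p) ^ n p * exp (- real p / 100000)) \<and>
      (\<forall>d\<in>space (sph p {..<k p}) - A. \<forall>S x. S \<subseteq> {..<k p} \<longrightarrow> real (card S) \<le> real p powr (1 - 1/1000000) \<longrightarrow> (\<Sum>l\<in>S. (dot p x (d l))\<^sup>2) \<le> 1.05 * dot p x x)"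
    proof (rule sph_rip[OF p, of "k p" "n p"])
      fix A assume A: "A \<in> sets (sph p {..<k p})" "emeasure (sph p {..<k p}) A \<le> ennreal (real (k p) ^ n p * exp (- real p / 100000))"
        "\<And>d x S. d \<in> space (sph p {..<k p}) - A \<Longrightarrow> S \<subseteq> {..<k p} \<Longrightarrow> card S = n p \<Longrightarrow> (\<Sum>l\<in>S. (dot p x (d l))\<^sup>2) \<le> (1.04 + 12000 * real (n p) / real p) * dot p x x"
      show ?thesis
      proof (intro bexI[OF _ A(1)] conjI A(2) ballI allI impI)
        fix d S x assume d: "d \<in> space (sph p {..<k p}) - A" and S: "S \<subseteq> {..<k p}" "real (card S) \<le> real p powr (1 - 1/1000000)"
        have "card S \<le> n p" using S(2) card_mono[OF _ S(1)] by (simp add: n_def le_nat_floor)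
        moreover have "n p \<le> card {..<k p}" by (simp add: n_def)
        ultimately obtain S' where S': "S \<subseteq> S'" "S' \<subseteq> {..<k p}" "card S' = n p" using exists_subset_between[OF _ _ S(1)] by (metis finite_lessThan)
        have "(\<Sum>l\<in>S. (dot p x (d l))\<^sup>2) \<le> (\<Sum>l\<in>S'. (dot p x (d l))\<^sup>2)" using S' finite_subset[OF S'(2)] by (intro sum_mono2) auto
        also have "\<dots> \<le> (1.04 + 12000 * real (n p) / real p) * dot p x x" by (rule A(3)[OF d S'(2,3)])
        also have "\<dots> \<le> 1.05 * dot p x x" by (intro mult_right_mono c ip_self_nonneg)
        finally show "(\<Sum>l\<in>S. (dot p x (d l))\<^sup>2) \<le> 1.05 * dot p x x" .
      qed
    qed
  next
    fix p assume B: "(p \<ge> 2 \<and> k p > 0 \<and> real (k p) \<le> 2 * real p * ln (real p) \<and> real (k p) \<le> real p powr 1.01 \<and> \<Lambda> p \<le> 1.01 * ln (real p) \<and> (large p \<longrightarrow> 0.2 * ln (real p) \<le> \<Lambda> p))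
      \<and> 12000 * real p powr (1 - 1/1000000) / real p \<le> 0.01"
    have k: "real (k p) = exp (\<Lambda> p)" using B by (simp add: \<Lambda>_def)
    have L0: "\<Lambda> p \<ge> 0" unfolding \<Lambda>_def using B by (intro ln_ge_zero) auto
    have "real (n p) * \<Lambda> p \<le> real p powr (1 - 1/1000000) * (1.01 * ln (real p))" using n[of p] L0 B by (intro mult_mono) auto
    then show "real (k p) ^ n p * exp (- real p / 100000) \<le> exp (real p powr (1 - 1/1000000) * (1.01 * ln (real p)) - real p / 100000)"
      unfolding k exp_power_real by (simp flip: exp_add)
  qed real_asymp
qed

text \<open>\<open>sph_bulk\<close> with \<open>\<tau> = \<Lambda> / 250000\<close> and
  \<open>\<eta> = 1/500\<close>. Its three error terms are each at most
  \<open>0.01 * \<Lambda>\<close>: the frame term because \<open>\<eta>^2\<close> is small against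
  \<open>k / p \<le> 10 * \<Lambda>\<close>, the entropy term because \<open>\<tau>\<close> is a
  tiny multiple of \<open>\<Lambda>\<close>, and the second-order term because it is a huge
  constant, whence the large lower bound on \<open>ln p\<close>.\<close>

lemma whp_bulk: "whp k (\<lambda>p u d. large p \<longrightarrow> (\<forall>x. (\<Sum>l<k p. (dot p x (d l))\<^sup>2) \<le> fb p * dot p x x) \<longrightarrow>
   (\<forall>x. (\<Sum>l<k p. trunc_weight p u (\<Lambda> p / 250000) (d l) * (dot p x (d l))\<^sup>2) \<le> 2 * real (k p) / real p * (dot p u x)\<^sup>2 + 0.05 * \<Lambda> p * dot p x x))"
proof -
  have e: "\<forall>\<^sub>F p in sequentially. ln (real p) \<ge> 100000000000000000000" by real_asymp
  show ?thesis
  proof (rule whpI_on[OF _ eventually_conj[OF basics e], of "\<lambda>p. exp (- real p)" _ "\<lambda>p. exp (- real p)"])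
    fix p u assume B: "(p \<ge> 2 \<and> k p > 0 \<and> real (k p) \<le> 2 * real p * ln (real p) \<and> real (k p) \<le> real p powr 1.01 \<and> \<Lambda> p \<le> 1.01 * ln (real p) \<and> (large p \<longrightarrow> 0.2 * ln (real p) \<le> \<Lambda> p))
      \<and> ln (real p) \<ge> 100000000000000000000" and lg: "large p" and u: "dot p u u = 1"
    have p: "p \<ge> 1" using B by auto
    have L: "\<Lambda> p \<ge> 0.2 * ln (real p)" "\<Lambda> p \<ge> 10000000000000000000" using B lg by linarith+
    have \<tau>: "\<Lambda> p / 250000 \<ge> 1" using L by simp
    have kp: "real (k p) / real p \<le> 2 * ln (real p)" using B by (simp add: divide_le_eq algebra_simps)
    have c: "(1/500)\<^sup>2 * (fb p + 2 * real (k p) / real p) + 1181952 * real (k p) / (real p * (\<Lambda> p / 250000)) + 256 * (\<Lambda> p / 250000) * (1 + ln ((1 + 1/500) / (1/500))) \<le> 0.05 * \<Lambda> p"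
    proof -
      have "(1/500)\<^sup>2 * (fb p + 2 * real (k p) / real p) = 162 / 250000 * (real (k p) / real p) + 64 / 250000" by (simp add: fb_def power2_eq_square)
      moreover have "162 / 250000 * (real (k p) / real p) + 64 / 250000 \<le> 0.01 * \<Lambda> p"
      proof -
        define r where "r = real (k p) / real p"
        have "r \<le> 10 * \<Lambda> p" unfolding r_def using kp L by linarith
        then show ?thesis unfolding r_def[symmetric] using L(2) by simp
      qed
      ultimately have 1: "(1/500)\<^sup>2 * (fb p + 2 * real (k p) / real p) \<le> 0.01 * \<Lambda> p" by (simp only:)
      have "1181952 * real (k p) / (real p * (\<Lambda> p / 250000)) = 1181952 * 250000 * (real (k p) / real p / \<Lambda> p)" by simp
      also have "real (k p) / real p / \<Lambda> p \<le> 10"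
      proof -
        have "real (k p) / real p \<le> 10 * \<Lambda> p" using kp L by linarith
        then show ?thesis using L(2) by (subst pos_divide_le_eq) auto
      qed
      finally have 2: "1181952 * real (k p) / (real p * (\<Lambda> p / 250000)) \<le> 0.01 * \<Lambda> p" using L by simp
      have "ln (501::real) \<le> 7.5"
      proof -
        have "(501::real) \<le> (1 + 1.5 + 1.5\<^sup>2 / 2) ^ 5" by (simp add: power2_eq_square power_numeral_reduce)
        also have "\<dots> \<le> exp 1.5 ^ 5" by (intro power_mono exp_lower_Taylor_quadratic) auto
        also have "\<dots> = exp (7.5::real)" by (simp flip: exp_of_nat_mult)
        finally have "(501::real) \<le> exp 7.5" .
        then show ?thesis by (subst (asm) ln_le_cancel_iff[symmetric]) auto
      qed
      then have "256 * (\<Lambda> p / 250000) * (1 + ln ((1 + 1/500) / (1/500))) \<le> 256 * (\<Lambda> p / 250000) * 8.5" using L by (intro mult_left_mono) auto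
      then have 3: "256 * (\<Lambda> p / 250000) * (1 + ln ((1 + 1/500) / (1/500))) \<le> 0.01 * \<Lambda> p" using L by simp
      show ?thesis by (rule order_trans[OF add_mono[OF add_mono[OF 1 2] 3]]) (use L in simp)
    qed
    show "\<exists>A\<in>sets (sph p {..<k p}). emeasure (sph p {..<k p}) A \<le> ennreal (exp (- real p)) \<and>
      (\<forall>d\<in>space (sph p {..<k p}) - A. (\<forall>x. (\<Sum>l<k p. (dot p x (d l))\<^sup>2) \<le> fb p * dot p x x) \<longrightarrow>
   (\<forall>x. (\<Sum>l<k p. trunc_weight p u (\<Lambda> p / 250000) (d l) * (dot p x (d l))\<^sup>2) \<le> 2 * real (k p) / real p * (dot p u x)\<^sup>2 + 0.05 * \<Lambda> p * dot p x x))"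
    proof (rule sph_bulk[OF p u \<tau>, of "1/500" "k p"])
      fix A assume A: "A \<in> sets (sph p {..<k p})" "emeasure (sph p {..<k p}) A \<le> ennreal (exp (- real p))"
        "\<And>d x K. d \<in> space (sph p {..<k p}) - A \<Longrightarrow> K \<ge> 0 \<Longrightarrow> (\<And>x. (\<Sum>l<k p. (dot p x (d l))\<^sup>2) \<le> K * dot p x x) \<Longrightarrow>
       (\<Sum>l<k p. trunc_weight p u (\<Lambda> p / 250000) (d l) * (dot p x (d l))\<^sup>2) \<le> 2 * real (k p) / real p * (dot p u x)\<^sup>2 +
         ((1/500)\<^sup>2 * (K + 2 * real (k p) / real p) + 1181952 * real (k p) / (real p * (\<Lambda> p / 250000)) + 256 * (\<Lambda> p / 250000) * (1 + ln ((1 + 1/500) / (1/500)))) * dot p x x"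
      show ?thesis
      proof (intro bexI[OF _ A(1)] conjI A(2) ballI allI impI)
        fix d x assume d: "d \<in> space (sph p {..<k p}) - A" and fr: "\<forall>x. (\<Sum>l<k p. (dot p x (d l))\<^sup>2) \<le> fb p * dot p x x"
        show "(\<Sum>l<k p. trunc_weight p u (\<Lambda> p / 250000) (d l) * (dot p x (d l))\<^sup>2) \<le> 2 * real (k p) / real p * (dot p u x)\<^sup>2 + 0.05 * \<Lambda> p * dot p x x"
        proof (rule order_trans[OF A(3)[OF d, of "fb p"]])
          show "0 \<le> fb p" by (simp add: fb_def)
        qed (rule fr[rule_format], intro add_left_mono mult_right_mono c ip_self_nonneg)
      qed
    qed simp_all
  qed (real_asymp, simp)
qed

end

text \<open>The off-diagonal entries of the squared Gram kernel are the \<open>mvec\<close>.\<close>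
lemma hop_from_mvec:
  assumes \<beta>: "\<And>l m. l < k \<Longrightarrow> m < k \<Longrightarrow> l \<noteq> m \<Longrightarrow> \<bar>hh p (d l) (d m)\<bar> \<le> \<beta>"
    and t: "(\<Sum>(l, n)\<in>{..<k} \<times> {..<k} - Id. (mvec p k d l n)\<^sup>2) \<le> t"
  shows "(\<Sum>l<k. (\<Sum>m\<in>{..<k} - {l}. hh p (d l) (d m) * b m)\<^sup>2) \<le> (real k * \<beta>\<^sup>2 + sqrt t) * (\<Sum>m<k. (b m)\<^sup>2)"
proof -
  define H where "H l m = (if l = m then 0 else hh p (d l) (d m))" for l m
  define G where "G m n = (\<Sum>l<k. H l m * H l n)" for m n
  let ?O = "{..<k} \<times> {..<k} - Id" and ?B = "\<Sum>m<k. (b m)\<^sup>2"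
  have in_H: "(\<Sum>m\<in>{..<k} - {l}. hh p (d l) (d m) * b m) = (\<Sum>m<k. H l m * b m)" for l
    by (intro sum.mono_neutral_cong_left) (auto simp: H_def)
  have "(\<Sum>l<k. (\<Sum>m<k. H l m * b m)\<^sup>2) = (\<Sum>l<k. \<Sum>m<k. \<Sum>n<k. (H l m * b m) * (H l n * b n))"
    by (simp add: power2_eq_square sum_product)
  also have "\<dots> = (\<Sum>m<k. \<Sum>l<k. \<Sum>n<k. (H l m * b m) * (H l n * b n))" by (rule sum.swap)
  also have "\<dots> = (\<Sum>m<k. \<Sum>n<k. \<Sum>l<k. (H l m * b m) * (H l n * b n))" by (intro sum.cong refl sum.swap)
  also have "\<dots> = (\<Sum>m<k. \<Sum>n<k. b m * b n * G m n)" by (simp add: G_def sum_distrib_left ac_simps)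
  also have "\<dots> = (\<Sum>x\<in>{..<k} \<times> {..<k}. b (fst x) * b (snd x) * G (fst x) (snd x))" by (simp add: sum.cartesian_product split_def)
  also have "\<dots> = (\<Sum>x\<in>(\<lambda>m. (m, m)) ` {..<k}. b (fst x) * b (snd x) * G (fst x) (snd x)) + (\<Sum>x\<in>?O. b (fst x) * b (snd x) * G (fst x) (snd x))"
    by (subst sum.union_disjoint[symmetric]) (auto intro!: sum.cong)
  also have "\<dots> \<le> real k * \<beta>\<^sup>2 * ?B + ?B * sqrt t"
  proof (rule add_mono)
    have "(\<Sum>x\<in>(\<lambda>m. (m, m)) ` {..<k}. b (fst x) * b (snd x) * G (fst x) (snd x)) = (\<Sum>m<k. (b m)\<^sup>2 * G m m)"
      by (subst sum.reindex) (auto simp: inj_on_def power2_eq_square)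
    also have "\<dots> \<le> (\<Sum>m<k. (b m)\<^sup>2 * (real k * \<beta>\<^sup>2))"
    proof (intro sum_mono mult_left_mono)
      fix m assume m: "m \<in> {..<k}"
      have "H l m * H l m \<le> \<beta>\<^sup>2" if "l < k" for l
      proof (cases "l = m")
        case False
        then show ?thesis using power_mono[OF \<beta>[OF that _ False], of 2] m by (simp add: H_def power2_eq_square)
      qed (simp add: H_def)
      then have "G m m \<le> (\<Sum>l<k. \<beta>\<^sup>2)" unfolding G_def by (intro sum_mono) auto
      then show "G m m \<le> real k * \<beta>\<^sup>2" by simp
    qed auto
    finally show "(\<Sum>x\<in>(\<lambda>m. (m, m)) ` {..<k}. b (fst x) * b (snd x) * G (fst x) (snd x)) \<le> real k * \<beta>\<^sup>2 * ?B" by (simp add: sum_distrib_right[symmetric] mult.commute)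
    let ?S = "\<Sum>x\<in>?O. b (fst x) * b (snd x) * G (fst x) (snd x)"
    have Gm: "G m n = mvec p k d m n" if "m < k" "n < k" "m \<noteq> n" for m n
      unfolding G_def mvec_def by (rule sum.mono_neutral_cong_right) (use that in \<open>auto simp: H_def hh_commute\<close>)
    have "?S\<^sup>2 \<le> (\<Sum>x\<in>?O. (b (fst x) * b (snd x))\<^sup>2) * (\<Sum>x\<in>?O. (G (fst x) (snd x))\<^sup>2)" by (rule Cauchy_Schwarz_ineq_sum)
    also have "\<dots> \<le> ?B\<^sup>2 * t"
    proof (rule mult_mono)
      have "(\<Sum>x\<in>?O. (b (fst x) * b (snd x))\<^sup>2) \<le> (\<Sum>x\<in>{..<k} \<times> {..<k}. (b (fst x) * b (snd x))\<^sup>2)" by (intro sum_mono2) auto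
      also have "\<dots> = ?B\<^sup>2" by (simp add: power2_eq_square[of ?B] sum_product sum.cartesian_product split_def power_mult_distrib)
      finally show "(\<Sum>x\<in>?O. (b (fst x) * b (snd x))\<^sup>2) \<le> ?B\<^sup>2" .
      have "(G (fst x) (snd x))\<^sup>2 = (mvec p k d (fst x) (snd x))\<^sup>2" if "x \<in> ?O" for x
        using that by (cases x) (simp add: Gm)
      then have "(\<Sum>x\<in>?O. (G (fst x) (snd x))\<^sup>2) = (\<Sum>(l, n)\<in>?O. (mvec p k d l n)\<^sup>2)" unfolding split_def by (intro sum.cong refl)
      then show "(\<Sum>x\<in>?O. (G (fst x) (snd x))\<^sup>2) \<le> t" using t by simp
    qed (auto intro: sum_nonneg)
    finally have "sqrt (?S\<^sup>2) \<le> sqrt (?B\<^sup>2 * t)" by (rule real_sqrt_le_mono)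
    then have "\<bar>?S\<bar> \<le> \<bar>?B\<bar> * sqrt t" by (simp only: real_sqrt_abs real_sqrt_mult)
    moreover have "\<bar>?B\<bar> = ?B" by (intro abs_of_nonneg sum_nonneg) auto
    ultimately have "\<bar>?S\<bar> \<le> ?B * sqrt t" by (simp only:)
    then show "?S \<le> ?B * sqrt t" by (rule order_trans[OF abs_ge_self])
  qed
  finally show ?thesis unfolding in_H by (simp add: algebra_simps)
qed

text \<open>Outside \<open>T\<close> the weights above the level are at most \<open>V\<close> and
  sit on few vectors, where \<open>R\<close> applies; the others are the truncated weights. Removing
  \<open>T\<close> from the truncated sum costs at most \<open>R\<close>, since these weights are at
  least -1.\<close>

lemma weighted_upper:
  fixes d :: "nat \<Rightarrow> nat \<Rightarrow> real"
  assumes p: "p \<ge> 1" and T: "T \<subseteq> {..<k}"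
    and bulk: "(\<Sum>l<k. trunc_weight p u \<tau> (d l) * (dot p x (d l))\<^sup>2) \<le> B"
    and mid: "(\<Sum>l\<in>{l. l < k \<and> (dot p u (d l))\<^sup>2 > \<tau> / real p}. (dot p x (d l))\<^sup>2) \<le> R" and top: "(\<Sum>l\<in>T. (dot p x (d l))\<^sup>2) \<le> R"
    and v: "\<And>l. l \<in> {..<k} - T \<Longrightarrow> (dot p u (d l))\<^sup>2 \<le> V" and V: "V \<ge> 0"
  shows "(\<Sum>l\<in>{..<k} - T. hh p u (d l) * (dot p x (d l))\<^sup>2) \<le> V * R + (B + R) / real p"
proof -
  let ?M = "{l. l < k \<and> (dot p u (d l))\<^sup>2 > \<tau> / real p}" and ?w = "\<lambda>l. trunc_weight p u \<tau> (d l)" and ?q = "\<lambda>l. (dot p x (d l))\<^sup>2"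
  have p0: "real p > 0" using p by simp
  have "hh p u (d l) * ?q l \<le> ?w l / real p * ?q l + (if l \<in> ?M then V * ?q l else 0)" if l: "l \<in> {..<k} - T" for l
  proof (cases "l \<in> ?M")
    case True
    then have "?w l = 0" using p0 by (simp add: trunc_weight_def divide_less_eq mult.commute)
    moreover have "hh p u (d l) \<le> V" using v[OF l] p0 unfolding hh_def by (smt (verit) divide_nonneg_pos)
    then have "hh p u (d l) * ?q l \<le> V * ?q l" by (intro mult_right_mono) auto
    ultimately show ?thesis using True by simp
  next
    case False
    then have "real p * (dot p u (d l))\<^sup>2 \<le> \<tau>" using l p0 by (simp add: not_less pos_le_divide_eq mult.commute)
    then have "?w l / real p = hh p u (d l)" using p0 by (simp add: trunc_weight_def hh_def diff_divide_distrib)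
    then show ?thesis unfolding if_not_P[OF False] by simp
  qed
  then have "(\<Sum>l\<in>{..<k} - T. hh p u (d l) * ?q l) \<le> (\<Sum>l\<in>{..<k} - T. ?w l / real p * ?q l + (if l \<in> ?M then V * ?q l else 0))"
    by (rule sum_mono)
  also have "\<dots> = (\<Sum>l\<in>{..<k} - T. ?w l * ?q l) / real p + (\<Sum>l\<in>{..<k} - T. if l \<in> ?M then V * ?q l else 0)"
    by (simp add: sum.distrib sum_divide_distrib)
  also have "\<dots> \<le> (B + R) / real p + V * R"
  proof (intro add_mono divide_right_mono)
    have "(\<Sum>l<k. ?w l * ?q l) = (\<Sum>l\<in>{..<k} - T. ?w l * ?q l) + (\<Sum>l\<in>T. ?w l * ?q l)" by (rule sum.subset_diff[OF T]) simp
    moreover have "- (\<Sum>l\<in>T. ?w l * ?q l) \<le> (\<Sum>l\<in>T. ?q l)"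
      unfolding sum_negf[symmetric]
    proof (rule sum_mono)
      fix l
      have "- ?w l \<le> 1" using p0 by (simp add: trunc_weight_def)
      then have "- ?w l * ?q l \<le> 1 * ?q l" by (intro mult_right_mono) auto
      then show "- (?w l * ?q l) \<le> ?q l" by simp
    qed
    ultimately show "(\<Sum>l\<in>{..<k} - T. ?w l * ?q l) \<le> B + R" using bulk top by linarith
    have "(\<Sum>l\<in>{..<k} - T. if l \<in> ?M then V * ?q l else 0) = (\<Sum>l\<in>({..<k} - T) \<inter> ?M. V * ?q l)" by (simp add: sum.inter_restrict)
    also have "\<dots> \<le> (\<Sum>l\<in>?M. V * ?q l)" using V by (intro sum_mono2) auto
    also have "\<dots> \<le> V * R" unfolding sum_distrib_left[symmetric] using V mid by (intro mult_left_mono)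
    finally show "(\<Sum>l\<in>{..<k} - T. if l \<in> ?M then V * ?q l else 0) \<le> V * R" .
  qed (use p0 in auto)
  finally show ?thesis by simp
qed

section \<open>Exceptional indices and the choice of exponents\<close>

lemma card_large_le:
  fixes e :: "nat \<Rightarrow> real"
  assumes "(\<Sum>m<k. (e m)\<^sup>2) \<le> t" "\<tau> > 0" shows "real (card {m. m < k \<and> \<bar>e m\<bar> > \<tau>}) \<le> t / \<tau>\<^sup>2"
proof -
  let ?S = "{m. m < k \<and> \<bar>e m\<bar> > \<tau>}"
  have "\<tau>\<^sup>2 \<le> (e m)\<^sup>2" if "m \<in> ?S" for m using that assms(2) by (intro abs_le_square_iff[THEN iffD1]) auto
  then have "real (card ?S) * \<tau>\<^sup>2 \<le> (\<Sum>m\<in>?S. (e m)\<^sup>2)" by (intro sum_bounded_below)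
  also have "\<dots> \<le> (\<Sum>m<k. (e m)\<^sup>2)" by (intro sum_mono2) auto
  also have "\<dots> \<le> t" by (rule assms)
  finally show ?thesis using assms(2) by (subst pos_le_divide_eq) auto
qed

text \<open>All of \<open>Z\<close> except \<open>\<mu>\<close>, as a function of bare real numbers:
  monotonicity allows the random quantities to be replaced by powers of \<open>P\<close>.\<close>

definition Zrem :: "real \<Rightarrow> real \<Rightarrow> real \<Rightarrow> real \<Rightarrow> real \<Rightarrow> real \<Rightarrow> real \<Rightarrow> real \<Rightarrow> real \<Rightarrow> real \<Rightarrow> real" where
  "Zrem P \<kappa> n K \<nu> \<alpha> h \<tau> E2 \<rho> =
     2 * \<nu> * sqrt \<kappa> * (4 * n * \<alpha>^3 + 4 * n\<^sup>2 * \<alpha>^4) + \<tau> * K + 2 * h * E2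
   + 2 * (\<tau> * sqrt (32 * n\<^sup>2 * \<alpha>\<^sup>2 * K^3 + 8 * \<kappa> * K\<^sup>2 * n\<^sup>2 * \<alpha>^4) + sqrt \<kappa> * \<tau> / P) + 2 * \<kappa> * \<tau> / P + 2 * sqrt \<kappa> * n * \<alpha>^4
   + 2 * (\<alpha>\<^sup>2 * sqrt (32 * n\<^sup>2 * \<alpha>\<^sup>2 * K^3 + 8 * \<kappa> * K\<^sup>2 * n\<^sup>2 * \<alpha>^4) + sqrt \<kappa> * \<alpha>\<^sup>2 / P) + 2 * (\<rho> + n * \<alpha>\<^sup>2) / P + 2 / P"

lemma Zrem_mono:
  assumes "P > 0" "0 \<le> \<kappa>" "\<kappa> \<le> \<kappa>'" "0 \<le> n" "n \<le> n'" "0 \<le> K" "K \<le> K'" "0 \<le> \<nu>" "\<nu> \<le> \<nu>'" "0 \<le> \<alpha>" "0 \<le> \<tau>" "0 \<le> h" "0 \<le> E2" "0 \<le> \<rho>"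
  shows "Zrem P \<kappa> n K \<nu> \<alpha> h \<tau> E2 \<rho> \<le> Zrem P \<kappa>' n' K' \<nu>' \<alpha> h \<tau> E2 \<rho>"
proof -
  have \<Xi>: "sqrt (32 * n\<^sup>2 * \<alpha>\<^sup>2 * K^3 + 8 * \<kappa> * K\<^sup>2 * n\<^sup>2 * \<alpha>^4) \<le> sqrt (32 * n'\<^sup>2 * \<alpha>\<^sup>2 * K'^3 + 8 * \<kappa>' * K'\<^sup>2 * n'\<^sup>2 * \<alpha>^4)"
    using assms by (intro real_sqrt_le_mono add_mono mult_mono power_mono order_refl mult_nonneg_nonneg zero_le_power) auto
  have s: "sqrt \<kappa> \<le> sqrt \<kappa>'" using assms by simp
  have nn: "0 \<le> n'" "0 \<le> K'" "0 \<le> \<nu>'" "0 \<le> \<kappa>'" using assms by linarith+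
  have s0: "0 \<le> sqrt \<kappa>" "0 \<le> sqrt \<kappa>'" "0 \<le> sqrt (32 * n\<^sup>2 * \<alpha>\<^sup>2 * K^3 + 8 * \<kappa> * K\<^sup>2 * n\<^sup>2 * \<alpha>^4)"
    by (intro real_sqrt_ge_zero add_nonneg_nonneg mult_nonneg_nonneg zero_le_power zero_le_numeral assms nn)+
  show ?thesis unfolding Zrem_def
    by (intro add_mono mult_mono power_mono divide_right_mono order_refl mult_nonneg_nonneg add_nonneg_nonneg zero_le_power zero_le_numeral
      divide_nonneg_nonneg \<Xi> s s0 nn assms less_imp_le[OF assms(1)])
qed

lemma (in sdp_cert) Z_eq: "Z = \<mu> + Zrem (real p) (real k) n K \<nu> \<alpha> h \<tau> E2 \<rho>0"
  by (simp add: Z_def Zrem_def \<Xi>_def)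

text \<open>The margins are narrow in a few places. Frame bound times \<open>\<tau>\<close> is
  \<open>P powr (-1.027)\<close> and operator norm times Euclidean norm is
  \<open>P powr (-1.06)\<close>, both below \<open>1 / P\<close>, so that \<open>P\<close> times the
  remainder tends to 2, its last term. With \<open>P powr 0.2\<close> exceptional vectors the
  relative loss on \<open>T\<close> is of order \<open>P powr (-0.075)\<close>.\<close>

definition numerics :: "real \<Rightarrow> bool" where
  "numerics P \<longleftrightarrow> P \<ge> 2 \<and>
    1 / P \<le> P powr (-0.98) \<and> P powr (-0.98) < 1 \<and> P powr 0.2 * P powr (-0.49) \<le> 1/2 \<and>
    P powr 1.01 * (P powr (-0.98))\<^sup>2 + sqrt (P powr (-0.5)) \<le> (P powr (-0.12))\<^sup>2 \<and>
    P powr (-1.9) \<le> (P powr (-0.94))\<^sup>2 \<and> P powr (-1.9) / (P powr (-1.035))\<^sup>2 + P powr 0.18 \<le> P powr 0.2 \<and>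
    P powr 0.2 \<le> P powr (1 - 1/1000000) \<and>
    2 * P powr 1.01 / P\<^sup>2 \<le> 0.001 \<and>
    160 * (2 * ln P) + 64 \<le> P powr 0.008 \<and>
    4 * P powr 0.2 * (P powr (-0.49))\<^sup>2 + P powr (-0.12) + 1 / P + (4 * P powr 0.2 * (P powr (-0.49))^3 + 4 * (P powr 0.2)\<^sup>2 * (P powr (-0.49))^4) * P powr 1.01 \<le> 3/4 \<and>
    4 * sqrt (P powr 1.01) * P powr 0.2 * (P powr (-0.49))\<^sup>2 \<le> 0.001 \<and> 8 * sqrt (P powr 1.01) * (P powr 0.2)\<^sup>2 * (P powr (-0.49))\<^sup>2 \<le> 0.001 \<and>
    P * Zrem P (P powr 1.01) (P powr 0.2) (P powr 0.008) (2 * P powr 1.01 / P\<^sup>2) (P powr (-0.49)) (P powr (-0.12)) (P powr (-1.035)) (P powr (-0.94)) (P powr (-0.1)) \<le> 2.9 \<and>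
    0.2 * ln P \<ge> 10000"

lemma eventually_numerics: "\<forall>\<^sub>F p in sequentially. numerics (real p)"
  unfolding numerics_def Zrem_def by (intro eventually_conj) real_asymp+

lemma powr_sq: "(P powr a)\<^sup>2 = P powr (2 * a)" if "P > 0" for P :: real
  using that by (simp add: powr_add[symmetric] power2_eq_square)

section \<open>Optimality on the good event\<close>

context growth
begin

text \<open>Entirely deterministic: the random input enters through the assumptions, and the
  remaining work is to supply \<open>sdp_cert\<close> with concrete powers of
  \<open>p\<close>.\<close>

lemma maximizer_if_large:
  assumes nm: "numerics (real p)" and lg: "large p" and k: "real (k p) \<le> 2 * real p * ln (real p)" "real (k p) \<le> real p powr 1.01"
    and \<Lambda>: "0.2 * ln (real p) \<le> \<Lambda> p"
    and unit: "\<And>l. l < k p \<Longrightarrow> dot p (d l) (d l) = 1"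
    and inc: "\<And>l. l < k p \<Longrightarrow> (dot p u (d l))\<^sup>2 \<le> real p powr (-0.98)"
       "\<And>l m. l < k p \<Longrightarrow> m < k p \<Longrightarrow> l \<noteq> m \<Longrightarrow> (dot p (d l) (d m))\<^sup>2 \<le> real p powr (-0.98)"
    and big: "\<exists>l<k p. (dot p u (d l))\<^sup>2 \<ge> 1.9 * \<Lambda> p / real p"
    and top: "real (card {l. l < k p \<and> (dot p u (d l))\<^sup>2 > 1.7 * \<Lambda> p / real p}) \<le> real p powr 0.18"
    and mid: "real (card {l. l < k p \<and> (dot p u (d l))\<^sup>2 > 1/250000 * \<Lambda> p / real p}) \<le> real p powr (1 - 1/1000000)"
    and frame: "\<And>x. (\<Sum>l<k p. (dot p x (d l))\<^sup>2) \<le> fb p * dot p x x"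
    and rip: "\<And>S x. S \<subseteq> {..<k p} \<Longrightarrow> real (card S) \<le> real p powr (1 - 1/1000000) \<Longrightarrow> (\<Sum>l\<in>S. (dot p x (d l))\<^sup>2) \<le> 1.05 * dot p x x"
    and bulk: "\<And>x. (\<Sum>l<k p. trunc_weight p u (\<Lambda> p / 250000) (d l) * (dot p x (d l))\<^sup>2) \<le> 2 * real (k p) / real p * (dot p u x)\<^sup>2 + 0.05 * \<Lambda> p * dot p x x"
    and ev: "(\<Sum>m<k p. (evec p (k p) u d m)\<^sup>2) \<le> real p powr (-1.9)"
    and mv: "(\<Sum>(l, n)\<in>{..<k p} \<times> {..<k p} - Id. (mvec p (k p) d l n)\<^sup>2) \<le> real p powr (-0.5)"
    and hs: "(\<Sum>l<k p. hh p u (d l))\<^sup>2 \<le> real p powr (-0.2)"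
    and i: "i < k p" and mx: "\<And>j. j < k p \<Longrightarrow> j \<noteq> i \<Longrightarrow> (dot p u (d j))\<^sup>2 < (dot p u (d i))\<^sup>2"
  shows "sdp_unique_maximizer p (k p) d (rank1 p u) (rank1 p (d i))"
proof -
  define P where "P = real p"
  note nm' = nm[unfolded numerics_def P_def[symmetric]]
  have P: "P \<ge> 2" using nm' by blast
  then have P0: "P > 0" and p1: "p \<ge> 1" by (auto simp: P_def)
  define \<alpha> where "\<alpha> = P powr (-0.49)"
  define h where "h = P powr (-0.12)"
  define \<tau> where "\<tau> = P powr (-1.035)"
  define E where "E = P powr (-0.94)"
  define \<rho> where "\<rho> = P powr (-0.1)"
  define \<nu> where "\<nu> = 2 * real (k p) / P\<^sup>2"
  \<comment> \<open>The output of \<open>weighted_upper\<close>: level 1.7 times isometry constant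
    1.05, the truncated part 0.05, and one isometry constant for removing \<open>T\<close>.\<close>
  define \<mu> where "\<mu> = (1.7 * 1.05 * \<Lambda> p + 0.05 * \<Lambda> p + 1.05) / P"
  have pos: "0 \<le> \<alpha>" "0 \<le> h" "0 < \<tau>" "0 \<le> E" "0 \<le> \<rho>" "0 \<le> \<nu>" using P0 by (auto simp: \<alpha>_def h_def \<tau>_def E_def \<rho>_def \<nu>_def)
  have "0.2 * ln P \<ge> 10000" using nm' by blast
  then have L: "\<Lambda> p \<ge> 10000" using \<Lambda> unfolding P_def by linarith
  have \<mu>0: "\<mu> \<ge> 0" using L P0 by (simp add: \<mu>_def)
  have \<alpha>2: "\<alpha>\<^sup>2 = P powr (-0.98)" unfolding \<alpha>_def powr_sq[OF P0] by simp
  have \<rho>2: "\<rho>\<^sup>2 = P powr (-0.2)" unfolding \<rho>_def powr_sq[OF P0] by simp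
  have incu: "\<bar>dot p u (d l)\<bar> \<le> \<alpha>" if "l < k p" for l
    using inc(1)[OF that] pos unfolding P_def[symmetric] \<alpha>2[symmetric] by (simp add: abs_le_square_iff[symmetric])
  have incd: "\<bar>dot p (d l) (d m)\<bar> \<le> \<alpha>" if "l < k p" "m < k p" "l \<noteq> m" for l m
    using inc(2)[OF that] pos unfolding P_def[symmetric] \<alpha>2[symmetric] by (simp add: abs_le_square_iff[symmetric])
  have ip\<alpha>: "1 / P \<le> \<alpha>\<^sup>2" unfolding \<alpha>2 using nm' by blast
  define T1 where "T1 = {l. l < k p \<and> (dot p u (d l))\<^sup>2 > 1.7 * \<Lambda> p / P}"
  define T2 where "T2 = {m. m < k p \<and> \<bar>evec p (k p) u d m\<bar> > \<tau>}"
  define T where "T = T1 \<union> T2"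
  have T: "T \<subseteq> {..<k p}" by (auto simp: T_def T1_def T2_def)
  \<comment> \<open>At most \<open>P powr 0.18\<close> large projections, plus exceptional entries
    of \<open>evec\<close>, whose number is at most
    \<open>P powr (-1.9) / \<tau>^2 = P powr 0.17\<close>.\<close>
  have n: "real (card T) \<le> P powr 0.2"
  proof -
    have "real (card T) \<le> real (card T1) + real (card T2)" unfolding T_def of_nat_add[symmetric] of_nat_le_iff by (rule card_Un_le)
    also have "\<dots> \<le> P powr 0.18 + P powr (-1.9) / \<tau>\<^sup>2"
      using top card_large_le[OF ev pos(3)] unfolding T1_def T2_def P_def by (intro add_mono)
    also have "\<dots> \<le> P powr 0.2" using nm' unfolding \<tau>_def by linarith
    finally show ?thesis .
  qed
  have no: "near_orth p (k p) d T \<alpha>"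
  proof
    have "real (card T) * \<alpha> \<le> P powr 0.2 * \<alpha>" using n pos by (intro mult_right_mono)
    also have "\<dots> \<le> 1/2" using nm' unfolding \<alpha>_def by blast
    finally show "real (card T) * \<alpha> \<le> 1/2" .
  qed (use unit T pos incd in auto)
  have \<kappa>: "real (k p) \<le> P powr 1.01" using k by (simp add: P_def)
  have fb: "fb p \<le> P powr 0.008" "0 \<le> fb p"
  proof -
    have "real (k p) / P \<le> 2 * ln P" using k(1) P0 unfolding P_def[symmetric] by (subst pos_divide_le_eq) (auto simp: algebra_simps)
    then have "fb p \<le> 160 * (2 * ln P) + 64" by (simp add: fb_def P_def)
    also have "\<dots> \<le> P powr 0.008" using nm' by blast
    finally show "fb p \<le> P powr 0.008" .
  qed (simp add: fb_def)
  have \<nu>1: "\<nu> \<le> 2 * P powr 1.01 / P\<^sup>2" unfolding \<nu>_def using \<kappa> by (intro divide_right_mono mult_left_mono) auto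
  moreover have "2 * P powr 1.01 / P\<^sup>2 \<le> 0.001" using nm' by blast
  ultimately have \<nu>2: "\<nu> \<le> 0.001" by linarith
  have mono: "4 * real (card T) * \<alpha>\<^sup>2 + h + 1 / P + (4 * real (card T) * \<alpha>^3 + 4 * (real (card T))\<^sup>2 * \<alpha>^4) * real (k p)
     \<le> 4 * P powr 0.2 * \<alpha>\<^sup>2 + h + 1 / P + (4 * P powr 0.2 * \<alpha>^3 + 4 * (P powr 0.2)\<^sup>2 * \<alpha>^4) * P powr 1.01"
     using n \<kappa> pos by (intro add_mono mult_mono power_mono order_refl add_nonneg_nonneg mult_nonneg_nonneg zero_le_power) auto
  have c2: "4 * sqrt (real (k p)) * real (card T) * \<alpha>\<^sup>2 \<le> 0.001"
  proof -
    have "4 * sqrt (real (k p)) * real (card T) * \<alpha>\<^sup>2 \<le> 4 * sqrt (P powr 1.01) * P powr 0.2 * \<alpha>\<^sup>2"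
      using n \<kappa> by (intro mult_mono real_sqrt_le_mono order_refl mult_nonneg_nonneg) auto
    also have "\<dots> \<le> 0.001" unfolding \<alpha>_def using nm' by blast
    finally show ?thesis .
  qed
  have c3: "8 * sqrt (real (k p)) * (real (card T))\<^sup>2 * \<alpha>\<^sup>2 \<le> 0.001"
  proof -
    have "8 * sqrt (real (k p)) * (real (card T))\<^sup>2 * \<alpha>\<^sup>2 \<le> 8 * sqrt (P powr 1.01) * (P powr 0.2)\<^sup>2 * \<alpha>\<^sup>2"
      using n \<kappa> by (intro mult_mono real_sqrt_le_mono power_mono order_refl mult_nonneg_nonneg) auto
    also have "\<dots> \<le> 0.001" unfolding \<alpha>_def using nm' by blast
    finally show ?thesis .
  qed
  have hop: "(\<Sum>l<k p. (\<Sum>m\<in>{..<k p} - {l}. hh p (d l) (d m) * b m)\<^sup>2) \<le> h\<^sup>2 * (\<Sum>m<k p. (b m)\<^sup>2)" for b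
  proof -
    have "(\<Sum>l<k p. (\<Sum>m\<in>{..<k p} - {l}. hh p (d l) (d m) * b m)\<^sup>2) \<le> (real (k p) * (\<alpha>\<^sup>2)\<^sup>2 + sqrt (P powr (-0.5))) * (\<Sum>m<k p. (b m)\<^sup>2)"
      unfolding P_def
    proof (rule hop_from_mvec[OF _ mv])
      show "\<bar>hh p (d l) (d m)\<bar> \<le> \<alpha>\<^sup>2" if "l < k p" "m < k p" "l \<noteq> m" for l m
        using near_orth.hh_d_bound[OF no that] ip\<alpha> by (simp add: P_def)
    qed
    also have "\<dots> \<le> h\<^sup>2 * (\<Sum>m<k p. (b m)\<^sup>2)"
    proof (intro mult_right_mono sum_nonneg)
      have "real (k p) * (\<alpha>\<^sup>2)\<^sup>2 + sqrt (P powr (-0.5)) \<le> P powr 1.01 * (P powr (-0.98))\<^sup>2 + sqrt (P powr (-0.5))"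
        unfolding \<alpha>2 using \<kappa> by (intro add_mono mult_right_mono order_refl) auto
      also have "\<dots> \<le> h\<^sup>2" unfolding h_def using nm' by blast
      finally show "real (k p) * (\<alpha>\<^sup>2)\<^sup>2 + sqrt (P powr (-0.5)) \<le> h\<^sup>2" .
    qed auto
    finally show ?thesis .
  qed
  have wop: "(\<Sum>l\<in>{..<k p} - T. hh p u (d l) * (dot p x (d l))\<^sup>2) \<le> \<mu> * dot p x x + \<nu> * (dot p u x)\<^sup>2" for x
  proof -
    have "(\<Sum>l\<in>{..<k p} - T. hh p u (d l) * (dot p x (d l))\<^sup>2) \<le> 1.7 * \<Lambda> p / P * (1.05 * dot p x x) +
       ((2 * real (k p) / real p * (dot p u x)\<^sup>2 + 0.05 * \<Lambda> p * dot p x x) + 1.05 * dot p x x) / real p"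
    proof (rule weighted_upper[OF p1 T bulk])
      show "(\<Sum>l | l < k p \<and> \<Lambda> p / 250000 / real p < (dot p u (d l))\<^sup>2. (dot p x (d l))\<^sup>2) \<le> 1.05 * dot p x x"
        using mid by (intro rip) auto
      show "(\<Sum>l\<in>T. (dot p x (d l))\<^sup>2) \<le> 1.05 * dot p x x"
      proof (rule rip[OF T])
        have "P powr 0.2 \<le> P powr (1 - 1/1000000)" using nm' by blast
        then show "real (card T) \<le> real p powr (1 - 1/1000000)" using n unfolding P_def by linarith
      qed
      show "(dot p u (d l))\<^sup>2 \<le> 1.7 * \<Lambda> p / P" if "l \<in> {..<k p} - T" for l
        using that by (auto simp: T_def T1_def)
      show "0 \<le> 1.7 * \<Lambda> p / P" using L P0 by simp
    qed
    also have "\<dots> = \<mu> * dot p x x + \<nu> * (dot p u x)\<^sup>2"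
      unfolding P_def[symmetric] \<mu>_def \<nu>_def using P0 by (simp add: field_simps power2_eq_square)
    finally show ?thesis .
  qed
  have Li: "1.9 * \<Lambda> p / P \<le> (dot p u (d i))\<^sup>2" and Lmax: "\<And>l. l < k p \<Longrightarrow> (dot p u (d l))\<^sup>2 \<le> (dot p u (d i))\<^sup>2"
  proof -
    show m: "(dot p u (d l))\<^sup>2 \<le> (dot p u (d i))\<^sup>2" if "l < k p" for l using mx[OF that] by (cases "l = i") auto
    obtain l where "l < k p" "(dot p u (d l))\<^sup>2 \<ge> 1.9 * \<Lambda> p / real p" using big by blast
    then show "1.9 * \<Lambda> p / P \<le> (dot p u (d i))\<^sup>2" using m[of l] by (simp add: P_def)
  qed
  show ?thesis
  proof (rule unique_maximizer_if_gap[OF no i mx])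
    fix c :: "nat \<Rightarrow> real" assume psd: "\<And>x. 0 \<le> (\<Sum>l<k p. c l * (dot p (d l) x)\<^sup>2)"
    obtain y where y: "\<And>a b. (\<Sum>l<k p. c l * (dot p (d l) a * dot p (d l) b)) = (\<Sum>t<p. dot p (y t) a * dot p (y t) b)"
      using psd_comb_decomp[OF psd] by blast
    interpret near_orth p "k p" d T \<alpha> by (rule no)
    interpret sdp_cert p "k p" d T \<alpha> c y "fb p" h u \<tau> E \<rho> \<mu> \<nu>
    proof
      show "\<bar>evec p (k p) u d m\<bar> \<le> \<tau>" if "m \<in> {..<k p} - T" for m using that by (auto simp: T_def T2_def)
      have "P powr (-1.9) \<le> E\<^sup>2" unfolding E_def using nm' by blast
      then show "(\<Sum>m<k p. (evec p (k p) u d m)\<^sup>2) \<le> E\<^sup>2" using ev unfolding P_def by linarith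
      show "\<bar>\<Sum>l<k p. hh p u (d l)\<bar> \<le> \<rho>" using hs pos unfolding P_def[symmetric] \<rho>2[symmetric] by (simp add: abs_le_square_iff[symmetric])
      have "4 * P powr 0.2 * \<alpha>\<^sup>2 + h + 1 / P + (4 * P powr 0.2 * \<alpha>^3 + 4 * (P powr 0.2)\<^sup>2 * \<alpha>^4) * P powr 1.01 \<le> 3/4"
        unfolding \<alpha>_def h_def using nm' by blast
      then show "4 * real (card T) * \<alpha>\<^sup>2 + h + 1 / real p + (4 * real (card T) * \<alpha>^3 + 4 * (real (card T))\<^sup>2 * \<alpha>^4) * real (k p) \<le> 3/4"
        using mono unfolding P_def by linarith
      show "1 / real p \<le> \<alpha>\<^sup>2" using ip\<alpha> by (simp add: P_def)
      show "4 * sqrt (real (k p)) * real (card T) * \<alpha>\<^sup>2 \<le> 1" by (rule order_trans[OF c2]) simp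
    qed (use y frame fb hop pos wop \<mu>0 \<nu>2 incu in auto)
    show "(\<forall>l\<in>{..<k p} - T. c l = 0) \<or> 0 < (\<Sum>l<k p. c l * ((dot p u (d i))\<^sup>2 - (dot p u (d l))\<^sup>2))"
    proof (cases "s = 0")
      case True then show ?thesis using s_zero by blast
    next
      case False
      let ?L = "(dot p u (d i))\<^sup>2"
      have "P * Zrem P (real (k p)) (real (card T)) (fb p) \<nu> \<alpha> h \<tau> E \<rho>
         \<le> P * Zrem P (P powr 1.01) (P powr 0.2) (P powr 0.008) (2 * P powr 1.01 / P\<^sup>2) \<alpha> h \<tau> E \<rho>"
        using P0 \<kappa> n fb pos \<nu>1 by (intro mult_left_mono Zrem_mono) auto
      also have "\<dots> \<le> 2.9" unfolding \<alpha>_def h_def \<tau>_def E_def \<rho>_def using nm' by blast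
      finally have R: "P * Zrem P (real (k p)) (real (card T)) (fb p) \<nu> \<alpha> h \<tau> E \<rho> \<le> 2.9" .
      have "P * Z = (1.7 * 1.05 * \<Lambda> p + 0.05 * \<Lambda> p + 1.05) + P * Zrem P (real (k p)) (real (card T)) (fb p) \<nu> \<alpha> h \<tau> E \<rho>"
        unfolding Z_eq P_def[symmetric] distrib_left using P0 by (simp add: \<mu>_def)
      \<comment> \<open>\<open>1.7 * 1.05 + 0.05\<close> is 1.835, and the additive
        \<open>1.05 + 2.9\<close> is absorbed since \<open>\<Lambda> \<ge> 10000\<close>.\<close>
      also have "\<dots> < 1.881 * \<Lambda> p" using R L by simp
      finally have PZ: "P * Z < 1.881 * \<Lambda> p" .
      have L0: "1.9 * \<Lambda> p \<le> P * ?L" using Li P0 by (simp add: divide_le_eq mult.commute)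
      let ?f = "1 - 4 * sqrt (real (k p)) * real (card T) * \<alpha>\<^sup>2 - 8 * sqrt (real (k p)) * (real (card T))\<^sup>2 * \<alpha>\<^sup>2"
      have f: "0.998 \<le> ?f" by (rule order_trans[OF _ diff_mono[OF diff_mono[OF order_refl c2] c3]]) simp
      have "1.9 * \<Lambda> p * 0.998 \<le> P * ?L * ?f" using P0 by (intro mult_mono[OF L0 f]) auto
      then have "0.999 * (1.9 * \<Lambda> p * 0.998) \<le> (1 - \<nu>) * (P * ?L * ?f)" using \<nu>2 L by (intro mult_mono[of "0.999"]) auto
      \<comment> \<open>The losses 0.998 from the leak and 0.999 from \<open>\<nu>\<close> still
        leave \<open>1.9 * \<Lambda>\<close> above the bound for \<open>P * Z\<close>.\<close>
      moreover have "1.881 * \<Lambda> p \<le> 0.999 * (1.9 * \<Lambda> p * 0.998)" using L by simp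
      ultimately have "P * Z < (1 - \<nu>) * (P * ?L * ?f)" using PZ by (meson less_le_trans)
      then have "P * Z < P * ((1 - \<nu>) * (?L * ?f))" by (simp only: ac_simps)
      then have gap: "Z < (1 - \<nu>) * (?L * ?f)" using P0 by simp
      have "0 < (\<Sum>l<k p. c l * (?L - (dot p u (d l))\<^sup>2))"
        using psd Lmax gap s0 False by (intro objective_gap) auto
      then show ?thesis ..
    qed
  qed
qed

text \<open>Here \<open>T\<close> is the full index set, so the gap condition holds vacuously and
  nonnegativity of the coefficients decides.\<close>

lemma maximizer_if_small:
  assumes nm: "numerics (real p)" and lg: "\<not> large p"
    and unit: "\<And>l. l < k p \<Longrightarrow> dot p (d l) (d l) = 1"
    and inc: "\<And>l m. l < k p \<Longrightarrow> m < k p \<Longrightarrow> l \<noteq> m \<Longrightarrow> (dot p (d l) (d m))\<^sup>2 \<le> real p powr (-0.98)"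
    and i: "i < k p" and mx: "\<And>j. j < k p \<Longrightarrow> j \<noteq> i \<Longrightarrow> (dot p u (d j))\<^sup>2 < (dot p u (d i))\<^sup>2"
  shows "sdp_unique_maximizer p (k p) d (rank1 p u) (rank1 p (d i))"
proof (rule unique_maximizer_if_gap[where T = "{..<k p}" and \<alpha> = "real p powr (-0.49)"])
  have P0: "real p > 0" using nm by (simp add: numerics_def)
  have \<alpha>2: "(real p powr (-0.49))\<^sup>2 = real p powr (-0.98)" unfolding powr_sq[OF P0] by simp
  show "near_orth p (k p) d {..<k p} (real p powr (-0.49))"
  proof
    show "\<bar>dot p (d l) (d m)\<bar> \<le> real p powr (-0.49)" if "l < k p" "m < k p" "l \<noteq> m" for l m
      using inc[OF that] unfolding \<alpha>2[symmetric] by (simp only: abs_le_square_iff[symmetric]) simp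
    have "real (k p) * real p powr (-0.49) \<le> real p powr 0.2 * real p powr (-0.49)" using lg unfolding large_def by (intro mult_right_mono) auto
    also have "\<dots> \<le> 1/2" using nm unfolding numerics_def by blast
    finally show "real (card {..<k p}) * real p powr (-0.49) \<le> 1/2" by simp
  qed (use unit in auto)
qed (use i mx in auto)

text \<open>Optimality is only claimed for an index that is a strict maximum. The first two
  conjuncts are carried along so that ties can later be excluded using the randomness of
  \<open>u\<close>.\<close>

lemma whp_maximizer: "whp k (\<lambda>p u d. (\<forall>l<k p. dot p (d l) (d l) = 1) \<and> (\<forall>l<k p. \<forall>m<k p. l \<noteq> m \<longrightarrow> (dot p (d l) (d m))\<^sup>2 < 1) \<and>
   (\<forall>i<k p. (\<forall>j<k p. j \<noteq> i \<longrightarrow> (dot p u (d j))\<^sup>2 < (dot p u (d i))\<^sup>2) \<longrightarrow> sdp_unique_maximizer p (k p) d (rank1 p u) (rank1 p (d i))))"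
proof (rule whp_mono[OF whp_conj[OF whp_unit whp_conj[OF whp_incoherent whp_conj[OF whp_some_large whp_conj[OF whp_count_top whp_conj[OF whp_count_mid
    whp_conj[OF whp_frame whp_conj[OF whp_rip whp_conj[OF whp_bulk whp_conj[OF whp_evec whp_conj[OF whp_mvec whp_hh_sum]]]]]]]]]]], goal_cases)
  case 1
  show ?case using basics eventually_numerics
  proof eventually_elim
    case (elim p)
    show ?case
    proof ((rule allI)+, rule impI, rule impI)
      fix u d
      assume ev: "(True \<longrightarrow> (\<forall>l<k p. dot p (d l) (d l) = 1)) \<and> (True \<longrightarrow> (\<forall>l<k p. (dot p u (d l))\<^sup>2 \<le> real p powr (-0.98)) \<and> (\<forall>l<k p. \<forall>m<k p. l \<noteq> m \<longrightarrow> (dot p (d l) (d m))\<^sup>2 \<le> real p powr (-0.98))) \<and>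
        (large p \<longrightarrow> (\<exists>l<k p. (dot p u (d l))\<^sup>2 \<ge> 1.9 * \<Lambda> p / real p)) \<and>
        (large p \<longrightarrow> real (card {l. l < k p \<and> (dot p u (d l))\<^sup>2 > 1.7 * \<Lambda> p / real p}) \<le> real p powr 0.18) \<and>
        (large p \<longrightarrow> real (card {l. l < k p \<and> (dot p u (d l))\<^sup>2 > 1/250000 * \<Lambda> p / real p}) \<le> real p powr (1 - 1/1000000)) \<and>
        (True \<longrightarrow> (\<forall>x. (\<Sum>l<k p. (dot p x (d l))\<^sup>2) \<le> fb p * dot p x x)) \<and>
        (True \<longrightarrow> (\<forall>S x. S \<subseteq> {..<k p} \<longrightarrow> real (card S) \<le> real p powr (1 - 1/1000000) \<longrightarrow> (\<Sum>l\<in>S. (dot p x (d l))\<^sup>2) \<le> 1.05 * dot p x x)) \<and>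
        (large p \<longrightarrow> (\<forall>x. (\<Sum>l<k p. (dot p x (d l))\<^sup>2) \<le> fb p * dot p x x) \<longrightarrow>
           (\<forall>x. (\<Sum>l<k p. trunc_weight p u (\<Lambda> p / 250000) (d l) * (dot p x (d l))\<^sup>2) \<le> 2 * real (k p) / real p * (dot p u x)\<^sup>2 + 0.05 * \<Lambda> p * dot p x x)) \<and>
        (True \<longrightarrow> (\<Sum>m<k p. (evec p (k p) u d m)\<^sup>2) \<le> real p powr (-1.9)) \<and>
        (True \<longrightarrow> (\<Sum>(l, n)\<in>{..<k p} \<times> {..<k p} - Id. (mvec p (k p) d l n)\<^sup>2) \<le> real p powr (-0.5)) \<and>
        (True \<longrightarrow> (\<Sum>l<k p. hh p u (d l))\<^sup>2 \<le> real p powr (-0.2))"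
      note e1 = conjunct1[OF ev, THEN mp, OF TrueI] and r1 = conjunct2[OF ev]
      note e2 = conjunct1[OF r1, THEN mp, OF TrueI] and r2 = conjunct2[OF r1]
      note e3 = conjunct1[OF r2, THEN mp] and r3 = conjunct2[OF r2]
      note e4 = conjunct1[OF r3, THEN mp] and r4 = conjunct2[OF r3]
      note e5 = conjunct1[OF r4, THEN mp] and r5 = conjunct2[OF r4]
      note e6 = conjunct1[OF r5, THEN mp, OF TrueI] and r6 = conjunct2[OF r5]
      note e7 = conjunct1[OF r6, THEN mp, OF TrueI] and r7 = conjunct2[OF r6]
      note e8 = conjunct1[OF r7, THEN mp] and r8 = conjunct2[OF r7]
      note e9 = conjunct1[OF r8, THEN mp, OF TrueI] and r9 = conjunct2[OF r8]
      note e10 = conjunct1[OF r9, THEN mp, OF TrueI] and e11 = conjunct2[OF r9, THEN mp, OF TrueI]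
      have unit: "\<And>l. l < k p \<Longrightarrow> dot p (d l) (d l) = 1" by (rule e1[rule_format])
      have incu: "\<And>l. l < k p \<Longrightarrow> (dot p u (d l))\<^sup>2 \<le> real p powr (-0.98)" by (rule conjunct1[OF e2, rule_format])
      have inc: "\<And>l m. l < k p \<Longrightarrow> m < k p \<Longrightarrow> l \<noteq> m \<Longrightarrow> (dot p (d l) (d m))\<^sup>2 \<le> real p powr (-0.98)" by (rule conjunct2[OF e2, rule_format])
      have nm: "numerics (real p)" and kk: "real (k p) \<le> 2 * real p * ln (real p)" "real (k p) \<le> real p powr 1.01"
        and \<Lambda>: "large p \<Longrightarrow> 0.2 * ln (real p) \<le> \<Lambda> p" using elim by blast+
      have lt1: "real p powr (-0.98) < 1" using nm unfolding numerics_def by blast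
      have mi: "sdp_unique_maximizer p (k p) d (rank1 p u) (rank1 p (d i))" if i: "i < k p" and mx: "\<And>j. j < k p \<Longrightarrow> j \<noteq> i \<Longrightarrow> (dot p u (d j))\<^sup>2 < (dot p u (d i))\<^sup>2" for i
      proof (cases "large p")
        case True
        show ?thesis
        proof (rule maximizer_if_large[OF nm True kk \<Lambda>[OF True]])
          show "\<And>x. (\<Sum>l<k p. trunc_weight p u (\<Lambda> p / 250000) (d l) * (dot p x (d l))\<^sup>2) \<le> 2 * real (k p) / real p * (dot p u x)\<^sup>2 + 0.05 * \<Lambda> p * dot p x x"
            by (rule e8[OF True, THEN mp, OF e6, rule_format])
          show "\<And>S x. S \<subseteq> {..<k p} \<Longrightarrow> real (card S) \<le> real p powr (1 - 1/1000000) \<Longrightarrow> (\<Sum>l\<in>S. (dot p x (d l))\<^sup>2) \<le> 1.05 * dot p x x"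
            by (rule e7[rule_format])
          show "\<And>x. (\<Sum>l<k p. (dot p x (d l))\<^sup>2) \<le> fb p * dot p x x" by (rule e6[rule_format])
        qed (fact unit incu inc e3[OF True] e4[OF True] e5[OF True] e9 e10 e11 i mx)+
      next
        case False
        show ?thesis by (rule maximizer_if_small[OF nm False]) (fact unit inc i mx)+
      qed
      show "(\<forall>l<k p. dot p (d l) (d l) = 1) \<and> (\<forall>l<k p. \<forall>m<k p. l \<noteq> m \<longrightarrow> (dot p (d l) (d m))\<^sup>2 < 1) \<and>
        (\<forall>i<k p. (\<forall>j<k p. j \<noteq> i \<longrightarrow> (dot p u (d j))\<^sup>2 < (dot p u (d i))\<^sup>2) \<longrightarrow> sdp_unique_maximizer p (k p) d (rank1 p u) (rank1 p (d i)))"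
      proof (intro conjI allI impI)
        fix l m assume "l < k p" "m < k p" "l \<noteq> m"
        then show "(dot p (d l) (d m))\<^sup>2 < 1" by (intro le_less_trans[OF inc lt1])
      qed (rule unit, assumption, rule mi, auto)
    qed
  qed
qed

end

section \<open>Absence of ties and passage to the limit\<close>

lemma ip_diff_self: "ip I (\<lambda>i. x i - c * y i) (\<lambda>i. x i - c * y i) = ip I x x - 2 * c * ip I x y + c\<^sup>2 * ip I y y"
  by (simp add: ip_def sum_subtractf sum.distrib sum_distrib_left algebra_simps power2_eq_square)

text \<open>A tie means that \<open>u\<close> is orthogonal to \<open>x - y\<close> or to
  \<open>x + y\<close>, and both are nonzero because \<open>x\<close> and \<open>y\<close> are not
  parallel.\<close>

lemma AE_no_tie:
  assumes x: "dot p x x = 1" and y: "dot p y y = 1" and xy: "(dot p x y)\<^sup>2 < 1"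
  shows "AE u in unif_sphere p. (dot p u x)\<^sup>2 \<noteq> (dot p u y)\<^sup>2"
proof -
  have "AE u in unif_sphere p. dot p (\<lambda>i. x i - c * y i) u \<noteq> 0" if c: "c\<^sup>2 = 1" for c
  proof (rule AE_I)
    have "c * dot p x y \<noteq> 1"
    proof
      assume "c * dot p x y = 1"
      then have "c\<^sup>2 * (dot p x y)\<^sup>2 = 1" by (metis power_mult_distrib power_one)
      then show False using c xy by simp
    qed
    then have "dot p (\<lambda>i. x i - c * y i) (\<lambda>i. x i - c * y i) \<noteq> 0" unfolding ip_diff_self using x y c by simp
    then show "emeasure (unif_sphere p) {u \<in> space (unif_sphere p). dot p (\<lambda>i. x i - c * y i) u = 0} = 0" by (rule sphere_hyperplane_null)
    show "{u \<in> space (unif_sphere p). dot p (\<lambda>i. x i - c * y i) u = 0} \<in> sets (unif_sphere p)" by measurable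
  qed auto
  from this[of 1] this[of "-1"] show ?thesis
  proof (simp, elim AE_mp, intro AE_I2 impI)
    fix u assume a: "dot p (\<lambda>i. x i - y i) u \<noteq> 0" "dot p (\<lambda>i. x i + y i) u \<noteq> 0"
    have e: "dot p (\<lambda>i. x i - y i) u = dot p u x - dot p u y" "dot p (\<lambda>i. x i + y i) u = dot p u x + dot p u y"
      by (simp_all add: ip_def sum_subtractf sum.distrib algebra_simps)
    show "(dot p u x)\<^sup>2 \<noteq> (dot p u y)\<^sup>2" using a unfolding e power2_eq_iff by auto
  qed
qed

text \<open>Ties are excluded for fixed \<open>d\<close> by varying \<open>u\<close>, but the final
  argument fixes \<open>u\<close> first; the two quantifiers are exchanged by Fubini, which is where
  measurability is needed.\<close>

lemma AE_sph_no_ties: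
  "AE u in unif_sphere p. AE d in sph p {..<k}. (\<forall>l\<in>{..<k}. dot p (d l) (d l) = 1) \<longrightarrow> (\<forall>l\<in>{..<k}. \<forall>m\<in>{..<k}. l \<noteq> m \<longrightarrow> (dot p (d l) (d m))\<^sup>2 < 1) \<longrightarrow>
     (\<forall>l\<in>{..<k}. \<forall>m\<in>{..<k}. l \<noteq> m \<longrightarrow> (dot p u (d l))\<^sup>2 \<noteq> (dot p u (d m))\<^sup>2)"
proof -
  interpret M: prob_space "sph p {..<k}" by (rule prob_space_sph)
  interpret U: prob_space "unif_sphere p" by (rule prob_space_sphere)
  interpret pair_sigma_finite "sph p {..<k}" "unif_sphere p" ..
  let ?P = "\<lambda>d u. (\<forall>l\<in>{..<k}. dot p (d l) (d l) = 1) \<longrightarrow> (\<forall>l\<in>{..<k}. \<forall>m\<in>{..<k}. l \<noteq> m \<longrightarrow> (dot p (d l) (d m))\<^sup>2 < 1) \<longrightarrow>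
     (\<forall>l\<in>{..<k}. \<forall>m\<in>{..<k}. l \<noteq> m \<longrightarrow> (dot p u (d l))\<^sup>2 \<noteq> (dot p u (d m))\<^sup>2)"
  have a: "AE u in unif_sphere p. ?P d u" for d
  proof (cases "(\<forall>l\<in>{..<k}. dot p (d l) (d l) = 1) \<and> (\<forall>l\<in>{..<k}. \<forall>m\<in>{..<k}. l \<noteq> m \<longrightarrow> (dot p (d l) (d m))\<^sup>2 < 1)")
    case True
    have "AE u in unif_sphere p. \<forall>l\<in>{..<k}. \<forall>m\<in>{..<k}. l \<noteq> m \<longrightarrow> (dot p u (d l))\<^sup>2 \<noteq> (dot p u (d m))\<^sup>2"
    proof (intro AE_finite_allI finite_lessThan)
      fix l m assume "l \<in> {..<k}" "m \<in> {..<k}"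
      then show "AE u in unif_sphere p. l \<noteq> m \<longrightarrow> (dot p u (d l))\<^sup>2 \<noteq> (dot p u (d m))\<^sup>2"
        using AE_no_tie[of p "d l" "d m"] True by (cases "l = m") auto
    qed
    then show ?thesis by eventually_elim simp
  qed auto
  let ?S = "sph p {..<k} \<Otimes>\<^sub>M unif_sphere p"
  have c1: "(\<lambda>\<omega>. fst \<omega> l i) \<in> borel_measurable ?S" if "l \<in> {..<k}" "i < p" for l i
    using that by (intro measurable_compose[OF measurable_fst measurable_sph_component2])
  have c2: "(\<lambda>\<omega>. snd \<omega> i) \<in> borel_measurable ?S" if "i < p" for i
    using that by (intro measurable_compose[OF measurable_snd measurable_component_sphere])
  have d1: "(\<lambda>\<omega>. dot p (fst \<omega> l) (fst \<omega> m)) \<in> borel_measurable ?S" if "l \<in> {..<k}" "m \<in> {..<k}" for l m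
    by (intro measurable_ip c1 that; simp)
  have d2: "(\<lambda>\<omega>. (dot p (snd \<omega>) (fst \<omega> l))\<^sup>2) \<in> borel_measurable ?S" if "l \<in> {..<k}" for l
    by (intro borel_measurable_power measurable_ip c1 c2 that; simp)
  have m1: "{\<omega> \<in> space ?S. dot p (fst \<omega> l) (fst \<omega> l) = 1} \<in> sets ?S" if "l \<in> {..<k}" for l
    by (rule borel_measurable_eq[OF d1[OF that that] borel_measurable_const])
  have m2: "{\<omega> \<in> space ?S. l \<noteq> m \<longrightarrow> (dot p (fst \<omega> l) (fst \<omega> m))\<^sup>2 < 1} \<in> sets ?S" if "l \<in> {..<k}" "m \<in> {..<k}" for l m
    by (rule sets.sets_Collect_imp[OF borel_measurable_less[OF borel_measurable_power[OF d1[OF that]] borel_measurable_const] sets.sets_Collect_const])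
  have m3: "{\<omega> \<in> space ?S. l \<noteq> m \<longrightarrow> (dot p (snd \<omega>) (fst \<omega> l))\<^sup>2 \<noteq> (dot p (snd \<omega>) (fst \<omega> m))\<^sup>2} \<in> sets ?S" if "l \<in> {..<k}" "m \<in> {..<k}" for l m
    by (rule sets.sets_Collect_imp[OF borel_measurable_neq[OF d2[OF that(1)] d2[OF that(2)]] sets.sets_Collect_const])
  have m: "{\<omega> \<in> space ?S. ?P (fst \<omega>) (snd \<omega>)} \<in> sets ?S"
  proof (rule sets.sets_Collect_imp[OF sets.sets_Collect_imp])
    show "{\<omega> \<in> space ?S. \<forall>l\<in>{..<k}. \<forall>m\<in>{..<k}. l \<noteq> m \<longrightarrow> (dot p (snd \<omega>) (fst \<omega> l))\<^sup>2 \<noteq> (dot p (snd \<omega>) (fst \<omega> m))\<^sup>2} \<in> sets ?S"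
      by (rule sets.sets_Collect_finite_All[OF sets.sets_Collect_finite_All[OF m3]]) auto
    show "{\<omega> \<in> space ?S. \<forall>l\<in>{..<k}. \<forall>m\<in>{..<k}. l \<noteq> m \<longrightarrow> (dot p (fst \<omega> l) (fst \<omega> m))\<^sup>2 < 1} \<in> sets ?S"
      by (rule sets.sets_Collect_finite_All[OF sets.sets_Collect_finite_All[OF m2]]) auto
    show "{\<omega> \<in> space ?S. \<forall>l\<in>{..<k}. dot p (fst \<omega> l) (fst \<omega> l) = 1} \<in> sets ?S"
      by (rule sets.sets_Collect_finite_All[OF m1]) auto
  qed
  show "AE u in unif_sphere p. AE d in sph p {..<k}. ?P d u"
    by (rule AE_commute[OF m, THEN iffD1]) (rule AE_I2, rule a)
qed

theorem theorem1:
  fixes \<epsilon> :: real and k :: "nat \<Rightarrow> nat"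
  assumes "\<epsilon> > 0"
    and "eventually (\<lambda>p. 0 < k p \<and> real (k p) < (2 - \<epsilon>) * real p * ln (real p)) sequentially"
  shows "(\<lambda>p. measure (sample_space p (k p))
                {\<omega> \<in> space (sample_space p (k p)). good_event p (k p) (fst \<omega>) (snd \<omega>)})
         \<longlonglongrightarrow> 1"
proof -
  interpret growth k
  proof
    show "\<forall>\<^sub>F p in sequentially. 0 < k p" using assms(2) by eventually_elim simp
    show "\<forall>\<^sub>F p in sequentially. real (k p) \<le> 2 * real p * ln (real p)"
      using assms(2) eventually_ge_at_top[of 1]
    proof eventually_elim
      case (elim p)
      have "(2 - \<epsilon>) * (real p * ln (real p)) \<le> 2 * (real p * ln (real p))" using assms(1) elim by (intro mult_right_mono) auto
      then show ?case using elim unfolding mult.assoc by linarith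
    qed
  qed
  have key: "\<forall>\<^sub>F p in sequentially. 1 - \<eta> \<le> measure (sample_space p (k p)) {\<omega> \<in> space (sample_space p (k p)). good_event p (k p) (fst \<omega>) (snd \<omega>)}" if \<eta>: "\<eta> > 0" for \<eta>
    using whp_maximizer[unfolded whp_def, rule_format, OF \<eta>] kpos eventually_ge_at_top[of 1]
  proof eventually_elim
    case (elim p)
    note ev = elim(1) and kp = elim(2) and p1 = elim(3)
    let ?M = "sph p {..<k p}" and ?U = "unif_sphere p"
    interpret M: prob_space ?M by (rule prob_space_sph)
    interpret U: prob_space ?U by (rule prob_space_sphere)
    interpret S: pair_prob_space ?M ?U ..
    let ?S = "?M \<Otimes>\<^sub>M ?U"
    define G where "G = {\<omega> \<in> space ?S. good_event p (k p) (fst \<omega>) (snd \<omega>)}"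
    have G: "G \<in> sets ?S" using good_event_sets[of p "k p"] unfolding sample_space_eq G_def .
    define B where "B = space ?S - G"
    have B: "B \<in> sets ?S" unfolding B_def by (rule sets.Diff[OF sets.top G])
    \<comment> \<open>For almost every fixed \<open>u\<close> the bad slice lies, up to a null set,
      in the exceptional set belonging to this \<open>u\<close>: off that set the absence of ties
      yields a strict maximum, and that index is optimal.\<close>
    have slice: "AE u in ?U. emeasure ?M ((\<lambda>d. (d, u)) -` B) \<le> ennreal \<eta>"
      using AE_sphere_unit[OF p1] AE_sph_no_ties[where p = p and k = "k p"] AE_space[of ?U]
    proof eventually_elim
      case (elim u)
      obtain A where A: "A \<in> sets ?M" and A': "emeasure ?M A \<le> ennreal \<eta> \<and> (\<forall>d\<in>space ?M - A. (\<forall>l<k p. dot p (d l) (d l) = 1) \<and>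
          (\<forall>l<k p. \<forall>m<k p. l \<noteq> m \<longrightarrow> (dot p (d l) (d m))\<^sup>2 < 1) \<and>
          (\<forall>i<k p. (\<forall>j<k p. j \<noteq> i \<longrightarrow> (dot p u (d j))\<^sup>2 < (dot p u (d i))\<^sup>2) \<longrightarrow> sdp_unique_maximizer p (k p) d (rank1 p u) (rank1 p (d i))))"
        by (rule bexE[OF mp[OF spec[OF ev] elim(1)]])
      have "emeasure ?M ((\<lambda>d. (d, u)) -` B) \<le> emeasure ?M A"
      proof (rule emeasure_mono_AE[OF _ A])
        show "AE d in ?M. d \<in> (\<lambda>d. (d, u)) -` B \<longrightarrow> d \<in> A"
          using elim(2) AE_space[of ?M]
        proof (eventually_elim, intro impI)
          fix d
          assume t: "(\<forall>l\<in>{..<k p}. dot p (d l) (d l) = 1) \<longrightarrow> (\<forall>l\<in>{..<k p}. \<forall>m\<in>{..<k p}. l \<noteq> m \<longrightarrow> (dot p (d l) (d m))\<^sup>2 < 1) \<longrightarrow>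
             (\<forall>l\<in>{..<k p}. \<forall>m\<in>{..<k p}. l \<noteq> m \<longrightarrow> (dot p u (d l))\<^sup>2 \<noteq> (dot p u (d m))\<^sup>2)"
            and d: "d \<in> space ?M" and dB: "d \<in> (\<lambda>d. (d, u)) -` B"
          show "d \<in> A"
          proof (rule ccontr)
            assume "d \<notin> A"
            then have dA: "d \<in> space ?M - A" using d by blast
            note D = bspec[OF conjunct2[OF A'] dA]
            have nt: "(dot p u (d l))\<^sup>2 \<noteq> (dot p u (d m))\<^sup>2" if "l < k p" "m < k p" "l \<noteq> m" for l m
              using t conjunct1[OF D] conjunct1[OF conjunct2[OF D]] that by (simp add: Ball_def)
            let ?V = "(\<lambda>l. (dot p u (d l))\<^sup>2) ` {..<k p}"
            have ne: "finite ?V" "?V \<noteq> {}" using kp by auto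
            obtain i where i: "i < k p" "(dot p u (d i))\<^sup>2 = Max ?V" using Max_in[OF ne] by auto
            have mx: "(dot p u (d j))\<^sup>2 < (dot p u (d i))\<^sup>2" if "j < k p" "j \<noteq> i" for j
            proof -
              have "(dot p u (d j))\<^sup>2 \<le> Max ?V" using that(1) by (intro Max_ge[OF ne(1)] imageI) simp
              then show ?thesis using nt[OF that(1) i(1) that(2)] i(2) by linarith
            qed
            then have "good_event p (k p) d u" unfolding good_event_def quad_rank1 using conjunct2[OF conjunct2[OF D]] i(1) by blast
            then have "(d, u) \<in> G" using d elim(3) by (simp add: G_def space_pair_measure)
            then show False using dB by (simp add: B_def)
          qed
        qed
      qed
      also have "\<dots> \<le> ennreal \<eta>" by (rule conjunct1[OF A'])
      finally show ?case .
    qed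
    have "emeasure ?S B = (\<integral>\<^sup>+u. emeasure ?M ((\<lambda>d. (d, u)) -` B) \<partial>?U)" by (rule S.emeasure_pair_measure_alt2[OF B])
    also have "\<dots> \<le> (\<integral>\<^sup>+u. ennreal \<eta> \<partial>?U)" by (rule nn_integral_mono_AE[OF slice])
    also have "\<dots> = ennreal \<eta>" by (simp add: U.emeasure_space_1)
    finally have "ennreal (measure ?S B) \<le> ennreal \<eta>" by (simp add: S.P.emeasure_eq_measure)
    then have "measure ?S B \<le> \<eta>" using \<eta> by simp
    moreover have "measure ?S B = 1 - measure ?S G" unfolding B_def by (rule S.P.prob_compl[OF G])
    ultimately show ?case unfolding sample_space_eq G_def by linarith
  qed
  have up: "measure (sample_space p (k p)) X \<le> 1" for p X
  proof -
    interpret M: prob_space "sph p {..<k p}" by (rule prob_space_sph)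
    interpret U: prob_space "unif_sphere p" by (rule prob_space_sphere)
    interpret S: pair_prob_space "sph p {..<k p}" "unif_sphere p" ..
    show ?thesis unfolding sample_space_eq by (rule S.P.prob_le_1)
  qed
  show ?thesis
  proof (rule tendstoI)
    fix e :: real assume "e > 0"
    then have "e / 2 > 0" by simp
    from key[OF this] show "\<forall>\<^sub>F p in sequentially. dist (measure (sample_space p (k p)) {\<omega> \<in> space (sample_space p (k p)). good_event p (k p) (fst \<omega>) (snd \<omega>)}) 1 < e"
    proof eventually_elim
      case (elim p)
      then show ?case using up[of p "{\<omega> \<in> space (sample_space p (k p)). good_event p (k p) (fst \<omega>) (snd \<omega>)}"] \<open>e > 0\<close> unfolding dist_real_def by linarith
    qed
  qed
qed

end
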